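(* If $F$ is an expansion-net with cut of type $\Gamma$, then there is a cut-free expansion-net $F'$, reachable from $F$ by (finitely many applications of) the cut-reduction operations, such that the type $\Delta$ of $F'$ is a subsequent of $\Gamma$.
   Context: **Formulae.** $A ::= a \mid \bar a \mid \top \mid \bot \mid A\land A \mid A\lor A$ ($a$ a proposition symbol); $\bar A$ is the De Morgan dual of $A$. A classical sequent is a finite collection of formula occurrences (order irrelevant); a subsequent of $\Gamma$ is obtained by deleting some of the formula occurrences of $\Gamma$. **Expansion trees.** Wire variables come in dual pairs $x,\bar x$. Expansion trees $t$ and witnesses $w$: $t ::= 1 \mid (w+\dots+w) \mid (t\lor t)\mid (t\lor * )\mid ( *\lor t)$, $w ::= x\mid \bar x\mid t\otimes t$, where $(w_1+\dots+w_n)$ is a nonempty finite formal (unordered) sum, called an expansion (nontrivial if $n\ge 2$). **Types.** A type is a formula or a witness type $[a]$, $[\bar a]$, $A\otimes B$, with underlying formulae $a$, $\bar a$, $A\land B$. Typing: $x:[p]$, $\bar x:[\bar p]$; $1:\top$; $(t\lor * ):A\lor B$ if $t:A$; $( *\lor t):A\lor B$ if $t:B$; $(t\lor s):A\lor B$ and $t\otimes s:A\otimes B$ if $t:A,s:B$; $(w_1+\dots+w_n)$ has type $p$, $\bar p$, $A\land B$ if all $w_i$ have type $[p]$, $[\bar p]$, $A\otimes B$ respectively. Dual wire variables carry dual types. **Cuts.** A cut tree $t\bowtie s$ is an unordered pair of expansion trees $t:A$, $s:\bar A$ with $A\neq\top,\bot$. Its positive term is the one of type $\bar a$ or $A\land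 B$; by convention it is written on the left. A typed forest with cut is a finite collection of typed expansion trees, typed witnesses and cut trees in which each wire variable occurs at most once and $x$ occurs iff $\bar x$ occurs; its type is the collection of types of its roots that are not cuts. **Nets.** An expansion-net with cut is a typed forest with cut derivable by the following rules (premisses of binary rules have disjoint wire variables). Axioms $1:\top$ and $(\bar x):\bar p,(x):p$; mix: from $F$ and $G$ infer $F,G$; $\lor$: from $F,t:A,s:B$ infer $F,(t\lor s):A\lor B$; $\lor_0$: from $F,t:A$ infer $F,(t\lor * ):A\lor B$; $\lor_1$: from $F,s:B$ infer $F,( *\lor s):A\lor B$; $\land$: from $F,t:A$ and $G,s:B$ infer $F,G,(t\otimes s):A\land B$; contraction: from $F,t:C,s:C$ infer $F,t+s:C$ for $C$ an atom or conjunction (joining the formal sums); cut: from $F,t:A$ and $G,s:\bar A$ infer $F,G,t\bowtie s$. It is cut-free, and called an expansion-net, if it contains no cut trees and is derivable without the cut rule. **AC-correctness and subnets.** View a typed forest with cut $F$ as a forest of nodes (subterm occurrences, including occurrences of $*$), where a cut $t\bowtie s$ is a root node with successors $t,s$; $(t\lor * )$ has successors $t$ and $*$; an expansion has its summands as successors; wire variables, $1$ and $*$ are leaves. The graph of $F$ has an edge from each node to its predecessor and an edge between $x$ and $\bar x$ for each wire variable. Switched nodes are expansions and nodes $t\lor s$ with neither $t$ nor $s$ equal to $*$; cuts, $\otimes$-nodes and default weakenings $(t\lor * )$, $( *\lor t)$ are unswitched. A switching chooses one successor of each switched node; its switching graph is obtained by deleting all edges from the non-chosen successors of switched nodes to those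 nodes and forgetting directions. $F$ is AC (AC-correct) if all its switching graphs are acyclic. A switching path is a path in some switching graph. A substructure is a nonempty set of nodes closed under taking successors, closed under axiom links (if it contains a wire variable occurrence it contains its dual), and such that if it contains an occurrence of $*$ it contains the predecessor of that occurrence; its roots are its nodes with no predecessor in it. A subnet of an AC forest $F$ is a substructure $G$ such that for any two roots of $G$ every switching path of $F$ between them lies inside $G$. **Cut-reduction operations** (on AC typed forests with cut). When a witness that is a summand of an expansion is replaced by an expansion, the sums are flattened; if it is a root it is replaced by the expansion as a root. 1. Logical, $\land/\lor$: $F,(s_1\otimes s_2)\bowtie(t_1\lor t_2)$ with $t_1,t_2\ne *$ reduces to $F,\ s_1\bowtie t_1,\ s_2\bowtie t_2$. 2. Logical, atomic: $F,(x)\bowtie t$, where $x$ is a wire variable (of either polarity) and $\bar x$ is its dual, reduces to $F[\bar x:=t]$. 3. Contraction: let $G=F,\ s\bowtie t$ with $s$ a nontrivial expansion (the positive term), partitioned as $s=s_1+s_2$ with $s_1,s_2$ nonempty. Let $w_1,\dots,w_k,c_1,\dots,c_m,t$ be the roots of a subnet of $G$, where the $w_i$ are witnesses and the $c_i$ are cuts. Then $G$ reduces to $F',\ s_1\bowtie t^L,\ s_2\bowtie t^R$, where $F'$ is $F$ with each $w_i$ replaced by $(w_i^L+w_i^R)$ and each $c_i$ replaced by the two cuts $c_i^L,c_i^R$. Here $(\cdot)^L,(\cdot)^R$ are two copies with wire variables renamed to fresh ones, $x^L$ being dual to $\bar x^L$ and $x^R$ to $\bar x^R$. 4. Default weakening: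 let $G=F,(s_1\otimes s_2)\bowtie(t\lor * )$, and let $E$ be a subnet of $G$ with roots $u_1,\dots,u_n,s_2$, where each $u_i$ is either a root of $G$, or a successor of an expansion containing at least one summand not in $E$, or a successor of a disjunction node whose other successor is neither $*$ nor in $E$. Then $G$ reduces to $F',\ s_1\bowtie t$, where $F'$ is $F$ with each $u_i$ deleted if it is a root or a summand of an expansion, and replaced by $*$ if it is a successor of a disjunction. Symmetrically for $(s_1\otimes s_2)\bowtie( *\lor t)$, which reduces to $F',\ s_2\bowtie t$ using a subnet with root $s_1$. *)

theory Defs
  imports "HOL-Library.Multiset"
begin

section \<open>Formulae and types\<close>

datatype 'p formula =
    Pos 'p | Neg 'p | Top | Bot
  | Conj "'p formula" "'p formula" | Disj "'p formula" "'p formula"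

primrec dual :: "'p formula \<Rightarrow> 'p formula" where
  "dual (Pos a) = Neg a"
| "dual (Neg a) = Pos a"
| "dual Top = Bot"
| "dual Bot = Top"
| "dual (Conj A B) = Disj (dual A) (dual B)"
| "dual (Disj A B) = Conj (dual A) (dual B)"

datatype 'p wit_type = PosW 'p | NegW 'p | TensorW "'p formula" "'p formula"

primrec underlying :: "'p wit_type \<Rightarrow> 'p formula" where
  "underlying (PosW a) = Pos a"
| "underlying (NegW a) = Neg a"
| "underlying (TensorW A B) = Conj A B"

datatype 'p net_type = Formula "'p formula" | Witness "'p wit_type"

text \<open>The type of a term in a cut written on the left, i.e. of the positive term.\<close>

fun positive :: "'p formula \<Rightarrow> bool" where
  "positive (Neg a) = True"
| "positive (Conj A B) = True"
| "positive _ = False"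


section \<open>Expansion trees and forests\<close>

datatype 'v wire = X 'v | Xbar 'v

primrec wdual :: "'v wire \<Rightarrow> 'v wire" where
  "wdual (X x) = Xbar x"
| "wdual (Xbar x) = X x"

text \<open>
  Every node of a term, including every occurrence of \<open>*\<close>, carries a name of type \<open>'i\<close>.
  Terms proper are obtained for \<open>'i = unit\<close>.  Taking distinct names for the nodes of a term
  makes its subterm occurrences available although formal sums and forests are unordered.
  The trees \<open>t \<or> s\<close>, \<open>t \<or> *\<close> and \<open>* \<or> t\<close> are \<open>Vee i t s\<close>, \<open>VeeL i t j\<close> and \<open>VeeR i j t\<close>,
  where \<open>j\<close> is the name of the occurrence of \<open>*\<close>.  Sums are required to be nonempty by the
  typing judgement.
\<close>

datatype (tree_names: 'i, tree_vars: 'v) tree =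
    Unit (tname: 'i)
  | Exp (tname: 'i) "('i, 'v) wit multiset"
  | Vee (tname: 'i) "('i, 'v) tree" "('i, 'v) tree"
  | VeeL (tname: 'i) "('i, 'v) tree" 'i
  | VeeR (tname: 'i) 'i "('i, 'v) tree"
and (wit_names: 'i, wit_vars: 'v) wit =
    Wire (wname: 'i) "'v wire"
  | Tensor (wname: 'i) "('i, 'v) tree" "('i, 'v) tree"

text \<open>
  \<open>Cut i t A s\<close> is the cut of \<open>t : A\<close> against \<open>s : dual A\<close>, with \<open>t\<close> the positive term.
  As this convention orients a cut, an ordered representation suffices.
\<close>

datatype ('p, 'i, root_vars: 'v) root =
    Tree "('i, 'v) tree" "'p formula"
  | Wit "('i, 'v) wit" "'p wit_type"
  | Cut 'i "('i, 'v) tree" "'p formula" "('i, 'v) tree"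

text \<open>The unordered pair of \<open>t : A\<close> and \<open>s : dual A\<close>, oriented according to the convention.\<close>

definition mk_cut ::
  "'i \<Rightarrow> ('i, 'v) tree \<Rightarrow> 'p formula \<Rightarrow> ('i, 'v) tree \<Rightarrow> ('p, 'i, 'v) root" where
  "mk_cut i t A s = (if positive A then Cut i t A s else Cut i s (dual A) t)"

primrec rname :: "('p, 'i, 'v) root \<Rightarrow> 'i" where
  "rname (Tree t A) = tname t"
| "rname (Wit w T) = wname w"
| "rname (Cut i t A s) = i"

type_synonym ('p, 'i, 'v) gen_forest = "('p, 'i, 'v) root multiset"
type_synonym 'p forest = "('p, unit, nat) gen_forest"
type_synonym 'p named_forest = "('p, nat, nat) gen_forest"

definition erase :: "'p named_forest \<Rightarrow> 'p forest" where
  "erase F = image_mset (map_root id (\<lambda>_. ()) id) F"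

definition forest_vars :: "('p, 'i, 'v) gen_forest \<Rightarrow> 'v set" where
  "forest_vars F = (\<Union>r\<in>set_mset F. root_vars r)"

fun root_type :: "('p, 'i, 'v) root \<Rightarrow> 'p net_type multiset" where
  "root_type (Tree t A) = {#Formula A#}"
| "root_type (Wit w T) = {#Witness T#}"
| "root_type (Cut i t A s) = {#}"

definition forest_type :: "('p, 'i, 'v) gen_forest \<Rightarrow> 'p net_type multiset" where
  "forest_type F = sum_mset (image_mset root_type F)"


section \<open>Nodes\<close>

datatype 'v label = LUnit | LExp | LVee | LWeak | LStar | LWire "'v wire" | LTensor | LCut

datatype ('i, 'v) node = Node (node_name: 'i) (node_label: "'v label") (succs: "'i set")

primrec tree_nodes :: "('i, 'v) tree \<Rightarrow> ('i, 'v) node multiset"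
  and wit_nodes :: "('i, 'v) wit \<Rightarrow> ('i, 'v) node multiset" where
  "tree_nodes (Unit i) = {#Node i LUnit {}#}"
| "tree_nodes (Exp i ws) =
     add_mset (Node i LExp (wname ` set_mset ws)) (sum_mset (image_mset wit_nodes ws))"
| "tree_nodes (Vee i t s) =
     add_mset (Node i LVee {tname t, tname s}) (tree_nodes t + tree_nodes s)"
| "tree_nodes (VeeL i t j) =
     add_mset (Node i LWeak {tname t, j}) (add_mset (Node j LStar {}) (tree_nodes t))"
| "tree_nodes (VeeR i j t) =
     add_mset (Node i LWeak {j, tname t}) (add_mset (Node j LStar {}) (tree_nodes t))"
| "wit_nodes (Wire i x) = {#Node i (LWire x) {}#}"
| "wit_nodes (Tensor i t s) =
     add_mset (Node i LTensor {tname t, tname s}) (tree_nodes t + tree_nodes s)"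

primrec root_nodes :: "('p, 'i, 'v) root \<Rightarrow> ('i, 'v) node multiset" where
  "root_nodes (Tree t A) = tree_nodes t"
| "root_nodes (Wit w T) = wit_nodes w"
| "root_nodes (Cut i t A s) =
     add_mset (Node i LCut {tname t, tname s}) (tree_nodes t + tree_nodes s)"

definition forest_nodes :: "('p, 'i, 'v) gen_forest \<Rightarrow> ('i, 'v) node multiset" where
  "forest_nodes F = sum_mset (image_mset root_nodes F)"

definition occurrences :: "('p, 'i, 'v) gen_forest \<Rightarrow> 'v wire \<Rightarrow> nat" where
  "occurrences F x = size {#n \<in># forest_nodes F. node_label n = LWire x#}"

definition distinctly_named :: "('p, 'i, 'v) gen_forest \<Rightarrow> bool" where
  "distinctly_named F \<longleftrightarrow> (\<forall>i. count (image_mset node_name (forest_nodes F)) i \<le> 1)"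


section \<open>Typing\<close>

text \<open>
  The typing of a forest is relative to an assignment \<open>\<Theta>\<close> of a proposition symbol to each dual
  pair of wire variables, which ensures that dual wire variables carry dual types.
\<close>

inductive tree_typed :: "('v \<Rightarrow> 'p) \<Rightarrow> ('i, 'v) tree \<Rightarrow> 'p formula \<Rightarrow> bool"
  and wit_typed :: "('v \<Rightarrow> 'p) \<Rightarrow> ('i, 'v) wit \<Rightarrow> 'p wit_type \<Rightarrow> bool"
  for \<Theta> :: "'v \<Rightarrow> 'p" where
  "tree_typed \<Theta> (Unit i) Top"
| "ws \<noteq> {#} \<Longrightarrow> \<forall>w\<in>set_mset ws. wit_typed \<Theta> w T \<Longrightarrow> tree_typed \<Theta> (Exp i ws) (underlying T)"
| "tree_typed \<Theta> t A \<Longrightarrow> tree_typed \<Theta> s B \<Longrightarrow> tree_typed \<Theta> (Vee i t s) (Disj A B)"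
| "tree_typed \<Theta> t A \<Longrightarrow> tree_typed \<Theta> (VeeL i t j) (Disj A B)"
| "tree_typed \<Theta> t B \<Longrightarrow> tree_typed \<Theta> (VeeR i j t) (Disj A B)"
| "wit_typed \<Theta> (Wire i (X x)) (PosW (\<Theta> x))"
| "wit_typed \<Theta> (Wire i (Xbar x)) (NegW (\<Theta> x))"
| "tree_typed \<Theta> t A \<Longrightarrow> tree_typed \<Theta> s B \<Longrightarrow> wit_typed \<Theta> (Tensor i t s) (TensorW A B)"

primrec root_typed :: "('v \<Rightarrow> 'p) \<Rightarrow> ('p, 'i, 'v) root \<Rightarrow> bool" where
  "root_typed \<Theta> (Tree t A) \<longleftrightarrow> tree_typed \<Theta> t A"
| "root_typed \<Theta> (Wit w T) \<longleftrightarrow> wit_typed \<Theta> w T"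
| "root_typed \<Theta> (Cut i t A s) \<longleftrightarrow> positive A \<and> tree_typed \<Theta> t A \<and> tree_typed \<Theta> s (dual A)"

definition typed_forest :: "('p, 'i, 'v) gen_forest \<Rightarrow> bool" where
  "typed_forest F \<longleftrightarrow>
     (\<exists>\<Theta>. \<forall>r\<in>set_mset F. root_typed \<Theta> r) \<and>
     (\<forall>x. occurrences F x \<le> 1 \<and> (0 < occurrences F x \<longleftrightarrow> 0 < occurrences F (wdual x)))"


section \<open>Expansion-nets\<close>

text \<open>
  Node names play no role here and are unconstrained.  The Boolean parameter tells whether the
  cut rule may be used.  Atoms and conjunctions are exactly the formulae \<open>underlying T\<close>, and the
  trees of these types are exactly the expansions.
\<close>

inductive derivable :: "bool \<Rightarrow> ('p, 'i, 'v) gen_forest \<Rightarrow> bool" for c :: bool where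
  unit: "derivable c {#Tree (Unit i) Top#}"
| axiom: "derivable c {#Tree (Exp i {#Wire j (Xbar x)#}) (Neg p),
                        Tree (Exp k {#Wire l (X x)#}) (Pos p)#}"
| mix: "derivable c F \<Longrightarrow> derivable c G \<Longrightarrow> forest_vars F \<inter> forest_vars G = {} \<Longrightarrow>
        derivable c (F + G)"
| vee: "derivable c (F + {#Tree t A, Tree s B#}) \<Longrightarrow>
        derivable c (F + {#Tree (Vee i t s) (Disj A B)#})"
| vee0: "derivable c (F + {#Tree t A#}) \<Longrightarrow> derivable c (F + {#Tree (VeeL i t j) (Disj A B)#})"
| vee1: "derivable c (F + {#Tree s B#}) \<Longrightarrow> derivable c (F + {#Tree (VeeR i j s) (Disj A B)#})"
| tensor: "derivable c (F + {#Tree t A#}) \<Longrightarrow> derivable c (G + {#Tree s B#}) \<Longrightarrow>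
           forest_vars (F + {#Tree t A#}) \<inter> forest_vars (G + {#Tree s B#}) = {} \<Longrightarrow>
           derivable c (F + G + {#Tree (Exp i {#Tensor j t s#}) (Conj A B)#})"
| contraction: "derivable c (F + {#Tree (Exp i ws) (underlying T), Tree (Exp j vs) (underlying T)#})
           \<Longrightarrow> derivable c (F + {#Tree (Exp k (ws + vs)) (underlying T)#})"
| cut: "c \<Longrightarrow> derivable c (F + {#Tree t A#}) \<Longrightarrow> derivable c (G + {#Tree s (dual A)#}) \<Longrightarrow>
        A \<noteq> Top \<Longrightarrow> A \<noteq> Bot \<Longrightarrow>
        forest_vars (F + {#Tree t A#}) \<inter> forest_vars (G + {#Tree s (dual A)#}) = {} \<Longrightarrow>
        derivable c (F + G + {#mk_cut i t A s#})"

definition expansion_net_with_cut :: "('p, 'i, 'v) gen_forest \<Rightarrow> bool" where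
  "expansion_net_with_cut F \<longleftrightarrow> typed_forest F \<and> derivable True F"

definition expansion_net :: "('p, 'i, 'v) gen_forest \<Rightarrow> bool" where
  "expansion_net F \<longleftrightarrow>
     typed_forest F \<and> (\<forall>i t A s. Cut i t A s \<notin># F) \<and> derivable False F"


section \<open>AC-correctness and subnets\<close>

text \<open>The notions of this section are meant for forests whose nodes have distinct names.\<close>

definition node_set :: "('p, 'i, 'v) gen_forest \<Rightarrow> 'i set" where
  "node_set F = node_name ` set_mset (forest_nodes F)"

definition labelled :: "('p, 'i, 'v) gen_forest \<Rightarrow> 'i \<Rightarrow> 'v label \<Rightarrow> bool" where
  "labelled F i l \<longleftrightarrow> (\<exists>n\<in>#forest_nodes F. node_name n = i \<and> node_label n = l)"

definition succ_edges :: "('p, 'i, 'v) gen_forest \<Rightarrow> ('i \<times> 'i) set" where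
  "succ_edges F = {(i, j). \<exists>n\<in>#forest_nodes F. node_name n = i \<and> j \<in> succs n}"

definition axiom_links :: "('p, 'i, 'v) gen_forest \<Rightarrow> ('i \<times> 'i) set" where
  "axiom_links F = {(i, j). \<exists>x. labelled F i (LWire x) \<and> labelled F j (LWire (wdual x))}"

definition switched :: "('p, 'i, 'v) gen_forest \<Rightarrow> 'i \<Rightarrow> bool" where
  "switched F i \<longleftrightarrow> labelled F i LExp \<or> labelled F i LVee"

definition switching :: "('p, 'i, 'v) gen_forest \<Rightarrow> ('i \<Rightarrow> 'i) \<Rightarrow> bool" where
  "switching F \<sigma> \<longleftrightarrow> (\<forall>i. switched F i \<longrightarrow> (i, \<sigma> i) \<in> succ_edges F)"

text \<open>Undirected graphs are represented by symmetric relations.\<close>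

definition switching_graph :: "('p, 'i, 'v) gen_forest \<Rightarrow> ('i \<Rightarrow> 'i) \<Rightarrow> ('i \<times> 'i) set" where
  "switching_graph F \<sigma> =
     (let E = {(i, j) \<in> succ_edges F. switched F i \<longrightarrow> j = \<sigma> i} \<union> axiom_links F in E \<union> E\<inverse>)"

definition path :: "('i \<times> 'i) set \<Rightarrow> 'i list \<Rightarrow> bool" where
  "path E p \<longleftrightarrow> p \<noteq> [] \<and> distinct p \<and> successively (\<lambda>i j. (i, j) \<in> E) p"

definition acyclic_graph :: "('i \<times> 'i) set \<Rightarrow> bool" where
  "acyclic_graph E \<longleftrightarrow> (\<nexists>p. path E p \<and> 3 \<le> length p \<and> (last p, hd p) \<in> E)"

definition AC :: "('p, 'i, 'v) gen_forest \<Rightarrow> bool" where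
  "AC F \<longleftrightarrow> (\<forall>\<sigma>. switching F \<sigma> \<longrightarrow> acyclic_graph (switching_graph F \<sigma>))"

definition switching_path :: "('p, 'i, 'v) gen_forest \<Rightarrow> 'i list \<Rightarrow> bool" where
  "switching_path F p \<longleftrightarrow> (\<exists>\<sigma>. switching F \<sigma> \<and> path (switching_graph F \<sigma>) p)"

definition substructure :: "('p, 'i, 'v) gen_forest \<Rightarrow> 'i set \<Rightarrow> bool" where
  "substructure F E \<longleftrightarrow>
     E \<noteq> {} \<and> E \<subseteq> node_set F \<and>
     (\<forall>(i, j)\<in>succ_edges F. i \<in> E \<longrightarrow> j \<in> E) \<and>
     (\<forall>(i, j)\<in>axiom_links F. i \<in> E \<longrightarrow> j \<in> E) \<and>
     (\<forall>(i, j)\<in>succ_edges F. j \<in> E \<and> labelled F j LStar \<longrightarrow> i \<in> E)"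

definition roots :: "('p, 'i, 'v) gen_forest \<Rightarrow> 'i set \<Rightarrow> 'i set" where
  "roots F E = {j \<in> E. \<forall>i\<in>E. (i, j) \<notin> succ_edges F}"

definition subnet :: "('p, 'i, 'v) gen_forest \<Rightarrow> 'i set \<Rightarrow> bool" where
  "subnet F E \<longleftrightarrow> substructure F E \<and>
     (\<forall>p. switching_path F p \<and> hd p \<in> roots F E \<and> last p \<in> roots F E \<longrightarrow> set p \<subseteq> E)"


section \<open>Cut-reduction\<close>

text \<open>
  Replace every outermost witness on which \<open>h\<close> is defined by a formal sum, flattening sums; a
  witness that is a root becomes an expansion.
\<close>

primrec tree_replace ::
    "(('i, 'v) wit \<Rightarrow> ('i, 'v) wit multiset option) \<Rightarrow> ('i, 'v) tree \<Rightarrow> ('i, 'v) tree"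
  and wit_replace ::
    "(('i, 'v) wit \<Rightarrow> ('i, 'v) wit multiset option) \<Rightarrow> ('i, 'v) wit \<Rightarrow> ('i, 'v) wit multiset"
  where
  "tree_replace h (Unit i) = Unit i"
| "tree_replace h (Exp i ws) = Exp i (sum_mset (image_mset (wit_replace h) ws))"
| "tree_replace h (Vee i t s) = Vee i (tree_replace h t) (tree_replace h s)"
| "tree_replace h (VeeL i t j) = VeeL i (tree_replace h t) j"
| "tree_replace h (VeeR i j t) = VeeR i j (tree_replace h t)"
| "wit_replace h (Wire i x) =
     (case h (Wire i x) of Some us \<Rightarrow> us | None \<Rightarrow> {#Wire i x#})"
| "wit_replace h (Tensor i t s) =
     (case h (Tensor i t s) of Some us \<Rightarrow> us
      | None \<Rightarrow> {#Tensor i (tree_replace h t) (tree_replace h s)#})"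

primrec root_replace ::
    "(('i, 'v) wit \<Rightarrow> ('i, 'v) wit multiset option) \<Rightarrow> ('p, 'i, 'v) root \<Rightarrow>
     ('p, 'i, 'v) gen_forest" where
  "root_replace h (Tree t A) = {#Tree (tree_replace h t) A#}"
| "root_replace h (Wit w T) =
     (case h w of Some us \<Rightarrow> {#Tree (Exp (wname w) us) (underlying T)#}
      | None \<Rightarrow> {#Wit v T. v \<in># wit_replace h w#})"
| "root_replace h (Cut i t A s) = {#Cut i (tree_replace h t) A (tree_replace h s)#}"

text \<open>Substitution of the expansion with summands \<open>us\<close> for a wire variable.\<close>

definition subst ::
  "'v wire \<Rightarrow> ('i, 'v) wit multiset \<Rightarrow> ('p, 'i, 'v) gen_forest \<Rightarrow> ('p, 'i, 'v) gen_forest" where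
  "subst y us F =
     sum_mset (image_mset (root_replace (\<lambda>w. if \<exists>k. w = Wire k y then Some us else None)) F)"

text \<open>
  Duplication of the witnesses and cuts with names in \<open>R\<close>, the wire variables of the two copies
  being renamed by \<open>l\<close> and \<open>r\<close>.
\<close>

definition duplicate_wit ::
  "('v \<Rightarrow> 'v) \<Rightarrow> ('v \<Rightarrow> 'v) \<Rightarrow> 'i set \<Rightarrow> ('i, 'v) wit \<Rightarrow> ('i, 'v) wit multiset option" where
  "duplicate_wit l r R w = (if wname w \<in> R then Some {#map_wit id l w, map_wit id r w#} else None)"

definition duplicate ::
  "('v \<Rightarrow> 'v) \<Rightarrow> ('v \<Rightarrow> 'v) \<Rightarrow> 'i set \<Rightarrow> ('p, 'i, 'v) gen_forest \<Rightarrow> ('p, 'i, 'v) gen_forest" where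
  "duplicate l r R F =
     sum_mset (image_mset
       (\<lambda>c. if (\<exists>i t A s. c = Cut i t A s) \<and> rname c \<in> R
            then {#map_root id id l c, map_root id id r c#}
            else root_replace (duplicate_wit l r R) c) F)"

definition fresh_copies :: "('v \<Rightarrow> 'v) \<Rightarrow> ('v \<Rightarrow> 'v) \<Rightarrow> 'v set \<Rightarrow> bool" where
  "fresh_copies l r V \<longleftrightarrow> inj_on l V \<and> inj_on r V \<and>
     l ` V \<inter> V = {} \<and> r ` V \<inter> V = {} \<and> l ` V \<inter> r ` V = {}"

text \<open>
  Deletion of the nodes in \<open>U\<close> that are roots or summands, and replacement by \<open>*\<close> of those that
  are successors of a disjunction node.
\<close>

primrec tree_prune :: "'i set \<Rightarrow> ('i, 'v) tree \<Rightarrow> ('i, 'v) tree"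
  and wit_prune :: "'i set \<Rightarrow> ('i, 'v) wit \<Rightarrow> ('i, 'v) wit" where
  "tree_prune U (Unit i) = Unit i"
| "tree_prune U (Exp i ws) = Exp i {#w \<in># image_mset (wit_prune U) ws. wname w \<notin> U#}"
| "tree_prune U (Vee i t s) =
     (if tname t \<in> U then VeeR i (tname t) (tree_prune U s)
      else if tname s \<in> U then VeeL i (tree_prune U t) (tname s)
      else Vee i (tree_prune U t) (tree_prune U s))"
| "tree_prune U (VeeL i t j) = VeeL i (tree_prune U t) j"
| "tree_prune U (VeeR i j t) = VeeR i j (tree_prune U t)"
| "wit_prune U (Wire i x) = Wire i x"
| "wit_prune U (Tensor i t s) = Tensor i (tree_prune U t) (tree_prune U s)"

primrec root_prune :: "'i set \<Rightarrow> ('p, 'i, 'v) root \<Rightarrow> ('p, 'i, 'v) root" where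
  "root_prune U (Tree t A) = Tree (tree_prune U t) A"
| "root_prune U (Wit w T) = Wit (wit_prune U w) T"
| "root_prune U (Cut i t A s) = Cut i (tree_prune U t) A (tree_prune U s)"

definition prune :: "'i set \<Rightarrow> ('p, 'i, 'v) gen_forest \<Rightarrow> ('p, 'i, 'v) gen_forest" where
  "prune U F = image_mset (root_prune U) {#c \<in># F. rname c \<notin> U#}"

definition prunable :: "('p, 'i, 'v) gen_forest \<Rightarrow> 'i set \<Rightarrow> 'i \<Rightarrow> bool" where
  "prunable G E u \<longleftrightarrow>
     u \<in> rname ` set_mset G \<or>
     (\<exists>n. labelled G n LExp \<and> (n, u) \<in> succ_edges G \<and>
          (\<exists>v. (n, v) \<in> succ_edges G \<and> v \<notin> E)) \<or>
     (\<exists>n v. labelled G n LVee \<and> (n, u) \<in> succ_edges G \<and> (n, v) \<in> succ_edges G \<and>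
          v \<noteq> u \<and> v \<notin> E)"

definition weakening_subnet :: "('p, 'i, 'v) gen_forest \<Rightarrow> 'i set \<Rightarrow> 'i set \<Rightarrow> 'i \<Rightarrow> bool" where
  "weakening_subnet G E U s \<longleftrightarrow>
     subnet G E \<and> s \<notin> U \<and> roots G E = insert s U \<and> (\<forall>u\<in>U. prunable G E u)"

text \<open>
  Reduction is specified on distinctly named forests.  The node names of the right-hand sides are
  immaterial; they are erased by \<open>cut_reduces\<close>.
\<close>

inductive reduct :: "'p named_forest \<Rightarrow> 'p named_forest \<Rightarrow> bool" where
  logical:
    "reduct (F + {#Cut i (Exp j {#Tensor k s1 s2#}) (Conj A B) (Vee l t1 t2)#})
            (F + {#mk_cut i s1 A t1, mk_cut i s2 B t2#})"
| atomic:
    "A = Pos p \<or> A = Neg p \<Longrightarrow>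
     reduct (F + {#mk_cut i (Exp j {#Wire k x#}) A (Exp l us)#}) (subst (wdual x) us F)"
| contraction:
    "G = F + {#Cut i (Exp j (S1 + S2)) A t#} \<Longrightarrow> S1 \<noteq> {#} \<Longrightarrow> S2 \<noteq> {#} \<Longrightarrow>
     subnet G E \<Longrightarrow> roots G E = insert (tname t) R \<Longrightarrow>
     \<forall>u\<in>R. (\<exists>x. labelled G u (LWire x)) \<or> labelled G u LTensor \<or> labelled G u LCut \<Longrightarrow>
     fresh_copies f g (forest_vars G) \<Longrightarrow>
     reduct G (duplicate f g R F +
       {#Cut i (Exp j S1) A (map_tree id f t), Cut i (Exp j S2) A (map_tree id g t)#})"
| weakening_left:
    "G = F + {#Cut i (Exp j {#Tensor k s1 s2#}) (Conj A B) (VeeL l t m)#} \<Longrightarrow>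
     weakening_subnet G E U (tname s2) \<Longrightarrow>
     reduct G (prune U F + {#mk_cut i s1 A t#})"
| weakening_right:
    "G = F + {#Cut i (Exp j {#Tensor k s1 s2#}) (Conj A B) (VeeR l m t)#} \<Longrightarrow>
     weakening_subnet G E U (tname s1) \<Longrightarrow>
     reduct G (prune U F + {#mk_cut i s2 B t#})"

definition cut_reduces :: "'p forest \<Rightarrow> 'p forest \<Rightarrow> bool" where
  "cut_reduces F F' \<longleftrightarrow>
     (\<exists>G G'. distinctly_named G \<and> typed_forest G \<and> AC G \<and> reduct G G' \<and>
             F = erase G \<and> F' = erase G')"

end

theory Submission
  imports Defs
begin

text \<open>
  The argument avoids sequentialization: instead of recovering a proof from AC-correctness, it
  carries a derivation along and operates on it.  Derivability is rephrased as the relation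
  \<open>drv\<close>, whose derivations can be transformed without changing the forest they conclude
  (inversion, splitting of sums, detaching a factor of a tensor, substitution).  With it, each
  reduction step is shown to lead from a derivable forest to a derivable one.  As reduction refers
  to names of nodes, every forest is first named distinctly, and derivations are lifted along.

  For a cut whose positive side is a single witness there is no choice.  The logical and atomic
  steps only need inversion of derivations.  For a default weakening some subnet has to be erased.
  Let \<open>k\<close> be the tensor and \<open>u\<close> its erased factor; the nodes that no switching path from \<open>k\<close>
  avoiding \<open>u\<close> reaches form a subnet with \<open>u\<close> among its roots (\<open>subnet_E\<close>), and erasing them turns a
  derivation into a derivation (\<open>drv_survivors\<close>, \<open>weakening_step\<close>).

  For a cut against a sum of several witnesses a subnet has to be duplicated.  The net above the
  right premise of a cut, followed down the derivation, is always such a subnet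
  (\<open>subnet_track\<close>, \<open>nd_contraction_site\<close>).  Duplicating it also duplicates the cuts in
  it, so the cut is chosen with no other cut of maximal rank above its right premise; that such a
  cut exists is seen by going up the derivation (\<open>wide_flag\<close>).  The flag \<open>e\<close> and the
  numbers \<open>r\<close> and \<open>n\<close> of \<open>drv r n e\<close> say that the derivation contains such a cut, of rank
  \<open>r\<close> against a sum of \<open>n\<close> witnesses.

  Termination is by induction on the rank \<open>r\<close> of the most complex cuts, and for fixed \<open>r\<close> on the
  number of cuts of rank \<open>r\<close> with at least two summands, then on the number of all cuts of rank \<open>r\<close>.
  Splitting summands off the chosen cut one by one makes it narrow without creating wide cuts; a
  narrow cut is replaced by cuts of smaller rank.
\<close>

section \<open>Derivations with control over the cuts\<close>

lemma forest_vars_simps [simp]: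
  "forest_vars {#} = {}"
  "forest_vars (add_mset c F) = root_vars c \<union> forest_vars F"
  "forest_vars (F + G) = forest_vars F \<union> forest_vars G"
  by (auto simp: forest_vars_def)

primrec rank :: "'p formula \<Rightarrow> nat" where
  "rank (Pos a) = 0"
| "rank (Neg a) = 0"
| "rank Top = 0"
| "rank Bot = 0"
| "rank (Conj A B) = Suc (max (rank A) (rank B))"
| "rank (Disj A B) = Suc (max (rank A) (rank B))"

lemma rank_dual [simp]: "rank (dual A) = rank A"
  by (induction A) auto

lemma dual_dual [simp]: "dual (dual A) = A"
  by (induction A) auto

fun width :: "('i, 'v) tree \<Rightarrow> nat" where
  "width (Exp i ws) = size ws"
| "width t = 0"

definition lacks_rank :: "nat \<Rightarrow> ('p, 'i, 'v) gen_forest \<Rightarrow> bool" where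
  "lacks_rank r F \<longleftrightarrow> (\<forall>i s A t. Cut i s A t \<in># F \<longrightarrow> rank A \<noteq> r)"

lemma lacks_rank_simps [simp]:
  "lacks_rank r {#}"
  "lacks_rank r (F + G) \<longleftrightarrow> lacks_rank r F \<and> lacks_rank r G"
  "lacks_rank r (add_mset (Tree t A) F) \<longleftrightarrow> lacks_rank r F"
  "lacks_rank r (add_mset (Wit w T) F) \<longleftrightarrow> lacks_rank r F"
  "lacks_rank r (add_mset (Cut i s B t) F) \<longleftrightarrow> rank B \<noteq> r \<and> lacks_rank r F"
  unfolding lacks_rank_def by auto blast+

inductive unary :: "('p, 'i, 'v) gen_forest \<Rightarrow> ('p, 'i, 'v) root \<Rightarrow> bool" where
  vee: "unary {#Tree t A, Tree s B#} (Tree (Vee i t s) (Disj A B))"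
| veeL: "unary {#Tree t A#} (Tree (VeeL i t j) (Disj A B))"
| veeR: "unary {#Tree s B#} (Tree (VeeR i j s) (Disj A B))"
| contraction: "ws \<noteq> {#} \<Longrightarrow> vs \<noteq> {#} \<Longrightarrow>
    unary {#Tree (Exp i ws) (underlying T), Tree (Exp j vs) (underlying T)#}
          (Tree (Exp k (ws + vs)) (underlying T))"

text \<open>
  The rules of derivability with three changes: contraction joins nonempty sums, a cut is always oriented with the positive term on the left, and a flag may single out a cut. A set flag says that the derivation contains a cut of rank \<open>r\<close> against a sum of \<open>n\<close> witnesses whose right premise has no cut of rank \<open>r\<close>, and that no narrow cut of rank \<open>r\<close> lies below it; this is what lets the subnet above its right premise be duplicated without duplicating or widening other cuts of rank \<open>r\<close>.
\<close>

inductive drv :: "nat \<Rightarrow> nat \<Rightarrow> bool \<Rightarrow> ('p, 'i, 'v) gen_forest \<Rightarrow> bool" for r n :: nat where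
  unit: "drv r n False {#Tree (Unit i) Top#}"
| axiom: "drv r n False {#Tree (Exp i {#Wire j (Xbar x)#}) (Neg p),
                          Tree (Exp k {#Wire l (X x)#}) (Pos p)#}"
| mix: "drv r n b F \<Longrightarrow> drv r n c G \<Longrightarrow> forest_vars F \<inter> forest_vars G = {} \<Longrightarrow>
    (e \<Longrightarrow> b \<or> c) \<Longrightarrow> drv r n e (F + G)"
| un: "drv r n e (F + P) \<Longrightarrow> unary P c \<Longrightarrow> drv r n e (F + {#c#})"
| tensor: "drv r n b (F + {#Tree t A#}) \<Longrightarrow> drv r n c (G + {#Tree s B#}) \<Longrightarrow>
    forest_vars (F + {#Tree t A#}) \<inter> forest_vars (G + {#Tree s B#}) = {} \<Longrightarrow>
    (e \<Longrightarrow> b \<or> c) \<Longrightarrow>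
    drv r n e (F + G + {#Tree (Exp i {#Tensor j t s#}) (Conj A B)#})"
| cut: "drv r n b (F + {#Tree s A#}) \<Longrightarrow> drv r n c (G + {#Tree t (dual A)#}) \<Longrightarrow>
    positive A \<Longrightarrow>
    forest_vars (F + {#Tree s A#}) \<inter> forest_vars (G + {#Tree t (dual A)#}) = {} \<Longrightarrow>
    (e \<Longrightarrow> (b \<or> c) \<and> (rank A = r \<longrightarrow> 2 \<le> width s) \<or>
           rank A = r \<and> width s = n \<and> lacks_rank r G) \<Longrightarrow>
    drv r n e (F + G + {#Cut i s A t#})"

lemma drv_forget_flag: "drv r n e F \<Longrightarrow> drv r' n' False F"
proof (induction rule: drv.induct)
  case (mix b F c G e) then show ?case by (blast intro: drv.mix)
next
  case (tensor b F t A c G s B e i j) then show ?case by (blast intro: drv.tensor)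
next
  case (cut b F s A c G t e i) then show ?case by (blast intro: drv.cut)
qed (blast intro: drv.intros)+

lemma drv_weaken: "drv r n c F \<Longrightarrow> (e \<Longrightarrow> c) \<Longrightarrow> drv r n e F"
  using drv_forget_flag[of r n c F r n] by (cases e; cases c) auto

lemma unary_vars: "unary P c \<Longrightarrow> forest_vars P = root_vars c"
  by (induction rule: unary.induct) auto

lemma unary_nonempty: "unary P c \<Longrightarrow> P \<noteq> {#}"
  by (induction rule: unary.induct) auto

lemma unary_concl_tree: "unary P c \<Longrightarrow> \<exists>t A. c = Tree t A"
  by (induction rule: unary.induct) auto

lemma drv_nonempty: "drv r n e F \<Longrightarrow> F \<noteq> {#}"
  by (induction rule: drv.induct) auto

lemma drv_flagged_cut: "drv r n e F \<Longrightarrow> e \<Longrightarrow> \<exists>i s A t. Cut i s A t \<in># F"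
proof (induction rule: drv.induct)
  case (un e F P c)
  then show ?case by (auto elim!: unary.cases)
qed (simp; blast)+

lemma drv_no_witness: "drv r n e F \<Longrightarrow> Wit w T \<notin># F"
  by (induction rule: drv.induct) (auto dest: unary_concl_tree)

lemma drv_no_Bot: "drv r n e F \<Longrightarrow> Tree t Bot \<notin># F"
proof (induction rule: drv.induct)
  case (un e F P c)
  then show ?case by (auto elim!: unary.cases) (metis formula.distinct underlying.simps wit_type.exhaust)+
qed auto

primrec rmap :: "(('i, 'v) wit \<Rightarrow> ('i, 'v) wit multiset option) \<Rightarrow>
    ('p, 'i, 'v) root \<Rightarrow> ('p, 'i, 'v) root" where
  "rmap h (Tree t A) = Tree (tree_replace h t) A"
| "rmap h (Wit w T) = Wit w T"
| "rmap h (Cut i t A s) = Cut i (tree_replace h t) A (tree_replace h s)"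

definition sums_nonempty :: "(('i, 'v) wit \<Rightarrow> ('i, 'v) wit multiset option) \<Rightarrow> bool" where
  "sums_nonempty h \<longleftrightarrow> (\<forall>w us. h w = Some us \<longrightarrow> us \<noteq> {#})"

lemma wit_replace_nonempty: "sums_nonempty h \<Longrightarrow> wit_replace h w \<noteq> {#}"
  by (cases w) (auto simp: sums_nonempty_def split: option.split)

lemma sum_replace_nonempty:
  "sums_nonempty h \<Longrightarrow> ws \<noteq> {#} \<Longrightarrow> sum_mset (image_mset (wit_replace h) ws) \<noteq> {#}"
  using wit_replace_nonempty[of h] by (auto simp: multiset_eq_iff) 
     (metis multiset_nonemptyE wit_replace_nonempty)

lemma size_sum_replace:
  "sums_nonempty h \<Longrightarrow> size ws \<le> size (sum_mset (image_mset (wit_replace h) ws))"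
proof (induction ws)
  case (add w ws)
  then have "0 < size (wit_replace h w)" using wit_replace_nonempty nonempty_has_size by blast
  with add show ?case by simp
qed simp

lemma replace_vars:
  assumes "\<And>w us. h w = Some us \<Longrightarrow> \<Union>(wit_vars ` set_mset us) \<subseteq> V"
  shows "tree_vars (tree_replace h t) \<subseteq> tree_vars t \<union> V"
    and "\<Union>(wit_vars ` set_mset (wit_replace h w)) \<subseteq> wit_vars w \<union> V"
proof (induction t and w)
  case (Exp i ws)
  then show ?case by fastforce
next
  case (Wire i x)
  then show ?case using assms by (auto split: option.split)
next
  case (Tensor i t s)
  then show ?case using assms[of "Tensor i t s"] by (auto split: option.split) blast+
qed auto

lemma replace_untouched:
  assumes "\<And>w us. h w = Some us \<Longrightarrow> wit_vars w \<inter> V \<noteq> {}"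
  shows "tree_vars t \<inter> V = {} \<Longrightarrow> tree_replace h t = t"
    and "wit_vars w \<inter> V = {} \<Longrightarrow> wit_replace h w = {#w#}"
proof (induction t and w)
  case (Exp i ws)
  then have "image_mset (wit_replace h) ws = image_mset (\<lambda>w. {#w#}) ws"
    by (intro image_mset_cong) auto
  then show ?case by simp
next
  case (Wire i x)
  then show ?case using assms[of "Wire i x"] by (auto split: option.split)
next
  case (Tensor i t s)
  then show ?case using assms[of "Tensor i t s"] by (auto split: option.split)
qed auto

lemma rmap_untouched:
  assumes "\<And>w us. h w = Some us \<Longrightarrow> wit_vars w \<inter> V \<noteq> {}"
  shows "forest_vars F \<inter> V = {} \<Longrightarrow> image_mset (rmap h) F = F"
proof (induction F)
  case (add c F)
  then show ?case using replace_untouched[OF assms] by (cases c) (auto simp: Int_Un_distrib2)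
qed simp

lemma rmap_vars:
  assumes "\<And>w us. h w = Some us \<Longrightarrow> \<Union>(wit_vars ` set_mset us) \<subseteq> V"
  shows "forest_vars (image_mset (rmap h) F) \<subseteq> forest_vars F \<union> V"
proof (induction F)
  case (add c F)
  have "root_vars (rmap h c) \<subseteq> root_vars c \<union> V"
    using replace_vars(1)[OF assms] by (cases c) fastforce+
  with add show ?case by auto
qed simp

lemma unary_rmap:
  assumes "unary P c" "sums_nonempty h"
  shows "unary (image_mset (rmap h) P) (rmap h c)"
  using assms
proof (induction rule: unary.induct)
  case (contraction ws vs i T j k)
  then show ?case
    using unary.contraction[OF sum_replace_nonempty[of h ws] sum_replace_nonempty[of h vs]]
    by auto
qed (auto intro: unary.intros)

lemma rmap_None [simp]: "image_mset (rmap (\<lambda>_. None)) F = F"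
  by (rule rmap_untouched[of _ "{}"]) auto

lemma width_replace: "sums_nonempty h \<Longrightarrow> width s \<le> width (tree_replace h s)"
  using size_sum_replace[of h] by (cases s) auto

text \<open>
  The one induction behind inversion, splitting of sums and substitution: replace a root \<open>c0\<close> by \<open>Q\<close> and apply \<open>h\<close> to the wires elsewhere. Going up the derivation, the root stays in the context until the rule that introduces it, and only those rules have to be treated.
\<close>

lemma drv_transform:
  fixes H :: "('p, 'i, 'v) gen_forest"
  assumes "drv r n e H" and "c0 \<in># H" and "V \<inter> forest_vars H = {}"
    and Q: "forest_vars Q \<subseteq> root_vars c0 \<union> V"
    and h: "\<And>w us. h w = Some us \<Longrightarrow>
      wit_vars w \<inter> root_vars c0 \<noteq> {} \<and> (\<exists>i x. w = Wire i x) \<and>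
      \<Union>(wit_vars ` set_mset us) \<subseteq> root_vars c0 \<union> V"
    and ne: "sums_nonempty h"
    and flag: "flagged \<Longrightarrow> h = (\<lambda>_. None) \<and> lacks_rank r Q \<and> (\<exists>t A. c0 = Tree t A)"
    and p_unit: "\<And>i. c0 = Tree (Unit i) Top \<Longrightarrow> Q = {#} \<or> drv r n False Q"
    and p_neg: "\<And>i j x p k l. c0 = Tree (Exp i {#Wire j (Xbar x)#}) (Neg p) \<Longrightarrow> x \<notin> V \<Longrightarrow>
      drv r n False ({#rmap h (Tree (Exp k {#Wire l (X x)#}) (Pos p))#} + Q)"
    and p_pos: "\<And>i j x p k l. c0 = Tree (Exp k {#Wire l (X x)#}) (Pos p) \<Longrightarrow> x \<notin> V \<Longrightarrow>
      drv r n False ({#rmap h (Tree (Exp i {#Wire j (Xbar x)#}) (Neg p))#} + Q)"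
    and p_un: "\<And>F P e. unary P c0 \<Longrightarrow> drv r n e (F + P) \<Longrightarrow> 
      V \<inter> forest_vars (F + P) = {} \<Longrightarrow> drv r n (e \<and> flagged) (image_mset (rmap h) F + Q)"
    and p_tensor: "\<And>F G i j t s A B. c0 = Tree (Exp i {#Tensor j t s#}) (Conj A B) \<Longrightarrow>
      drv r n False (F + {#Tree t A#}) \<Longrightarrow> drv r n False (G + {#Tree s B#}) \<Longrightarrow>
      forest_vars (F + {#Tree t A#}) \<inter> forest_vars (G + {#Tree s B#}) = {} \<Longrightarrow>
      V \<inter> forest_vars (F + G + {#c0#}) = {} \<Longrightarrow>
      \<not> flagged \<and> drv r n False (image_mset (rmap h) (F + G) + Q)"
    and p_cut: "\<And>F G i A s t. c0 = Cut i s A t \<Longrightarrow>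
      drv r n False (F + {#Tree s A#}) \<Longrightarrow> drv r n False (G + {#Tree t (dual A)#}) \<Longrightarrow>
      forest_vars (F + {#Tree s A#}) \<inter> forest_vars (G + {#Tree t (dual A)#}) = {} \<Longrightarrow>
      V \<inter> forest_vars (F + G + {#c0#}) = {} \<Longrightarrow> positive A \<Longrightarrow>
      \<not> flagged \<and> drv r n False (image_mset (rmap h) (F + G) + Q)"
  shows "image_mset (rmap h) (H - {#c0#}) + Q = {#} \<or>
    drv r n (e \<and> flagged) (image_mset (rmap h) (H - {#c0#}) + Q)"
proof -
  have hV: "\<Union>(wit_vars ` set_mset us) \<subseteq> root_vars c0 \<union> V" if "h w = Some us" for w us
    using h[OF that] by blast
  have h_tensor [simp]: "h (Tensor i t s) = None" for i t s
    using h[of "Tensor i t s"] by (cases "h (Tensor i t s)") auto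
  have after: "forest_vars (image_mset (rmap h) F + Q) \<subseteq> forest_vars F \<union> root_vars c0 \<union> V" for F
    using rmap_vars[of h "root_vars c0 \<union> V" F] hV Q by (simp only: forest_vars_simps) blast
  have vars_after: "tree_vars (tree_replace h t) \<subseteq> tree_vars t \<union> root_vars c0 \<union> V" for t
    using replace_vars(1)[of h "root_vars c0 \<union> V" t] hV by blast
  have untouched: "image_mset (rmap h) F = F" if "forest_vars F \<inter> root_vars c0 = {}"
    for F :: "('p, 'i, 'v) gen_forest"
    using rmap_untouched[of h "root_vars c0" F] h that by blast
  have untouched_tree: "tree_replace h t = t" if "tree_vars t \<inter> root_vars c0 = {}" for t
    using replace_untouched(1)[of h "root_vars c0" t] h that by blast
  have mix_side: "drv r n (e \<and> flagged) (image_mset (rmap h) F' + Q + image_mset (rmap h) G)"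
    if "drv r n b (F' + {#c0#})" "drv r n c G" "forest_vars (F' + {#c0#}) \<inter> forest_vars G = {}"
      "V \<inter> forest_vars G = {}" "e \<Longrightarrow> b \<or> c"
      "image_mset (rmap h) F' + Q = {#} \<or> drv r n (b \<and> flagged) (image_mset (rmap h) F' + Q)"
    for F' G b c e
  proof -
    have G: "image_mset (rmap h) G = G" using untouched[of G] that(3) by auto
    show ?thesis
    proof (cases "image_mset (rmap h) F' + Q = {#}")
      case True
      have "c" if "e \<and> flagged"
      proof (rule ccontr)
        assume "\<not> c"
        with that \<open>e \<Longrightarrow> b \<or> c\<close> have b by blast
        with drv_flagged_cut[OF \<open>drv r n b (F' + {#c0#})\<close>] True obtain i s A t where "c0 = Cut i s A t"
          by auto
        with flag that show False by auto
      qed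
      with drv_weaken[OF \<open>drv r n c G\<close>] True G show ?thesis by simp
    next
      case False
      with that have *: "drv r n (b \<and> flagged) (image_mset (rmap h) F' + Q)" by blast
      have "forest_vars (image_mset (rmap h) F' + Q) \<inter> forest_vars G = {}"
        using that(3,4) after[of F'] by auto
      from drv.mix[OF * \<open>drv r n c G\<close> this, of "e \<and> flagged"] that(5) G
      show ?thesis by auto
    qed
  qed
  have split: "\<exists>F'. F = F' + {#c0#}" if "c0 \<in># F" for F
    using that by (metis add_mset_add_single insert_DiffM)
  show ?thesis
    using assms(1-3)
  proof (induction rule: drv.induct)
    case (unit i)
    then show ?case using p_unit[of i] by auto
  next
    case (axiom i j x p k l)
    then show ?case using p_neg[of i j x p k l] p_pos[of k l x p i j]
      by (auto simp: add_mset_commute)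
  next
    case (mix b F c G e)
    consider "c0 \<in># F" | "c0 \<in># G" using mix.prems(1) by auto
    then show ?case
    proof cases
      case 1
      then obtain F' where F: "F = F' + {#c0#}" using split by blast
      have "drv r n (e \<and> flagged) (image_mset (rmap h) F' + Q + image_mset (rmap h) G)"
        by (rule mix_side[of b F' c G e]) (use mix 1 F in auto)
      then show ?thesis using F by (simp add: ac_simps)
    next
      case 2
      then obtain G' where G: "G = G' + {#c0#}" using split by blast
      have "drv r n (e \<and> flagged) (image_mset (rmap h) G' + Q + image_mset (rmap h) F)"
        by (rule mix_side[of c G' b F e]) (use mix 2 G in auto)
      then show ?thesis using G by (simp add: ac_simps)
    qed
  next
    case (un e F P c)
    show ?case
    proof (cases "c0 = c")
      case True
      then show ?thesis using p_un[OF _ un.hyps(1)] un.hyps un.prems unary_vars[OF un.hyps(2)]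
        by auto
    next
      case False
      then have "c0 \<in># F" using un.prems(1) by auto
      then obtain F' where F: "F = F' + {#c0#}" using split by blast
      have "drv r n (e \<and> flagged) (image_mset (rmap h) (F' + P) + Q)"
        using un.IH un.prems F unary_vars[OF un.hyps(2)] unary_nonempty[OF un.hyps(2)] by auto
      then have "drv r n (e \<and> flagged) ((image_mset (rmap h) F' + Q) + image_mset (rmap h) P)"
        by (simp add: ac_simps)
      from drv.un[OF this unary_rmap[OF un.hyps(2) ne]] show ?thesis
        using F by (simp add: ac_simps)
    qed
  next
    case (tensor b F t A c G s B e i j)
    let ?new = "Tree (Exp i {#Tensor j t s#}) (Conj A B)"
    consider "c0 = ?new" | "c0 \<noteq> ?new" "c0 \<in># F" | "c0 \<noteq> ?new" "c0 \<in># G"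
      using tensor.prems(1) by auto
    then show ?case
    proof cases
      case 1
      have V: "V \<inter> forest_vars (F + G + {#c0#}) = {}" using tensor.prems(2) 1 by simp
      from p_tensor[OF 1 drv_forget_flag[OF tensor.hyps(1)] drv_forget_flag[OF tensor.hyps(2)]
          tensor.hyps(3) V]
      show ?thesis using 1 by simp
    next
      case 2
      then obtain F' where F: "F = F' + {#c0#}" using split by blast
      have "drv r n (b \<and> flagged) (image_mset (rmap h) (F' + {#Tree t A#}) + Q)"
        using tensor.IH(1) tensor.prems 2 F by auto
      then have 3: "drv r n (b \<and> flagged) ((image_mset (rmap h) F' + Q) + {#Tree (tree_replace h t) A#})"
        by (simp add: ac_simps)
      have G: "image_mset (rmap h) G = G" "tree_replace h s = s"
        using untouched[of G] untouched_tree[of s] tensor.hyps(3) F by auto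
      have "forest_vars ((image_mset (rmap h) F' + Q) + {#Tree (tree_replace h t) A#}) \<inter>
          forest_vars (G + {#Tree s B#}) = {}"
        using after[of F'] vars_after[of t] tensor.hyps(3) tensor.prems F by auto
      from drv.tensor[OF 3 tensor.hyps(2) this, of "e \<and> flagged" i j] tensor.hyps(4)
      show ?thesis using F G by (auto simp: ac_simps)
    next
      case 3
      then obtain G' where G: "G = G' + {#c0#}" using split by blast
      have "drv r n (c \<and> flagged) (image_mset (rmap h) (G' + {#Tree s B#}) + Q)"
        using tensor.IH(2) tensor.prems 3 G by auto
      then have 4: "drv r n (c \<and> flagged) ((image_mset (rmap h) G' + Q) + {#Tree (tree_replace h s) B#})"
        by (simp add: ac_simps)
      have F: "image_mset (rmap h) F = F" "tree_replace h t = t"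
        using untouched[of F] untouched_tree[of t] tensor.hyps(3) G by auto
      have "forest_vars (F + {#Tree t A#}) \<inter>
          forest_vars ((image_mset (rmap h) G' + Q) + {#Tree (tree_replace h s) B#}) = {}"
        using after[of G'] vars_after[of s] tensor.hyps(3) tensor.prems G by auto
      from drv.tensor[OF tensor.hyps(1) 4 this, of "e \<and> flagged" i j] tensor.hyps(4)
      show ?thesis using F G by (auto simp: ac_simps)
    qed
  next
    case (cut b F s A c G t e i)
    let ?new = "Cut i s A t"
    consider "c0 = ?new" | "c0 \<noteq> ?new" "c0 \<in># F" | "c0 \<noteq> ?new" "c0 \<in># G"
      using cut.prems(1) by auto
    then show ?case
    proof cases
      case 1
      have V: "V \<inter> forest_vars (F + G + {#c0#}) = {}" using cut.prems(2) 1 by simp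
      from p_cut[OF 1 drv_forget_flag[OF cut.hyps(1)] drv_forget_flag[OF cut.hyps(2)]
          cut.hyps(4) V cut.hyps(3)]
      show ?thesis using 1 by simp
    next
      case 2
      then obtain F' where F: "F = F' + {#c0#}" using split by blast
      have "drv r n (b \<and> flagged) (image_mset (rmap h) (F' + {#Tree s A#}) + Q)"
        using cut.IH(1) cut.prems 2 F by auto
      then have 3: "drv r n (b \<and> flagged) ((image_mset (rmap h) F' + Q) + {#Tree (tree_replace h s) A#})"
        by (simp add: ac_simps)
      have G: "image_mset (rmap h) G = G" "tree_replace h t = t"
        using untouched[of G] untouched_tree[of t] cut.hyps(4) F by auto
      have "forest_vars ((image_mset (rmap h) F' + Q) + {#Tree (tree_replace h s) A#}) \<inter>
          forest_vars (G + {#Tree t (dual A)#}) = {}"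
        using after[of F'] vars_after[of s] cut.hyps(4) cut.prems F by auto
      moreover have "width (tree_replace h s) = width s" if flagged
        using flag[OF that] rmap_None[of "{#Tree s A#}"] by simp
      ultimately have "drv r n (e \<and> flagged) ((image_mset (rmap h) F' + Q) + G + {#Cut i (tree_replace h s) A t#})"
        by (intro drv.cut[OF 3 cut.hyps(2,3), of "e \<and> flagged"]) (use cut.hyps(5) in auto)
      then show ?thesis using F G by (auto simp: ac_simps)
    next
      case 3
      then obtain G' where G: "G = G' + {#c0#}" using split by blast
      have "drv r n (c \<and> flagged) (image_mset (rmap h) (G' + {#Tree t (dual A)#}) + Q)"
        using cut.IH(2) cut.prems 3 G by auto
      then have 4: "drv r n (c \<and> flagged) ((image_mset (rmap h) G' + Q) + {#Tree (tree_replace h t) (dual A)#})"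
        by (simp add: ac_simps)
      have F: "image_mset (rmap h) F = F" "tree_replace h s = s"
        using untouched[of F] untouched_tree[of s] cut.hyps(4) G by auto
      have "forest_vars (F + {#Tree s A#}) \<inter>
          forest_vars ((image_mset (rmap h) G' + Q) + {#Tree (tree_replace h t) (dual A)#}) = {}"
        using after[of G'] vars_after[of t] cut.hyps(4) cut.prems G by auto
      moreover have "lacks_rank r (image_mset (rmap h) G' + Q)" if flagged "lacks_rank r G"
        using flag[OF that(1)] that(2) G by auto
      ultimately have "drv r n (e \<and> flagged) (F + (image_mset (rmap h) G' + Q) + {#Cut i s A (tree_replace h t)#})"
        by (intro drv.cut[OF cut.hyps(1) 4 cut.hyps(3), of "e \<and> flagged"]) (use cut.hyps(5) in auto)
      then show ?thesis using F G by (auto simp: ac_simps)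
    qed
  qed
qed

section \<open>Typing and inversion\<close>

inductive_cases typed_elims:
  "tree_typed \<Theta> (Unit i) A" "tree_typed \<Theta> (Exp i ws) A" "tree_typed \<Theta> (Vee i t s) A"
  "tree_typed \<Theta> (VeeL i t j) A" "tree_typed \<Theta> (VeeR i j t) A"
  "wit_typed \<Theta> (Wire i x) T" "wit_typed \<Theta> (Tensor i t s) T"

lemma typed_cong:
  fixes t :: "('i, 'v) tree" and w :: "('i, 'v) wit"
  shows "tree_typed \<Theta> t A \<Longrightarrow> \<forall>x\<in>tree_vars t. \<Theta> x = \<Theta>' x \<Longrightarrow> tree_typed \<Theta>' t A"
  and "wit_typed \<Theta> w T \<Longrightarrow> \<forall>x\<in>wit_vars w. \<Theta> x = \<Theta>' x \<Longrightarrow> wit_typed \<Theta>' w T"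
proof (induction t and w arbitrary: A and T)
  case (Unit i)
  then show ?case by (elim typed_elims) (auto intro: tree_typed_wit_typed.intros)
next
  case (Exp i ws)
  from Exp.prems(1) obtain T where T: "A = underlying T" "ws \<noteq> {#}" "\<forall>w\<in>#ws. wit_typed \<Theta> w T"
    by (elim typed_elims) auto
  moreover have "wit_typed \<Theta>' w T" if "w \<in># ws" for w
    using Exp.IH[OF that] Exp.prems(2) that T(3) by simp
  ultimately show ?case by (auto intro: tree_typed_wit_typed.intros)
next
  case (Wire i x)
  from Wire.prems(1) show ?case
  proof (elim typed_elims)
    fix y assume "T = PosW (\<Theta> y)" "x = X y"
    with Wire.prems(2) show ?thesis using tree_typed_wit_typed.intros(6)[of \<Theta>' i y] by simp
  next
    fix y assume "T = NegW (\<Theta> y)" "x = Xbar y"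
    with Wire.prems(2) show ?thesis using tree_typed_wit_typed.intros(7)[of \<Theta>' i y] by simp
  qed
next
  case (Vee i t s)
  from Vee.prems(1) show ?case
    by (elim typed_elims) (use Vee in \<open>auto intro: tree_typed_wit_typed.intros\<close>)
next
  case (VeeL i t j)
  from VeeL.prems(1) show ?case
    by (elim typed_elims) (use VeeL in \<open>auto intro: tree_typed_wit_typed.intros\<close>)
next
  case (VeeR i j t)
  from VeeR.prems(1) show ?case
    by (elim typed_elims) (use VeeR in \<open>auto intro: tree_typed_wit_typed.intros\<close>)
next
  case (Tensor i t s)
  from Tensor.prems(1) show ?case
    by (elim typed_elims) (use Tensor in \<open>auto intro: tree_typed_wit_typed.intros\<close>)
qed

lemma root_typed_cong:
  "root_typed \<Theta> c \<Longrightarrow> \<forall>x\<in>root_vars c. \<Theta> x = \<Theta>' x \<Longrightarrow> root_typed \<Theta>' c"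
  by (cases c) (use typed_cong(1)[of \<Theta> _ _ \<Theta>'] typed_cong(2)[of \<Theta> _ _ \<Theta>'] in \<open>auto simp: ball_Un\<close>)

definition forest_typed :: "('v \<Rightarrow> 'p) \<Rightarrow> ('p, 'i, 'v) gen_forest \<Rightarrow> bool" where
  "forest_typed \<Theta> F \<longleftrightarrow> (\<forall>c\<in>#F. root_typed \<Theta> c)"

lemma forest_typed_simps [simp]:
  "forest_typed \<Theta> {#}"
  "forest_typed \<Theta> (add_mset c F) \<longleftrightarrow> root_typed \<Theta> c \<and> forest_typed \<Theta> F"
  "forest_typed \<Theta> (F + G) \<longleftrightarrow> forest_typed \<Theta> F \<and> forest_typed \<Theta> G"
  by (auto simp: forest_typed_def)

lemma join_typings:
  assumes "forest_typed \<Theta> F" "forest_typed \<Theta>' G" "forest_vars F \<inter> forest_vars G = {}"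
  shows "\<exists>\<Theta>. forest_typed \<Theta> F \<and> forest_typed \<Theta> G"
proof (intro exI conjI)
  let ?\<Theta> = "\<lambda>x. if x \<in> forest_vars F then \<Theta> x else \<Theta>' x"
  show "forest_typed ?\<Theta> F" unfolding forest_typed_def
  proof
    fix c assume "c \<in># F"
    then have "x \<in> forest_vars F" if "x \<in> root_vars c" for x
      using that by (auto simp: forest_vars_def)
    then show "root_typed ?\<Theta> c"
      using root_typed_cong[of \<Theta> c ?\<Theta>] assms(1) \<open>c \<in># F\<close> by (simp add: forest_typed_def)
  qed
  show "forest_typed ?\<Theta> G" unfolding forest_typed_def
  proof
    fix c assume "c \<in># G"
    then have "x \<notin> forest_vars F" if "x \<in> root_vars c" for x
      using assms(3) that by (auto simp: forest_vars_def)
    then show "root_typed ?\<Theta> c"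
      using root_typed_cong[of \<Theta>' c ?\<Theta>] assms(2) \<open>c \<in># G\<close> by (simp add: forest_typed_def)
  qed
qed

lemma underlying_inject: "underlying T = underlying T' \<Longrightarrow> T = T'"
  by (cases T; cases T') auto

lemma unary_typed: "unary P c \<Longrightarrow> forest_typed \<Theta> P \<Longrightarrow> root_typed \<Theta> c"
proof (induction rule: unary.induct)
  case (contraction ws vs i T j k)
  then have "\<forall>w\<in>set_mset (ws + vs). wit_typed \<Theta> w T"
    by (auto elim!: typed_elims dest!: underlying_inject)
  with contraction show ?case by (auto intro: tree_typed_wit_typed.intros)
qed (auto intro: tree_typed_wit_typed.intros)

lemma drv_typed: "drv r n e F \<Longrightarrow> \<exists>\<Theta>. forest_typed \<Theta> F"
proof (induction rule: drv.induct)
  case (unit i)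
  then show ?case by (auto intro: tree_typed_wit_typed.intros)
next
  case (axiom i j x p k l)
  have "wit_typed (\<lambda>_. p) (Wire j (Xbar x)) (NegW p)" "wit_typed (\<lambda>_. p) (Wire l (X x)) (PosW p)"
    using tree_typed_wit_typed.intros(6)[of "\<lambda>_. p" l x] tree_typed_wit_typed.intros(7)[of "\<lambda>_. p" j x]
    by auto
  then have "forest_typed (\<lambda>_. p) {#Tree (Exp i {#Wire j (Xbar x)#}) (Neg p),
      Tree (Exp k {#Wire l (X x)#}) (Pos p)#}"
    using tree_typed_wit_typed.intros(2)[of "{#Wire j (Xbar x)#}" "\<lambda>_. p" "NegW p" i]
      tree_typed_wit_typed.intros(2)[of "{#Wire l (X x)#}" "\<lambda>_. p" "PosW p" k] by auto
  then show ?case by blast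
next
  case (mix b F c G e)
  then show ?case using join_typings by (metis forest_typed_simps(3))
next
  case (un e F P c)
  then show ?case using unary_typed by auto
next
  case (tensor b F t A c G s B e i j)
  then obtain \<Theta> where 1: "forest_typed \<Theta> (F + {#Tree t A#})" "forest_typed \<Theta> (G + {#Tree s B#})"
    using join_typings by blast
  then have "wit_typed \<Theta> (Tensor j t s) (TensorW A B)"
    by (auto intro: tree_typed_wit_typed.intros)
  then have "tree_typed \<Theta> (Exp i {#Tensor j t s#}) (Conj A B)"
    using tree_typed_wit_typed.intros(2)[of "{#Tensor j t s#}" \<Theta> "TensorW A B" i] by auto
  with 1 have "forest_typed \<Theta> (F + G + {#Tree (Exp i {#Tensor j t s#}) (Conj A B)#})" by auto
  then show ?case by blast
next
  case (cut b F s A c G t e i)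
  then obtain \<Theta> where 1: "forest_typed \<Theta> (F + {#Tree s A#})" "forest_typed \<Theta> (G + {#Tree t (dual A)#})"
    using join_typings by blast
  with cut have "forest_typed \<Theta> (F + G + {#Cut i s A t#})" by auto
  then show ?case by blast
qed

subsection \<open>Inversion\<close>

lemma drv_invert:
  assumes "drv r n e (F + {#Tree t A#})" and "forest_vars Q \<subseteq> tree_vars t" and "lacks_rank r Q"
    and "\<And>i. t \<noteq> Unit i" and "\<And>i w. t \<noteq> Exp i {#w#}" and "Q \<noteq> {#}"
    and "\<And>F P e. unary P (Tree t A) \<Longrightarrow> drv r n e (F + P) \<Longrightarrow> drv r n e (F + Q)"
  shows "drv r n e (F + Q)"
proof -
  have "image_mset (rmap (\<lambda>_. None)) (F + {#Tree t A#} - {#Tree t A#}) + Q = {#} \<or>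
    drv r n (e \<and> True) (image_mset (rmap (\<lambda>_. None)) (F + {#Tree t A#} - {#Tree t A#}) + Q)"
    by (rule drv_transform[OF assms(1), of _ "{}"])
      (use assms(2-7) in \<open>auto simp: sums_nonempty_def\<close>)
  with \<open>Q \<noteq> {#}\<close> show ?thesis by simp
qed

lemma drv_invert_vee:
  "drv r n e (F + {#Tree (Vee i t s) (Disj A B)#}) \<Longrightarrow> drv r n e (F + {#Tree t A, Tree s B#})"
  by (rule drv_invert[of r n e F "Vee i t s" "Disj A B"]) (auto elim: unary.cases)

lemma drv_invert_veeL:
  "drv r n e (F + {#Tree (VeeL i t j) (Disj A B)#}) \<Longrightarrow> drv r n e (F + {#Tree t A#})"
  by (rule drv_invert[of r n e F "VeeL i t j" "Disj A B"]) (auto elim: unary.cases)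

lemma drv_invert_veeR:
  "drv r n e (F + {#Tree (VeeR i j t) (Disj A B)#}) \<Longrightarrow> drv r n e (F + {#Tree t B#})"
  by (rule drv_invert[of r n e F "VeeR i j t" "Disj A B"]) (auto elim: unary.cases)

lemma drv_remove_unit:
  assumes "drv r n e (F + {#Tree (Unit i) Top#})" "F \<noteq> {#}"
  shows "drv r n e F"
  using drv_transform[of r n e "F + {#Tree (Unit i) Top#}" "Tree (Unit i) Top" "{}" "{#}" "\<lambda>_. None" True] assms
  by (auto simp: sums_nonempty_def elim: unary.cases)

lemma drv_split_sum:
  fixes F :: "('p, unit, 'v) gen_forest"
  shows "drv r n e (F + {#Tree (Exp i ws) C#}) \<Longrightarrow> ws \<noteq> {#} \<Longrightarrow>
    drv r n e (F + image_mset (\<lambda>w. Tree (Exp () {#w#}) C) ws)"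
proof (induction "size ws" arbitrary: ws F e i rule: less_induct)
  case less
  show ?case
  proof (cases "size ws = 1")
    case True
    then obtain w where "ws = {#w#}" using size_1_singleton_mset by blast
    with less.prems show ?thesis by simp
  next
    case False
    show ?thesis
    proof (rule drv_invert[OF less.prems(1)])
      show "forest_vars (image_mset (\<lambda>w. Tree (Exp () {#w#}) C) ws) \<subseteq> tree_vars (Exp i ws)"
        by (auto simp: forest_vars_def)
      show "lacks_rank r (image_mset (\<lambda>w. Tree (Exp () {#w#}) C) ws)"
        by (auto simp: lacks_rank_def)
      fix F :: "('p, unit, 'v) gen_forest" and P e
      assume "unary P (Tree (Exp i ws) C)" "drv r n e (F + P)"
      then obtain vs us j k where P: "P = {#Tree (Exp j vs) C, Tree (Exp k us) C#}"
        and ws: "ws = vs + us" "vs \<noteq> {#}" "us \<noteq> {#}"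
        by (auto elim: unary.cases)
      have "drv r n e ((F + {#Tree (Exp j vs) C#}) + {#Tree (Exp k us) C#})"
        using \<open>drv r n e (F + P)\<close> P by (simp add: add_mset_commute)
      from less.hyps[OF _ this] have "drv r n e ((F + image_mset (\<lambda>w. Tree (Exp () {#w#}) C) us) + {#Tree (Exp j vs) C#})"
        using ws by (simp add: ac_simps nonempty_has_size)
      from less.hyps[OF _ this]
      show "drv r n e (F + image_mset (\<lambda>w. Tree (Exp () {#w#}) C) ws)"
        using ws by (simp add: ac_simps nonempty_has_size)
    qed (use False less.prems(2) in auto)
  qed
qed

lemma drv_join_sum:
  fixes F :: "('p, unit, 'v) gen_forest"
  assumes "drv r n e (F + image_mset (\<lambda>w. Tree (Exp () {#w#}) (underlying T)) ws)" "ws \<noteq> {#}"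
  shows "drv r n e (F + {#Tree (Exp () ws) (underlying T)#})"
  using assms
proof (induction ws arbitrary: F)
  case (add w ws)
  show ?case
  proof (cases "ws = {#}")
    case True
    with add show ?thesis by simp
  next
    case False
    have "drv r n e ((F + {#Tree (Exp () {#w#}) (underlying T)#}) + {#Tree (Exp () ws) (underlying T)#})"
      by (rule add.IH) (use add.prems False in \<open>simp_all add: ac_simps\<close>)
    then have "drv r n e (F + {#Tree (Exp () {#w#}) (underlying T), Tree (Exp () ws) (underlying T)#})"
      by (simp add: add_mset_commute)
    from drv.un[OF this unary.contraction[of "{#w#}" ws]] False show ?thesis by simp
  qed
qed simp

lemma drv_partition_sum:
  fixes F :: "('p, unit, 'v) gen_forest"
  assumes "drv r n e (F + {#Tree (Exp i (ws + vs)) (underlying T)#})" "ws \<noteq> {#}" "vs \<noteq> {#}"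
  shows "drv r n e (F + {#Tree (Exp j ws) (underlying T), Tree (Exp k vs) (underlying T)#})"
proof -
  have "drv r n e ((F + image_mset (\<lambda>w. Tree (Exp () {#w#}) (underlying T)) ws)
      + image_mset (\<lambda>w. Tree (Exp () {#w#}) (underlying T)) vs)"
    using drv_split_sum[OF assms(1)] assms(2) by (simp add: ac_simps)
  from drv_join_sum[OF this assms(3)]
  have "drv r n e ((F + {#Tree (Exp () vs) (underlying T)#})
      + image_mset (\<lambda>w. Tree (Exp () {#w#}) (underlying T)) ws)"
    by (simp add: ac_simps)
  from drv_join_sum[OF this assms(2)] show ?thesis by (simp add: add_mset_commute)
qed

subsection \<open>Renaming\<close>

lemma map_tree_vars [simp]:
  "tree_vars (map_tree u f t) = f ` tree_vars t"
  "wit_vars (map_wit u f w) = f ` wit_vars w"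
  by (simp_all add: tree.set_map wit.set_map)

primrec rename :: "('i \<Rightarrow> 'j) \<Rightarrow> ('v \<Rightarrow> 'w) \<Rightarrow> ('p, 'i, 'v) root \<Rightarrow> ('p, 'j, 'w) root" where
  "rename u f (Tree t A) = Tree (map_tree u f t) A"
| "rename u f (Wit w T) = Wit (map_wit u f w) T"
| "rename u f (Cut i s A t) = Cut (u i) (map_tree u f s) A (map_tree u f t)"

lemma map_root_rename: "map_root id u f c = rename u f c"
  by (cases c) (simp_all add: formula.map_id wit_type.map_id)

lemma root_vars_map [simp]: "root_vars (rename u f c) = f ` root_vars c"
  by (cases c) auto

lemma forest_vars_map [simp]:
  "forest_vars (image_mset (rename u f) F) = f ` forest_vars F"
  by (auto simp: forest_vars_def)

lemma width_map [simp]: "width (map_tree u f t) = width t"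
  by (cases t) auto

lemma lacks_rank_rename [simp]: "lacks_rank r (image_mset (rename u f) F) \<longleftrightarrow> lacks_rank r F"
proof (induction F)
  case (add c F)
  then show ?case by (cases c) auto
qed simp

lemma unary_map: "unary P c \<Longrightarrow> unary (image_mset (rename u f) P) (rename u f c)"
proof (induction rule: unary.induct)
  case (contraction ws vs i T j k)
  then show ?case
    using unary.contraction[of "image_mset (map_wit u f) ws" "image_mset (map_wit u f) vs" "u i" T "u j" "u k"]
    by (simp)
qed (auto intro: unary.intros)

lemma image_disjoint: "inj_on f (A \<union> B) \<Longrightarrow> A \<inter> B = {} \<Longrightarrow> f ` A \<inter> f ` B = {}"
  unfolding inj_on_def by blast

lemma drv_map:
  "drv r n e F \<Longrightarrow> inj_on f (forest_vars F) \<Longrightarrow> drv r n e (image_mset (rename u f) F)"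
proof (induction rule: drv.induct)
  case (unit i)
  then show ?case using drv.unit[of r n "u i"] by simp
next
  case (axiom i j x p k l)
  then show ?case using drv.axiom[of r n "u i" "u j" "f x" p "u k" "u l"] by simp
next
  case (mix b F c G e)
  have "inj_on f (forest_vars F \<union> forest_vars G)" using mix.prems by simp
  then have "f ` forest_vars F \<inter> f ` forest_vars G = {}" "inj_on f (forest_vars F)" "inj_on f (forest_vars G)"
    using image_disjoint[OF _ mix.hyps(3)] by (simp_all add: inj_on_Un)
  then show ?case using drv.mix[of r n b "image_mset (rename u f) F" c _ e] mix by simp
next
  case (un e F P c)
  from drv.un[OF _ unary_map[OF un.hyps(2)], of r n e "image_mset (rename u f) F" u f] un
  show ?case using unary_vars[OF un.hyps(2)] by (simp add: Un_commute)
next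
  case (tensor b F t A c G s B e i j)
  have "inj_on f (forest_vars (F + {#Tree t A#}) \<union> forest_vars (G + {#Tree s B#}))"
    using tensor.prems by (rule inj_on_subset) auto
  then have 1: "f ` forest_vars (F + {#Tree t A#}) \<inter> f ` forest_vars (G + {#Tree s B#}) = {}"
    "inj_on f (forest_vars (F + {#Tree t A#}))" "inj_on f (forest_vars (G + {#Tree s B#}))"
    using image_disjoint[OF _ tensor.hyps(3)] inj_on_subset by (blast, blast, blast)
  have "drv r n e (image_mset (rename u f) F + image_mset (rename u f) G +
      {#Tree (Exp (u i) {#Tensor (u j) (map_tree u f t) (map_tree u f s)#}) (Conj A B)#})"
    by (rule drv.tensor[of r n b _ _ A c]) (use 1 tensor in \<open>auto\<close>)
  then show ?case by (simp)
next
  case (cut b F s A c G t e i)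
  have "inj_on f (forest_vars (F + {#Tree s A#}) \<union> forest_vars (G + {#Tree t (dual A)#}))"
    using cut.prems by (rule inj_on_subset) auto
  then have 1: "f ` forest_vars (F + {#Tree s A#}) \<inter> f ` forest_vars (G + {#Tree t (dual A)#}) = {}"
    "inj_on f (forest_vars (F + {#Tree s A#}))" "inj_on f (forest_vars (G + {#Tree t (dual A)#}))"
    using image_disjoint[OF _ cut.hyps(4)] inj_on_subset by (blast, blast, blast)
  have "drv r n e (image_mset (rename u f) F + image_mset (rename u f) G +
      {#Cut (u i) (map_tree u f s) A (map_tree u f t)#})"
    by (rule drv.cut[of r n b _ _ A c]) (use 1 cut in \<open>auto\<close>)
  then show ?case by (simp)
qed

section \<open>Derivability of logical and atomic reducts\<close>

definition occ :: "('i, 'v) node multiset \<Rightarrow> 'v wire \<Rightarrow> nat" where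
  "occ N x = size {#n \<in># N. node_label n = LWire x#}"

lemma occ_simps [simp]:
  "occ {#} x = 0"
  "occ (add_mset n N) x = (if node_label n = LWire x then 1 else 0) + occ N x"
  "occ (N + M) x = occ N x + occ M x"
  by (auto simp: occ_def)

lemma occurrences_simps [simp]:
  "occurrences {#} x = 0"
  "occurrences (add_mset c F) x = occ (root_nodes c) x + occurrences F x"
  "occurrences (F + G) x = occurrences F x + occurrences G x"
  by (auto simp: occurrences_def forest_nodes_def occ_def)

lemma occ_sum: "occ (\<Sum>\<^sub># (image_mset f M)) x = (\<Sum>a\<in>#M. occ (f a) x)"
  by (induction M) auto

lemma sum_mset_pos: "0 < (\<Sum>a\<in>#M. f a :: nat) \<Longrightarrow> \<exists>a\<in>#M. 0 < f a"
  by (induction M) auto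

abbreviation wire_var :: "'v wire \<Rightarrow> 'v" where
  "wire_var x \<equiv> case_wire (\<lambda>a. a) (\<lambda>a. a) x"

lemma wire_vars_eq: "set_wire x = {wire_var x}"
  by (cases x) auto

lemma occ_vars:
  fixes t :: "('i, 'v) tree" and w :: "('i, 'v) wit"
  shows "0 < occ (tree_nodes t) x \<Longrightarrow> wire_var x \<in> tree_vars t"
    and "0 < occ (wit_nodes w) x \<Longrightarrow> wire_var x \<in> wit_vars w"
proof (induction t and w)
  case (Exp i ws)
  then show ?case by (auto simp: occ_sum dest!: sum_mset_pos)
qed (auto split: if_splits simp: wire_vars_eq)

lemma occurrences_vars: "0 < occurrences F x \<Longrightarrow> wire_var x \<in> forest_vars F"
proof (induction F)
  case (add c F)
  then show ?case by (cases c) (auto dest: occ_vars)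
qed simp

lemma unary_occurrences: "unary P c \<Longrightarrow> occurrences P x = occ (root_nodes c) x"
  by (induction rule: unary.induct) auto

definition linked :: "('p, 'i, 'v) gen_forest \<Rightarrow> bool" where
  "linked F \<longleftrightarrow>
     (\<forall>x. occurrences F x \<le> 1 \<and> (0 < occurrences F x \<longleftrightarrow> 0 < occurrences F (wdual x)))"

lemma wire_var_wdual [simp]: "wire_var (wdual x) = wire_var x"
  by (cases x) auto

lemma linked_union:
  assumes "linked F" "linked G" "forest_vars F \<inter> forest_vars G = {}"
  shows "linked (F + G)"
  unfolding linked_def
proof
  fix x
  have *: "occurrences F x = 0 \<or> occurrences G y = 0" if "wire_var x = wire_var y" for x y
    using occurrences_vars[of F x] occurrences_vars[of G y] assms(3) that by auto
  have F: "occurrences F x \<le> 1" "0 < occurrences F x \<longleftrightarrow> 0 < occurrences F (wdual x)"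
    and G: "occurrences G x \<le> 1" "0 < occurrences G x \<longleftrightarrow> 0 < occurrences G (wdual x)"
    using assms(1,2) by (simp_all add: linked_def)
  show "occurrences (F + G) x \<le> 1 \<and> (0 < occurrences (F + G) x) = (0 < occurrences (F + G) (wdual x))"
    using *[OF refl, of x] F G by auto
qed

lemma linked_cong: "(\<And>x. occurrences F x = occurrences G x) \<Longrightarrow> linked F = linked G"
  by (simp add: linked_def)

lemma drv_linked: "drv r n e F \<Longrightarrow> linked F"
proof (induction rule: drv.induct)
  case (unit i)
  then show ?case by (simp add: linked_def)
next
  case (axiom i j x p k l)
  show ?case unfolding linked_def
  proof
    fix y show "occurrences {#Tree (Exp i {#Wire j (Xbar x)#}) (Neg p), Tree (Exp k {#Wire l (X x)#}) (Pos p)#} y \<le> 1 \<and>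
      (0 < occurrences {#Tree (Exp i {#Wire j (Xbar x)#}) (Neg p), Tree (Exp k {#Wire l (X x)#}) (Pos p)#} y) =
      (0 < occurrences {#Tree (Exp i {#Wire j (Xbar x)#}) (Neg p), Tree (Exp k {#Wire l (X x)#}) (Pos p)#} (wdual y))"
      by (cases y) auto
  qed
next
  case (mix b F c G e)
  then show ?case using linked_union by blast
next
  case (un e F P c)
  have "linked (F + P) = linked (F + {#c#})"
    by (rule linked_cong) (simp add: unary_occurrences[OF un.hyps(2)])
  with un show ?case by simp
next
  case (tensor b F t A c G s B e i j)
  have "linked ((F + {#Tree t A#}) + (G + {#Tree s B#}))"
    using linked_union tensor by blast
  then show ?case by (subst linked_cong) (auto simp: ac_simps)
next
  case (cut b F s A c G t e i)
  have "linked ((F + {#Tree s A#}) + (G + {#Tree t (dual A)#}))"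
    using linked_union cut by blast
  then show ?case by (subst linked_cong) (auto simp: ac_simps)
qed

lemma drv_typed_forest: "drv r n e F \<Longrightarrow> typed_forest F"
  using drv_typed[of r n e F] drv_linked[of r n e F]
  by (auto simp: typed_forest_def linked_def forest_typed_def)

lemma drv_wire_not_alone: "\<not> drv r n e {#Tree (Exp i {#Wire k x#}) A#}"
proof
  assume "drv r n e {#Tree (Exp i {#Wire k x#}) A#}"
  from drv_linked[OF this] have "0 < occurrences {#Tree (Exp i {#Wire k x#}) A#} (wdual x)"
    by (auto simp: linked_def dest!: spec[of _ x])
  then show False by (cases x) auto
qed

subsection \<open>Logical steps\<close>

lemma positive_dual: "A \<noteq> Top \<Longrightarrow> A \<noteq> Bot \<Longrightarrow> \<not> positive A \<Longrightarrow> positive (dual A)"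
  by (cases A) auto

lemma drv_mk_cut:
  assumes F: "drv r n False (F + {#Tree t A#})" and G: "drv r n False (G + {#Tree s (dual A)#})"
    and "forest_vars (F + {#Tree t A#}) \<inter> forest_vars (G + {#Tree s (dual A)#}) = {}"
  shows "drv r n False (F + G + {#mk_cut i t A s#})"
proof (cases "positive A")
  case True
  then show ?thesis using drv.cut[OF F G, of False i] assms(3) by (simp add: mk_cut_def)
next
  case False
  have "A \<noteq> Bot" using drv_no_Bot[OF F] by auto
  moreover have "A \<noteq> Top" using drv_no_Bot[OF G, of s] by auto
  ultimately have "positive (dual A)" using False positive_dual by blast
  then have "drv r n False (G + F + {#Cut i s (dual A) t#})"
    using F G assms(3) by (intro drv.cut) (auto simp: Int_commute)
  then show ?thesis using False by (simp add: mk_cut_def ac_simps)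
qed

lemma no_contraction_single [simp]: "\<not> unary P (Tree (Exp i {#w#}) A)"
  by (auto elim!: unary.cases simp: single_is_union)

lemma no_unary_cut [simp]: "\<not> unary P (Cut i s A t)"
  by (auto elim!: unary.cases)

lemma drv_replace_tensor:
  assumes "drv r n False (F + {#Tree (Exp i {#Tensor j t s#}) (Conj A B)#})"
    and "V \<inter> forest_vars (F + {#Tree (Exp i {#Tensor j t s#}) (Conj A B)#}) = {}"
    and "forest_vars Q \<subseteq> tree_vars t \<union> tree_vars s \<union> V" and "Q \<noteq> {#}"
    and "\<And>F G. drv r n False (F + {#Tree t A#}) \<Longrightarrow> drv r n False (G + {#Tree s B#}) \<Longrightarrow>
      forest_vars (F + {#Tree t A#}) \<inter> forest_vars (G + {#Tree s B#}) = {} \<Longrightarrow>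
      V \<inter> forest_vars (F + G) = {} \<Longrightarrow> drv r n False (F + G + Q)"
  shows "drv r n False (F + Q)"
proof -
  let ?c = "Tree (Exp i {#Tensor j t s#}) (Conj A B)"
  have "image_mset (rmap (\<lambda>_. None)) (F + {#?c#} - {#?c#}) + Q = {#} \<or>
    drv r n (False \<and> False) (image_mset (rmap (\<lambda>_. None)) (F + {#?c#} - {#?c#}) + Q)"
  proof (rule drv_transform[OF assms(1), of _ V], goal_cases)
    case (11 F G i' j' t' s' A' B')
    then show ?case using assms(5)[of F G] by auto
  qed (use assms in \<open>auto simp: sums_nonempty_def\<close>)
  with \<open>Q \<noteq> {#}\<close> show ?thesis by simp
qed

lemma drv_replace_cut:
  assumes "drv r n False (F + {#Cut i s A t#})"
    and "forest_vars Q \<subseteq> tree_vars t \<union> tree_vars s" and "Q \<noteq> {#}"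
    and "\<And>F G. drv r n False (F + {#Tree s A#}) \<Longrightarrow> drv r n False (G + {#Tree t (dual A)#}) \<Longrightarrow>
      forest_vars (F + {#Tree s A#}) \<inter> forest_vars (G + {#Tree t (dual A)#}) = {} \<Longrightarrow>
      drv r n False (F + G + Q)"
  shows "drv r n False (F + Q)"
proof -
  let ?c = "Cut i s A t"
  have "image_mset (rmap (\<lambda>_. None)) (F + {#?c#} - {#?c#}) + Q = {#} \<or>
    drv r n (False \<and> False) (image_mset (rmap (\<lambda>_. None)) (F + {#?c#} - {#?c#}) + Q)"
  proof (rule drv_transform[OF assms(1), of _ "{}"], goal_cases)
    case (12 F G i' A' s' t')
    then show ?case using assms(4)[of F G] by auto
  qed (use assms in \<open>auto simp: sums_nonempty_def\<close>)
  with \<open>Q \<noteq> {#}\<close> show ?thesis by simp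
qed

lemma mk_cut_vars [simp]: "root_vars (mk_cut i t A s) = tree_vars t \<union> tree_vars s"
  by (auto simp: mk_cut_def)

text \<open>
  Inversion replaces the disjunction by its two components, and the two premises of the tensor are cut against them one after the other.
\<close>

lemma drv_logical:
  assumes "drv r n False (F + {#Cut i (Exp j {#Tensor k s1 s2#}) (Conj A B) (Vee l t1 t2)#})"
  shows "drv r n False (F + {#mk_cut i' s1 A t1, mk_cut i'' s2 B t2#})"
proof (rule drv_replace_cut[OF assms])
  fix F G :: "('a, 'b, 'c) gen_forest"
  assume F: "drv r n False (F + {#Tree (Exp j {#Tensor k s1 s2#}) (Conj A B)#})"
    and "drv r n False (G + {#Tree (Vee l t1 t2) (dual (Conj A B))#})"
    and disj: "forest_vars (F + {#Tree (Exp j {#Tensor k s1 s2#}) (Conj A B)#}) \<inter>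
      forest_vars (G + {#Tree (Vee l t1 t2) (dual (Conj A B))#}) = {}"
  then have G: "drv r n False (G + {#Tree t1 (dual A), Tree t2 (dual B)#})"
    using drv_invert_vee by simp
  have "drv r n False (F + (G + {#mk_cut i' s1 A t1, mk_cut i'' s2 B t2#}))"
  proof (rule drv_replace_tensor[OF F, of "forest_vars (G + {#Tree t1 (dual A), Tree t2 (dual B)#})"])
    fix F1 F2 :: "('a, 'b, 'c) gen_forest"
    assume 1: "drv r n False (F1 + {#Tree s1 A#})" "drv r n False (F2 + {#Tree s2 B#})"
      "forest_vars (F1 + {#Tree s1 A#}) \<inter> forest_vars (F2 + {#Tree s2 B#}) = {}"
      "forest_vars (G + {#Tree t1 (dual A), Tree t2 (dual B)#}) \<inter> forest_vars (F1 + F2) = {}"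
    have "drv r n False (F1 + (G + {#Tree t2 (dual B)#}) + {#mk_cut i' s1 A t1#})"
      by (rule drv_mk_cut[OF 1(1)]) (use G 1 disj in \<open>auto simp: add_mset_commute\<close>)
    then have "drv r n False ((F1 + G + {#mk_cut i' s1 A t1#}) + {#Tree t2 (dual B)#})"
      by (simp add: add_mset_commute)
    from drv_mk_cut[OF 1(2) this, of i'']
    show "drv r n False (F1 + F2 + (G + {#mk_cut i' s1 A t1, mk_cut i'' s2 B t2#}))"
      using 1 disj by (auto simp: ac_simps add_mset_commute Int_Un_distrib Int_Un_distrib2)
  qed (use disj in auto)
  then show "drv r n False (F + G + {#mk_cut i' s1 A t1, mk_cut i'' s2 B t2#})"
    by (simp add: ac_simps)
qed auto

lemma drv_detach_factor:
  assumes F: "drv r n False (F + {#Tree (Exp j {#Tensor k s1 s2#}) (Conj A B)#})"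
    and G: "drv r n False (G + {#Tree t (dual A)#})"
    and disj: "forest_vars (F + {#Tree (Exp j {#Tensor k s1 s2#}) (Conj A B)#}) \<inter>
      forest_vars (G + {#Tree t (dual A)#}) = {}"
  shows "drv r n False (F + G + {#mk_cut i s1 A t, Tree s2 B#})"
proof -
  have "drv r n False (F + (G + {#mk_cut i s1 A t, Tree s2 B#}))"
  proof (rule drv_replace_tensor[OF F, of "forest_vars (G + {#Tree t (dual A)#})"])
    fix F1 F2
    assume 1: "drv r n False (F1 + {#Tree s1 A#})" "drv r n False (F2 + {#Tree s2 B#})"
      "forest_vars (F1 + {#Tree s1 A#}) \<inter> forest_vars (F2 + {#Tree s2 B#}) = {}"
      "forest_vars (G + {#Tree t (dual A)#}) \<inter> forest_vars (F1 + F2) = {}"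
    have "drv r n False (F1 + G + {#mk_cut i s1 A t#})"
      by (rule drv_mk_cut[OF 1(1) G]) (use 1 disj in auto)
    from drv.mix[OF this 1(2), of False]
    show "drv r n False (F1 + F2 + (G + {#mk_cut i s1 A t, Tree s2 B#}))"
      using 1 disj by (auto simp: ac_simps add_mset_commute Int_Un_distrib Int_Un_distrib2)
  qed (use disj in auto)
  then show ?thesis by (simp add: ac_simps)
qed

lemma drv_detach_factor':
  assumes F: "drv r n False (F + {#Tree (Exp j {#Tensor k s1 s2#}) (Conj A B)#})"
    and G: "drv r n False (G + {#Tree t (dual B)#})"
    and disj: "forest_vars (F + {#Tree (Exp j {#Tensor k s1 s2#}) (Conj A B)#}) \<inter>
      forest_vars (G + {#Tree t (dual B)#}) = {}"
  shows "drv r n False (F + G + {#mk_cut i s2 B t, Tree s1 A#})"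
proof -
  have "drv r n False (F + {#Tree (Exp j {#Tensor k s2 s1#}) (Conj B A)#})"
  proof (rule drv_replace_tensor[OF F, of "{}"])
    fix F1 F2
    assume "drv r n False (F1 + {#Tree s1 A#})" "drv r n False (F2 + {#Tree s2 B#})"
      "forest_vars (F1 + {#Tree s1 A#}) \<inter> forest_vars (F2 + {#Tree s2 B#}) = {}"
    from drv.tensor[OF this(2,1), of False j k] this(3)
    show "drv r n False (F1 + F2 + {#Tree (Exp j {#Tensor k s2 s1#}) (Conj B A)#})"
      by (auto simp: ac_simps)
  qed auto
  from drv_detach_factor[OF this G] disj show ?thesis by (simp add: ac_simps)
qed

lemma drv_weakening_left:
  assumes "drv r n False (F + {#Cut i (Exp j {#Tensor k s1 s2#}) (Conj A B) (VeeL l t m)#})"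
  shows "drv r n False (F + {#mk_cut i' s1 A t, Tree s2 B#})"
proof (rule drv_replace_cut[OF assms])
  fix F G :: "('a, 'b, 'c) gen_forest"
  assume F: "drv r n False (F + {#Tree (Exp j {#Tensor k s1 s2#}) (Conj A B)#})"
    and G: "drv r n False (G + {#Tree (VeeL l t m) (dual (Conj A B))#})"
    and disj: "forest_vars (F + {#Tree (Exp j {#Tensor k s1 s2#}) (Conj A B)#}) \<inter>
      forest_vars (G + {#Tree (VeeL l t m) (dual (Conj A B))#}) = {}"
  from drv_detach_factor[OF F drv_invert_veeL[OF G[simplified dual.simps]]] disj
  show "drv r n False (F + G + {#mk_cut i' s1 A t, Tree s2 B#})" by simp
qed auto

lemma drv_weakening_right:
  assumes "drv r n False (F + {#Cut i (Exp j {#Tensor k s1 s2#}) (Conj A B) (VeeR l m t)#})"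
  shows "drv r n False (F + {#mk_cut i' s2 B t, Tree s1 A#})"
proof (rule drv_replace_cut[OF assms])
  fix F G :: "('a, 'b, 'c) gen_forest"
  assume F: "drv r n False (F + {#Tree (Exp j {#Tensor k s1 s2#}) (Conj A B)#})"
    and G: "drv r n False (G + {#Tree (VeeR l m t) (dual (Conj A B))#})"
    and disj: "forest_vars (F + {#Tree (Exp j {#Tensor k s1 s2#}) (Conj A B)#}) \<inter>
      forest_vars (G + {#Tree (VeeR l m t) (dual (Conj A B))#}) = {}"
  from drv_detach_factor'[OF F drv_invert_veeR[OF G[simplified dual.simps]]] disj
  show "drv r n False (F + G + {#mk_cut i' s2 B t, Tree s1 A#})" by simp
qed auto

subsection \<open>Substitution\<close>

definition wire_subst :: "'v wire \<Rightarrow> ('i, 'v) wit multiset \<Rightarrow> ('i, 'v) wit \<Rightarrow> ('i, 'v) wit multiset option" where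
  "wire_subst y us = (\<lambda>w. if \<exists>k. w = Wire k y then Some us else None)"

lemma wire_subst_SomeD: "wire_subst y us w = Some vs \<Longrightarrow> vs = us \<and> (\<exists>k. w = Wire k y)"
  by (auto simp: wire_subst_def split: if_splits)

lemma wire_subst_Wire [simp]: "wire_subst y us (Wire k y) = Some us"
  by (simp add: wire_subst_def)

lemma wire_subst_sums_nonempty: "us \<noteq> {#} \<Longrightarrow> sums_nonempty (wire_subst y us)"
  by (auto simp: sums_nonempty_def dest: wire_subst_SomeD)

lemma drv_subst_premise:
  fixes F G :: "('p, unit, 'v) gen_forest"
  assumes F: "drv r n False (F + {#Tree (Exp i {#Wire k (Xbar a)#}) (Neg p)#})"
    and G: "drv r n False (G + {#Tree (Exp l us) (Pos p)#})" and us: "us \<noteq> {#}"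
    and disj: "forest_vars (F + {#Tree (Exp i {#Wire k (Xbar a)#}) (Neg p)#}) \<inter>
      forest_vars (G + {#Tree (Exp l us) (Pos p)#}) = {}"
  shows "drv r n False (image_mset (rmap (wire_subst (X a) us)) F + G)"
proof -
  let ?c = "Tree (Exp i {#Wire k (Xbar a)#}) (Neg p)"
  have "image_mset (rmap (wire_subst (X a) us)) (F + {#?c#} - {#?c#}) + G = {#} \<or>
    drv r n (False \<and> False) (image_mset (rmap (wire_subst (X a) us)) (F + {#?c#} - {#?c#}) + G)"
  proof (rule drv_transform[OF F, of _ "forest_vars (G + {#Tree (Exp l us) (Pos p)#})"], goal_cases)
    case 2
    then show ?case using disj by (simp add: Int_commute)
  next
    case (4 w vs)
    then show ?case by (auto dest!: wire_subst_SomeD)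
  next
    case 5
    then show ?case using us by (rule wire_subst_sums_nonempty)
  next
    case (8 i' j' x p' k' l')
    then show ?case using G by (simp add: add_mset_commute)
  qed auto
  moreover have "F \<noteq> {#}" using F drv_wire_not_alone[of r n False i k "Xbar a" "Neg p"] by auto
  ultimately show ?thesis by simp
qed

lemma drv_cut_not_alone: "\<not> drv r n e {#Cut i (Exp j {#Wire k x#}) A t#}"
proof
  assume "drv r n e {#Cut i (Exp j {#Wire k x#}) A t#}"
  then show False
  proof cases
    case (mix b F c G)
    then show False using drv_nonempty[of r n b F] drv_nonempty[of r n c G]
      by (auto simp: single_is_union)
  next
    case (un F P c)
    then show False by auto
  next
    case (cut b F s A' c G t' i')
    then show False using drv_wire_not_alone[of r n b j k x A] by auto
  qed auto
qed

text \<open>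
  An axiom link to the cut wire is replaced by a link to what it is cut against; since the derivation introduces the wire only in an axiom, substitution acts there.
\<close>

lemma drv_atomic:
  fixes F :: "('p, unit, 'v) gen_forest"
  assumes H: "drv r n False (F + {#Cut i (Exp j {#Wire k (Xbar a)#}) (Neg p) (Exp l us)#})"
  shows "drv r n False (image_mset (rmap (wire_subst (X a) us)) F)"
proof -
  let ?c = "Cut i (Exp j {#Wire k (Xbar a)#}) (Neg p) (Exp l us)"
  from drv_typed[OF H] have us: "us \<noteq> {#}" by (auto elim: typed_elims)
  have "image_mset (rmap (wire_subst (X a) us)) (F + {#?c#} - {#?c#}) + {#} = {#} \<or>
    drv r n (False \<and> False) (image_mset (rmap (wire_subst (X a) us)) (F + {#?c#} - {#?c#}) + {#})"
  proof (rule drv_transform[OF H, of _ "{}"], goal_cases)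
    case (4 w vs)
    then show ?case by (auto dest!: wire_subst_SomeD)
  next
    case 5
    then show ?case using us by (rule wire_subst_sums_nonempty)
  next
    case (12 F G i' A s t)
    have "image_mset (rmap (wire_subst (X a) us)) G = G"
      by (rule rmap_untouched[of _ "{a}"]) (use 12 in \<open>auto dest!: wire_subst_SomeD\<close>)
    with drv_subst_premise[of r n F j k a p G l us] 12 us show ?case by auto
  qed auto
  moreover have "F \<noteq> {#}" using H drv_cut_not_alone[of r n False i j k "Xbar a" "Neg p" "Exp l us"] by auto
  ultimately show ?thesis by simp
qed

section \<open>Erasing and merging parts of a derivation\<close>

subsection \<open>Pruning\<close>

text \<open>
  A tree vanishes when erasing the nodes of \<open>D\<close> leaves nothing of it; for the root of a tree this agrees with membership in \<open>D\<close> whenever the tree is coherent.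
\<close>

primrec vanishes :: "'i set \<Rightarrow> ('i, 'v) tree \<Rightarrow> bool" where
  "vanishes D (Unit i) \<longleftrightarrow> i \<in> D"
| "vanishes D (Exp i ws) \<longleftrightarrow> (\<forall>w\<in>#ws. wname w \<in> D)"
| "vanishes D (Vee i t s) \<longleftrightarrow> vanishes D t \<and> vanishes D s"
| "vanishes D (VeeL i t j) \<longleftrightarrow> vanishes D t"
| "vanishes D (VeeR i j t) \<longleftrightarrow> vanishes D t"

primrec coherent :: "'i set \<Rightarrow> 'v set \<Rightarrow> ('i, 'v) tree \<Rightarrow> bool"
  and wit_coherent :: "'i set \<Rightarrow> 'v set \<Rightarrow> ('i, 'v) wit \<Rightarrow> bool" where
  "coherent D V (Unit i) \<longleftrightarrow> True"
| "coherent D V (Exp i ws) \<longleftrightarrow> (\<forall>b\<in>#image_mset (wit_coherent D V) ws. b)"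
| "coherent D V (Vee i t s) \<longleftrightarrow> coherent D V t \<and> coherent D V s \<and>
     (tname t \<in> D \<longleftrightarrow> vanishes D t) \<and> (tname s \<in> D \<longleftrightarrow> vanishes D s)"
| "coherent D V (VeeL i t j) \<longleftrightarrow> coherent D V t"
| "coherent D V (VeeR i j t) \<longleftrightarrow> coherent D V t"
| "wit_coherent D V (Wire i x) \<longleftrightarrow> (i \<in> D \<longleftrightarrow> wire_var x \<in> V)"
| "wit_coherent D V (Tensor i t s) \<longleftrightarrow> coherent D V t \<and> coherent D V s \<and>
     (i \<in> D \<longleftrightarrow> vanishes D t) \<and> (i \<in> D \<longleftrightarrow> vanishes D s)"

primrec root_vanishes :: "'i set \<Rightarrow> ('p, 'i, 'v) root \<Rightarrow> bool" where
  "root_vanishes D (Tree t A) \<longleftrightarrow> vanishes D t"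
| "root_vanishes D (Wit w T) \<longleftrightarrow> wname w \<in> D"
| "root_vanishes D (Cut i s A t) \<longleftrightarrow> i \<in> D"

primrec root_coherent :: "'i set \<Rightarrow> 'v set \<Rightarrow> ('p, 'i, 'v) root \<Rightarrow> bool" where
  "root_coherent D V (Tree t A) \<longleftrightarrow> coherent D V t"
| "root_coherent D V (Wit w T) \<longleftrightarrow> wit_coherent D V w"
| "root_coherent D V (Cut i s A t) \<longleftrightarrow> coherent D V s \<and> coherent D V t \<and>
     (i \<in> D \<longleftrightarrow> vanishes D s) \<and> (i \<in> D \<longleftrightarrow> vanishes D t)"

definition survivors :: "'i set \<Rightarrow> ('p, 'i, 'v) gen_forest \<Rightarrow> ('p, unit, 'v) gen_forest" where
  "survivors D F = image_mset (\<lambda>c. rename (\<lambda>_. ()) (\<lambda>x. x) (root_prune D c)) {#c \<in># F. \<not> root_vanishes D c#}"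

lemma survivors_simps [simp]:
  "survivors D {#} = {#}"
  "survivors D (add_mset c F) = (if root_vanishes D c then {#} else
     {#rename (\<lambda>_. ()) (\<lambda>x. x) (root_prune D c)#}) + survivors D F"
  "survivors D (F + G) = survivors D F + survivors D G"
  by (auto simp: survivors_def)

lemma wname_prune [simp]: "wname (wit_prune D w) = wname w"
  by (cases w) auto

lemma prune_vars:
  fixes t :: "('i, 'v) tree" and w :: "('i, 'v) wit"
  shows "tree_vars (tree_prune D t) \<subseteq> tree_vars t" and "wit_vars (wit_prune D w) \<subseteq> wit_vars w"
proof (induction t and w)
  case (Exp i ws)
  then show ?case by fastforce
qed auto

lemma survivors_vars: "forest_vars (survivors D F) \<subseteq> forest_vars F"
proof (induction F)
  case (add c F)
  have "root_vars (root_prune D c) \<subseteq> root_vars c"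
    using prune_vars by (cases c) (fastforce simp: subset_iff)+
  with add show ?case by auto
qed simp

lemma drv_mix_maybe:
  assumes "F = {#} \<or> drv r n False F" "G = {#} \<or> drv r n False G" "forest_vars F \<inter> forest_vars G = {}"
  shows "F + G = {#} \<or> drv r n False (F + G)"
  using assms drv.mix[of r n False F False G False] by auto

text \<open>
  Erasing a coherent set of nodes erases rules of the derivation: a rule with a vanishing premise becomes a weakening, or disappears together with its conclusion.
\<close>

lemma drv_survivors:
  fixes F :: "('p, 'i, 'v) gen_forest"
  shows "drv r n e F \<Longrightarrow> \<forall>c\<in>#F. root_coherent D V c \<Longrightarrow>
    survivors D F = {#} \<or> drv r n False (survivors D F)"
proof (induction rule: drv.induct)
  case (unit i)
  show ?case
  proof (cases "i \<in> D")
    case False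
    have "drv r n False {#Tree (Unit ()) Top#}" by (rule drv.unit)
    with False show ?thesis by simp
  qed simp
next
  case (axiom i j x p k l)
  have "drv r n False {#Tree (Exp () {#Wire () (X x)#}) (Pos p), Tree (Exp () {#Wire () (Xbar x)#}) (Neg p)#}"
    using drv.axiom[of r n "()" "()" x p "()" "()"] by (rule back_subst) (rule add_mset_commute)
  moreover have "j \<in> D \<longleftrightarrow> l \<in> D" using axiom by simp
  ultimately show ?case using drv.axiom[of r n "()" "()" x p "()" "()"] by (cases "l \<in> D") simp_all
next
  case (mix b F c G e)
  have "forest_vars (survivors D F) \<inter> forest_vars (survivors D G) = {}"
    using survivors_vars[of D F] survivors_vars[of D G] mix.hyps(3) by blast
  moreover have "survivors D F = {#} \<or> drv r n False (survivors D F)"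
    by (rule mix.IH(1)) (use mix.prems in simp)
  moreover have "survivors D G = {#} \<or> drv r n False (survivors D G)"
    by (rule mix.IH(2)) (use mix.prems in simp)
  ultimately show ?case using drv_mix_maybe[of "survivors D F" r n "survivors D G"] by simp
next
  case (un e F P c)
  from un.hyps(2) show ?case
  proof cases
    case (vee t A s B i)
    have IH: "survivors D (F + P) = {#} \<or> drv r n False (survivors D (F + P))"
      by (rule un.IH) (use un.prems vee in simp)
    have names: "tname t \<in> D \<longleftrightarrow> vanishes D t" "tname s \<in> D \<longleftrightarrow> vanishes D s"
      using un.prems vee by simp_all
    let ?t = "map_tree (\<lambda>_. ()) (\<lambda>x. x) (tree_prune D t)" and ?s = "map_tree (\<lambda>_. ()) (\<lambda>x. x) (tree_prune D s)"
    consider "vanishes D t" "vanishes D s" | "vanishes D t" "\<not> vanishes D s"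
      | "\<not> vanishes D t" "vanishes D s" | "\<not> vanishes D t" "\<not> vanishes D s" by blast
    then show ?thesis
    proof cases
      case 1
      with IH vee show ?thesis by simp
    next
      case 2
      with IH vee have "drv r n False (survivors D F + {#Tree ?s B#})" by simp
      from drv.un[OF this unary.veeR, of "()" "()" A] 2 names vee show ?thesis by simp
    next
      case 3
      with IH vee have "drv r n False (survivors D F + {#Tree ?t A#})" by simp
      from drv.un[OF this unary.veeL, of "()" "()" B] 3 names vee show ?thesis by simp
    next
      case 4
      with IH vee have "drv r n False (survivors D F + {#Tree ?t A, Tree ?s B#})"
        by (simp add: add_mset_commute)
      from drv.un[OF this unary.vee, of "()"] 4 names vee show ?thesis by simp
    qed
  next
    case (veeL t A i j B)
    have IH: "survivors D (F + P) = {#} \<or> drv r n False (survivors D (F + P))"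
      by (rule un.IH) (use un.prems veeL in simp)
    show ?thesis
    proof (cases "vanishes D t")
      case True
      with IH veeL show ?thesis by simp
    next
      case False
      with IH veeL have "drv r n False (survivors D F + {#Tree (map_tree (\<lambda>_. ()) (\<lambda>x. x) (tree_prune D t)) A#})"
        by simp
      from drv.un[OF this unary.veeL, of "()" "()" B] False veeL show ?thesis by simp
    qed
  next
    case (veeR t B i j A)
    have IH: "survivors D (F + P) = {#} \<or> drv r n False (survivors D (F + P))"
      by (rule un.IH) (use un.prems veeR in simp)
    show ?thesis
    proof (cases "vanishes D t")
      case True
      with IH veeR show ?thesis by simp
    next
      case False
      with IH veeR have "drv r n False (survivors D F + {#Tree (map_tree (\<lambda>_. ()) (\<lambda>x. x) (tree_prune D t)) B#})"
        by simp
      from drv.un[OF this unary.veeR, of "()" "()" A] False veeR show ?thesis by simp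
    qed
  next
    case (contraction ws vs i T j k)
    have IH: "survivors D (F + P) = {#} \<or> drv r n False (survivors D (F + P))"
      by (rule un.IH) (use un.prems contraction in \<open>simp add: ball_Un\<close>)
    define sv where "sv us = image_mset (map_wit (\<lambda>_. ()) (\<lambda>x. x)) {#w \<in># image_mset (wit_prune D) us. wname w \<notin> D#}"
      for us :: "('i, 'v) wit multiset"
    have sv_empty: "sv us = {#} \<longleftrightarrow> vanishes D (Exp k us)" for us k
      by (auto simp: sv_def filter_mset_eq_conv)
    have pr: "map_tree (\<lambda>_. ()) (\<lambda>x. x) (tree_prune D (Exp k us)) = Exp () (sv us)" for k us
      by (simp add: sv_def)
    have sv_plus: "sv (ws + vs) = sv ws + sv vs"
      by (simp add: sv_def)
    have surv: "survivors D {#Tree (Exp k us) C#} = (if sv us = {#} then {#} else {#Tree (Exp () (sv us)) C#})" for k us C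
      using pr[of k us] sv_empty[of us k] by simp
    have "survivors D (F + P) = survivors D F + survivors D {#Tree (Exp i ws) (underlying T)#} + survivors D {#Tree (Exp j vs) (underlying T)#}"
      unfolding contraction by simp
    note IH' = IH[unfolded this surv]
    have "survivors D (F + {#c#}) = survivors D F + (if sv ws + sv vs = {#} then {#}
        else {#Tree (Exp () (sv ws + sv vs)) (underlying T)#})"
      unfolding contraction survivors_simps(3) surv sv_plus by simp
    with IH' show ?thesis
      using drv.un[OF _ unary.contraction[of "sv ws" "sv vs" "()" T "()" "()"], of r n False "survivors D F"]
      by (cases "sv ws = {#}"; cases "sv vs = {#}")
        (simp_all add: add_mset_commute[of "Tree (Exp () (sv ws)) (underlying T)"])
  qed
next
  case (tensor b F t A c G s B e i j)
  have F: "survivors D (F + {#Tree t A#}) = {#} \<or> drv r n False (survivors D (F + {#Tree t A#}))"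
    and G: "survivors D (G + {#Tree s B#}) = {#} \<or> drv r n False (survivors D (G + {#Tree s B#}))"
    and del: "j \<in> D \<longleftrightarrow> vanishes D t" "j \<in> D \<longleftrightarrow> vanishes D s"
    using tensor by auto
  have disj: "forest_vars (survivors D (F + {#Tree t A#})) \<inter> forest_vars (survivors D (G + {#Tree s B#})) = {}"
    using survivors_vars[of D "F + {#Tree t A#}"] survivors_vars[of D "G + {#Tree s B#}"] tensor.hyps(3)
    by blast
  show ?case
  proof (cases "j \<in> D")
    case True
    with drv_mix_maybe[OF F G disj] del show ?thesis by simp
  next
    case False
    let ?t = "map_tree (\<lambda>_. ()) (\<lambda>x. x) (tree_prune D t)" and ?s = "map_tree (\<lambda>_. ()) (\<lambda>x. x) (tree_prune D s)"
    have "drv r n False (survivors D F + {#Tree ?t A#})" "drv r n False (survivors D G + {#Tree ?s B#})"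
      using F G del False by auto
    from drv.tensor[OF this, of False "()" "()"] disj del False show ?thesis by (simp add: Int_commute)
  qed
next
  case (cut b F s A c G t e i)
  have F: "survivors D (F + {#Tree s A#}) = {#} \<or> drv r n False (survivors D (F + {#Tree s A#}))"
    and G: "survivors D (G + {#Tree t (dual A)#}) = {#} \<or> drv r n False (survivors D (G + {#Tree t (dual A)#}))"
    and del: "i \<in> D \<longleftrightarrow> vanishes D s" "i \<in> D \<longleftrightarrow> vanishes D t"
    using cut by auto
  have disj: "forest_vars (survivors D (F + {#Tree s A#})) \<inter> forest_vars (survivors D (G + {#Tree t (dual A)#})) = {}"
    using survivors_vars[of D "F + {#Tree s A#}"] survivors_vars[of D "G + {#Tree t (dual A)#}"]
      cut.hyps(4) by blast
  show ?case
  proof (cases "i \<in> D")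
    case True
    with drv_mix_maybe[OF F G disj] del show ?thesis by simp
  next
    case False
    let ?t = "map_tree (\<lambda>_. ()) (\<lambda>x. x) (tree_prune D t)" and ?s = "map_tree (\<lambda>_. ()) (\<lambda>x. x) (tree_prune D s)"
    have "drv r n False (survivors D F + {#Tree ?s A#})" "drv r n False (survivors D G + {#Tree ?t (dual A)#})"
      using F G del False by auto
    from drv.cut[OF this cut.hyps(3), of False "()"] disj del False show ?thesis by (simp add: Int_commute)
  qed
qed

subsection \<open>Merging two copies\<close>

primrec outer_names :: "('i, 'v) tree \<Rightarrow> 'i set" where
  "outer_names (Unit i) = {}"
| "outer_names (Exp i ws) = wname ` set_mset ws"
| "outer_names (Vee i t s) = outer_names t \<union> outer_names s"
| "outer_names (VeeL i t j) = outer_names t"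
| "outer_names (VeeR i j t) = outer_names t"

lemma duplicate_outer:
  assumes "wname ` set_mset ws \<subseteq> R"
  shows "image_mset (map_wit (\<lambda>_. ()) (\<lambda>x. x)) (\<Sum>\<^sub># (image_mset (wit_replace (duplicate_wit f g R)) ws)) =
    image_mset (map_wit (\<lambda>_. ()) f) ws + image_mset (map_wit (\<lambda>_. ()) g) ws"
  using assms
proof (induction ws)
  case (add w ws)
  have "wit_replace (duplicate_wit f g R) w = {#map_wit id f w, map_wit id g w#}"
    using add.prems by (cases w) (auto simp: duplicate_wit_def)
  then show ?case using add by (simp add: wit.map_comp o_def)
qed simp

text \<open>
  Two copies of a tree are contracted back into one along its structure, down to the outermost witnesses, which are paired up in sums.
\<close>

lemma drv_merge_copies:
  fixes t :: "('i, 'v) tree" and w :: "('i, 'v) wit"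
  shows "drv r n e (H + {#Tree (map_tree (\<lambda>_. ()) f t) A, Tree (map_tree (\<lambda>_. ()) g t) A#}) \<Longrightarrow>
    outer_names t \<subseteq> R \<Longrightarrow>
    drv r n e (H + {#Tree (map_tree (\<lambda>_. ()) (\<lambda>x. x) (tree_replace (duplicate_wit f g R) t)) A#})"
    and "True"
proof (induction t and w arbitrary: H A)
  case (Unit i)
  from drv_typed[OF Unit.prems(1)] have A: "A = Top" by (auto elim: typed_elims)
  have "drv r n e ((H + {#Tree (Unit ()) Top#}) + {#Tree (Unit ()) Top#})"
    using Unit.prems(1) A by simp
  from drv_remove_unit[OF this] A show ?case by simp
next
  case (Exp i ws)
  from drv_typed[OF Exp.prems(1)] obtain T where A: "A = underlying T" and ws: "ws \<noteq> {#}"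
    by (auto elim: typed_elims)
  show ?case
    using drv.un[OF Exp.prems(1)[unfolded A tree.map] unary.contraction, of "()"] ws A
      duplicate_outer[of ws R f g] Exp.prems(2) by simp
next
  case (Vee i t s)
  let ?f = "map_tree (\<lambda>_. ()) f" and ?g = "map_tree (\<lambda>_. ()) g"
    and ?d = "\<lambda>t. map_tree (\<lambda>_. ()) (\<lambda>x. x) (tree_replace (duplicate_wit f g R) t)"
  from drv_typed[OF Vee.prems(1)] obtain A1 A2 where A: "A = Disj A1 A2" by (auto elim: typed_elims)
  have "drv r n e ((H + {#Tree (?f (Vee i t s)) A#}) + {#Tree (Vee () (?g t) (?g s)) (Disj A1 A2)#})"
    using Vee.prems(1) A by (simp add: add_mset_commute)
  from drv_invert_vee[OF this]
  have "drv r n e ((H + {#Tree (?g t) A1, Tree (?g s) A2#}) + {#Tree (Vee () (?f t) (?f s)) (Disj A1 A2)#})"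
    using A by (simp add: add_mset_commute)
  from drv_invert_vee[OF this]
  have "drv r n e ((H + {#Tree (?f s) A2, Tree (?g s) A2#}) + {#Tree (?f t) A1, Tree (?g t) A1#})"
    by (simp add: add_mset_commute)
  from Vee.IH(1)[OF this] Vee.prems(2)
  have "drv r n e ((H + {#Tree (?d t) A1#}) + {#Tree (?f s) A2, Tree (?g s) A2#})"
    by (simp add: add_mset_commute)
  from Vee.IH(2)[OF this] Vee.prems(2)
  have "drv r n e (H + {#Tree (?d t) A1, Tree (?d s) A2#})" by (simp add: add_mset_commute)
  from drv.un[OF this unary.vee, of "()"] A show ?case by simp
next
  case (VeeL i t j)
  let ?f = "map_tree (\<lambda>_. ()) f" and ?g = "map_tree (\<lambda>_. ()) g"
    and ?d = "\<lambda>t. map_tree (\<lambda>_. ()) (\<lambda>x. x) (tree_replace (duplicate_wit f g R) t)"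
  from drv_typed[OF VeeL.prems(1)] obtain A1 A2 where A: "A = Disj A1 A2" by (auto elim: typed_elims)
  have "drv r n e ((H + {#Tree (?f (VeeL i t j)) A#}) + {#Tree (VeeL () (?g t) ()) (Disj A1 A2)#})"
    using VeeL.prems(1) A by (simp add: add_mset_commute)
  from drv_invert_veeL[OF this]
  have "drv r n e ((H + {#Tree (?g t) A1#}) + {#Tree (VeeL () (?f t) ()) (Disj A1 A2)#})"
    using A by (simp add: add_mset_commute)
  from drv_invert_veeL[OF this]
  have "drv r n e (H + {#Tree (?f t) A1, Tree (?g t) A1#})"
    by (simp add: add_mset_commute)
  from VeeL.IH[OF this] VeeL.prems(2)
  have "drv r n e (H + {#Tree (?d t) A1#})" by simp
  from drv.un[OF this unary.veeL, of "()" "()" A2] A show ?case by simp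
next
  case (VeeR i j t)
  let ?f = "map_tree (\<lambda>_. ()) f" and ?g = "map_tree (\<lambda>_. ()) g"
    and ?d = "\<lambda>t. map_tree (\<lambda>_. ()) (\<lambda>x. x) (tree_replace (duplicate_wit f g R) t)"
  from drv_typed[OF VeeR.prems(1)] obtain A1 A2 where A: "A = Disj A1 A2" by (auto elim: typed_elims)
  have "drv r n e ((H + {#Tree (?f (VeeR i j t)) A#}) + {#Tree (VeeR () () (?g t)) (Disj A1 A2)#})"
    using VeeR.prems(1) A by (simp add: add_mset_commute)
  from drv_invert_veeR[OF this]
  have "drv r n e ((H + {#Tree (?g t) A2#}) + {#Tree (VeeR () () (?f t)) (Disj A1 A2)#})"
    using A by (simp add: add_mset_commute)
  from drv_invert_veeR[OF this]
  have "drv r n e (H + {#Tree (?f t) A2, Tree (?g t) A2#})"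
    by (simp add: add_mset_commute)
  from VeeR.IH[OF this] VeeR.prems(2)
  have "drv r n e (H + {#Tree (?d t) A2#})" by simp
  from drv.un[OF this unary.veeR, of "()" "()" A1] A show ?case by simp
qed auto

section \<open>Names, predecessors and acyclic graphs\<close>

subsection \<open>Nodes of distinctly named forests\<close>

lemma forest_nodes_simps [simp]:
  "forest_nodes {#} = {#}"
  "forest_nodes (add_mset c F) = root_nodes c + forest_nodes F"
  "forest_nodes (F + G) = forest_nodes F + forest_nodes G"
  by (auto simp: forest_nodes_def)

definition distinct_names :: "('i, 'v) node multiset \<Rightarrow> bool" where
  "distinct_names N \<longleftrightarrow> (\<forall>i. count (image_mset node_name N) i \<le> 1)"

lemma distinctly_named_nodes: "distinctly_named F \<longleftrightarrow> distinct_names (forest_nodes F)"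
  by (simp add: distinctly_named_def distinct_names_def)

lemma count_le_1_plus:
  "(\<forall>i. count (A + B) i \<le> 1) \<longleftrightarrow>
   (\<forall>i. count A i \<le> 1) \<and> (\<forall>i. count B i \<le> 1) \<and> set_mset A \<inter> set_mset B = {}" (is "?L \<longleftrightarrow> ?R")
proof
  assume L: ?L
  have "count A i \<le> 1 \<and> count B i \<le> 1 \<and> \<not> (i \<in># A \<and> i \<in># B)" for i
    using L[rule_format, of i] by (auto simp: count_greater_zero_iff[symmetric] simp del: count_greater_zero_iff)
  then show ?R by blast
next
  assume R: ?R
  show ?L
  proof
    fix i
    from R have "count A i \<le> 1" "count B i \<le> 1" "i \<notin># A \<or> i \<notin># B" by auto
    then show "count (A + B) i \<le> 1" by (auto simp: not_in_iff)
  qed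
qed

lemma distinct_names_simps [simp]:
  "distinct_names {#}"
  "distinct_names (N + M) \<longleftrightarrow> distinct_names N \<and> distinct_names M \<and>
     node_name ` set_mset N \<inter> node_name ` set_mset M = {}"
  "distinct_names (add_mset n N) \<longleftrightarrow> distinct_names N \<and> node_name n \<notin> node_name ` set_mset N"
  subgoal by (simp add: distinct_names_def)
  subgoal unfolding distinct_names_def image_mset_union count_le_1_plus by auto
  subgoal
    using count_le_1_plus[of "{#node_name n#}" "image_mset node_name N"]
    by (auto simp: distinct_names_def)
  done

lemma distinct_names_eq:
  assumes "distinct_names N" "n \<in># N" "m \<in># N" "node_name n = node_name m"
  shows "n = m"
proof (rule ccontr)
  assume "n \<noteq> m"
  then obtain N' where "N = add_mset n (add_mset m N')"
    using assms(2,3) by (metis insert_DiffM insert_noteq_member)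
  with assms show False by auto
qed

lemma name_in_nodes:
  "tname t \<in> node_name ` set_mset (tree_nodes t)"
  "wname w \<in> node_name ` set_mset (wit_nodes w)"
  by (cases t; simp; fail) (cases w; simp; fail)

lemma tname_neq:
  "node_name ` set_mset (tree_nodes t) \<inter> node_name ` set_mset (tree_nodes s) = {} \<Longrightarrow> tname t \<noteq> tname s"
  "i \<notin> node_name ` set_mset (tree_nodes t) \<Longrightarrow> tname t \<noteq> i"
  using name_in_nodes(1)[of t] name_in_nodes(1)[of s] by (metis disjoint_iff, metis)

lemma finite_succs:
  fixes t :: "('i, 'v) tree" and w :: "('i, 'v) wit"
  shows "n \<in># tree_nodes t \<Longrightarrow> finite (succs n)" and "n \<in># wit_nodes w \<Longrightarrow> finite (succs n)"
  by (induction t and w) auto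

definition succ_mset :: "('i, 'v) node multiset \<Rightarrow> 'i multiset" where
  "succ_mset N = (\<Sum>n\<in>#N. mset_set (succs n))"

lemma succ_mset_simps [simp]:
  "succ_mset {#} = {#}"
  "succ_mset (add_mset n N) = mset_set (succs n) + succ_mset N"
  "succ_mset (N + M) = succ_mset N + succ_mset M"
  by (auto simp: succ_mset_def)

lemma mset_set_image:
  assumes "\<forall>i. count (image_mset f M) i \<le> 1"
  shows "mset_set (f ` set_mset M) = image_mset f M"
proof (rule multiset_eqI)
  fix i
  have "count (image_mset f M) i \<le> 1" using assms by blast
  moreover have "0 < count (image_mset f M) i \<longleftrightarrow> i \<in> f ` set_mset M" by simp
  ultimately show "count (mset_set (f ` set_mset M)) i = count (image_mset f M) i"
    by (cases "i \<in> f ` set_mset M") (auto simp: count_mset_set(1) count_mset_set(3) simp del: count_greater_zero_iff)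
qed

lemma distinct_wnames:
  "distinct_names (\<Sum>\<^sub># (image_mset wit_nodes ws)) \<Longrightarrow> \<forall>i. count (image_mset wname ws) i \<le> 1"
proof (induction ws)
  case (add w ws)
  have "wname ` set_mset ws \<subseteq> node_name ` set_mset (\<Sum>\<^sub># (image_mset wit_nodes ws))"
  proof
    fix i assume "i \<in> wname ` set_mset ws"
    then obtain v where "v \<in># ws" "i = wname v" by auto
    with name_in_nodes(2)[of v] show "i \<in> node_name ` set_mset (\<Sum>\<^sub># (image_mset wit_nodes ws))"
      by fastforce
  qed
  then have "wname w \<notin># image_mset wname ws"
    using add.prems name_in_nodes(2)[of w] by auto
  then show ?case using add count_le_1_plus[of "{#wname w#}" "image_mset wname ws"] by auto
qed simp

text \<open>Every name but that of the root is a successor exactly once.\<close>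

lemma names_from_succs:
  fixes t :: "('i, 'v) tree" and w :: "('i, 'v) wit"
  shows "distinct_names (tree_nodes t) \<Longrightarrow>
      image_mset node_name (tree_nodes t) = add_mset (tname t) (succ_mset (tree_nodes t))"
    and "distinct_names (wit_nodes w) \<Longrightarrow>
      image_mset node_name (wit_nodes w) = add_mset (wname w) (succ_mset (wit_nodes w))"
proof (induction t and w)
  case (Exp i ws)
  have d: "distinct_names (\<Sum>\<^sub># (image_mset wit_nodes ws))" using Exp.prems by simp
  have "distinct_names (\<Sum>\<^sub># (image_mset wit_nodes vs)) \<Longrightarrow> vs \<subseteq># ws \<Longrightarrow>
      image_mset node_name (\<Sum>\<^sub># (image_mset wit_nodes vs)) =
      image_mset wname vs + succ_mset (\<Sum>\<^sub># (image_mset wit_nodes vs))" for vs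
  proof (induction vs)
    case (add v vs)
    then have "v \<in># ws" "vs \<subseteq># ws" by (auto dest: mset_subset_eq_insertD)
    with Exp.IH[of v] add show ?case by simp
  qed simp
  from this[OF d] show ?case
    using mset_set_image[OF distinct_wnames[OF d]] by simp
next
  case (Vee i t s)
  then have "tname t \<noteq> tname s" using tname_neq(1)[of t s] by simp
  with Vee show ?case by simp
next
  case (VeeL i t j)
  then have "tname t \<noteq> j" using tname_neq(2)[of j t] by simp
  with VeeL show ?case by simp
next
  case (VeeR i j t)
  then have "tname t \<noteq> j" using tname_neq(2)[of j t] by simp
  with VeeR show ?case by simp
next
  case (Tensor i t s)
  then have "tname t \<noteq> tname s" using tname_neq(1)[of t s] by simp
  with Tensor show ?case by simp
qed auto

lemma forest_names:
  "distinct_names (forest_nodes F) \<Longrightarrow>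
    image_mset node_name (forest_nodes F) = image_mset rname F + succ_mset (forest_nodes F)"
proof (induction F)
  case (add c F)
  have "image_mset node_name (root_nodes c) = add_mset (rname c) (succ_mset (root_nodes c))"
  proof (cases c)
    case (Cut i s A t)
    with add.prems have "tname t \<noteq> tname s" using tname_neq(1)[of t s] by auto
    with add.prems Cut names_from_succs(1)[of t] names_from_succs(1)[of s] show ?thesis by simp
  qed (use add.prems names_from_succs in auto)
  with add show ?case by simp
qed simp

lemma finite_forest_succs: "n \<in># forest_nodes F \<Longrightarrow> finite (succs n)"
proof (induction F)
  case (add c F)
  then show ?case by (cases c) (auto dest: finite_succs)
qed simp

lemma in_succ_mset:
  assumes "\<forall>n\<in>#N. finite (succs n)"
  shows "i \<in># succ_mset N \<longleftrightarrow> (\<exists>n\<in>#N. i \<in> succs n)"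
  using assms by (induction N) auto

context
  fixes F :: "('p, 'i, 'v) gen_forest"
  assumes named: "distinctly_named F"
begin

lemma named_count: "count (image_mset rname F + succ_mset (forest_nodes F)) i \<le> 1"
proof -
  have d: "distinct_names (forest_nodes F)" using named by (simp add: distinctly_named_nodes)
  show ?thesis using d unfolding forest_names[OF d, symmetric] by (simp add: distinct_names_def)
qed

lemma node_set_succs: "i \<in> node_set F \<longleftrightarrow> i \<in> rname ` set_mset F \<or> (\<exists>v. (v, i) \<in> succ_edges F)"
proof -
  have "i \<in> node_set F \<longleftrightarrow> i \<in># image_mset node_name (forest_nodes F)" by (simp add: node_set_def)
  also have "\<dots> \<longleftrightarrow> i \<in> rname ` set_mset F \<or> i \<in># succ_mset (forest_nodes F)"
    using named forest_names[of F] by (simp add: distinctly_named_nodes)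
  also have "i \<in># succ_mset (forest_nodes F) \<longleftrightarrow> (\<exists>v. (v, i) \<in> succ_edges F)"
    using in_succ_mset[of "forest_nodes F" i] finite_forest_succs[of _ F] by (auto simp: succ_edges_def)
  finally show ?thesis .
qed

lemma succ_edge_nodes: "(v, u) \<in> succ_edges F \<Longrightarrow> v \<in> node_set F \<and> u \<in> node_set F"
  using node_set_succs[of u] by (auto simp: succ_edges_def node_set_def)

lemma root_no_predecessor: "c \<in># F \<Longrightarrow> (v, rname c) \<notin> succ_edges F"
proof
  assume "c \<in># F" "(v, rname c) \<in> succ_edges F"
  then have "rname c \<in># image_mset rname F" "rname c \<in># succ_mset (forest_nodes F)"
    using in_succ_mset[of "forest_nodes F"] finite_forest_succs[of _ F] by (auto simp: succ_edges_def)
  with count_le_1_plus[of "image_mset rname F" "succ_mset (forest_nodes F)"] named_count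
  show False by blast
qed

lemma unique_node: "n \<in># forest_nodes F \<Longrightarrow> m \<in># forest_nodes F \<Longrightarrow> node_name n = node_name m \<Longrightarrow> n = m"
  using distinct_names_eq named distinctly_named_nodes by blast

lemma unique_predecessor:
  assumes "(v, u) \<in> succ_edges F" "(v', u) \<in> succ_edges F"
  shows "v = v'"
proof (rule ccontr)
  assume "v \<noteq> v'"
  from assms obtain n m where nm: "n \<in># forest_nodes F" "node_name n = v" "u \<in> succs n"
    "m \<in># forest_nodes F" "node_name m = v'" "u \<in> succs m" by (auto simp: succ_edges_def)
  with \<open>v \<noteq> v'\<close> obtain N where N: "forest_nodes F = add_mset n (add_mset m N)"
    by (metis insert_DiffM insert_noteq_member)
  have "count (mset_set (succs n)) u = 1" "count (mset_set (succs m)) u = 1"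
    using nm finite_forest_succs[of _ F] by (simp_all add: count_mset_set(1))
  with N have "2 \<le> count (succ_mset (forest_nodes F)) u" by simp
  with named_count[of u] show False by simp
qed

lemma unique_label: "labelled F i l \<Longrightarrow> labelled F i l' \<Longrightarrow> l = l'"
  using unique_node by (auto simp: labelled_def)

end

subsection \<open>Acyclic graphs\<close>

lemma cycle_nth:
  assumes "path E p" "(last p, hd p) \<in> E" "i < length p"
  shows "(p ! i, p ! (Suc i mod length p)) \<in> E"
proof (cases "Suc i = length p")
  case True
  then have "p \<noteq> []" "length p - 1 = i" by auto
  then have "last p = p ! i" "hd p = p ! 0"
    by (simp_all add: last_conv_nth hd_conv_nth)
  with assms(2) True show ?thesis by simp
next
  case False
  with assms(3) have "Suc i < length p" by simp
  moreover have "successively (\<lambda>i j. (i, j) \<in> E) p" using assms(1) by (simp add: path_def)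
  ultimately have "(p ! i, p ! Suc i) \<in> E" by (simp add: successively_conv_nth)
  with \<open>Suc i < length p\<close> show ?thesis by simp
qed

lemma cyclic_change:
  assumes "i < n" "Q i" "j < (n :: nat)" "\<not> Q j"
  shows "\<exists>i<n. Q i \<and> \<not> Q (Suc i mod n)"
proof (rule ccontr)
  assume *: "\<not> ?thesis"
  have "Q ((i + k) mod n)" for k
  proof (induction k)
    case 0
    show ?case using assms(1,2) by simp
  next
    case (Suc k)
    have "(i + k) mod n < n" using assms(1) by simp
    with * Suc have "Q (Suc ((i + k) mod n) mod n)" by blast
    then show ?case by (simp only: mod_Suc_eq add_Suc_right)
  qed
  from this[of "n - i + j"] have "Q ((n + j) mod n)" using assms(1) by simp
  with assms(3,4) show False by simp
qed

lemma successively_subset: "successively (\<lambda>i j. (i, j) \<in> E) p \<Longrightarrow> E \<subseteq> D \<Longrightarrow> successively (\<lambda>i j. (i, j) \<in> D) p"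
  by (erule successively_mono) auto

lemma path_subset: "path E p \<Longrightarrow> E \<subseteq> D \<Longrightarrow> path D p"
  using successively_subset[of E p D] by (simp add: path_def)

lemma acyclic_graph_subset: "acyclic_graph E \<Longrightarrow> E' \<subseteq> E \<Longrightarrow> acyclic_graph E'"
  using path_subset[of E' _ E] unfolding acyclic_graph_def by blast

text \<open>A cycle would have to traverse the new edge in both directions.\<close>

lemma acyclic_graph_bridge:
  assumes E: "acyclic_graph E" "acyclic_graph E'" and V: "E \<subseteq> V \<times> V" "E' \<subseteq> V' \<times> V'" "V \<inter> V' = {}"
    and ab: "a \<in> V" "b \<in> V'"
  shows "acyclic_graph (E \<union> E' \<union> {(a, b), (b, a)})"
  unfolding acyclic_graph_def
proof
  let ?E = "E \<union> E' \<union> {(a, b), (b, a)}"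
  assume "\<exists>p. path ?E p \<and> 3 \<le> length p \<and> (last p, hd p) \<in> ?E"
  then obtain p where p: "path ?E p" "3 \<le> length p" "(last p, hd p) \<in> ?E" by blast
  let ?n = "length p"
  have d: "distinct p" using p by (simp add: path_def)
  have next_edge: "(p ! i, p ! (Suc i mod ?n)) \<in> ?E" if "i < ?n" for i using cycle_nth[OF p(1,3) that] .
  have restrict: False if sub: "set p \<subseteq> W" and ac: "acyclic_graph D" and W: "\<And>x y. (x, y) \<in> ?E \<Longrightarrow> x \<in> W \<Longrightarrow> y \<in> W \<Longrightarrow> (x, y) \<in> D" for W D
  proof -
    have "path D p" unfolding path_def
    proof (intro conjI)
      show "successively (\<lambda>i j. (i, j) \<in> D) p"
      proof (rule successively_mono[of "\<lambda>i j. (i, j) \<in> ?E"])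
        show "successively (\<lambda>i j. (i, j) \<in> ?E) p" using p by (simp add: path_def)
        show "\<And>x y. x \<in> set p \<Longrightarrow> y \<in> set p \<Longrightarrow> (x, y) \<in> ?E \<Longrightarrow> (x, y) \<in> D" using sub W by blast
      qed
    qed (use p in \<open>auto simp: path_def\<close>)
    moreover have "(last p, hd p) \<in> D"
    proof -
      have "p \<noteq> []" using p by (simp add: path_def)
      then have "last p \<in> W" "hd p \<in> W" using sub by auto
      with W p(3) show ?thesis by blast
    qed
    ultimately show False using ac p(2) by (auto simp: acyclic_graph_def)
  qed
  have mem: "p ! i \<in> V \<union> V'" if "i < ?n" for i using next_edge[OF that] V ab by auto
  consider "set p \<subseteq> V" | "set p \<subseteq> V'" | "\<exists>i<?n. p ! i \<in> V" "\<exists>j<?n. p ! j \<notin> V"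
    using mem by (metis UnE in_set_conv_nth subsetI)
  then show False
  proof cases
    case 1
    then show False by (rule restrict[OF _ E(1)]) (use V ab in auto)
  next
    case 2
    then show False by (rule restrict[OF _ E(2)]) (use V ab in auto)
  next
    case 3
    from 3 obtain i where i: "i < ?n" "p ! i \<in> V" "p ! (Suc i mod ?n) \<notin> V"
      using cyclic_change[of _ ?n "\<lambda>i. p ! i \<in> V"] by blast
    from 3 obtain j where j: "j < ?n" "p ! j \<notin> V" "p ! (Suc j mod ?n) \<in> V"
      using cyclic_change[of _ ?n "\<lambda>i. p ! i \<notin> V"] by blast
    have i': "p ! i = a" "p ! (Suc i mod ?n) = b" using next_edge[OF i(1)] i V ab by auto
    have j': "p ! j = b" "p ! (Suc j mod ?n) = a" using next_edge[OF j(1)] j V ab by auto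
    have pos: "Suc i mod ?n < ?n" "Suc j mod ?n < ?n" using p(2) by (auto intro!: mod_less_divisor)
    have "j = Suc i mod ?n" using d i' j' j(1) pos nth_eq_iff_index_eq by metis
    moreover have "i = Suc j mod ?n" using d i' j' i(1) pos nth_eq_iff_index_eq by metis
    ultimately have "i = Suc (Suc i mod ?n) mod ?n" by metis
    then have "i = Suc (Suc i) mod ?n" by (simp only: mod_Suc_eq)
    with i(1) p(2) show False by (cases "Suc (Suc i) < ?n") (auto simp: mod_if split: if_splits)
  qed
qed

lemma acyclic_graph_empty [simp]: "acyclic_graph {}"
  unfolding acyclic_graph_def
proof
  assume "\<exists>p. path {} p \<and> 3 \<le> length p \<and> (last p, hd p) \<in> {}"
  then show False by blast
qed

lemma acyclic_graph_pendant:
  assumes "acyclic_graph E" "E \<subseteq> V \<times> V" "v \<notin> V" "v \<noteq> a"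
  shows "acyclic_graph (E \<union> {(a, v), (v, a)})"
  using acyclic_graph_bridge[of E "{}" "insert a V" "{v}" a v] assms by auto

section \<open>Named derivations and their switching graphs\<close>

subsection \<open>Switching graphs of sets of nodes\<close>

abbreviation nodes :: "('p, 'i, 'v) gen_forest \<Rightarrow> ('i, 'v) node set" where
  "nodes F \<equiv> set_mset (forest_nodes F)"

definition is_switched :: "('i, 'v) node \<Rightarrow> bool" where
  "is_switched n \<longleftrightarrow> node_label n = LExp \<or> node_label n = LVee"

definition chosen_edges :: "('i, 'v) node \<Rightarrow> ('i \<Rightarrow> 'i) \<Rightarrow> ('i \<times> 'i) set" where
  "chosen_edges n \<sigma> = {(node_name n, j) |j. j \<in> succs n \<and> (is_switched n \<longrightarrow> j = \<sigma> (node_name n))}"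

definition link_edges :: "('i, 'v) node set \<Rightarrow> ('i \<times> 'i) set" where
  "link_edges N = {(node_name n, node_name m) |n m x.
     n \<in> N \<and> m \<in> N \<and> node_label n = LWire x \<and> node_label m = LWire (wdual x)}"

definition sgraph :: "('i, 'v) node set \<Rightarrow> ('i \<Rightarrow> 'i) \<Rightarrow> ('i \<times> 'i) set" where
  "sgraph N \<sigma> = (\<Union>n\<in>N. chosen_edges n \<sigma> \<union> (chosen_edges n \<sigma>)\<inverse>) \<union> link_edges N"

definition switches :: "('i, 'v) node set \<Rightarrow> ('i \<Rightarrow> 'i) \<Rightarrow> bool" where
  "switches N \<sigma> \<longleftrightarrow> (\<forall>n\<in>N. is_switched n \<longrightarrow> \<sigma> (node_name n) \<in> succs n)"

definition acyc :: "('i, 'v) node set \<Rightarrow> bool" where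
  "acyc N \<longleftrightarrow> (\<forall>\<sigma>. switches N \<sigma> \<longrightarrow> acyclic_graph (sgraph N \<sigma>))"

definition unlinked :: "('i, 'v) node set \<Rightarrow> ('i, 'v) node set \<Rightarrow> bool" where
  "unlinked N M \<longleftrightarrow> (\<forall>n\<in>N. \<forall>m\<in>M. \<forall>x. node_label n = LWire x \<longrightarrow> node_label m \<noteq> LWire (wdual x))"

lemma wdual_wdual [simp]: "wdual (wdual x) = x"
  by (cases x) auto

lemma link_edges_sym: "(i, j) \<in> link_edges N \<Longrightarrow> (j, i) \<in> link_edges N"
  unfolding link_edges_def using wdual_wdual by fastforce

lemma sgraph_sym: "(i, j) \<in> sgraph N \<sigma> \<Longrightarrow> (j, i) \<in> sgraph N \<sigma>"
  using link_edges_sym[of i j N] unfolding sgraph_def by blast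

lemma switched_iff:
  assumes "distinctly_named F" "n \<in> nodes F"
  shows "switched F (node_name n) \<longleftrightarrow> is_switched n"
  using unique_node[OF assms(1) _ assms(2)] assms(2)
  by (auto simp: switched_def labelled_def is_switched_def)

lemma switching_nodes:
  assumes "distinctly_named F"
  shows "switching F \<sigma> \<longleftrightarrow> switches (nodes F) \<sigma>"
proof
  assume L: "switching F \<sigma>"
  show "switches (nodes F) \<sigma>" unfolding switches_def
  proof (intro ballI impI)
    fix n assume n: "n \<in># forest_nodes F" "is_switched n"
    then have "(node_name n, \<sigma> (node_name n)) \<in> succ_edges F"
      using L switched_iff[OF assms] by (auto simp: switching_def)
    then show "\<sigma> (node_name n) \<in> succs n"
      using unique_node[OF assms _ n(1)] by (auto simp: succ_edges_def)
  qed
next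
  assume R: "switches (nodes F) \<sigma>"
  show "switching F \<sigma>" unfolding switching_def
  proof (intro allI impI)
    fix i assume i: "switched F i"
    then obtain n where n: "n \<in># forest_nodes F" "node_name n = i"
      by (auto simp: switched_def labelled_def)
    with i switched_iff[OF assms, of n] R show "(i, \<sigma> i) \<in> succ_edges F"
      by (auto simp: switches_def succ_edges_def)
  qed
qed

lemma switching_graph_nodes:
  assumes "distinctly_named F"
  shows "switching_graph F \<sigma> = sgraph (nodes F) \<sigma>"
proof -
  have *: "{(i, j) \<in> succ_edges F. switched F i \<longrightarrow> j = \<sigma> i} = (\<Union>n\<in>nodes F. chosen_edges n \<sigma>)"
    using switched_iff[OF assms] by (fastforce simp: succ_edges_def chosen_edges_def)
  have "axiom_links F = link_edges (nodes F)"
    by (auto simp: axiom_links_def labelled_def link_edges_def)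
  moreover have "(link_edges (nodes F))\<inverse> = link_edges (nodes F)"
    using link_edges_sym by auto
  ultimately show ?thesis unfolding switching_graph_def sgraph_def Let_def * by blast
qed

lemma AC_acyc: "distinctly_named F \<Longrightarrow> AC F \<longleftrightarrow> acyc (nodes F)"
  by (simp add: AC_def acyc_def switching_nodes switching_graph_nodes)

lemma sgraph_mono: "N \<subseteq> M \<Longrightarrow> sgraph N \<sigma> \<subseteq> sgraph M \<sigma>"
  unfolding sgraph_def link_edges_def by blast

lemma sgraph_union:
  assumes "unlinked N M"
  shows "sgraph (N \<union> M) \<sigma> = sgraph N \<sigma> \<union> sgraph M \<sigma>"
proof -
  have "link_edges (N \<union> M) = link_edges N \<union> link_edges M" (is "?L = ?R")
  proof
    show "?L \<subseteq> ?R"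
    proof clarify
      fix i j assume "(i, j) \<in> ?L" and j: "(i, j) \<notin> link_edges M"
      then obtain n m x where e: "i = node_name n" "j = node_name m" "n \<in> N \<union> M" "m \<in> N \<union> M"
        "node_label n = LWire x" "node_label m = LWire (wdual x)"
        by (auto simp: link_edges_def)
      have "\<not> (n \<in> N \<and> m \<in> M)" "\<not> (n \<in> M \<and> m \<in> N)"
        using assms e(5,6) wdual_wdual[of x] unfolding unlinked_def by (blast, metis)
      with e j show "(i, j) \<in> link_edges N" unfolding link_edges_def by blast
    qed
  qed (auto simp: link_edges_def)
  then show ?thesis by (auto simp: sgraph_def)
qed

lemma sgraph_insert:
  assumes "\<forall>x. node_label n \<noteq> LWire x"
  shows "sgraph (insert n N) \<sigma> = sgraph N \<sigma> \<union> chosen_edges n \<sigma> \<union> (chosen_edges n \<sigma>)\<inverse>"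
proof -
  have "link_edges (insert n N) = link_edges N" using assms by (auto simp: link_edges_def)
  then show ?thesis by (auto simp: sgraph_def)
qed

lemma unlinked_forests:
  assumes "forest_vars F \<inter> forest_vars G = {}"
  shows "unlinked (nodes F) (nodes G)"
  unfolding unlinked_def
proof (intro ballI allI impI notI)
  fix n m x assume *: "n \<in># forest_nodes F" "m \<in># forest_nodes G" "node_label n = LWire x"
    "node_label m = LWire (wdual x)"
  then have "0 < occurrences F x" "0 < occurrences G (wdual x)"
    by (auto simp: occurrences_def nonempty_has_size[symmetric] filter_mset_eq_conv)
  from occurrences_vars[OF this(1)] occurrences_vars[OF this(2)] assms show False by auto
qed

lemma sgraph_nodes:
  assumes "distinctly_named F"
  shows "sgraph (nodes F) \<sigma> \<subseteq> node_set F \<times> node_set F"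
proof -
  have "chosen_edges n \<sigma> \<subseteq> node_set F \<times> node_set F" if "n \<in> nodes F" for n
  proof -
    have "chosen_edges n \<sigma> \<subseteq> succ_edges F" using that by (auto simp: chosen_edges_def succ_edges_def)
    with succ_edge_nodes[OF assms] show ?thesis by auto
  qed
  moreover have "link_edges (nodes F) \<subseteq> node_set F \<times> node_set F"
    by (auto simp: link_edges_def node_set_def)
  ultimately show ?thesis unfolding sgraph_def by blast
qed

lemma node_set_simps [simp]:
  "node_set {#} = {}"
  "node_set (add_mset c F) = node_name ` set_mset (root_nodes c) \<union> node_set F"
  "node_set (F + G) = node_set F \<union> node_set G"
  by (auto simp: node_set_def)

lemma distinctly_named_simps [simp]:
  "distinctly_named {#}"
  "distinctly_named (add_mset c F) \<longleftrightarrow> distinct_names (root_nodes c) \<and> distinctly_named F \<and>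
     node_name ` set_mset (root_nodes c) \<inter> node_set F = {}"
  "distinctly_named (F + G) \<longleftrightarrow> distinctly_named F \<and> distinctly_named G \<and> node_set F \<inter> node_set G = {}"
  by (auto simp: distinctly_named_nodes node_set_def)

subsection \<open>Derivations of distinctly named forests\<close>

inductive named_unary :: "('p, 'i, 'v) gen_forest \<Rightarrow> ('p, 'i, 'v) root \<Rightarrow> bool" where
  vee: "named_unary {#Tree t A, Tree s B#} (Tree (Vee i t s) (Disj A B))"
| veeL: "named_unary {#Tree t A#} (Tree (VeeL i t j) (Disj A B))"
| veeR: "named_unary {#Tree s B#} (Tree (VeeR i j s) (Disj A B))"
| contraction: "ws \<noteq> {#} \<Longrightarrow> vs \<noteq> {#} \<Longrightarrow>
    named_unary {#Tree (Exp k ws) (underlying T), Tree (Exp j vs) (underlying T)#}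
          (Tree (Exp k (ws + vs)) (underlying T))"

lemma named_unary_unary: "named_unary P c \<Longrightarrow> unary P c"
  by (induction rule: named_unary.induct) (auto intro: unary.intros)

inductive nd :: "nat \<Rightarrow> nat \<Rightarrow> bool \<Rightarrow> ('p, 'i, 'v) gen_forest \<Rightarrow> bool" for r n :: nat where
  unit: "nd r n False {#Tree (Unit i) Top#}"
| axiom: "distinctly_named {#Tree (Exp i {#Wire j (Xbar x)#}) (Neg p),
                          Tree (Exp k {#Wire l (X x)#}) (Pos p)#} \<Longrightarrow>
    nd r n False {#Tree (Exp i {#Wire j (Xbar x)#}) (Neg p),
                          Tree (Exp k {#Wire l (X x)#}) (Pos p)#}"
| mix: "nd r n b F \<Longrightarrow> nd r n c G \<Longrightarrow> forest_vars F \<inter> forest_vars G = {} \<Longrightarrow>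
    (e \<Longrightarrow> b \<or> c) \<Longrightarrow> distinctly_named (F + G) \<Longrightarrow> nd r n e (F + G)"
| un: "nd r n e (F + P) \<Longrightarrow> named_unary P c \<Longrightarrow> distinctly_named (F + P) \<Longrightarrow>
    distinctly_named (F + {#c#}) \<Longrightarrow> nd r n e (F + {#c#})"
| tensor: "nd r n b (F + {#Tree t A#}) \<Longrightarrow> nd r n c (G + {#Tree s B#}) \<Longrightarrow>
    forest_vars (F + {#Tree t A#}) \<inter> forest_vars (G + {#Tree s B#}) = {} \<Longrightarrow>
    (e \<Longrightarrow> b \<or> c) \<Longrightarrow>
    distinctly_named (F + G + {#Tree (Exp i {#Tensor j t s#}) (Conj A B)#}) \<Longrightarrow>
    nd r n e (F + G + {#Tree (Exp i {#Tensor j t s#}) (Conj A B)#})"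
| cut: "nd r n b (F + {#Tree s A#}) \<Longrightarrow> nd r n c (G + {#Tree t (dual A)#}) \<Longrightarrow>
    positive A \<Longrightarrow>
    forest_vars (F + {#Tree s A#}) \<inter> forest_vars (G + {#Tree t (dual A)#}) = {} \<Longrightarrow>
    (e \<Longrightarrow> (b \<or> c) \<and> (rank A = r \<longrightarrow> 2 \<le> width s) \<or>
           rank A = r \<and> width s = n \<and> lacks_rank r G) \<Longrightarrow>
    distinctly_named (F + G + {#Cut i s A t#}) \<Longrightarrow>
    nd r n e (F + G + {#Cut i s A t#})"

lemma nd_drv: "nd r n e F \<Longrightarrow> drv r n e F"
proof (induction rule: nd.induct)
  case (un e F P c)
  then show ?case using drv.un named_unary_unary by blast
next
  case (tensor b F t A c G s B e i j)
  show ?case by (rule drv.tensor[OF tensor.IH tensor.hyps(3,4)])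
next
  case (cut b F s A c G t e i)
  show ?case by (rule drv.cut[OF cut.IH cut.hyps(3,4,5)])
next
  case (mix b F c G e)
  show ?case by (rule drv.mix[OF mix.IH mix.hyps(3,4)])
qed (auto intro: drv.intros)

lemma nd_named: "nd r n e F \<Longrightarrow> distinctly_named F"
  by (induction rule: nd.induct) auto

abbreviation strip :: "('p, 'i, 'v) gen_forest \<Rightarrow> ('p, unit, 'v) gen_forest" where
  "strip F \<equiv> image_mset (rename (\<lambda>_. ()) (\<lambda>x. x)) F"

lemma rename_Tree: "rename u f c = Tree t A \<longleftrightarrow> (\<exists>t'. c = Tree t' A \<and> map_tree u f t' = t)"
  by (cases c) auto

lemma rename_Cut: "rename u f c = Cut i s A t \<longleftrightarrow>
    (\<exists>i' s' t'. c = Cut i' s' A t' \<and> u i' = i \<and> map_tree u f s' = s \<and> map_tree u f t' = t)"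
  by (cases c) auto

lemma map_tree_eqs:
  "map_tree u f t = Unit i \<longleftrightarrow> (\<exists>i'. t = Unit i' \<and> u i' = i)"
  "map_tree u f t = Exp i ws \<longleftrightarrow> (\<exists>i' ws'. t = Exp i' ws' \<and> u i' = i \<and> image_mset (map_wit u f) ws' = ws)"
  "map_tree u f t = Vee i t1 t2 \<longleftrightarrow>
     (\<exists>i' t1' t2'. t = Vee i' t1' t2' \<and> u i' = i \<and> map_tree u f t1' = t1 \<and> map_tree u f t2' = t2)"
  "map_tree u f t = VeeL i t1 j \<longleftrightarrow> (\<exists>i' t1' j'. t = VeeL i' t1' j' \<and> u i' = i \<and> map_tree u f t1' = t1 \<and> u j' = j)"
  "map_tree u f t = VeeR i j t1 \<longleftrightarrow> (\<exists>i' t1' j'. t = VeeR i' j' t1' \<and> u i' = i \<and> map_tree u f t1' = t1 \<and> u j' = j)"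
  "map_wit u f w = Wire i x \<longleftrightarrow> (\<exists>i' x'. w = Wire i' x' \<and> u i' = i \<and> map_wire f x' = x)"
  "map_wit u f w = Tensor i t1 t2 \<longleftrightarrow>
     (\<exists>i' t1' t2'. w = Tensor i' t1' t2' \<and> u i' = i \<and> map_tree u f t1' = t1 \<and> map_tree u f t2' = t2)"
  by (cases t; fastforce)+ (cases w; fastforce)+

lemma strip_addD: "image_mset f M = N + {#b#} \<Longrightarrow> \<exists>M' a. M = M' + {#a#} \<and> image_mset f M' = N \<and> f a = b"
  using msed_map_invR[of f M b N] by auto

lemma strip_singleD: "image_mset f M = {#b#} \<Longrightarrow> \<exists>a. M = {#a#} \<and> f a = b"
  using msed_map_invR[of f M b "{#}"] by auto

lemma rename_axiomD:
  assumes "rename u f c = Tree (Exp i {#Wire j x#}) A"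
  shows "\<exists>i' j' x'. c = Tree (Exp i' {#Wire j' x'#}) A \<and> map_wire f x' = x"
proof -
  from assms obtain i' ws where c: "c = Tree (Exp i' ws) A" "image_mset (map_wit u f) ws = {#Wire j x#}"
    unfolding rename_Tree map_tree_eqs by blast
  from strip_singleD[OF c(2)] obtain w where "ws = {#w#}" "map_wit u f w = Wire j x" by blast
  with c show ?thesis unfolding map_tree_eqs by blast
qed

lemma rename_tensorD:
  assumes "rename u f c = Tree (Exp i {#Tensor j t s#}) A"
  shows "\<exists>i' j' t' s'. c = Tree (Exp i' {#Tensor j' t' s'#}) A \<and> map_tree u f t' = t \<and> map_tree u f s' = s"
proof -
  from assms obtain i' ws where c: "c = Tree (Exp i' ws) A" "image_mset (map_wit u f) ws = {#Tensor j t s#}"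
    unfolding rename_Tree map_tree_eqs by blast
  from strip_singleD[OF c(2)] obtain w where "ws = {#w#}" "map_wit u f w = Tensor j t s" by blast
  with c show ?thesis unfolding map_tree_eqs by blast
qed

lemma map_wire_ident_eqs [simp]: "map_wire (\<lambda>x. x) y = x \<longleftrightarrow> y = x"
  by (simp add: wire.map_ident)

lemma strip_vars [simp]: "forest_vars (strip F) = forest_vars F"
  by simp

lemma finite_node_set: "finite (node_set F)"
  by (simp add: node_set_def)

lemma fresh_nat: "finite N \<Longrightarrow> \<exists>j :: nat. j \<notin> N"
  using ex_new_if_finite infinite_UNIV_nat by blast

text \<open>
  Names can be reintroduced from the conclusion upwards, as the conclusion of each rule contains all nodes of its premises except for the expansions joined by a contraction.
\<close>

lemma nd_lift:
  fixes F :: "('p, nat, 'v) gen_forest"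
  shows "drv r n e F0 \<Longrightarrow> strip F = F0 \<Longrightarrow> distinctly_named F \<Longrightarrow> nd r n e F"
proof (induction arbitrary: F rule: drv.induct)
  case (unit i)
  then obtain c where c: "F = {#c#}" "rename (\<lambda>_. ()) (\<lambda>x. x) c = Tree (Unit i) Top"
    using strip_singleD[OF unit.prems(1)] by blast
  then obtain j where "c = Tree (Unit j) Top" unfolding rename_Tree map_tree_eqs by blast
  with c nd.unit[of r n j] show ?case by simp
next
  case (axiom i j x p k l)
  have "strip F = {#Tree (Exp i {#Wire j (Xbar x)#}) (Neg p)#} + {#Tree (Exp k {#Wire l (X x)#}) (Pos p)#}"
    using axiom.prems(1) by (simp add: add_mset_commute)
  from strip_addD[OF this] obtain F' d where F': "F = F' + {#d#}"
    "strip F' = {#Tree (Exp i {#Wire j (Xbar x)#}) (Neg p)#}"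
    "rename (\<lambda>_. ()) (\<lambda>x. x) d = Tree (Exp k {#Wire l (X x)#}) (Pos p)" by blast
  from strip_singleD[OF F'(2)] obtain c where c0: "F' = {#c#}"
    "rename (\<lambda>_. ()) (\<lambda>x. x) c = Tree (Exp i {#Wire j (Xbar x)#}) (Neg p)" by blast
  from rename_axiomD[OF c0(2)] obtain i' j' where c: "c = Tree (Exp i' {#Wire j' (Xbar x)#}) (Neg p)"
    by auto
  from rename_axiomD[OF F'(3)] obtain k' l' where d: "d = Tree (Exp k' {#Wire l' (X x)#}) (Pos p)"
    by auto
  have "F = {#c, d#}" using F'(1) c0(1) by (simp add: add_mset_commute)
  with axiom.prems(2) show ?case unfolding c d by (auto intro: nd.axiom)
next
  case (mix b F1 c G1 e)
  from image_mset_eq_plusD[OF mix.prems(1)] obtain F' G' where F: "F = F' + G'" "F1 = strip F'" "G1 = strip G'"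
    by blast
  show ?case unfolding F
    by (rule nd.mix[of r n b F' c G']) (use mix F in auto)
next
  case (un e F1 P c)
  obtain F' c' where F: "F = F' + {#c'#}" "strip F' = F1" "rename (\<lambda>_. ()) (\<lambda>x. x) c' = c"
    using strip_addD[OF un.prems(1)] by blast
  have "\<exists>P'. strip P' = P \<and> named_unary P' c' \<and> distinctly_named (F' + P')"
    using un.hyps(2)
  proof cases
    case (vee t A s B i)
    with F(3) obtain i' t' s' where c': "c' = Tree (Vee i' t' s') (Disj A B)"
      "map_tree (\<lambda>_. ()) (\<lambda>x. x) t' = t" "map_tree (\<lambda>_. ()) (\<lambda>x. x) s' = s"
      unfolding rename_Tree by (auto simp: rename_Tree map_tree_eqs(3))
    with vee show ?thesis using un.prems(2) F(1)
      by (intro exI[of _ "{#Tree t' A, Tree s' B#}"]) (auto intro: named_unary.vee)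
  next
    case (veeL t A i j B)
    with F(3) obtain i' t' j' where c': "c' = Tree (VeeL i' t' j') (Disj A B)"
      "map_tree (\<lambda>_. ()) (\<lambda>x. x) t' = t"
      unfolding rename_Tree by (auto simp: rename_Tree map_tree_eqs(4))
    with veeL show ?thesis using un.prems(2) F(1)
      by (intro exI[of _ "{#Tree t' A#}"]) (auto intro: named_unary.veeL)
  next
    case (veeR t B i j A)
    with F(3) obtain i' t' j' where c': "c' = Tree (VeeR i' j' t') (Disj A B)"
      "map_tree (\<lambda>_. ()) (\<lambda>x. x) t' = t"
      unfolding rename_Tree by (auto simp: rename_Tree map_tree_eqs(5))
    with veeR show ?thesis using un.prems(2) F(1)
      by (intro exI[of _ "{#Tree t' B#}"]) (auto intro: named_unary.veeR)
  next
    case (contraction ws vs i T j k)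
    with F(3) obtain k' us where c': "c' = Tree (Exp k' us) (underlying T)"
      "image_mset (map_wit (\<lambda>_. ()) (\<lambda>x. x)) us = ws + vs"
      unfolding rename_Tree by (auto simp: rename_Tree map_tree_eqs(2))
    from image_mset_eq_plusD[OF c'(2)] obtain ws' vs' where us: "us = ws' + vs'" "image_mset (map_wit (\<lambda>_. ()) (\<lambda>x. x)) ws' = ws"
      "image_mset (map_wit (\<lambda>_. ()) (\<lambda>x. x)) vs' = vs"
      by blast
    obtain j' where "j' \<notin> node_set F" using fresh_nat[OF finite_node_set[of F]] by blast
    let ?P = "{#Tree (Exp k' ws') (underlying T), Tree (Exp j' vs') (underlying T)#}"
    have "distinctly_named (F' + ?P)"
      using un.prems(2) \<open>j' \<notin> node_set F\<close> unfolding F(1) c'(1) us(1)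
      by (simp add: image_Un Int_Un_distrib Int_Un_distrib2 Int_commute)
    moreover have "strip ?P = P" using us contraction by simp
    moreover have "named_unary ?P c'" unfolding c'(1) us(1)
      by (rule named_unary.contraction) (use us contraction in auto)
    ultimately show ?thesis by blast
  qed
  then obtain P' where P': "strip P' = P" "named_unary P' c'" "distinctly_named (F' + P')" by blast
  show ?case unfolding F(1)
    by (rule nd.un[OF un.IH]) (use P' F un.prems in auto)
next
  case (tensor b F1 t A c G1 s B e i j)
  obtain F' c' where F: "F = F' + {#c'#}" "strip F' = F1 + G1"
    "rename (\<lambda>_. ()) (\<lambda>x. x) c' = Tree (Exp i {#Tensor j t s#}) (Conj A B)"
    using strip_addD[OF tensor.prems(1)] by blast
  from image_mset_eq_plusD[OF F(2)] obtain F'' G'' where F': "F' = F'' + G''" "F1 = strip F''" "G1 = strip G''"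
    by blast
  from F(3) obtain i' j' t' s' where c': "c' = Tree (Exp i' {#Tensor j' t' s'#}) (Conj A B)"
    "map_tree (\<lambda>_. ()) (\<lambda>x. x) t' = t" "map_tree (\<lambda>_. ()) (\<lambda>x. x) s' = s"
    using rename_tensorD[OF F(3)] by blast
  have v: "tree_vars t = tree_vars t'" "tree_vars s = tree_vars s'" using c' by auto
  show ?case unfolding F(1) F'(1) c'(1)
  proof (rule nd.tensor[of r n b F'' t' A c G''])
    show "nd r n b (F'' + {#Tree t' A#})" by (rule tensor.IH(1)) (use F F' c' tensor.prems in auto)
    show "nd r n c (G'' + {#Tree s' B#})" by (rule tensor.IH(2)) (use F F' c' tensor.prems in auto)
    show "forest_vars (F'' + {#Tree t' A#}) \<inter> forest_vars (G'' + {#Tree s' B#}) = {}"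
      using tensor.hyps(3) F' v by simp
  qed (use tensor F F' c' in auto)
next
  case (cut b F1 s A c G1 t e i)
  obtain F' c' where F: "F = F' + {#c'#}" "strip F' = F1 + G1"
    "rename (\<lambda>_. ()) (\<lambda>x. x) c' = Cut i s A t"
    using strip_addD[OF cut.prems(1)] by blast
  from image_mset_eq_plusD[OF F(2)] obtain F'' G'' where F': "F' = F'' + G''" "F1 = strip F''" "G1 = strip G''"
    by blast
  from F(3) obtain i' t' s' where c': "c' = Cut i' s' A t'"
    "map_tree (\<lambda>_. ()) (\<lambda>x. x) t' = t" "map_tree (\<lambda>_. ()) (\<lambda>x. x) s' = s"
    by (auto simp: rename_Cut)
  have v: "tree_vars t = tree_vars t'" "tree_vars s = tree_vars s'" using c' by auto
  have w: "width s' = width s" using c'(3) width_map by metis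
  show ?case unfolding F(1) F'(1) c'(1)
  proof (rule nd.cut[of r n b F'' s' A c G''])
    show "nd r n b (F'' + {#Tree s' A#})" by (rule cut.IH(1)) (use F F' c' cut.prems in auto)
    show "nd r n c (G'' + {#Tree t' (dual A)#})" by (rule cut.IH(2)) (use F F' c' cut.prems in auto)
    show "forest_vars (F'' + {#Tree s' A#}) \<inter> forest_vars (G'' + {#Tree t' (dual A)#}) = {}"
      using cut.hyps(4) F' v by simp
    show "(b \<or> c) \<and> (rank A = r \<longrightarrow> 2 \<le> width s') \<or> rank A = r \<and> width s' = n \<and> lacks_rank r G''" if e
      using cut.hyps(5)[OF that] F'(3) w by simp
  qed (use cut.hyps(3) cut.prems F F' c' in auto)
qed

subsection \<open>Distinct names exist\<close>

lemma finite_names: "finite (node_name ` set_mset M)"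
  by simp

lemma names_exist:
  fixes t :: "(unit, 'v) tree" and w :: "(unit, 'v) wit"
  shows "finite N \<Longrightarrow> \<exists>t' :: (nat, 'v) tree. map_tree (\<lambda>_. ()) (\<lambda>x. x) t' = t \<and> distinct_names (tree_nodes t') \<and>
      node_name ` set_mset (tree_nodes t') \<inter> N = {}"
    and "finite N \<Longrightarrow> \<exists>w' :: (nat, 'v) wit. map_wit (\<lambda>_. ()) (\<lambda>x. x) w' = w \<and> distinct_names (wit_nodes w') \<and>
      node_name ` set_mset (wit_nodes w') \<inter> N = {}"
proof (induction t and w arbitrary: N and N)
  case (Unit i)
  then obtain j where "j \<notin> N" using fresh_nat by blast
  then show ?case by (intro exI[of _ "Unit j"]) auto
next
  case (Exp i ws)
  obtain j where j: "j \<notin> N" using fresh_nat[OF Exp.prems] by blast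
  have "\<exists>vs' :: (nat, 'v) wit multiset. image_mset (map_wit (\<lambda>_. ()) (\<lambda>x. x)) vs' = vs \<and>
      distinct_names (\<Sum>\<^sub># (image_mset wit_nodes vs')) \<and>
      node_name ` set_mset (\<Sum>\<^sub># (image_mset wit_nodes vs')) \<inter> insert j N = {}" if "vs \<subseteq># ws" for vs
    using that
  proof (induction vs)
    case empty
    show ?case by (intro exI[of _ "{#}"]) auto
  next
    case (add v vs)
    then have "v \<in># ws" "vs \<subseteq># ws" by (auto dest: mset_subset_eq_insertD)
    with add obtain vs' :: "(nat, 'v) wit multiset" where vs': "image_mset (map_wit (\<lambda>_. ()) (\<lambda>x. x)) vs' = vs"
      "distinct_names (\<Sum>\<^sub># (image_mset wit_nodes vs'))"
      "node_name ` set_mset (\<Sum>\<^sub># (image_mset wit_nodes vs')) \<inter> insert j N = {}" by blast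
    obtain v' :: "(nat, 'v) wit" where "map_wit (\<lambda>_. ()) (\<lambda>x. x) v' = v" "distinct_names (wit_nodes v')"
      "node_name ` set_mset (wit_nodes v') \<inter>
       (insert j N \<union> node_name ` set_mset (\<Sum>\<^sub># (image_mset wit_nodes vs'))) = {}"
      using Exp.IH[OF \<open>v \<in># ws\<close>, of "insert j N \<union> node_name ` set_mset (\<Sum>\<^sub># (image_mset wit_nodes vs'))"]
        Exp.prems by auto
    with vs' show ?case by (intro exI[of _ "add_mset v' vs'"])
      (simp add: image_Un Int_Un_distrib Int_Un_distrib2 Int_commute)
  qed
  from this[of ws] obtain ws' :: "(nat, 'v) wit multiset" where "image_mset (map_wit (\<lambda>_. ()) (\<lambda>x. x)) ws' = ws"
    "distinct_names (\<Sum>\<^sub># (image_mset wit_nodes ws'))"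
    "node_name ` set_mset (\<Sum>\<^sub># (image_mset wit_nodes ws')) \<inter> insert j N = {}" by blast
  with j show ?case by (intro exI[of _ "Exp j ws'"]) (auto)
next
  case (Vee i t s)
  obtain j where j: "j \<notin> N" using fresh_nat[OF Vee.prems] by blast
  obtain t' :: "(nat, 'v) tree" where t': "map_tree (\<lambda>_. ()) (\<lambda>x. x) t' = t" "distinct_names (tree_nodes t')"
    "node_name ` set_mset (tree_nodes t') \<inter> insert j N = {}"
    using Vee.IH(1)[of "insert j N"] Vee.prems by auto
  obtain s' :: "(nat, 'v) tree" where s': "map_tree (\<lambda>_. ()) (\<lambda>x. x) s' = s" "distinct_names (tree_nodes s')"
    "node_name ` set_mset (tree_nodes s') \<inter> (insert j N \<union> node_name ` set_mset (tree_nodes t')) = {}"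
    using Vee.IH(2)[of "insert j N \<union> node_name ` set_mset (tree_nodes t')"] Vee.prems by auto
  show ?case using j t' s' by (intro exI[of _ "Vee j t' s'"]) auto
next
  case (VeeL i t k)
  obtain j where j: "j \<notin> N" using fresh_nat[OF VeeL.prems] by blast
  obtain k' where k': "k' \<notin> insert j N" using fresh_nat[of "insert j N"] VeeL.prems by auto
  obtain t' :: "(nat, 'v) tree" where t': "map_tree (\<lambda>_. ()) (\<lambda>x. x) t' = t" "distinct_names (tree_nodes t')"
    "node_name ` set_mset (tree_nodes t') \<inter> insert k' (insert j N) = {}"
    using VeeL.IH[of "insert k' (insert j N)"] VeeL.prems by auto
  show ?case using j k' t' by (intro exI[of _ "VeeL j t' k'"]) auto
next
  case (VeeR i k t)
  obtain j where j: "j \<notin> N" using fresh_nat[OF VeeR.prems] by blast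
  obtain k' where k': "k' \<notin> insert j N" using fresh_nat[of "insert j N"] VeeR.prems by auto
  obtain t' :: "(nat, 'v) tree" where t': "map_tree (\<lambda>_. ()) (\<lambda>x. x) t' = t" "distinct_names (tree_nodes t')"
    "node_name ` set_mset (tree_nodes t') \<inter> insert k' (insert j N) = {}"
    using VeeR.IH[of "insert k' (insert j N)"] VeeR.prems by auto
  show ?case using j k' t' by (intro exI[of _ "VeeR j k' t'"]) auto
next
  case (Wire i x)
  then obtain j where "j \<notin> N" using fresh_nat by blast
  then show ?case by (intro exI[of _ "Wire j x"]) (auto simp: wire.map_ident)
next
  case (Tensor i t s)
  obtain j where j: "j \<notin> N" using fresh_nat[OF Tensor.prems] by blast
  obtain t' :: "(nat, 'v) tree" where t': "map_tree (\<lambda>_. ()) (\<lambda>x. x) t' = t" "distinct_names (tree_nodes t')"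
    "node_name ` set_mset (tree_nodes t') \<inter> insert j N = {}"
    using Tensor.IH(1)[of "insert j N"] Tensor.prems by auto
  obtain s' :: "(nat, 'v) tree" where s': "map_tree (\<lambda>_. ()) (\<lambda>x. x) s' = s" "distinct_names (tree_nodes s')"
    "node_name ` set_mset (tree_nodes s') \<inter> (insert j N \<union> node_name ` set_mset (tree_nodes t')) = {}"
    using Tensor.IH(2)[of "insert j N \<union> node_name ` set_mset (tree_nodes t')"] Tensor.prems by auto
  show ?case using j t' s' by (intro exI[of _ "Tensor j t' s'"]) auto
qed

lemma root_names_exist:
  fixes c :: "('p, unit, 'v) root"
  assumes "finite N"
  shows "\<exists>c' :: ('p, nat, 'v) root. rename (\<lambda>_. ()) (\<lambda>x. x) c' = c \<and> distinct_names (root_nodes c') \<and>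
      node_name ` set_mset (root_nodes c') \<inter> N = {}"
proof (cases c)
  case (Tree t A)
  from names_exist(1)[OF assms, of t] obtain t' :: "(nat, 'v) tree" where
    "map_tree (\<lambda>_. ()) (\<lambda>x. x) t' = t" "distinct_names (tree_nodes t')"
    "node_name ` set_mset (tree_nodes t') \<inter> N = {}" by blast
  with Tree show ?thesis by (intro exI[of _ "Tree t' A"]) auto
next
  case (Wit w A)
  from names_exist(2)[OF assms, of w] obtain w' :: "(nat, 'v) wit" where
    "map_wit (\<lambda>_. ()) (\<lambda>x. x) w' = w" "distinct_names (wit_nodes w')"
    "node_name ` set_mset (wit_nodes w') \<inter> N = {}" by blast
  with Wit show ?thesis by (intro exI[of _ "Wit w' A"]) auto
next
  case (Cut i t A s)
  \<comment> \<open>The two sides of the cut are named like the two factors of a tensor.\<close>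
  from names_exist(2)[OF assms, of "Tensor () t s"] obtain w' :: "(nat, 'v) wit" where
    w': "map_wit (\<lambda>_. ()) (\<lambda>x. x) w' = Tensor () t s" "distinct_names (wit_nodes w')"
    "node_name ` set_mset (wit_nodes w') \<inter> N = {}" by blast
  then obtain j t' s' where "w' = Tensor j t' s'" "map_tree (\<lambda>_. ()) (\<lambda>x. x) t' = t" "map_tree (\<lambda>_. ()) (\<lambda>x. x) s' = s"
    by (auto simp: map_tree_eqs)
  with w' Cut show ?thesis by (intro exI[of _ "Cut j t' A s'"]) auto
qed

lemma naming_exists:
  fixes F :: "('p, unit, 'v) gen_forest"
  shows "\<exists>G :: ('p, nat, 'v) gen_forest. strip G = F \<and> distinctly_named G"
proof (induction F)
  case (add c F)
  then obtain G :: "('p, nat, 'v) gen_forest" where G: "strip G = F" "distinctly_named G" by blast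
  from root_names_exist[OF finite_node_set[of G], of c] obtain c' :: "('p, nat, 'v) root" where
    "rename (\<lambda>_. ()) (\<lambda>x. x) c' = c" "distinct_names (root_nodes c')"
    "node_name ` set_mset (root_nodes c') \<inter> node_set G = {}" by blast
  with G show ?case by (intro exI[of _ "add_mset c' G"]) auto
qed auto

section \<open>Correctness of derivable forests\<close>

subsection \<open>Derivable forests are AC-correct\<close>

lemma chosen_edges_switched: "is_switched n \<Longrightarrow> \<sigma> (node_name n) \<in> succs n \<Longrightarrow>
    chosen_edges n \<sigma> = {(node_name n, \<sigma> (node_name n))}"
  by (auto simp: chosen_edges_def)

lemma chosen_edges_unswitched: "\<not> is_switched n \<Longrightarrow> chosen_edges n \<sigma> = {node_name n} \<times> succs n"
  by (auto simp: chosen_edges_def)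

lemma is_switched_simps [simp]:
  "is_switched (Node i LUnit S) = False" "is_switched (Node i LExp S) = True"
  "is_switched (Node i LVee S) = True" "is_switched (Node i LWeak S) = False"
  "is_switched (Node i LStar S) = False" "is_switched (Node i (LWire x) S) = False"
  "is_switched (Node i LTensor S) = False" "is_switched (Node i LCut S) = False"
  by (auto simp: is_switched_def)

lemma sgraph_empty [simp]: "sgraph {} \<sigma> = {}"
  by (simp add: sgraph_def link_edges_def)

lemma sgraph_cong: "(\<And>n. n \<in> N \<Longrightarrow> \<sigma> (node_name n) = \<tau> (node_name n)) \<Longrightarrow> sgraph N \<sigma> = sgraph N \<tau>"
  by (simp add: sgraph_def chosen_edges_def)

lemma sgraph_closed:
  assumes "\<And>n. n \<in> N \<Longrightarrow> node_name n \<in> W \<and> succs n \<subseteq> W"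
  shows "sgraph N \<sigma> \<subseteq> W \<times> W"
proof -
  have "chosen_edges n \<sigma> \<subseteq> W \<times> W" if "n \<in> N" for n
    using assms[OF that] by (auto simp: chosen_edges_def)
  moreover have "link_edges N \<subseteq> W \<times> W" using assms by (auto simp: link_edges_def)
  ultimately show ?thesis unfolding sgraph_def by blast
qed

lemma switches_subset: "switches M \<sigma> \<Longrightarrow> N \<subseteq> M \<Longrightarrow> switches N \<sigma>"
  by (auto simp: switches_def)

lemma acyclic_graph_disjoint:
  assumes "acyclic_graph E" "acyclic_graph E'" "E \<subseteq> V \<times> V" "E' \<subseteq> V' \<times> V'" "V \<inter> V' = {}"
  shows "acyclic_graph (E \<union> E')"
proof (cases "E = {} \<or> E' = {}")
  case False
  then obtain a b where "a \<in> V" "b \<in> V'" using assms(3,4) by fast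
  from acyclic_graph_bridge[OF assms this] show ?thesis by (rule acyclic_graph_subset) auto
qed (use assms in auto)

lemma tname_node_set: "Tree t A \<in># F \<Longrightarrow> tname t \<in> node_set F"
  using name_in_nodes(1)[of t] by (auto dest: multi_member_split)

lemma contraction_core:
  assumes named: "distinctly_named (F + {#Tree (Exp k ws) C, Tree (Exp j vs) C#})"
  defines "K \<equiv> nodes F \<union> set_mset (\<Sum>\<^sub># (image_mset wit_nodes (ws + vs)))"
  shows "\<And>n. n \<in> K \<Longrightarrow> node_name n \<in> node_name ` K \<and> succs n \<subseteq> node_name ` K"
    and "k \<notin> node_name ` K" "j \<notin> node_name ` K"
    and "nodes (F + {#Tree (Exp k ws) C, Tree (Exp j vs) C#}) =
      K \<union> {Node k LExp (wname ` set_mset ws), Node j LExp (wname ` set_mset vs)}"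
    and "nodes (F + {#Tree (Exp k (ws + vs)) C#}) = K \<union> {Node k LExp (wname ` set_mset (ws + vs))}"
proof -
  let ?P = "F + {#Tree (Exp k ws) C, Tree (Exp j vs) C#}"
  show P: "nodes ?P = K \<union> {Node k LExp (wname ` set_mset ws), Node j LExp (wname ` set_mset vs)}"
    unfolding K_def by (simp add: Un_ac insert_commute)
  show "nodes (F + {#Tree (Exp k (ws + vs)) C#}) = K \<union> {Node k LExp (wname ` set_mset (ws + vs))}"
    unfolding K_def by (simp add: Un_ac insert_commute)
  have K': "node_name ` K = node_set F \<union> node_name ` set_mset (\<Sum>\<^sub># (image_mset wit_nodes ws))
      \<union> node_name ` set_mset (\<Sum>\<^sub># (image_mset wit_nodes vs))"
    by (simp add: K_def node_set_def image_Un Un_assoc)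
  show k: "k \<notin> node_name ` K" and j: "j \<notin> node_name ` K"
    using named unfolding K' by simp_all
  fix n assume n: "n \<in> K"
  have "u \<in> node_name ` K" if "u \<in> succs n" for u
  proof -
    have "n \<in> nodes ?P" using n unfolding P by blast
    then have e: "(node_name n, u) \<in> succ_edges ?P" using that unfolding succ_edges_def by blast
    have "u \<noteq> k"
    proof
      assume "u = k"
      with root_no_predecessor[OF named, of "Tree (Exp k ws) C" "node_name n"] e show False by simp
    qed
    moreover have "u \<noteq> j"
    proof
      assume "u = j"
      with root_no_predecessor[OF named, of "Tree (Exp j vs) C" "node_name n"] e show False by simp
    qed
    moreover have "u \<in> node_name ` nodes ?P"
      using succ_edge_nodes[OF named e] unfolding node_set_def by blast
    ultimately show ?thesis unfolding P by (simp add: image_Un)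
  qed
  with n show "node_name n \<in> node_name ` K \<and> succs n \<subseteq> node_name ` K" by blast
qed

lemma nd_acyc:
  fixes F :: "('p, 'i, 'v) gen_forest"
  shows "nd r n e F \<Longrightarrow> acyc (nodes F)"
proof (induction rule: nd.induct)
  case (unit i)
  have "sgraph {Node i LUnit {} :: ('i, 'v) node} \<sigma> = {}" for \<sigma> :: "'i \<Rightarrow> 'i"
    by (subst sgraph_insert) (auto simp: chosen_edges_def)
  then show ?case by (simp add: acyc_def)
next
  case (axiom i j x p k l)
  let ?N = "nodes {#Tree (Exp i {#Wire j (Xbar x)#}) (Neg p) :: ('p, 'i, 'v) root, Tree (Exp k {#Wire l (X x)#}) (Pos p)#}"
  have d: "i \<noteq> j" "i \<noteq> k" "i \<noteq> l" "j \<noteq> k" "j \<noteq> l" "k \<noteq> l" using axiom by auto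
  let ?E = "{} \<union> {(j, l), (l, j)}" let ?E' = "?E \<union> {(j, i), (i, j)}" let ?E'' = "?E' \<union> {(l, k), (k, l)}"
  have "acyclic_graph ?E" by (rule acyclic_graph_pendant[of _ "{}"]) (use d in auto)
  then have "acyclic_graph ?E'" by (rule acyclic_graph_pendant[of _ "{j, l}"]) (use d in auto)
  then have ac: "acyclic_graph ?E''" by (rule acyclic_graph_pendant[of _ "{i, j, l}"]) (use d in auto)
  let ?W = "{Node j (LWire (Xbar x)) {}, Node l (LWire (X x)) {}} :: ('i, 'v) node set"
  have N: "?N = insert (Node i LExp {j}) (insert (Node k LExp {l}) ?W)" by auto
  have "sgraph ?W \<sigma> \<subseteq> {(j, l), (l, j)}" for \<sigma>
    by (auto simp: sgraph_def chosen_edges_def link_edges_def)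
  then have "sgraph ?N \<sigma> \<subseteq> ?E''" for \<sigma>
    unfolding N by (simp add: sgraph_insert) (auto simp: chosen_edges_def)
  then show ?case using acyclic_graph_subset[OF ac] by (auto simp: acyc_def)
next
  case (mix b F c G e)
  have u: "unlinked (nodes F) (nodes G)" using mix.hyps(3) by (rule unlinked_forests)
  have d: "distinctly_named F" "distinctly_named G" "node_set F \<inter> node_set G = {}"
    using mix.hyps(5) by auto
  show ?case unfolding acyc_def
  proof (intro allI impI)
    fix \<sigma> assume s: "switches (nodes (F + G)) \<sigma>"
    have "acyclic_graph (sgraph (nodes F) \<sigma>)" "acyclic_graph (sgraph (nodes G) \<sigma>)"
      using mix.IH switches_subset[OF s] by (auto simp: acyc_def)
    then have "acyclic_graph (sgraph (nodes F) \<sigma> \<union> sgraph (nodes G) \<sigma>)"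
      by (rule acyclic_graph_disjoint[OF _ _ sgraph_nodes[OF d(1)] sgraph_nodes[OF d(2)] d(3)])
    then show "acyclic_graph (sgraph (nodes (F + G)) \<sigma>)" using sgraph_union[OF u] by simp
  qed
next
  case (un e F P c)
  show ?case unfolding acyc_def
  proof (intro allI impI)
    fix \<sigma> assume s: "switches (nodes (F + {#c#})) \<sigma>"
    have V: "sgraph (nodes (F + P)) \<sigma> \<subseteq> node_set (F + P) \<times> node_set (F + P)"
      using un.hyps(3) by (rule sgraph_nodes)
    from un.hyps(2) show "acyclic_graph (sgraph (nodes (F + {#c#})) \<sigma>)"
    proof cases
      case (vee t A s' B i)
      let ?n = "Node i LVee {tname t, tname s'} :: ('i, 'v) node"
      have N: "nodes (F + {#c#}) = insert ?n (nodes (F + P))" unfolding vee by auto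
      have "\<sigma> i \<in> {tname t, tname s'}" using s unfolding N by (auto simp: switches_def)
      moreover have "{tname t, tname s'} \<subseteq> node_set (F + P)"
        using tname_node_set[of t A "F + P"] tname_node_set[of s' B "F + P"] vee by simp
      moreover have "i \<notin> node_set (F + P)" using un.hyps(4) unfolding vee by (auto simp: node_set_def)
      moreover have "acyclic_graph (sgraph (nodes (F + P)) \<sigma>)"
        using un.IH[unfolded acyc_def, rule_format, of \<sigma>] switches_subset[OF s, of "nodes (F + P)"] N by auto
      ultimately have "acyclic_graph (sgraph (nodes (F + P)) \<sigma> \<union> {(\<sigma> i, i), (i, \<sigma> i)})"
        by (intro acyclic_graph_pendant[of _ "node_set (F + P)"] V) auto
      then show ?thesis unfolding N
        by (rule acyclic_graph_subset) (use \<open>\<sigma> i \<in> _\<close> in \<open>simp add: sgraph_insert chosen_edges_switched, auto\<close>)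
    next
      case (veeL t A i j B)
      let ?n = "Node i LWeak {tname t, j} :: ('i, 'v) node" and ?m = "Node j LStar {} :: ('i, 'v) node"
      have N: "nodes (F + {#c#}) = insert ?n (insert ?m (nodes (F + P)))" unfolding veeL by auto
      have t: "tname t \<in> node_set (F + P)" using tname_node_set[of t A "F + P"] veeL by simp
      have ij: "i \<notin> node_set (F + P)" "j \<notin> node_set (F + P)" "i \<noteq> j"
        using un.hyps(4) unfolding veeL by (auto simp: node_set_def)
      have "acyclic_graph (sgraph (nodes (F + P)) \<sigma>)"
        using un.IH[unfolded acyc_def, rule_format, of \<sigma>] switches_subset[OF s, of "nodes (F + P)"] N by auto
      then have "acyclic_graph (sgraph (nodes (F + P)) \<sigma> \<union> {(tname t, i), (i, tname t)})"
        by (rule acyclic_graph_pendant[OF _ V ij(1)]) (use t ij in auto)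
      then have "acyclic_graph (sgraph (nodes (F + P)) \<sigma> \<union> {(tname t, i), (i, tname t)} \<union> {(i, j), (j, i)})"
        by (rule acyclic_graph_pendant[of _ "insert i (node_set (F + P))"]) (use V t ij in auto)
      then show ?thesis unfolding N
        by (rule acyclic_graph_subset) (simp add: sgraph_insert chosen_edges_unswitched, auto)
    next
      case (veeR t A i j B)
      let ?n = "Node i LWeak {j, tname t} :: ('i, 'v) node" and ?m = "Node j LStar {} :: ('i, 'v) node"
      have N: "nodes (F + {#c#}) = insert ?n (insert ?m (nodes (F + P)))" unfolding veeR by auto
      have t: "tname t \<in> node_set (F + P)" using tname_node_set[of t A "F + P"] veeR by simp
      have ij: "i \<notin> node_set (F + P)" "j \<notin> node_set (F + P)" "i \<noteq> j"
        using un.hyps(4) unfolding veeR by (auto simp: node_set_def)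
      have "acyclic_graph (sgraph (nodes (F + P)) \<sigma>)"
        using un.IH[unfolded acyc_def, rule_format, of \<sigma>] switches_subset[OF s, of "nodes (F + P)"] N by auto
      then have "acyclic_graph (sgraph (nodes (F + P)) \<sigma> \<union> {(tname t, i), (i, tname t)})"
        by (rule acyclic_graph_pendant[OF _ V ij(1)]) (use t ij in auto)
      then have "acyclic_graph (sgraph (nodes (F + P)) \<sigma> \<union> {(tname t, i), (i, tname t)} \<union> {(i, j), (j, i)})"
        by (rule acyclic_graph_pendant[of _ "insert i (node_set (F + P))"]) (use V t ij in auto)
      then show ?thesis unfolding N
        by (rule acyclic_graph_subset) (simp add: sgraph_insert chosen_edges_unswitched, auto)
    next
      case (contraction ws vs k T j)
      define K where "K = nodes F \<union> set_mset (\<Sum>\<^sub># (image_mset wit_nodes (ws + vs)))"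
      note core = contraction_core[OF un.hyps(3)[unfolded contraction(1)], folded K_def]
      let ?n = "Node k LExp (wname ` set_mset (ws + vs)) :: ('i, 'v) node"
      have N: "nodes (F + {#c#}) = insert ?n K" unfolding contraction(2) core(5) by simp
      obtain w v where wv: "w \<in># ws" "v \<in># vs" using contraction by fast
      define \<tau> where "\<tau> = \<sigma>(k := wname w, j := wname v)"
      have "k \<noteq> j" using un.hyps(3) unfolding contraction by auto
      have eq: "sgraph K \<sigma> = sgraph K \<tau>"
        by (rule sgraph_cong) (use core(2,3) in \<open>auto simp: \<tau>_def\<close>)
      have "switches (nodes (F + P)) \<tau>" unfolding contraction(1) core(4) switches_def
      proof
        fix n assume "n \<in> K \<union> {Node k LExp (wname ` set_mset ws), Node j LExp (wname ` set_mset vs)}"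
        then consider "n \<in> K" | "n = Node k LExp (wname ` set_mset ws)" | "n = Node j LExp (wname ` set_mset vs)"
          by blast
        then show "is_switched n \<longrightarrow> \<tau> (node_name n) \<in> succs n"
        proof cases
          case 1
          then have "node_name n \<noteq> k" "node_name n \<noteq> j" using core(2,3) by auto
          with 1 s show ?thesis unfolding N by (auto simp: switches_def \<tau>_def)
        qed (use wv \<open>k \<noteq> j\<close> in \<open>auto simp: \<tau>_def\<close>)
      qed
      then have "acyclic_graph (sgraph (nodes (F + P)) \<tau>)" using un.IH by (simp add: acyc_def)
      moreover have "sgraph K \<tau> \<subseteq> sgraph (nodes (F + P)) \<tau>"
        unfolding contraction(1) core(4) by (rule sgraph_mono) auto
      ultimately have acK: "acyclic_graph (sgraph K \<sigma>)" unfolding eq by (rule acyclic_graph_subset)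
      have sk: "\<sigma> k \<in> wname ` set_mset (ws + vs)" using s unfolding N by (auto simp: switches_def)
      have "wname ` set_mset (ws + vs) \<subseteq> node_name ` K"
      proof
        fix u assume "u \<in> wname ` set_mset (ws + vs)"
        then obtain w where w: "w \<in># ws + vs" "u = wname w" by blast
        then have "set_mset (wit_nodes w) \<subseteq> K" unfolding K_def by auto
        with name_in_nodes(2)[of w] w(2) show "u \<in> node_name ` K" by blast
      qed
      from subsetD[OF this sk] have "k \<noteq> \<sigma> k" using core(2) by (cases "k = \<sigma> k") simp_all
      from acyclic_graph_pendant[OF acK sgraph_closed[OF core(1), of K \<sigma>] core(2) this]
      have "acyclic_graph (sgraph K \<sigma> \<union> {(\<sigma> k, k), (k, \<sigma> k)})" by blast
      then show ?thesis unfolding N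
        by (rule acyclic_graph_subset) (use sk in \<open>simp add: sgraph_insert chosen_edges_switched, auto\<close>)
    qed
  qed
next
  case (tensor b F t A c G s B e i j)
  let ?F = "F + {#Tree t A#}" and ?G = "G + {#Tree s B#}"
  have u: "unlinked (nodes ?F) (nodes ?G)" using tensor.hyps(3) by (rule unlinked_forests)
  have d: "distinctly_named ?F" "distinctly_named ?G" "node_set ?F \<inter> node_set ?G = {}"
    and ij: "i \<noteq> j" "i \<notin> node_set ?F" "i \<notin> node_set ?G" "j \<notin> node_set ?F" "j \<notin> node_set ?G"
    using tensor.hyps(5) by (auto simp: node_set_def)
  show ?case unfolding acyc_def
  proof (intro allI impI)
    fix \<sigma> assume sw: "switches (nodes (F + G + {#Tree (Exp i {#Tensor j t s#}) (Conj A B)#})) \<sigma>"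
    have N: "nodes (F + G + {#Tree (Exp i {#Tensor j t s#}) (Conj A B)#}) =
      insert (Node i LExp {j}) (insert (Node j LTensor {tname t, tname s}) (nodes ?F \<union> nodes ?G))"
      by auto
    have ac: "acyclic_graph (sgraph (nodes ?F) \<sigma>)" "acyclic_graph (sgraph (nodes ?G) \<sigma>)"
      using tensor.IH switches_subset[OF sw] unfolding N by (auto simp: acyc_def)
    have V: "sgraph (nodes ?F) \<sigma> \<subseteq> node_set ?F \<times> node_set ?F" "sgraph (nodes ?G) \<sigma> \<subseteq> node_set ?G \<times> node_set ?G"
      by (rule sgraph_nodes[OF d(1)], rule sgraph_nodes[OF d(2)])
    have ts: "tname t \<in> node_set ?F" "tname s \<in> node_set ?G"
      using tname_node_set[of t A ?F] tname_node_set[of s B ?G] by simp_all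
    have "acyclic_graph (sgraph (nodes ?F) \<sigma> \<union> {(tname t, j), (j, tname t)})"
      by (rule acyclic_graph_pendant[OF ac(1) V(1) ij(4)]) (use ts ij in auto)
    then have "acyclic_graph ((sgraph (nodes ?F) \<sigma> \<union> {(tname t, j), (j, tname t)}) \<union> {(j, i), (i, j)})"
      by (rule acyclic_graph_pendant[of _ "insert j (node_set ?F)"]) (use V ts ij in auto)
    from acyclic_graph_bridge[OF this ac(2), of "insert i (insert j (node_set ?F))" "node_set ?G" j "tname s"]
    have "acyclic_graph ((sgraph (nodes ?F) \<sigma> \<union> {(tname t, j), (j, tname t)}) \<union> {(j, i), (i, j)} \<union>
        sgraph (nodes ?G) \<sigma> \<union> {(j, tname s), (tname s, j)})"
      using V ts ij d(3) by auto
    then show "acyclic_graph (sgraph (nodes (F + G + {#Tree (Exp i {#Tensor j t s#}) (Conj A B)#})) \<sigma>)"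
      unfolding N
      by (rule acyclic_graph_subset) (simp add: sgraph_insert sgraph_union[OF u, simplified] chosen_edges_def, auto)
  qed
next
  case (cut b F s A c G t e i)
  let ?F = "F + {#Tree s A#}" and ?G = "G + {#Tree t (dual A)#}"
  have u: "unlinked (nodes ?F) (nodes ?G)" using cut.hyps(4) by (rule unlinked_forests)
  have d: "distinctly_named ?F" "distinctly_named ?G" "node_set ?F \<inter> node_set ?G = {}"
    and i: "i \<notin> node_set ?F" "i \<notin> node_set ?G"
    using cut.hyps(6) by (auto simp: node_set_def)
  show ?case unfolding acyc_def
  proof (intro allI impI)
    fix \<sigma> assume sw: "switches (nodes (F + G + {#Cut i s A t#})) \<sigma>"
    have N: "nodes (F + G + {#Cut i s A t#}) = insert (Node i LCut {tname s, tname t}) (nodes ?F \<union> nodes ?G)"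
      by auto
    have ac: "acyclic_graph (sgraph (nodes ?F) \<sigma>)" "acyclic_graph (sgraph (nodes ?G) \<sigma>)"
      using cut.IH switches_subset[OF sw] unfolding N by (auto simp: acyc_def)
    have V: "sgraph (nodes ?F) \<sigma> \<subseteq> node_set ?F \<times> node_set ?F" "sgraph (nodes ?G) \<sigma> \<subseteq> node_set ?G \<times> node_set ?G"
      by (rule sgraph_nodes[OF d(1)], rule sgraph_nodes[OF d(2)])
    have ts: "tname s \<in> node_set ?F" "tname t \<in> node_set ?G"
      using tname_node_set[of s A ?F] tname_node_set[of t "dual A" ?G] by simp_all
    have "acyclic_graph (sgraph (nodes ?F) \<sigma> \<union> {(tname s, i), (i, tname s)})"
      by (rule acyclic_graph_pendant[OF ac(1) V(1) i(1)]) (use ts i in auto)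
    from acyclic_graph_bridge[OF this ac(2), of "insert i (node_set ?F)" "node_set ?G" i "tname t"]
    have "acyclic_graph ((sgraph (nodes ?F) \<sigma> \<union> {(tname s, i), (i, tname s)}) \<union>
        sgraph (nodes ?G) \<sigma> \<union> {(i, tname t), (tname t, i)})"
      using V ts i d(3) by auto
    then show "acyclic_graph (sgraph (nodes (F + G + {#Cut i s A t#})) \<sigma>)"
      unfolding N
      by (rule acyclic_graph_subset) (simp add: sgraph_insert sgraph_union[OF u, simplified] chosen_edges_def, auto)
  qed
qed

text \<open>
  Each rule adds a node that joins disjoint graphs by single edges, or a switched node of which one edge is chosen; neither closes a cycle.
\<close>

lemma nd_AC: "nd r n e F \<Longrightarrow> AC F"
  using AC_acyc[OF nd_named] nd_acyc by blast

section \<open>Following a subnet down a derivation\<close>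

subsection \<open>Subnets of premises are subnets of the conclusion\<close>

lemma first_change: "Q 0 \<Longrightarrow> \<not> Q k \<Longrightarrow> \<exists>i<k. Q i \<and> \<not> Q (Suc i)" for k :: nat
proof (induction k)
  case (Suc k)
  then show ?case by (cases "Q k") (auto intro: less_SucI)
qed simp

text \<open>A path that left \<open>W\<close> through its only boundary node could not come back.\<close>

lemma path_stays:
  assumes p: "path E p" "hd p \<in> W" "last p \<in> W"
    and sym: "\<And>a b. (a, b) \<in> E \<Longrightarrow> (b, a) \<in> E"
    and boundary: "\<And>a b. (a, b) \<in> E \<Longrightarrow> a \<in> W \<Longrightarrow> b \<notin> W \<Longrightarrow> a = e"
  shows "set p \<subseteq> W"
proof (rule ccontr)
  assume "\<not> set p \<subseteq> W"
  then obtain k where k: "k < length p" "p ! k \<notin> W" by (metis in_set_conv_nth subsetI)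
  have ne: "p \<noteq> []" and d: "distinct p" using p(1) by (auto simp: path_def)
  have edge: "(p ! i, p ! Suc i) \<in> E" if "Suc i < length p" for i
    using p(1) that by (simp add: path_def successively_conv_nth)
  have "p ! 0 \<in> W" using p(2) ne by (simp add: hd_conv_nth)
  then obtain i where i: "i < k" "p ! i \<in> W" "p ! Suc i \<notin> W"
    using first_change[of "\<lambda>i. p ! i \<in> W" k] k(2) by blast
  have last: "p ! (length p - 1) \<in> W" using p(3) ne by (simp add: last_conv_nth)
  have "\<exists>j<length p - 1 - k. p ! (k + j) \<notin> W \<and> \<not> p ! (k + Suc j) \<notin> W"
    using first_change[of "\<lambda>j. p ! (k + j) \<notin> W" "length p - 1 - k"] k last by simp
  then obtain j where j: "j < length p - 1 - k" "p ! (k + j) \<notin> W" "p ! Suc (k + j) \<in> W" by auto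
  have "p ! i = e" using boundary[OF edge i(2,3)] i(1) k(1) by simp
  moreover have "p ! Suc (k + j) = e" using boundary[OF sym[OF edge] j(3,2)] j(1) by simp
  moreover have "i < length p" "Suc (k + j) < length p" using i(1) j(1) k(1) by linarith+
  ultimately have "i = Suc (k + j)" using d nth_eq_iff_index_eq[of p i "Suc (k + j)"] by simp
  with i(1) show False by simp
qed

lemma path_within:
  assumes "path E p" "hd p \<in> V" "E \<subseteq> V \<times> V"
  shows "set p \<subseteq> V"
proof
  fix x assume "x \<in> set p"
  then obtain i where i: "i < length p" "x = p ! i" by (metis in_set_conv_nth)
  have ne: "p \<noteq> []" using assms(1) by (simp add: path_def)
  show "x \<in> V"
  proof (cases i)
    case 0
    with i assms(2) ne show ?thesis by (simp add: hd_conv_nth)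
  next
    case (Suc k)
    with i assms(1) have "(p ! k, p ! i) \<in> E" by (simp add: path_def successively_conv_nth)
    with assms(3) i show ?thesis by auto
  qed
qed

lemma axiom_links_nodes: "axiom_links F = link_edges (nodes F)"
  by (auto simp: axiom_links_def labelled_def link_edges_def)

lemma subnet_track:
  fixes F P :: "('p, 'i, 'v) gen_forest"
  assumes named: "distinctly_named F" "distinctly_named P"
    and F: "nodes F = K \<union> Y" and P: "nodes P = K \<union> Z"
    and W: "W = node_name ` K"
    and closed: "\<And>n. n \<in> K \<Longrightarrow> succs n \<subseteq> W"
    and Y: "\<And>y. y \<in> Y \<Longrightarrow> node_name y \<notin> W" and Z: "\<And>z. z \<in> Z \<Longrightarrow> node_name z \<notin> W"
    and unl: "unlinked K Y"
    and Zne: "\<And>z. z \<in> Z \<Longrightarrow> is_switched z \<Longrightarrow> succs z \<noteq> {}"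
    and boundary: "\<And>\<sigma>. \<exists>e. \<forall>y\<in>Y. \<forall>a\<in>succs y \<inter> W. (is_switched y \<longrightarrow> a = \<sigma> (node_name y)) \<longrightarrow> a = e"
    and star: "\<And>n y. n \<in> K \<Longrightarrow> node_label n = LStar \<Longrightarrow> y \<in> Y \<Longrightarrow> node_name n \<notin> succs y"
    and E: "subnet P E" "E \<subseteq> W"
  shows "subnet F E \<and> roots F E = roots P E"
proof
  have in_K: "n \<in> K" if "n \<in> nodes F \<or> n \<in> nodes P" "node_name n \<in> W" for n
    using that F P Y Z by blast
  have edges: "(i, j) \<in> succ_edges F \<longleftrightarrow> (i, j) \<in> succ_edges P" if "i \<in> W" for i j
  proof -
    have "(\<exists>n\<in>nodes G. node_name n = i \<and> j \<in> succs n) \<longleftrightarrow> (\<exists>n\<in>K. node_name n = i \<and> j \<in> succs n)"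
      if "G = F \<or> G = P" for G using that in_K F P \<open>i \<in> W\<close> by blast
    then show ?thesis by (auto simp: succ_edges_def)
  qed
  show rt: "roots F E = roots P E" using edges E(2) by (auto simp: roots_def)
  have S: "substructure P E" using E(1) by (simp add: subnet_def)
  have S_succ: "j \<in> E" if "(i, j) \<in> succ_edges P" "i \<in> E" for i j
    using S that unfolding substructure_def by blast
  have lab: "labelled F i l \<longleftrightarrow> (\<exists>n\<in>K. node_name n = i \<and> node_label n = l)"
    "labelled P i l \<longleftrightarrow> (\<exists>n\<in>K. node_name n = i \<and> node_label n = l)" if "i \<in> W" for i l
    using that in_K F P unfolding labelled_def by blast+
  have links: "(i, j) \<in> axiom_links F \<Longrightarrow> i \<in> W \<Longrightarrow> (i, j) \<in> axiom_links P" for i j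
  proof -
    assume "(i, j) \<in> axiom_links F" and i: "i \<in> W"
    then obtain n m x where e: "i = node_name n" "j = node_name m" "n \<in> nodes F" "m \<in> nodes F"
      "node_label n = LWire x" "node_label m = LWire (wdual x)"
      by (auto simp: axiom_links_nodes link_edges_def)
    have "n \<in> K" using in_K e(1,3) i by blast
    moreover from this e(4-6) unl F have "m \<in> K" unfolding unlinked_def by blast
    ultimately show ?thesis using e P unfolding axiom_links_nodes link_edges_def by blast
  qed
  have "substructure F E" unfolding substructure_def
  proof (intro conjI ballI)
    show "E \<noteq> {}" using S by (simp add: substructure_def)
    show "E \<subseteq> node_set F" using E(2) W F by (auto simp: node_set_def)
  next
    fix e assume "e \<in> succ_edges F"
    then show "case e of (i, j) \<Rightarrow> i \<in> E \<longrightarrow> j \<in> E"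
      using S_succ edges E(2) by (cases e) auto
  next
    fix e assume "e \<in> axiom_links F"
    then show "case e of (i, j) \<Rightarrow> i \<in> E \<longrightarrow> j \<in> E"
      using S links E(2) by (fastforce simp: substructure_def)
  next
    fix e assume e: "e \<in> succ_edges F"
    show "case e of (i, j) \<Rightarrow> j \<in> E \<and> labelled F j LStar \<longrightarrow> i \<in> E"
    proof (cases e, clarsimp)
      fix i j assume ij: "e = (i, j)" "j \<in> E" "labelled F j LStar"
      then obtain n where n: "n \<in> K" "node_name n = j" "node_label n = LStar" using lab E(2) by blast
      obtain m where m: "m \<in> nodes F" "node_name m = i" "j \<in> succs m"
        using e ij by (auto simp: succ_edges_def)
      with star[OF n(1,3)] n(2) have "m \<notin> Y" by blast
      with m F W have "i \<in> W" by blast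
      then have "(i, j) \<in> succ_edges P" using edges e ij by blast
      moreover have "labelled P j LStar" using n P by (auto simp: labelled_def)
      ultimately show "i \<in> E" using S ij(2) by (auto simp: substructure_def)
    qed
  qed
  moreover have "set p \<subseteq> E" if p: "switching_path F p" "hd p \<in> roots F E" "last p \<in> roots F E" for p
  proof -
    from p(1) obtain \<sigma> where \<sigma>: "switches (nodes F) \<sigma>" "path (sgraph (nodes F) \<sigma>) p"
      unfolding switching_path_def switching_nodes[OF named(1)] switching_graph_nodes[OF named(1)] by blast
    have G: "sgraph (nodes F) \<sigma> = sgraph K \<sigma> \<union> sgraph Y \<sigma>" unfolding F by (rule sgraph_union[OF unl])
    have GK: "sgraph K \<sigma> \<subseteq> W \<times> W" by (rule sgraph_closed) (use W closed in auto)
    obtain e where e: "\<forall>y\<in>Y. \<forall>a\<in>succs y \<inter> W. (is_switched y \<longrightarrow> a = \<sigma> (node_name y)) \<longrightarrow> a = e"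
      using boundary by blast
    have Ye: "a = e" if "(a, b) \<in> sgraph Y \<sigma>" "a \<in> W" for a b
    proof -
      from that(1) consider y where "y \<in> Y" "(a, b) \<in> chosen_edges y \<sigma>"
        | y where "y \<in> Y" "(b, a) \<in> chosen_edges y \<sigma>" | "(a, b) \<in> link_edges Y"
        unfolding sgraph_def by blast
      then show ?thesis
      proof cases
        case 1
        then show ?thesis using Y[of y] that(2) by (auto simp: chosen_edges_def)
      next
        case 2
        then show ?thesis using e that(2) by (auto simp: chosen_edges_def)
      next
        case 3
        then show ?thesis using Y that(2) by (auto simp: link_edges_def)
      qed
    qed
    have hl: "hd p \<in> W" "last p \<in> W" using p(2,3) E(2) by (auto simp: roots_def)
    have pW: "set p \<subseteq> W"
    proof (rule path_stays[OF \<sigma>(2) hl sgraph_sym])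
      fix a b assume "(a, b) \<in> sgraph (nodes F) \<sigma>" "a \<in> W" "b \<notin> W"
      then show "a = e" using Ye GK unfolding G by blast
    qed
    \<comment> \<open>On the nodes of \<open>Z\<close> any choice will do.\<close>
    define \<tau> where "\<tau> i = (if i \<in> W then \<sigma> i else SOME j. \<exists>z\<in>Z. node_name z = i \<and> j \<in> succs z)" for i
    have "switches (nodes P) \<tau>" unfolding switches_def
    proof (intro ballI impI)
      fix n assume n: "n \<in> nodes P" "is_switched n"
      show "\<tau> (node_name n) \<in> succs n"
      proof (cases "node_name n \<in> W")
        case True
        then have "n \<in> nodes F" using n in_K F by blast
        with n True \<sigma>(1) show ?thesis by (simp add: \<tau>_def switches_def)
      next
        case False
        then have "n \<in> Z" using n P W by blast
        with Zne n have "\<exists>j. \<exists>z\<in>Z. node_name z = node_name n \<and> j \<in> succs z" by blast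
        then have "\<exists>z\<in>Z. node_name z = node_name n \<and> \<tau> (node_name n) \<in> succs z"
          using False by (simp add: \<tau>_def) (rule someI_ex)
        then obtain z where z: "z \<in> Z" "node_name z = node_name n" "\<tau> (node_name n) \<in> succs z" by blast
        then have "z = n" using unique_node[OF named(2)] P n by blast
        with z show ?thesis by simp
      qed
    qed
    moreover have "path (sgraph (nodes P) \<tau>) p" unfolding path_def
    proof (intro conjI)
      show "p \<noteq> []" "distinct p" using \<sigma>(2) by (auto simp: path_def)
      show "successively (\<lambda>i j. (i, j) \<in> sgraph (nodes P) \<tau>) p"
      proof (rule successively_mono[of "\<lambda>i j. (i, j) \<in> sgraph (nodes F) \<sigma>"])
        show "successively (\<lambda>i j. (i, j) \<in> sgraph (nodes F) \<sigma>) p" using \<sigma>(2) by (simp add: path_def)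
        fix a b assume ab: "a \<in> set p" "b \<in> set p" "(a, b) \<in> sgraph (nodes F) \<sigma>"
        then have "a \<in> W" "b \<in> W" using pW by auto
        then have "(a, b) \<notin> sgraph Y \<sigma>"
          using Y by (auto simp: sgraph_def chosen_edges_def link_edges_def)
        then have "(a, b) \<in> sgraph K \<sigma>" using ab G by blast
        also have "sgraph K \<sigma> = sgraph K \<tau>" by (rule sgraph_cong) (use W in \<open>auto simp: \<tau>_def\<close>)
        also have "\<dots> \<subseteq> sgraph (nodes P) \<tau>" unfolding P by (rule sgraph_mono) blast
        finally show "(a, b) \<in> sgraph (nodes P) \<tau>" .
      qed
    qed
    ultimately have "switching_path P p"
      unfolding switching_path_def switching_nodes[OF named(2)] switching_graph_nodes[OF named(2)] by blast
    with E(1) p(2,3) rt show ?thesis by (auto simp: subnet_def)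
  qed
  ultimately show "subnet F E" by (auto simp: subnet_def)
qed

lemma root_label: "\<exists>n\<in>#root_nodes c. node_name n = rname c \<and> node_label n \<noteq> LStar"
proof -
  have "\<exists>n\<in>#tree_nodes t. node_name n = tname t \<and> node_label n \<noteq> LStar" for t :: "('i, 'v) tree"
    by (cases t) auto
  moreover have "\<exists>n\<in>#wit_nodes w. node_name n = wname w \<and> node_label n \<noteq> LStar" for w :: "('i, 'v) wit"
    by (cases w) auto
  ultimately show ?thesis by (cases c) auto
qed

lemma subnet_track_above:
  fixes F P :: "('p, 'i, 'v) gen_forest"
  assumes named: "distinctly_named F" "distinctly_named P"
    and F: "nodes F = nodes P \<union> Y"
    and Y: "\<And>y. y \<in> Y \<Longrightarrow> node_name y \<notin> node_set P"
    and unl: "unlinked (nodes P) Y"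
    and boundary: "\<And>\<sigma>. \<exists>e. \<forall>y\<in>Y. \<forall>a\<in>succs y \<inter> node_set P. (is_switched y \<longrightarrow> a = \<sigma> (node_name y)) \<longrightarrow> a = e"
    and above: "\<And>y a. y \<in> Y \<Longrightarrow> a \<in> succs y \<Longrightarrow> a \<in> node_set P \<Longrightarrow> a \<in> rname ` set_mset P"
    and E: "subnet P E"
  shows "subnet F E \<and> roots F E = roots P E"
proof (rule subnet_track[OF named F, of "{}" "node_set P"])
  fix n assume "n \<in> nodes P"
  then show "succs n \<subseteq> node_set P" using succ_edge_nodes[OF named(2)] by (auto simp: succ_edges_def)
next
  fix n y assume n: "n \<in> nodes P" "node_label n = LStar" and y: "y \<in> Y"
  show "node_name n \<notin> succs y"
  proof
    assume "node_name n \<in> succs y"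
    then obtain c where c: "c \<in># P" "node_name n = rname c"
      using above[OF y, of "node_name n"] n by (auto simp: node_set_def)
    obtain m where m: "m \<in># root_nodes c" "node_name m = rname c" "node_label m \<noteq> LStar"
      using root_label by blast
    then have "m \<in> nodes P" using c(1) by (auto simp: forest_nodes_def)
    with unique_node[OF named(2) this n(1)] m c n(2) show False by simp
  qed
qed (use assms in \<open>auto simp: node_set_def subnet_def substructure_def\<close>)

lemma whole_subnet:
  assumes named: "distinctly_named P" and ne: "P \<noteq> {#}"
  shows "subnet P (node_set P)" and "roots P (node_set P) = rname ` set_mset P"
proof -
  show "roots P (node_set P) = rname ` set_mset P"
  proof
    show "roots P (node_set P) \<subseteq> rname ` set_mset P"
      using node_set_succs[OF named] succ_edge_nodes[OF named] by (auto simp: roots_def)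
    show "rname ` set_mset P \<subseteq> roots P (node_set P)"
      using root_no_predecessor[OF named] node_set_succs[OF named] by (auto simp: roots_def)
  qed
  obtain c where "c \<in># P" using ne by blast
  then have "node_set P \<noteq> {}" using node_set_succs[OF named, of "rname c"] by auto
  moreover have "set p \<subseteq> node_set P" if p: "switching_path P p" "hd p \<in> roots P (node_set P)" for p
  proof -
    from p(1) obtain \<sigma> where "path (sgraph (nodes P) \<sigma>) p"
      unfolding switching_path_def switching_graph_nodes[OF named] by blast
    from path_within[OF this _ sgraph_nodes[OF named]] p(2) show ?thesis by (auto simp: roots_def)
  qed
  ultimately show "subnet P (node_set P)"
    using succ_edge_nodes[OF named]
    by (auto simp: subnet_def substructure_def axiom_links_def labelled_def node_set_def)
qed

subsection \<open>Peeling\<close>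

primrec peel :: "'p wit_type \<Rightarrow> ('i, 'v) tree \<Rightarrow> ('p, 'i, 'v) gen_forest" where
  "peel T (Unit i) = {#}"
| "peel T (Exp i ws) = image_mset (\<lambda>w. Wit w T) ws"
| "peel T (Vee i t s) = peel T t + peel T s"
| "peel T (VeeL i t j) = peel T t"
| "peel T (VeeR i j t) = peel T t"

definition tracks :: "('p, 'i, 'v) gen_forest \<Rightarrow> ('p, 'i, 'v) gen_forest \<Rightarrow> bool" where
  "tracks P F \<longleftrightarrow> distinctly_named P \<and> distinctly_named F \<and> nodes P \<subseteq> nodes F \<and>
     (\<forall>E. subnet P E \<longrightarrow> subnet F E \<and> roots F E = roots P E)"

lemma tracks_refl: "distinctly_named P \<Longrightarrow> tracks P P"
  by (auto simp: tracks_def)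

lemma tracks_trans: "tracks P F \<Longrightarrow> tracks F G \<Longrightarrow> tracks P G"
  unfolding tracks_def by fastforce

lemma tracks_above:
  assumes "distinctly_named F" "distinctly_named P" "nodes F = nodes P \<union> Y"
    and "\<And>y. y \<in> Y \<Longrightarrow> node_name y \<notin> node_set P \<and> (\<forall>x. node_label y \<noteq> LWire x)"
    and "\<And>\<sigma>. \<exists>e. \<forall>y\<in>Y. \<forall>a\<in>succs y \<inter> node_set P. (is_switched y \<longrightarrow> a = \<sigma> (node_name y)) \<longrightarrow> a = e"
    and "\<And>y a. y \<in> Y \<Longrightarrow> a \<in> succs y \<Longrightarrow> a \<in> node_set P \<Longrightarrow> a \<in> rname ` set_mset P"
  shows "tracks P F"
proof -
  have "unlinked (nodes P) Y" using assms(4) by (auto simp: unlinked_def)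
  with subnet_track_above[OF assms(1-3) _ _ assms(5,6)] assms(1-4) show ?thesis
    by (auto simp: tracks_def)
qed

lemma forest_nodes_witnesses [simp]:
  "forest_nodes (image_mset (\<lambda>w. Wit w T) ws) = \<Sum>\<^sub># (image_mset wit_nodes ws)"
  by (simp add: forest_nodes_def image_mset.compositionality o_def)

lemma tracks_vee:
  assumes "distinctly_named (C + {#Tree (Vee i t s) A#})"
  shows "tracks (C + {#Tree t A1, Tree s A2#}) (C + {#Tree (Vee i t s) A#})"
proof (rule tracks_above[OF assms, of _ "{Node i LVee {tname t, tname s}}"])
  show "distinctly_named (C + {#Tree t A1, Tree s A2#})"
    using assms by (simp add: image_Un Int_Un_distrib Int_Un_distrib2 Int_commute)
  show "\<exists>e. \<forall>y\<in>{Node i LVee {tname t, tname s} :: ('b, 'c) node}. \<forall>a\<in>succs y \<inter> node_set (C + {#Tree t A1, Tree s A2#}).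
      (is_switched y \<longrightarrow> a = \<sigma> (node_name y)) \<longrightarrow> a = e" for \<sigma> by auto
qed (use assms in \<open>auto simp: node_set_def\<close>)

lemma tracks_weak:
  assumes "distinctly_named (C + {#Tree u A#})" "u = VeeL i t j \<or> u = VeeR i j t"
  shows "tracks (C + {#Tree t B#}) (C + {#Tree u A#})"
proof (rule tracks_above[OF assms(1), of _ "{Node i LWeak {tname t, j}, Node j LStar {}}"])
  have j: "j \<notin> node_set (C + {#Tree t B#})" using assms by (auto simp: node_set_def)
  show "\<exists>e. \<forall>y\<in>{Node i LWeak {tname t, j} :: ('b, 'c) node, Node j LStar {}}. \<forall>a\<in>succs y \<inter> node_set (C + {#Tree t B#}).
      (is_switched y \<longrightarrow> a = \<sigma> (node_name y)) \<longrightarrow> a = e" for \<sigma>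
    by (rule exI[of _ "tname t"]) (use j in auto)
  show "a \<in> rname ` set_mset (C + {#Tree t B#})"
    if "y \<in> {Node i LWeak {tname t, j} :: ('b, 'c) node, Node j LStar {}}" "a \<in> succs y" "a \<in> node_set (C + {#Tree t B#})"
    for y a using that j by auto
  show "nodes (C + {#Tree u A#}) = nodes (C + {#Tree t B#}) \<union> {Node i LWeak {tname t, j}, Node j LStar {}}"
    using assms(2) by (auto simp: insert_commute)
  show "distinctly_named (C + {#Tree t B#})"
    using assms(2) by (rule disjE) (use assms(1) in \<open>simp_all add: Int_commute\<close>)
  show "node_name y \<notin> node_set (C + {#Tree t B#}) \<and> (\<forall>x. node_label y \<noteq> LWire x)"
    if "y \<in> {Node i LWeak {tname t, j} :: ('b, 'c) node, Node j LStar {}}" for y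
    using that assms by (auto simp: node_set_def)
qed

lemma tracks_peel:
  fixes t :: "('i, 'v) tree" and w :: "('i, 'v) wit" and C :: "('p, 'i, 'v) gen_forest"
  shows "distinctly_named (C + {#Tree t A#}) \<Longrightarrow> tracks (C + peel T t) (C + {#Tree t A#})"
    and "True"
proof (induction t and w arbitrary: C A)
  case (Unit i)
  show ?case by (rule tracks_above[OF Unit.prems, of _ "{Node i LUnit {}}"])
      (use Unit.prems in \<open>auto simp: node_set_def\<close>)
next
  case (Exp i ws)
  have ns: "node_set (image_mset (\<lambda>w. Wit w T) ws) = node_name ` set_mset (\<Sum>\<^sub># (image_mset wit_nodes ws))"
    by (simp add: node_set_def)
  show ?case
  proof (rule tracks_above[OF Exp.prems, of _ "{Node i LExp (wname ` set_mset ws)}"])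
    show "distinctly_named (C + peel T (Exp i ws))" using Exp.prems
      by (simp add: distinctly_named_nodes node_set_def Int_commute)
    show "\<exists>e. \<forall>y\<in>{Node i LExp (wname ` set_mset ws) :: ('i, 'v) node}. \<forall>a\<in>succs y \<inter> node_set (C + peel T (Exp i ws)).
      (is_switched y \<longrightarrow> a = \<sigma> (node_name y)) \<longrightarrow> a = e" for \<sigma> by auto
    show "nodes (C + {#Tree (Exp i ws) A#}) = nodes (C + peel T (Exp i ws)) \<union> {Node i LExp (wname ` set_mset ws)}"
      by auto
    show "node_name y \<notin> node_set (C + peel T (Exp i ws)) \<and> (\<forall>x. node_label y \<noteq> LWire x)"
      if "y \<in> {Node i LExp (wname ` set_mset ws) :: ('i, 'v) node}" for y
      using that Exp.prems by (simp add: ns)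
    show "a \<in> rname ` set_mset (C + peel T (Exp i ws))"
      if "y \<in> {Node i LExp (wname ` set_mset ws) :: ('i, 'v) node}" "a \<in> succs y" for y a
      using that by (auto simp: image_Un image_image)
  qed
next
  case (Vee i t s)
  have 1: "tracks (C + {#Tree t A, Tree s A#}) (C + {#Tree (Vee i t s) A#})"
    by (rule tracks_vee[OF Vee.prems])
  then have "distinctly_named ((C + {#Tree s A#}) + {#Tree t A#})"
    by (simp add: tracks_def add_mset_commute Int_commute)
  from Vee.IH(1)[OF this] have 2: "tracks (C + peel T t + {#Tree s A#}) (C + {#Tree t A, Tree s A#})"
    by (simp add: add_mset_commute ac_simps)
  then have "distinctly_named (C + peel T t + {#Tree s A#})" by (simp add: tracks_def)
  from tracks_trans[OF tracks_trans[OF Vee.IH(2)[OF this] 2] 1] show ?case by (simp add: ac_simps)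
next
  case (VeeL i t j)
  have 1: "tracks (C + {#Tree t A#}) (C + {#Tree (VeeL i t j) A#})"
    by (rule tracks_weak[OF VeeL.prems]) simp
  then have "distinctly_named (C + {#Tree t A#})" by (simp only: tracks_def)
  from tracks_trans[OF VeeL.IH[OF this] 1] show ?case by simp
next
  case (VeeR i j t)
  have 1: "tracks (C + {#Tree t A#}) (C + {#Tree (VeeR i j t) A#})"
    by (rule tracks_weak[OF VeeR.prems]) simp
  then have "distinctly_named (C + {#Tree t A#})" by (simp only: tracks_def)
  from tracks_trans[OF VeeR.IH[OF this] 1] show ?case by simp
qed auto

fun peel_root :: "'p wit_type \<Rightarrow> ('p, 'i, 'v) root \<Rightarrow> ('p, 'i, 'v) gen_forest" where
  "peel_root T (Tree t A) = peel T t"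
| "peel_root T c = {#c#}"

definition peel_forest :: "'p wit_type \<Rightarrow> ('p, 'i, 'v) gen_forest \<Rightarrow> ('p, 'i, 'v) gen_forest" where
  "peel_forest T F = \<Sum>\<^sub># (image_mset (peel_root T) F)"

lemma tracks_peel_forest:
  "distinctly_named (C + F) \<Longrightarrow> tracks (C + peel_forest T F) (C + F)"
proof (induction F arbitrary: C)
  case empty
  then show ?case by (simp add: peel_forest_def tracks_refl)
next
  case (add c F)
  have "distinctly_named (C + F + {#c#})" using add.prems by simp
  then have 1: "tracks ((C + peel_root T c) + F) (C + F + {#c#})"
    using tracks_peel(1)[of "C + F" _ _ T] tracks_refl[of "C + F + {#c#}"]
    by (cases c) (simp_all add: ac_simps)
  then have "distinctly_named ((C + peel_root T c) + F)" by (simp only: tracks_def)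
  from tracks_trans[OF add.IH[OF this] 1] show ?case
    by (simp add: peel_forest_def ac_simps)
qed

lemma peel_witnesses: "c \<in># peel T t \<Longrightarrow> \<exists>w T. c = Wit w T"
  by (induction t) auto

lemma peel_forest_roots: "c \<in># peel_forest T F \<Longrightarrow> (\<exists>w T. c = Wit w T) \<or> (\<exists>i s A t. c = Cut i s A t)"
proof (induction F)
  case (add d F)
  then show ?case by (cases d) (auto simp: peel_forest_def dest: peel_witnesses)
qed (simp add: peel_forest_def)

lemma outer_names_peel: "outer_names t = rname ` set_mset (peel T t)"
  by (induction t) (auto simp: image_Un image_image)

section \<open>The duplicated subnet\<close>

subsection \<open>Duplication up to names\<close>

lemma duplicate_simps [simp]:
  "duplicate f g R {#} = {#}"
  "duplicate f g R (F + G) = duplicate f g R F + duplicate f g R G"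
  by (simp_all add: duplicate_def)

definition sdup :: "('v \<Rightarrow> 'v) \<Rightarrow> ('v \<Rightarrow> 'v) \<Rightarrow> 'i set \<Rightarrow> ('p, 'i, 'v) gen_forest \<Rightarrow> ('p, unit, 'v) gen_forest" where
  "sdup f g R F = strip (duplicate f g R F)"

abbreviation dup_tree :: "('v \<Rightarrow> 'v) \<Rightarrow> ('v \<Rightarrow> 'v) \<Rightarrow> 'i set \<Rightarrow> ('i, 'v) tree \<Rightarrow> (unit, 'v) tree" where
  "dup_tree f g R t \<equiv> map_tree (\<lambda>_. ()) (\<lambda>x. x) (tree_replace (duplicate_wit f g R) t)"

lemma map_tree_comp_id: "map_tree u (\<lambda>x. x) (map_tree id f t) = map_tree u f t"
  by (simp add: tree.map_comp o_def)

lemma sdup_simps [simp]: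
  "sdup f g R {#} = {#}"
  "sdup f g R (F + G) = sdup f g R F + sdup f g R G"
  "sdup f g R (add_mset (Tree t A) F) = add_mset (Tree (dup_tree f g R t) A) (sdup f g R F)"
  "sdup f g R (add_mset (Cut i s A t) F) = (if i \<in> R
     then {#Cut () (map_tree (\<lambda>_. ()) f s) A (map_tree (\<lambda>_. ()) f t),
            Cut () (map_tree (\<lambda>_. ()) g s) A (map_tree (\<lambda>_. ()) g t)#}
     else {#Cut () (dup_tree f g R s) A (dup_tree f g R t)#}) + sdup f g R F"
proof -
  show "sdup f g R {#} = {#}" "sdup f g R (F + G) = sdup f g R F + sdup f g R G"
    by (simp_all add: sdup_def)
  have "duplicate f g R (add_mset c F) = duplicate f g R {#c#} + duplicate f g R F" for c
    using duplicate_simps(2)[of f g R "{#c#}" F] by simp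
  then show "sdup f g R (add_mset (Tree t A) F) = add_mset (Tree (dup_tree f g R t) A) (sdup f g R F)"
    and "sdup f g R (add_mset (Cut i s A t) F) = (if i \<in> R
     then {#Cut () (map_tree (\<lambda>_. ()) f s) A (map_tree (\<lambda>_. ()) f t),
            Cut () (map_tree (\<lambda>_. ()) g s) A (map_tree (\<lambda>_. ()) g t)#}
     else {#Cut () (dup_tree f g R s) A (dup_tree f g R t)#}) + sdup f g R F"
    by (simp_all add: sdup_def duplicate_def formula.map_id map_tree_comp_id)
qed

lemma dup_vars:
  fixes t :: "('i, 'v) tree" and w :: "('i, 'v) wit"
  shows "tree_vars (tree_replace (duplicate_wit f g R) t) \<subseteq> tree_vars t \<union> f ` tree_vars t \<union> g ` tree_vars t"
    and "\<Union>(wit_vars ` set_mset (wit_replace (duplicate_wit f g R) w)) \<subseteq> wit_vars w \<union> f ` wit_vars w \<union> g ` wit_vars w"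
proof (induction t and w)
  case (Exp i ws)
  show ?case
  proof
    fix x assume "x \<in> tree_vars (tree_replace (duplicate_wit f g R) (Exp i ws))"
    then obtain w v where w: "w \<in># ws" "v \<in># wit_replace (duplicate_wit f g R) w" "x \<in> wit_vars v"
      by auto
    then have "x \<in> wit_vars w \<union> f ` wit_vars w \<union> g ` wit_vars w" using Exp.IH[OF w(1)] by blast
    with w(1) show "x \<in> tree_vars (Exp i ws) \<union> f ` tree_vars (Exp i ws) \<union> g ` tree_vars (Exp i ws)"
      by auto
  qed
next
  case (Vee i t s)
  then show ?case by (simp add: image_Un) blast
next
  case (Wire i x)
  show ?case by (simp add: duplicate_wit_def wire.set_map) blast
next
  case (Tensor i t s)
  show ?case
  proof (cases "i \<in> R")
    case True
    then show ?thesis by (simp add: duplicate_wit_def image_Un) blast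
  next
    case False
    with Tensor show ?thesis by (simp add: duplicate_wit_def image_Un) blast
  qed
qed auto

definition copied_vars :: "('v \<Rightarrow> 'v) \<Rightarrow> ('v \<Rightarrow> 'v) \<Rightarrow> 'v set \<Rightarrow> 'v set" where
  "copied_vars f g V = V \<union> f ` V \<union> g ` V"

lemma copied_vars_Un [simp]: "copied_vars f g (U \<union> V) = copied_vars f g U \<union> copied_vars f g V"
  by (auto simp: copied_vars_def)

lemma dup_tree_vars: "tree_vars (dup_tree f g R t) \<subseteq> copied_vars f g (tree_vars t)"
  using dup_vars(1)[of f g R t] by (auto simp: copied_vars_def)

lemma copied_varsI:
  "x \<in> V \<Longrightarrow> x \<in> copied_vars f g V" "x \<in> V \<Longrightarrow> f x \<in> copied_vars f g V" "x \<in> V \<Longrightarrow> g x \<in> copied_vars f g V"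
  by (auto simp: copied_vars_def)

lemma sdup_root_vars: "\<forall>w T. c \<noteq> Wit w T \<Longrightarrow> forest_vars (sdup f g R {#c#}) \<subseteq> copied_vars f g (root_vars c)"
  by (cases c) (auto intro: copied_varsI dest: subsetD[OF dup_tree_vars[simplified]])

lemma sdup_vars: "\<forall>w T. Wit w T \<notin># F \<Longrightarrow> forest_vars (sdup f g R F) \<subseteq> copied_vars f g (forest_vars F)"
proof (induction F)
  case (add c F)
  have "sdup f g R (add_mset c F) = sdup f g R {#c#} + sdup f g R F"
    using sdup_simps(2)[of f g R "{#c#}" F] by simp
  moreover have "forest_vars (sdup f g R {#c#}) \<subseteq> copied_vars f g (root_vars c)"
    by (rule sdup_root_vars) (use add.prems in auto)
  moreover have "forest_vars (sdup f g R F) \<subseteq> copied_vars f g (forest_vars F)"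
    using add by simp
  ultimately show ?case by (simp add: le_supI1 le_supI2)
qed simp

lemma copied_vars_disjoint:
  assumes "fresh_copies f g V" "U \<subseteq> V" "W \<subseteq> V" "U \<inter> W = {}"
  shows "copied_vars f g U \<inter> W = {}"
  using assms unfolding fresh_copies_def copied_vars_def by blast

lemma dup_untouched:
  fixes t :: "('i, 'v) tree" and w :: "('i, 'v) wit"
  shows "node_name ` set_mset (tree_nodes t) \<inter> R = {} \<Longrightarrow> tree_replace (duplicate_wit f g R) t = t"
    and "node_name ` set_mset (wit_nodes w) \<inter> R = {} \<Longrightarrow> wit_replace (duplicate_wit f g R) w = {#w#}"
proof (induction t and w)
  case (Exp i ws)
  have "wit_replace (duplicate_wit f g R) w = {#w#}" if "w \<in># ws" for w
  proof (rule Exp.IH[OF that])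
    have "node_name ` set_mset (wit_nodes w) \<subseteq> node_name ` set_mset (tree_nodes (Exp i ws))" using that by auto
    with Exp.prems show "node_name ` set_mset (wit_nodes w) \<inter> R = {}" by blast
  qed
  then have "image_mset (wit_replace (duplicate_wit f g R)) ws = image_mset (\<lambda>w. {#w#}) ws"
    by (intro image_mset_cong) auto
  then show ?case by simp
qed (auto simp: duplicate_wit_def image_Un Int_Un_distrib2)

lemma sdup_untouched:
  "\<forall>w T. Wit w T \<notin># F \<Longrightarrow> node_set F \<inter> R = {} \<Longrightarrow> sdup f g R F = strip F"
proof (induction F)
  case (add c F)
  then have F: "sdup f g R F = strip F" by (simp add: Int_Un_distrib2)
  show ?case
  proof (cases c)
    case (Tree t A)
    with add.prems dup_untouched(1)[of t R f g] F show ?thesis by (simp add: Int_Un_distrib2)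
  next
    case (Wit w T)
    then show ?thesis using add.prems by auto
  next
    case (Cut i s A t)
    with add.prems dup_untouched(1)[of s R f g] dup_untouched(1)[of t R f g] F show ?thesis
      by (simp add: Int_Un_distrib2 image_Un)
  qed
qed simp

lemma sums_nonempty_duplicate: "sums_nonempty (duplicate_wit f g R)"
  by (auto simp: sums_nonempty_def duplicate_wit_def split: if_splits)

lemma dup_unary:
  assumes "named_unary P c"
  shows "\<exists>d. sdup f g R {#c#} = {#d#} \<and> unary (sdup f g R P) d"
proof -
  have trees: "\<forall>x\<in>#P. \<exists>t A. x = Tree t A" "\<exists>t A. c = Tree t A"
    using assms by (induction rule: named_unary.induct) auto
  have "unary (image_mset (rename (\<lambda>_. ()) (\<lambda>x. x)) (image_mset (rmap (duplicate_wit f g R)) P))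
    (rename (\<lambda>_. ()) (\<lambda>x. x) (rmap (duplicate_wit f g R) c))"
    by (intro unary_map unary_rmap named_unary_unary assms sums_nonempty_duplicate)
  moreover have "image_mset (rename (\<lambda>_. ()) (\<lambda>x. x)) (image_mset (rmap (duplicate_wit f g R)) P) = sdup f g R P"
    using trees(1) by (induction P) auto
  moreover have "sdup f g R {#c#} = {#rename (\<lambda>_. ()) (\<lambda>x. x) (rmap (duplicate_wit f g R) c)#}"
    using trees(2) by auto
  ultimately show ?thesis by auto
qed

lemma drv_merge_forests:
  "drv r n e (H + image_mset (rename (\<lambda>_. ()) f) G + image_mset (rename (\<lambda>_. ()) g) G) \<Longrightarrow>
    \<forall>w T. Wit w T \<notin># G \<Longrightarrow> rname ` set_mset (peel_forest T G) \<subseteq> R \<Longrightarrow>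
    drv r n e (H + sdup f g R G)"
proof (induction G arbitrary: H)
  case (add c G)
  show ?case
  proof (cases c)
    case (Tree t A)
    have "drv r n e ((H + image_mset (rename (\<lambda>_. ()) f) G + image_mset (rename (\<lambda>_. ()) g) G) +
        {#Tree (map_tree (\<lambda>_. ()) f t) A, Tree (map_tree (\<lambda>_. ()) g t) A#})"
      using add.prems(1) Tree by (simp add: ac_simps add_mset_commute)
    moreover have "outer_names t \<subseteq> R"
      using add.prems(3) Tree unfolding outer_names_peel[of t T] by (auto simp: peel_forest_def)
    ultimately have "drv r n e ((H + image_mset (rename (\<lambda>_. ()) f) G + image_mset (rename (\<lambda>_. ()) g) G) +
        {#Tree (dup_tree f g R t) A#})" by (rule drv_merge_copies)
    then have "drv r n e ((H + {#Tree (dup_tree f g R t) A#}) +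
        image_mset (rename (\<lambda>_. ()) f) G + image_mset (rename (\<lambda>_. ()) g) G)"
      by (simp add: ac_simps)
    from add.IH[OF this] add.prems Tree show ?thesis by (simp add: peel_forest_def image_Un)
  next
    case (Wit w T)
    then show ?thesis using add.prems(2) by auto
  next
    case (Cut i s A t)
    let ?c = "{#Cut () (map_tree (\<lambda>_. ()) f s) A (map_tree (\<lambda>_. ()) f t),
            Cut () (map_tree (\<lambda>_. ()) g s) A (map_tree (\<lambda>_. ()) g t)#}"
    have "drv r n e ((H + ?c) + image_mset (rename (\<lambda>_. ()) f) G + image_mset (rename (\<lambda>_. ()) g) G)"
      using add.prems(1) Cut by (simp add: ac_simps add_mset_commute)
    from add.IH[OF this] add.prems Cut show ?thesis by (simp add: peel_forest_def ac_simps)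
  qed
qed simp

subsection \<open>Contraction at a flagged cut\<close>

inductive contraction_site ::
  "nat \<Rightarrow> nat \<Rightarrow> ('p, 'i, 'v) gen_forest \<Rightarrow> ('p, 'i, 'v) gen_forest \<Rightarrow> 'i \<Rightarrow> 'i \<Rightarrow>
   ('i, 'v) wit multiset \<Rightarrow> 'p formula \<Rightarrow> ('i, 'v) tree \<Rightarrow> 'i set \<Rightarrow> 'i set \<Rightarrow> bool"
  for r n F F0 i j S A t E R where
  site: "F = F0 + {#Cut i (Exp j S) A t#} \<Longrightarrow> rank A = r \<Longrightarrow> size S = n \<Longrightarrow>
    subnet F E \<Longrightarrow> roots F E = insert (tname t) R \<Longrightarrow>
    (\<And>u. u \<in> R \<Longrightarrow> (\<exists>x. labelled F u (LWire x)) \<or> labelled F u LTensor \<or> labelled F u LCut) \<Longrightarrow>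
    (\<And>t A. Tree t A \<in># F \<Longrightarrow> tname t \<notin> E) \<Longrightarrow>
    (\<And>k s B s'. Cut k s B s' \<in># F0 \<Longrightarrow> rank B = r \<Longrightarrow> k \<notin> R \<and> (2 \<le> width s \<or> outer_names s \<inter> R = {})) \<Longrightarrow>
    (\<And>f g V S1 S2. forest_vars F \<subseteq> V \<Longrightarrow> fresh_copies f g V \<Longrightarrow> S = S1 + S2 \<Longrightarrow> S1 \<noteq> {#} \<Longrightarrow> S2 \<noteq> {#} \<Longrightarrow>
       drv r (size S1) True (sdup f g R F0 +
         {#Cut () (Exp () (image_mset (map_wit (\<lambda>_. ()) (\<lambda>x. x)) S1)) A (map_tree (\<lambda>_. ()) f t),
           Cut () (Exp () (image_mset (map_wit (\<lambda>_. ()) (\<lambda>x. x)) S2)) A (map_tree (\<lambda>_. ()) g t)#})) \<Longrightarrow>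
    contraction_site r n F F0 i j S A t E R"

lemma labelled_mono: "nodes P \<subseteq> nodes F \<Longrightarrow> labelled P u l \<Longrightarrow> labelled F u l"
  by (auto simp: labelled_def)

text \<open>
  Common part of all rules below the cut: \<open>Pa\<close> are the active trees of the premise, \<open>D\<close> is what
  the rule adds to the context \<open>Pc\<close>.
\<close>

lemma contraction_site_extend:
  fixes Pc :: "('p, 'i, 'v) gen_forest"
  assumes site: "contraction_site r n (Pc + Pa) P0 i j S A t E R"
    and Pa: "\<And>c. c \<in># Pa \<Longrightarrow> \<exists>t A. c = Tree t A"
    and nowit: "\<forall>w T. Wit w T \<notin># Pc"
    and vars: "forest_vars (Pc + Pa) \<subseteq> forest_vars (Pc + D)"
    and track: "subnet (Pc + Pa) E \<Longrightarrow> (\<And>t A. Tree t A \<in># Pc + Pa \<Longrightarrow> tname t \<notin> E) \<Longrightarrow>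
      subnet (Pc + D) E \<and> roots (Pc + D) E = roots (Pc + Pa) E"
    and labels: "\<And>u l. l \<noteq> LExp \<Longrightarrow> labelled (Pc + Pa) u l \<Longrightarrow> labelled (Pc + D) u l"
    and trees: "\<And>t A. Tree t A \<in># D \<Longrightarrow>
      tname t \<notin> node_set (Pc + Pa) \<or> (\<exists>t' B. Tree t' B \<in># Pa \<and> tname t' = tname t)"
    and cuts: "\<And>k s B s'. Cut k s B s' \<in># D \<Longrightarrow> rank B = r \<Longrightarrow>
      k \<notin> node_set (Pc + Pa) \<and> (2 \<le> width s \<or> outer_names s \<inter> node_set (Pc + Pa) = {})"
    and rule: "\<And>f g V R K m. forest_vars (Pc + D) \<subseteq> V \<Longrightarrow> fresh_copies f g V \<Longrightarrow>
      R \<subseteq> node_set (Pc + Pa) \<Longrightarrow> forest_vars K \<subseteq> copied_vars f g (forest_vars Pc) \<Longrightarrow>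
      drv r m True (K + sdup f g R Pa) \<Longrightarrow> drv r m True (K + sdup f g R D)"
  shows "\<exists>F0. contraction_site r n (Pc + D) F0 i j S A t E R"
proof -
  let ?c = "Cut i (Exp j S) A t"
  show ?thesis
    using site
  proof cases
    case prems: site
    note P = prems(1) and A = prems(2,3) and sub = prems(4) and rt = prems(5) and lab = prems(6)
      and tr = prems(7) and ct = prems(8) and dv = prems(9)
    have "?c \<in># Pc + Pa" unfolding P by simp
    moreover have "?c \<notin># Pa" using Pa by blast
    ultimately have "?c \<in># Pc" by simp
    then obtain Pc0 where Pc: "Pc = Pc0 + {#?c#}" by (metis add_mset_add_single insert_DiffM)
    have P0: "P0 = Pc0 + Pa" using P Pc by simp
    have sub': "subnet (Pc + D) E" and rt': "roots (Pc + D) E = insert (tname t) R"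
      using track[OF sub tr] rt by simp_all
    have E: "E \<subseteq> node_set (Pc + Pa)" using sub unfolding subnet_def substructure_def by (elim conjE)
    have RE: "R \<subseteq> E"
    proof
      fix u assume "u \<in> R"
      then have "u \<in> roots (Pc + Pa) E" unfolding rt by simp
      then show "u \<in> E" by (simp add: roots_def)
    qed
    have "contraction_site r n (Pc + D) (Pc0 + D) i j S A t E R"
    proof (rule contraction_site.site)
      show "Pc + D = Pc0 + D + {#?c#}" using Pc by simp
    next
      fix u assume "u \<in> R"
      from lab[OF this] consider x where "labelled (Pc + Pa) u (LWire x)"
        | "labelled (Pc + Pa) u LTensor" | "labelled (Pc + Pa) u LCut" by blast
      then show "(\<exists>x. labelled (Pc + D) u (LWire x)) \<or> labelled (Pc + D) u LTensor \<or> labelled (Pc + D) u LCut"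
        by cases (use labels[of _ u] in blast)+
    next
      fix t' B assume "Tree t' B \<in># Pc + D"
      then consider "Tree t' B \<in># Pc" | "Tree t' B \<in># D" by auto
      then show "tname t' \<notin> E"
      proof cases
        case 1
        then show ?thesis using tr[of t' B] by simp
      next
        case 2
        from trees[OF this] show ?thesis
        proof (elim disjE exE conjE)
          assume "tname t' \<notin> node_set (Pc + Pa)"
          with E show ?thesis by blast
        next
          fix t'' B' assume "Tree t'' B' \<in># Pa" "tname t'' = tname t'"
          with tr[of t'' B'] show ?thesis by simp
        qed
      qed
    next
      fix k s B s' assume c: "Cut k s B s' \<in># Pc0 + D" "rank B = r"
      show "k \<notin> R \<and> (2 \<le> width s \<or> outer_names s \<inter> R = {})"
      proof (cases "Cut k s B s' \<in># Pc0")
        case True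
        then show ?thesis using ct[of k s B s'] c(2) P0 by simp
      next
        case False
        with c have "Cut k s B s' \<in># D" by simp
        from cuts[OF this c(2)] subset_trans[OF RE E] show ?thesis by blast
      qed
    next
      fix f g V S1 S2
      assume V: "forest_vars (Pc + D) \<subseteq> V" "fresh_copies f g V" and S: "S = S1 + S2" "S1 \<noteq> {#}" "S2 \<noteq> {#}"
      let ?c1 = "Cut () (Exp () (image_mset (map_wit (\<lambda>_. ()) (\<lambda>x. x)) S1)) A (map_tree (\<lambda>_. ()) f t)"
        and ?c2 = "Cut () (Exp () (image_mset (map_wit (\<lambda>_. ()) (\<lambda>x. x)) S2)) A (map_tree (\<lambda>_. ()) g t)"
      have "forest_vars (Pc + Pa) \<subseteq> V" by (rule subset_trans[OF vars V(1)])
      from dv[OF this V(2) S] have d: "drv r (size S1) True ((sdup f g R Pc0 + {#?c1, ?c2#}) + sdup f g R Pa)"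
        unfolding P0 by (simp add: ac_simps)
      have K: "forest_vars (sdup f g R Pc0 + {#?c1, ?c2#}) \<subseteq> copied_vars f g (forest_vars Pc)"
      proof -
        have 1: "forest_vars (sdup f g R Pc0) \<subseteq> copied_vars f g (forest_vars Pc0)"
          by (rule sdup_vars) (use nowit Pc in simp)
        have 2: "forest_vars {#?c1, ?c2#} \<subseteq> copied_vars f g (root_vars ?c)"
          using S by (auto intro: copied_varsI)
        show ?thesis using 1 2 unfolding Pc forest_vars_simps copied_vars_Un by blast
      qed
      from rule[OF V subset_trans[OF RE E] K d]
      show "drv r (size S1) True (sdup f g R (Pc0 + D) + {#?c1, ?c2#})"
        by (simp add: ac_simps)
    qed (use A sub' rt' in simp_all)
    then show ?thesis by blast
  qed
qed

lemma subnet_track_binary: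
  fixes P Q F :: "('p, 'i, 'v) gen_forest"
  assumes "distinctly_named F" "distinctly_named P" "distinctly_named Q"
    and "nodes F = nodes P \<union> (nodes Q \<union> Y)"
    and PQ: "node_set P \<inter> node_set Q = {}" "forest_vars P \<inter> forest_vars Q = {}"
    and Y: "\<And>y. y \<in> Y \<Longrightarrow> node_name y \<notin> node_set P \<and> (\<forall>x. node_label y \<noteq> LWire x) \<and> succs y \<inter> node_set P \<subseteq> {u}"
    and u: "u \<in> node_set P \<Longrightarrow> u \<in> rname ` set_mset P"
    and "subnet P E"
  shows "subnet F E \<and> roots F E = roots P E"
proof (rule subnet_track_above[OF assms(1,2,4)])
  have Q: "succs n \<inter> node_set P = {}" if "n \<in> nodes Q" for n
    using succ_edge_nodes[OF assms(3)] that PQ(1) by (auto simp: succ_edges_def)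
  show "\<exists>e. \<forall>y\<in>nodes Q \<union> Y. \<forall>a\<in>succs y \<inter> node_set P. (is_switched y \<longrightarrow> a = \<sigma> (node_name y)) \<longrightarrow> a = e" for \<sigma>
    by (rule exI[of _ u]) (use Q Y in blast)
  show "unlinked (nodes P) (nodes Q \<union> Y)"
    using unlinked_forests[OF PQ(2)] Y by (auto simp: unlinked_def)
  show "a \<in> rname ` set_mset P" if "y \<in> nodes Q \<union> Y" "a \<in> succs y" "a \<in> node_set P" for y a
    using that Q Y u by blast
  show "node_name y \<notin> node_set P" if "y \<in> nodes Q \<union> Y" for y
    using that Y[of y] PQ(1) unfolding node_set_def by blast
qed fact

lemma outer_names_nodes:
  fixes t :: "('i, 'v) tree" and w :: "('i, 'v) wit"
  shows "outer_names t \<subseteq> node_name ` set_mset (tree_nodes t)" and "True"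
proof (induction t and w)
  case (Exp i ws)
  have "wname w \<in> node_name ` set_mset (tree_nodes (Exp i ws))" if "w \<in># ws" for w
  proof -
    have "set_mset (wit_nodes w) \<subseteq> set_mset (tree_nodes (Exp i ws))" using that by auto
    with name_in_nodes(2)[of w] show ?thesis by blast
  qed
  then show ?case by auto
qed auto

lemma root_nodes_subset: "c \<in># F \<Longrightarrow> set_mset (root_nodes c) \<subseteq> nodes F"
  by (auto simp: forest_nodes_def)

lemma root_names_subset: "c \<in># F \<Longrightarrow> node_name ` set_mset (root_nodes c) \<subseteq> node_set F"
  unfolding node_set_def by (intro image_mono root_nodes_subset)

lemma labelledI: "n \<in> nodes F \<Longrightarrow> labelled F (node_name n) (node_label n)"
  by (auto simp: labelled_def)

lemma tree_root_label: "\<exists>n\<in>#tree_nodes t. node_name n = tname t \<and> node_label n \<in> {LUnit, LExp, LVee, LWeak}"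
  by (cases t) auto

lemma wit_root_label:
  "\<exists>n\<in>#wit_nodes w. node_name n = wname w \<and> ((\<exists>x. node_label n = LWire x) \<or> node_label n = LTensor)"
  by (cases w) auto

lemma fresh_copies_mono: "fresh_copies f g V \<Longrightarrow> U \<subseteq> V \<Longrightarrow> inj_on f U \<and> inj_on g U"
  by (auto simp: fresh_copies_def intro: inj_on_subset)

lemma nd_no_witness: "nd r n e F \<Longrightarrow> \<forall>w T. Wit w T \<notin># F"
  using drv_no_witness[OF nd_drv] by blast

lemma drv_strip: "drv r n e F \<Longrightarrow> drv r n e (strip F)"
  by (rule drv_map) auto

lemma contraction_site_base:
  fixes F1 G :: "('p, 'i, 'v) gen_forest"
  assumes F1: "nd r n b (F1 + {#Tree s A#})" and G: "nd r n c (G + {#Tree t (dual A)#})"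
    and A: "positive A" "rank A = r" and w: "width s = n" and lr: "lacks_rank r G"
    and disj: "forest_vars (F1 + {#Tree s A#}) \<inter> forest_vars (G + {#Tree t (dual A)#}) = {}"
    and named: "distinctly_named (F1 + G + {#Cut i s A t#})"
  shows "\<exists>F0 k j S C u E R. contraction_site r n (F1 + G + {#Cut i s A t#}) F0 k j S C u E R"
proof -
  let ?F = "F1 + G + {#Cut i s A t#}" and ?P = "G + {#Tree t (dual A)#}" and ?Q = "F1 + {#Tree s A#}"
  fix T :: "'p wit_type"
  let ?PP = "{#Tree t (dual A)#} + peel_forest T G"
  have dP: "distinctly_named ?P" and dQ: "distinctly_named ?Q"
    by (rule nd_named[OF G], rule nd_named[OF F1])
  have PQ: "node_set ?P \<inter> node_set ?Q = {}" and iP: "i \<notin> node_set ?P"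
    using named by (auto simp: node_set_def)
  have "distinctly_named ({#Tree t (dual A)#} + G)" using dP by simp
  from tracks_peel_forest[OF this, of T] have tr: "tracks ?PP ?P" by simp
  then have dPP: "distinctly_named ?PP" and sub: "nodes ?PP \<subseteq> nodes ?P"
    and lift: "\<And>E. subnet ?PP E \<Longrightarrow> subnet ?P E \<and> roots ?P E = roots ?PP E"
    unfolding tracks_def by blast+
  define E where "E = node_set ?PP"
  define R where "R = rname ` set_mset (peel_forest T G)"
  have "subnet ?PP E" "roots ?PP E = insert (tname t) R"
    using whole_subnet[OF dPP] unfolding E_def R_def by auto
  with lift[of E] have sP: "subnet ?P E" and rP: "roots ?P E = insert (tname t) R" by auto
  have EP: "E \<subseteq> node_set ?P" using sP unfolding subnet_def substructure_def by (elim conjE)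
  have RE: "R \<subseteq> E"
  proof
    fix u assume "u \<in> R"
    then have "u \<in> roots ?P E" unfolding rP by simp
    then show "u \<in> E" by (simp add: roots_def)
  qed
  have "subnet ?F E \<and> roots ?F E = roots ?P E"
  proof (rule subnet_track_binary[OF named dP dQ, of "{Node i LCut {tname s, tname t}}" "tname t"])
    show "nodes ?F = nodes ?P \<union> (nodes ?Q \<union> {Node i LCut {tname s, tname t}})" by auto
    have "tname s \<notin> node_set ?P" using PQ tname_node_set[of s A ?Q] by auto
    then show "node_name y \<notin> node_set ?P \<and> (\<forall>x. node_label y \<noteq> LWire x) \<and> succs y \<inter> node_set ?P \<subseteq> {tname t}"
      if "y \<in> {Node i LCut {tname s, tname t}}" for y using that iP by auto
  qed (use disj PQ sP in auto)
  then have sF: "subnet ?F E" and rF: "roots ?F E = insert (tname t) R" using rP by auto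
  have nF: "nodes ?P \<subseteq> nodes ?F" by auto
  have lab: "(\<exists>x. labelled ?P u (LWire x)) \<or> labelled ?P u LTensor \<or> labelled ?P u LCut" if "u \<in> R" for u
  proof -
    obtain d where d: "d \<in># peel_forest T G" "u = rname d" using \<open>u \<in> R\<close> unfolding R_def by blast
    have dn: "set_mset (root_nodes d) \<subseteq> nodes ?P"
    proof -
      have "set_mset (root_nodes d) \<subseteq> nodes ?PP" using d(1) by (auto simp: forest_nodes_def)
      with sub show ?thesis by blast
    qed
    from peel_forest_roots[OF d(1)] consider w T' where "d = Wit w T'" | k s' B t' where "d = Cut k s' B t'"
      by blast
    then show ?thesis
    proof cases
      case 1
      obtain m where m: "m \<in># wit_nodes w" "node_name m = wname w"
        "(\<exists>x. node_label m = LWire x) \<or> node_label m = LTensor" using wit_root_label by blast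
      then have "m \<in> nodes ?P" using dn 1 by (auto simp del: forest_nodes_simps)
      from labelledI[OF this] m d(2) 1 show ?thesis by auto
    next
      case 2
      then have "Node k LCut {tname s', tname t'} \<in> nodes ?P" using dn by (auto simp del: forest_nodes_simps)
      from labelledI[OF this] d(2) 2 show ?thesis by auto
    qed
  qed
  from drv_typed[OF nd_drv[OF F1]] obtain \<Theta> where ty: "tree_typed \<Theta> s A" by auto
  then obtain j S T' where s: "s = Exp j S" and T': "A = underlying T'"
    using A(1) by (cases s) (auto elim: typed_elims)
  have "contraction_site r n ?F (F1 + G) i j S A t E R"
  proof (rule contraction_site.site)
    show "?F = F1 + G + {#Cut i (Exp j S) A t#}" using s by simp
    show "rank A = r" "subnet ?F E" "roots ?F E = insert (tname t) R" by fact+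
    show "size S = n" using w s by simp
  next
    fix u assume "u \<in> R"
    from lab[OF this] labelled_mono[OF nF, of u]
    show "(\<exists>x. labelled ?F u (LWire x)) \<or> labelled ?F u LTensor \<or> labelled ?F u LCut" by blast
  next
    fix t' B assume "Tree t' B \<in># ?F"
    then consider "Tree t' B \<in># F1" | "Tree t' B \<in># G" by auto
    then show "tname t' \<notin> E"
    proof cases
      case 1
      then have "tname t' \<in> node_set ?Q" using tname_node_set[of t' B ?Q] by simp
      with PQ EP show ?thesis by blast
    next
      case 2
      then have tP: "Tree t' B \<in># ?P" by simp
      have "tname t' \<in> node_set G" using tname_node_set[OF 2] .
      then have ne: "tname t' \<noteq> tname t" using dP name_in_nodes(1)[of t] by auto
      show ?thesis
      proof
        assume "tname t' \<in> E"
        moreover have "(v, tname t') \<notin> succ_edges ?P" for v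
          using root_no_predecessor[OF dP tP, of v] by simp
        ultimately have "tname t' \<in> roots ?P E" by (simp add: roots_def)
        with rP ne have "tname t' \<in> R" by blast
        note l = lab[OF this]
        obtain m where m: "m \<in># tree_nodes t'" "node_name m = tname t'"
          "node_label m \<in> {LUnit, LExp, LVee, LWeak}" using tree_root_label by blast
        have "m \<in> nodes ?P" using m(1) root_nodes_subset[OF tP] by auto
        from labelledI[OF this] m have l': "labelled ?P (tname t') (node_label m)"
          "node_label m \<in> {LUnit, LExp, LVee, LWeak}" by auto
        from l obtain l'' where l'': "labelled ?P (tname t') l''"
          "(\<exists>x. l'' = LWire x) \<or> l'' = LTensor \<or> l'' = LCut" by blast
        from unique_label[OF dP l'(1) l''(1)] l''(2) l'(2) show False by auto
      qed
    qed
  next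
    fix k s' B t' assume c: "Cut k s' B t' \<in># F1 + G" "rank B = r"
    then have "Cut k s' B t' \<in># F1" using lr by (auto simp: lacks_rank_def)
    then have "Cut k s' B t' \<in># ?Q" by simp
    from root_names_subset[OF this] have "k \<in> node_set ?Q" "node_name ` set_mset (tree_nodes s') \<subseteq> node_set ?Q"
      by (simp_all add: image_Un)
    then have "k \<in> node_set ?Q" "outer_names s' \<subseteq> node_set ?Q"
      using outer_names_nodes(1)[of s'] by (blast, blast)
    with PQ EP RE show "k \<notin> R \<and> (2 \<le> width s' \<or> outer_names s' \<inter> R = {})" by blast
  next
    fix f g V S1 S2
    assume V: "forest_vars ?F \<subseteq> V" and fr: "fresh_copies f g V" and S: "S = S1 + S2" "S1 \<noteq> {#}" "S2 \<noteq> {#}"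
    let ?S = "image_mset (map_wit (\<lambda>_. ()) (\<lambda>x. x)) :: ('i, 'v) wit multiset \<Rightarrow> (unit, 'v) wit multiset"
    let ?m = "size S1"
    let ?Gf = "image_mset (rename (\<lambda>_. ()) f) G" and ?tf = "map_tree (\<lambda>_. ()) f t"
    let ?Gg = "image_mset (rename (\<lambda>_. ()) g) G" and ?tg = "map_tree (\<lambda>_. ()) g t"
    have VP: "forest_vars ?P \<subseteq> V" and VQ: "forest_vars ?Q \<subseteq> V" using V by auto
    have fg: "f ` V \<inter> V = {}" "g ` V \<inter> V = {}" "f ` V \<inter> g ` V = {}" using fr by (auto simp: fresh_copies_def)
    have inj: "inj_on f (forest_vars ?P)" "inj_on g (forest_vars ?P)"
      using fresh_copies_mono[OF fr VP] by auto
    have df: "drv r ?m False (?Gf + {#Tree ?tf (dual A)#})" and dg: "drv r ?m False (?Gg + {#Tree ?tg (dual A)#})"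
      using drv_map[OF drv_forget_flag[OF nd_drv[OF G]] inj(1), of r ?m "\<lambda>_. ()"]
        drv_map[OF drv_forget_flag[OF nd_drv[OF G]] inj(2), of r ?m "\<lambda>_. ()"] by auto
    have "drv r ?m False (strip F1 + {#Tree (Exp () (?S S1 + ?S S2)) (underlying T')#})"
      using drv_strip[OF drv_forget_flag[OF nd_drv[OF F1]], of r ?m] s T' S by simp
    from drv_partition_sum[OF this] S T'
    have "drv r ?m False ((strip F1 + {#Tree (Exp () (?S S1)) A#}) + {#Tree (Exp () (?S S2)) A#})"
      by (simp add: add_mset_commute)
    note d1 = drv.cut[OF this dg A(1), of False "()"]
    have Q: "forest_vars (strip F1 + {#Tree (Exp () (?S S1)) A#} + {#Tree (Exp () (?S S2)) A#}) \<subseteq> V"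
      using VQ s S by simp
    have Pg: "forest_vars (?Gg + {#Tree ?tg (dual A)#}) \<subseteq> g ` V" and Pf: "forest_vars (?Gf + {#Tree ?tf (dual A)#}) \<subseteq> f ` V"
      using VP by auto
    have "drv r ?m False (strip F1 + {#Tree (Exp () (?S S1)) A#} + ?Gg + {#Cut () (Exp () (?S S2)) A ?tg#})"
      by (rule d1) (use Q Pg fg(2) in blast, simp)
    then have "drv r ?m False ((strip F1 + ?Gg + {#Cut () (Exp () (?S S2)) A ?tg#}) + {#Tree (Exp () (?S S1)) A#})"
      by (simp add: ac_simps add_mset_commute)
    note d2 = drv.cut[OF this df A(1), of True "()"]
    have Q2: "forest_vars ((strip F1 + ?Gg + {#Cut () (Exp () (?S S2)) A ?tg#}) + {#Tree (Exp () (?S S1)) A#}) \<subseteq> V \<union> g ` V"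
      using Q Pg by auto
    have "drv r ?m True (strip F1 + ?Gg + {#Cut () (Exp () (?S S2)) A ?tg#} + ?Gf + {#Cut () (Exp () (?S S1)) A ?tf#})"
      by (rule d2) (use Q2 Pf fg in blast, use A lr in simp)
    then have "drv r ?m True ((strip F1 + {#Cut () (Exp () (?S S1)) A ?tf, Cut () (Exp () (?S S2)) A ?tg#}) + ?Gf + ?Gg)"
      by (simp add: ac_simps add_mset_commute)
    from drv_merge_forests[OF this, of T R]
    have "drv r ?m True ((strip F1 + {#Cut () (Exp () (?S S1)) A ?tf, Cut () (Exp () (?S S2)) A ?tg#}) + sdup f g R G)"
      using nd_no_witness[OF G] unfolding R_def by simp
    moreover have "node_set ?Q \<inter> R = {}" using PQ RE EP by blast
    then have "sdup f g R F1 = strip F1"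
      using sdup_untouched[of F1 R f g] nd_no_witness[OF F1] by (simp add: Int_Un_distrib2)
    ultimately show "drv r ?m True (sdup f g R (F1 + G) +
       {#Cut () (Exp () (?S S1)) A ?tf, Cut () (Exp () (?S S2)) A ?tg#})"
      by (simp add: ac_simps)
  qed
  then show ?thesis by blast
qed

lemma names_apart:
  assumes "c \<in># G" "node_set G \<inter> N = {}"
  shows "\<And>t A. c = Tree t A \<Longrightarrow> tname t \<notin> N"
    and "\<And>k s B s'. c = Cut k s B s' \<Longrightarrow> k \<notin> N \<and> outer_names s \<inter> N = {}"
proof -
  show "tname t \<notin> N" if "c = Tree t A" for t A
    using tname_node_set[of t A G] assms that by blast
  show "k \<notin> N \<and> outer_names s \<inter> N = {}" if "c = Cut k s B s'" for k s B s'
  proof -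
    from root_names_subset[OF assms(1)] that have "k \<in> node_set G" "node_name ` set_mset (tree_nodes s) \<subseteq> node_set G"
      by (simp_all add: image_Un)
    then show ?thesis using outer_names_nodes(1)[of s] assms(2) by blast
  qed
qed

lemma contraction_site_mix:
  fixes F G :: "('p, 'i, 'v) gen_forest"
  assumes site: "contraction_site r n F F0 i j S A t E R"
    and F: "nd r n b F" and G: "nd r n c G" and disj: "forest_vars F \<inter> forest_vars G = {}"
    and named: "distinctly_named (F + G)"
  shows "\<exists>F0. contraction_site r n (F + G) F0 i j S A t E R"
proof -
  from site have "contraction_site r n (F + {#}) F0 i j S A t E R" by simp
  then show ?thesis
  proof (rule contraction_site_extend)
    show "\<forall>w T. Wit w T \<notin># F" by (rule nd_no_witness[OF F])
    assume "subnet (F + {#}) E"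
    moreover obtain d where "d \<in># F" using drv_nonempty[OF nd_drv[OF F]] by blast
    ultimately show "subnet (F + G) E \<and> roots (F + G) E = roots (F + {#}) E"
      using subnet_track_binary[of "F + G" F G "{}" "rname d" E] named disj by simp
  next
    fix u l assume "labelled (F + {#}) u l"
    then show "labelled (F + G) u l" using labelled_mono[of F "F + G" u l] by simp
  next
    fix t A assume "Tree t A \<in># G"
    from names_apart(1)[OF this, of "node_set F"] named
    show "tname t \<notin> node_set (F + {#}) \<or> (\<exists>t' B. Tree t' B \<in># {#} \<and> tname t' = tname t)"
      by (simp add: Int_commute)
  next
    fix k s B s' assume "Cut k s B s' \<in># G"
    from names_apart(2)[OF this, of "node_set F"] named
    show "k \<notin> node_set (F + {#}) \<and> (2 \<le> width s \<or> outer_names s \<inter> node_set (F + {#}) = {})"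
      by (simp add: Int_commute)
  next
    fix f g V R m and K :: "('p, unit, 'v) gen_forest"
    assume V: "forest_vars (F + G) \<subseteq> V" "fresh_copies f g V" and R: "R \<subseteq> node_set (F + {#})"
      and K: "forest_vars K \<subseteq> copied_vars f g (forest_vars F)" "drv r m True (K + sdup f g R {#})"
    have "copied_vars f g (forest_vars F) \<inter> forest_vars G = {}"
      by (rule copied_vars_disjoint[OF V(2)]) (use V(1) disj in auto)
    then have "forest_vars K \<inter> forest_vars (strip G) = {}" using K(1) by auto
    with drv.mix[of r m True K False "strip G" True] K(2) drv_strip[OF drv_forget_flag[OF nd_drv[OF G], of r m]]
    have "drv r m True (K + strip G)" by simp
    moreover have "sdup f g R G = strip G"
      by (rule sdup_untouched[OF nd_no_witness[OF G]]) (use R named in auto)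
    ultimately show "drv r m True (K + sdup f g R G)" by simp
  qed auto
qed

lemma named_unary_tracks:
  fixes F :: "('p, 'i, 'v) gen_forest"
  assumes "named_unary P c" "distinctly_named (F + P)" "distinctly_named (F + {#c#})"
    and E: "subnet (F + P) E" "\<And>t A. Tree t A \<in># F + P \<Longrightarrow> tname t \<notin> E"
  shows "subnet (F + {#c#}) E \<and> roots (F + {#c#}) E = roots (F + P) E"
  using assms(1)
proof cases
  case (vee t A s B i)
  then show ?thesis using tracks_vee[of F i t s "Disj A B" A B] assms(3) E(1) by (simp add: tracks_def)
next
  case (veeL t A i j B)
  then show ?thesis using tracks_weak[of F _ "Disj A B" i t j A] assms(3) E(1) by (simp add: tracks_def)
next
  case (veeR t B i j A)
  then show ?thesis using tracks_weak[of F _ "Disj A B" i t j B] assms(3) E(1) by (simp add: tracks_def)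
next
  case (contraction ws vs k T j)
  define K where "K = nodes F \<union> set_mset (\<Sum>\<^sub># (image_mset wit_nodes (ws + vs)))"
  note core = contraction_core[OF assms(2)[unfolded contraction(1)], folded K_def]
  have "E \<subseteq> node_set (F + P)" using E(1) unfolding subnet_def substructure_def by (elim conjE)
  moreover have "node_set (F + P) = node_name ` K \<union> {k, j}"
    unfolding node_set_def contraction(1) core(4) by auto
  moreover have "k \<notin> E" "j \<notin> E"
    using E(2)[of "Exp k ws" "underlying T"] E(2)[of "Exp j vs" "underlying T"] contraction(1) by auto
  ultimately have EK: "E \<subseteq> node_name ` K" by blast
  show ?thesis
  proof (rule subnet_track[OF assms(3,2), of K "{Node k LExp (wname ` set_mset (ws + vs))}"
        "{Node k LExp (wname ` set_mset ws), Node j LExp (wname ` set_mset vs)}" "node_name ` K"])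
    show "nodes (F + {#c#}) = K \<union> {Node k LExp (wname ` set_mset (ws + vs))}"
      unfolding contraction(2) by (rule core(5))
    show "nodes (F + P) = K \<union> {Node k LExp (wname ` set_mset ws), Node j LExp (wname ` set_mset vs)}"
      unfolding contraction(1) by (rule core(4))
    show "\<And>n. n \<in> K \<Longrightarrow> succs n \<subseteq> node_name ` K" using core(1) by blast
    show "unlinked K {Node k LExp (wname ` set_mset (ws + vs))}" by (simp add: unlinked_def)
    show "\<exists>e. \<forall>y\<in>{Node k LExp (wname ` set_mset (ws + vs)) :: ('i, 'v) node}. \<forall>a\<in>succs y \<inter> node_name ` K.
      (is_switched y \<longrightarrow> a = \<sigma> (node_name y)) \<longrightarrow> a = e" for \<sigma> by auto
    fix n y assume n: "n \<in> K" "node_label n = LStar" and y: "y \<in> {Node k LExp (wname ` set_mset (ws + vs)) :: ('i, 'v) node}"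
    show "node_name n \<notin> succs y"
    proof
      assume "node_name n \<in> succs y"
      then obtain w where w: "w \<in># ws + vs" "node_name n = wname w" using y by auto
      obtain m where m: "m \<in># wit_nodes w" "node_name m = wname w"
        "(\<exists>x. node_label m = LWire x) \<or> node_label m = LTensor" using wit_root_label by blast
      have "m \<in> K" unfolding K_def using m(1) w(1) by auto
      then have "m \<in> nodes (F + P)" "n \<in> nodes (F + P)" using n(1) unfolding contraction(1) core(4) by auto
      from unique_node[OF assms(2) this] m w n show False by auto
    qed
  qed (use core(2,3) contraction EK E(1) in auto)
qed

lemma named_unary_labels:
  assumes "named_unary P c" "distinctly_named (F + P)" "l \<noteq> LExp" "labelled (F + P) u l"
  shows "labelled (F + {#c#}) u l"
proof -
  from assms(4) obtain n where n: "n \<in> nodes (F + P)" "node_name n = u" "node_label n = l"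
    by (auto simp: labelled_def)
  have "n \<in> nodes (F + {#c#})" using assms(1)
  proof cases
    case (contraction ws vs k T j)
    then show ?thesis using n assms(3) by auto
  qed (use n in auto)
  with n show ?thesis by (auto simp: labelled_def)
qed

lemma contraction_site_unary:
  assumes site: "contraction_site r n (F + P) F0 i j S A t E R"
    and F: "nd r n e (F + P)" and rule: "named_unary P c" and named: "distinctly_named (F + {#c#})"
  shows "\<exists>F0. contraction_site r n (F + {#c#}) F0 i j S A t E R"
  using site
proof (rule contraction_site_extend)
  show "\<exists>t A. c' = Tree t A" if "c' \<in># P" for c'
    using rule that by (induction rule: named_unary.induct) auto
  show "\<forall>w T. Wit w T \<notin># F" using nd_no_witness[OF F] by simp
  show "forest_vars (F + P) \<subseteq> forest_vars (F + {#c#})"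
    using unary_vars[OF named_unary_unary[OF rule]] by simp
  show "subnet (F + {#c#}) E \<and> roots (F + {#c#}) E = roots (F + P) E"
    if "subnet (F + P) E" "\<And>t A. Tree t A \<in># F + P \<Longrightarrow> tname t \<notin> E"
    by (rule named_unary_tracks[OF rule nd_named[OF F] named that])
  show "labelled (F + {#c#}) u l" if "l \<noteq> LExp" "labelled (F + P) u l" for u l
    by (rule named_unary_labels[OF rule nd_named[OF F] that])
  show "tname t \<notin> node_set (F + P) \<or> (\<exists>t' B. Tree t' B \<in># P \<and> tname t' = tname t)" if "Tree t A \<in># {#c#}" for t A
    using rule that named by cases (auto simp: node_set_def)
  show "k \<notin> node_set (F + P) \<and> (2 \<le> width s \<or> outer_names s \<inter> node_set (F + P) = {})"
    if "Cut k s B s' \<in># {#c#}" for k s B s'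
    using that unary_concl_tree[OF named_unary_unary[OF rule]] by auto
  show "drv r m True (K + sdup f g R {#c#})" if "drv r m True (K + sdup f g R P)" for f g R K m
    using dup_unary[OF rule, of f g R] drv.un[OF that] by auto
qed


lemma contraction_site_tensor_left:
  fixes F G :: "('p, 'i, 'v) gen_forest"
  assumes site: "contraction_site r n (F + {#Tree s A#}) F0 i j S C u E R"
    and F: "nd r n b (F + {#Tree s A#})" and G: "nd r n c (G + {#Tree t B#})"
    and disj: "forest_vars (F + {#Tree s A#}) \<inter> forest_vars (G + {#Tree t B#}) = {}"
    and named: "distinctly_named (F + G + {#Tree (Exp l {#Tensor k s t#}) (Conj A B)#})"
  shows "\<exists>F0. contraction_site r n (F + G + {#Tree (Exp l {#Tensor k s t#}) (Conj A B)#}) F0 i j S C u E R"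
proof -
  let ?P = "F + {#Tree s A#}" and ?Q = "G + {#Tree t B#}" and ?D = "G + {#Tree (Exp l {#Tensor k s t#}) (Conj A B)#}"
  have PQ: "node_set ?P \<inter> node_set ?Q = {}" and kP: "k \<notin> node_set ?P" "l \<notin> node_set ?P"
    using named by (auto simp: node_set_def)
  have otP: "tname t \<notin> node_set ?P" using PQ tname_node_set[of t "B" ?Q] by auto
  have eq: "F + G + {#Tree (Exp l {#Tensor k s t#}) (Conj A B)#} = F + ?D" by (simp add: ac_simps)
  from site show ?thesis unfolding eq
  proof (rule contraction_site_extend)
    show "\<exists>t A. d = Tree t A" if "d \<in># {#Tree s A#}" for d using that by auto
    show "\<forall>w T. Wit w T \<notin># F" using nd_no_witness[OF F] by simp
    show "forest_vars ?P \<subseteq> forest_vars (F + ?D)" by auto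
    assume E: "subnet ?P E"
    show "subnet (F + ?D) E \<and> roots (F + ?D) E = roots ?P E"
    proof (rule subnet_track_binary[OF _ nd_named[OF F] nd_named[OF G], of _ "{Node l LExp {k}, Node k LTensor {tname s, tname t}}" "tname s"])
      show "distinctly_named (F + ?D)" using named unfolding eq .
      show "nodes (F + ?D) = nodes ?P \<union> (nodes ?Q \<union> {Node l LExp {k}, Node k LTensor {tname s, tname t}})" by auto
      show "node_name y \<notin> node_set ?P \<and> (\<forall>x. node_label y \<noteq> LWire x) \<and> succs y \<inter> node_set ?P \<subseteq> {tname s}"
        if "y \<in> {Node l LExp {k}, Node k LTensor {tname s, tname t}}" for y using that by (elim insertE emptyE) (use kP otP in \<open>simp_all add: Int_insert_left\<close>)
    qed (use disj PQ E in auto)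
  next
    fix u l' assume "labelled ?P u l'"
    then show "labelled (F + ?D) u l'" by (rule labelled_mono[rotated]) auto
  next
    fix t' B' assume "Tree t' B' \<in># ?D"
    then have "tname t' \<notin> node_set ?P"
      using names_apart(1)[of "Tree t' B'" G "node_set ?P" t' B'] kP PQ by (auto simp: Int_commute)
    then show "tname t' \<notin> node_set ?P \<or> (\<exists>t'' C. Tree t'' C \<in># {#Tree s A#} \<and> tname t'' = tname t')" by (rule disjI1)
  next
    fix k' s' B' s'' assume c: "Cut k' s' B' s'' \<in># ?D" "rank B' = r"
    show "k' \<notin> node_set ?P \<and> (2 \<le> width s' \<or> outer_names s' \<inter> node_set ?P = {})"
    proof (cases "Cut k' s' B' s'' \<in># G")
      case True
      from names_apart(2)[OF this, of "node_set ?P" k' s' B' s''] PQ show ?thesis by (auto simp: Int_commute)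
    next
      case False
      with c kP show ?thesis by auto
    qed
  next
    fix f g V R m and K :: "('p, unit, 'v) gen_forest"
    assume V: "forest_vars (F + ?D) \<subseteq> V" "fresh_copies f g V" and R: "R \<subseteq> node_set ?P"
      and K: "forest_vars K \<subseteq> copied_vars f g (forest_vars F)" "drv r m True (K + sdup f g R {#Tree s A#})"
    have QR: "node_set ?Q \<inter> R = {}" using R PQ by blast
      have kR: "k \<notin> R" using R kP by blast
    have act: "drv r m True (K + {#Tree (dup_tree f g R s) A#})" using K(2) by simp
      have "tree_replace (duplicate_wit f g R) t = t"
        by (rule dup_untouched(1)) (use QR in \<open>simp add: Int_Un_distrib2\<close>)
      note untouched_t = this
      then have "map_tree (\<lambda>_. ()) (\<lambda>x. x) t = dup_tree f g R t" by simp
      with drv_strip[OF drv_forget_flag[OF nd_drv[OF G], of r m]] sdup_untouched[of G R f g] nd_no_witness[OF G] QR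
      have oth: "drv r m False (sdup f g R G + {#Tree (dup_tree f g R t) B#})"
        by (simp add: Int_Un_distrib2)
    have "copied_vars f g (forest_vars ?P) \<inter> forest_vars ?Q = {}"
      by (rule copied_vars_disjoint[OF V(2)]) (use V(1) disj in auto)
    moreover have "forest_vars (K + {#Tree (dup_tree f g R s) A#}) \<subseteq> copied_vars f g (forest_vars ?P)"
      using K(1) dup_tree_vars[of f g R s] by (simp, blast)
    moreover have "forest_vars (sdup f g R G + {#Tree (dup_tree f g R t) B#}) = forest_vars ?Q"
      using sdup_untouched[of G R f g] nd_no_witness[OF G] QR untouched_t by (simp add: Int_Un_distrib2)
    ultimately have vd: "forest_vars (K + {#Tree (dup_tree f g R s) A#}) \<inter>
        forest_vars (sdup f g R G + {#Tree (dup_tree f g R t) B#}) = {}" by blast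
    show "drv r m True (K + sdup f g R ?D)"
      using drv.tensor[OF act oth, of True "()" "()"] vd kR by (simp add: ac_simps duplicate_wit_def Int_commute)
  qed
qed

lemma contraction_site_tensor_right:
  fixes F G :: "('p, 'i, 'v) gen_forest"
  assumes site: "contraction_site r n (G + {#Tree t B#}) F0 i j S C u E R"
    and F: "nd r n b (F + {#Tree s A#})" and G: "nd r n c (G + {#Tree t B#})"
    and disj: "forest_vars (F + {#Tree s A#}) \<inter> forest_vars (G + {#Tree t B#}) = {}"
    and named: "distinctly_named (F + G + {#Tree (Exp l {#Tensor k s t#}) (Conj A B)#})"
  shows "\<exists>F0. contraction_site r n (F + G + {#Tree (Exp l {#Tensor k s t#}) (Conj A B)#}) F0 i j S C u E R"
proof -
  let ?P = "G + {#Tree t B#}" and ?Q = "F + {#Tree s A#}" and ?D = "F + {#Tree (Exp l {#Tensor k s t#}) (Conj A B)#}"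
  have PQ: "node_set ?P \<inter> node_set ?Q = {}" and kP: "k \<notin> node_set ?P" "l \<notin> node_set ?P"
    using named by (auto simp: node_set_def)
  have otP: "tname s \<notin> node_set ?P" using PQ tname_node_set[of s "A" ?Q] by auto
  have eq: "F + G + {#Tree (Exp l {#Tensor k s t#}) (Conj A B)#} = G + ?D" by (simp add: ac_simps)
  from site show ?thesis unfolding eq
  proof (rule contraction_site_extend)
    show "\<exists>t A. d = Tree t A" if "d \<in># {#Tree t B#}" for d using that by auto
    show "\<forall>w T. Wit w T \<notin># G" using nd_no_witness[OF G] by simp
    show "forest_vars ?P \<subseteq> forest_vars (G + ?D)" by auto
    assume E: "subnet ?P E"
    show "subnet (G + ?D) E \<and> roots (G + ?D) E = roots ?P E"
    proof (rule subnet_track_binary[OF _ nd_named[OF G] nd_named[OF F], of _ "{Node l LExp {k}, Node k LTensor {tname s, tname t}}" "tname t"])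
      show "distinctly_named (G + ?D)" using named unfolding eq .
      show "nodes (G + ?D) = nodes ?P \<union> (nodes ?Q \<union> {Node l LExp {k}, Node k LTensor {tname s, tname t}})" by auto
      show "node_name y \<notin> node_set ?P \<and> (\<forall>x. node_label y \<noteq> LWire x) \<and> succs y \<inter> node_set ?P \<subseteq> {tname t}"
        if "y \<in> {Node l LExp {k}, Node k LTensor {tname s, tname t}}" for y using that by (elim insertE emptyE) (use kP otP in \<open>simp_all add: Int_insert_left\<close>)
    qed (use disj PQ E in auto)
  next
    fix u l' assume "labelled ?P u l'"
    then show "labelled (G + ?D) u l'" by (rule labelled_mono[rotated]) auto
  next
    fix t' B' assume "Tree t' B' \<in># ?D"
    then have "tname t' \<notin> node_set ?P"
      using names_apart(1)[of "Tree t' B'" F "node_set ?P" t' B'] kP PQ by (auto simp: Int_commute)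
    then show "tname t' \<notin> node_set ?P \<or> (\<exists>t'' C. Tree t'' C \<in># {#Tree t B#} \<and> tname t'' = tname t')" by (rule disjI1)
  next
    fix k' s' B' s'' assume c: "Cut k' s' B' s'' \<in># ?D" "rank B' = r"
    show "k' \<notin> node_set ?P \<and> (2 \<le> width s' \<or> outer_names s' \<inter> node_set ?P = {})"
    proof (cases "Cut k' s' B' s'' \<in># F")
      case True
      from names_apart(2)[OF this, of "node_set ?P" k' s' B' s''] PQ show ?thesis by (auto simp: Int_commute)
    next
      case False
      with c kP show ?thesis by auto
    qed
  next
    fix f g V R m and K :: "('p, unit, 'v) gen_forest"
    assume V: "forest_vars (G + ?D) \<subseteq> V" "fresh_copies f g V" and R: "R \<subseteq> node_set ?P"
      and K: "forest_vars K \<subseteq> copied_vars f g (forest_vars G)" "drv r m True (K + sdup f g R {#Tree t B#})"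
    have QR: "node_set ?Q \<inter> R = {}" using R PQ by blast
      have kR: "k \<notin> R" using R kP by blast
    have act: "drv r m True (K + {#Tree (dup_tree f g R t) B#})" using K(2) by simp
      have "tree_replace (duplicate_wit f g R) s = s"
        by (rule dup_untouched(1)) (use QR in \<open>simp add: Int_Un_distrib2\<close>)
      note untouched_t = this
      then have "map_tree (\<lambda>_. ()) (\<lambda>x. x) s = dup_tree f g R s" by simp
      with drv_strip[OF drv_forget_flag[OF nd_drv[OF F], of r m]] sdup_untouched[of F R f g] nd_no_witness[OF F] QR
      have oth: "drv r m False (sdup f g R F + {#Tree (dup_tree f g R s) A#})"
        by (simp add: Int_Un_distrib2)
    have "copied_vars f g (forest_vars ?P) \<inter> forest_vars ?Q = {}"
      by (rule copied_vars_disjoint[OF V(2)]) (use V(1) disj in auto)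
    moreover have "forest_vars (K + {#Tree (dup_tree f g R t) B#}) \<subseteq> copied_vars f g (forest_vars ?P)"
      using K(1) dup_tree_vars[of f g R t] by (simp, blast)
    moreover have "forest_vars (sdup f g R F + {#Tree (dup_tree f g R s) A#}) = forest_vars ?Q"
      using sdup_untouched[of F R f g] nd_no_witness[OF F] QR untouched_t by (simp add: Int_Un_distrib2)
    ultimately have vd: "forest_vars (K + {#Tree (dup_tree f g R t) B#}) \<inter>
        forest_vars (sdup f g R F + {#Tree (dup_tree f g R s) A#}) = {}" by blast
    show "drv r m True (K + sdup f g R ?D)"
      using drv.tensor[OF oth act, of True "()" "()"] vd kR by (simp add: ac_simps duplicate_wit_def Int_commute)
  qed
qed

lemma contraction_site_cut_left:
  fixes F G :: "('p, 'i, 'v) gen_forest"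
  assumes site: "contraction_site r n (F + {#Tree s A#}) F0 i j S C u E R"
    and F: "nd r n b (F + {#Tree s A#})" and G: "nd r n c (G + {#Tree t (dual A)#})"
    and disj: "forest_vars (F + {#Tree s A#}) \<inter> forest_vars (G + {#Tree t (dual A)#}) = {}"
    and named: "distinctly_named (F + G + {#Cut k s A t#})"
    and A: "positive A" "rank A = r \<Longrightarrow> 2 \<le> width s"
  shows "\<exists>F0. contraction_site r n (F + G + {#Cut k s A t#}) F0 i j S C u E R"
proof -
  let ?P = "F + {#Tree s A#}" and ?Q = "G + {#Tree t (dual A)#}" and ?D = "G + {#Cut k s A t#}"
  have PQ: "node_set ?P \<inter> node_set ?Q = {}" and kP: "k \<notin> node_set ?P"
    using named by (auto simp: node_set_def)
  have otP: "tname t \<notin> node_set ?P" using PQ tname_node_set[of t "(dual A)" ?Q] by auto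
  have eq: "F + G + {#Cut k s A t#} = F + ?D" by (simp add: ac_simps)
  from site show ?thesis unfolding eq
  proof (rule contraction_site_extend)
    show "\<exists>t A. d = Tree t A" if "d \<in># {#Tree s A#}" for d using that by auto
    show "\<forall>w T. Wit w T \<notin># F" using nd_no_witness[OF F] by simp
    show "forest_vars ?P \<subseteq> forest_vars (F + ?D)" by auto
    assume E: "subnet ?P E"
    show "subnet (F + ?D) E \<and> roots (F + ?D) E = roots ?P E"
    proof (rule subnet_track_binary[OF _ nd_named[OF F] nd_named[OF G], of _ "{Node k LCut {tname s, tname t}}" "tname s"])
      show "distinctly_named (F + ?D)" using named unfolding eq .
      show "nodes (F + ?D) = nodes ?P \<union> (nodes ?Q \<union> {Node k LCut {tname s, tname t}})" by auto
      show "node_name y \<notin> node_set ?P \<and> (\<forall>x. node_label y \<noteq> LWire x) \<and> succs y \<inter> node_set ?P \<subseteq> {tname s}"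
        if "y \<in> {Node k LCut {tname s, tname t}}" for y using that by (elim insertE emptyE) (use kP otP in \<open>simp_all add: Int_insert_left\<close>)
    qed (use disj PQ E in auto)
  next
    fix u l' assume "labelled ?P u l'"
    then show "labelled (F + ?D) u l'" by (rule labelled_mono[rotated]) auto
  next
    fix t' B' assume "Tree t' B' \<in># ?D"
    then have "tname t' \<notin> node_set ?P"
      using names_apart(1)[of "Tree t' B'" G "node_set ?P" t' B'] kP PQ by (auto simp: Int_commute)
    then show "tname t' \<notin> node_set ?P \<or> (\<exists>t'' C. Tree t'' C \<in># {#Tree s A#} \<and> tname t'' = tname t')" by (rule disjI1)
  next
    fix k' s' B' s'' assume c: "Cut k' s' B' s'' \<in># ?D" "rank B' = r"
    show "k' \<notin> node_set ?P \<and> (2 \<le> width s' \<or> outer_names s' \<inter> node_set ?P = {})"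
    proof (cases "Cut k' s' B' s'' \<in># G")
      case True
      from names_apart(2)[OF this, of "node_set ?P" k' s' B' s''] PQ show ?thesis by (auto simp: Int_commute)
    next
      case False
      with c kP A show ?thesis by auto
    qed
  next
    fix f g V R m and K :: "('p, unit, 'v) gen_forest"
    assume V: "forest_vars (F + ?D) \<subseteq> V" "fresh_copies f g V" and R: "R \<subseteq> node_set ?P"
      and K: "forest_vars K \<subseteq> copied_vars f g (forest_vars F)" "drv r m True (K + sdup f g R {#Tree s A#})"
    have QR: "node_set ?Q \<inter> R = {}" using R PQ by blast
      have kR: "k \<notin> R" using R kP by blast
    have act: "drv r m True (K + {#Tree (dup_tree f g R s) A#})" using K(2) by simp
      have "tree_replace (duplicate_wit f g R) t = t"
        by (rule dup_untouched(1)) (use QR in \<open>simp add: Int_Un_distrib2\<close>)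
      note untouched_t = this
      then have "map_tree (\<lambda>_. ()) (\<lambda>x. x) t = dup_tree f g R t" by simp
      with drv_strip[OF drv_forget_flag[OF nd_drv[OF G], of r m]] sdup_untouched[of G R f g] nd_no_witness[OF G] QR
      have oth: "drv r m False (sdup f g R G + {#Tree (dup_tree f g R t) (dual A)#})"
        by (simp add: Int_Un_distrib2)
    have "copied_vars f g (forest_vars ?P) \<inter> forest_vars ?Q = {}"
      by (rule copied_vars_disjoint[OF V(2)]) (use V(1) disj in auto)
    moreover have "forest_vars (K + {#Tree (dup_tree f g R s) A#}) \<subseteq> copied_vars f g (forest_vars ?P)"
      using K(1) dup_tree_vars[of f g R s] by (simp, blast)
    moreover have "forest_vars (sdup f g R G + {#Tree (dup_tree f g R t) (dual A)#}) = forest_vars ?Q"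
      using sdup_untouched[of G R f g] nd_no_witness[OF G] QR untouched_t by (simp add: Int_Un_distrib2)
    ultimately have vd: "forest_vars (K + {#Tree (dup_tree f g R s) A#}) \<inter>
        forest_vars (sdup f g R G + {#Tree (dup_tree f g R t) (dual A)#}) = {}" by blast
      have w: "rank A = r \<Longrightarrow> 2 \<le> width (dup_tree f g R s)"
        using A(2) width_replace[OF sums_nonempty_duplicate, of s f g R] by simp
    show "drv r m True (K + sdup f g R ?D)"
      using drv.cut[OF act oth A(1), of True "()"] vd kR w by (simp add: ac_simps duplicate_wit_def Int_commute)
  qed
qed

lemma contraction_site_cut_right:
  fixes F G :: "('p, 'i, 'v) gen_forest"
  assumes site: "contraction_site r n (G + {#Tree t (dual A)#}) F0 i j S C u E R"
    and F: "nd r n b (F + {#Tree s A#})" and G: "nd r n c (G + {#Tree t (dual A)#})"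
    and disj: "forest_vars (F + {#Tree s A#}) \<inter> forest_vars (G + {#Tree t (dual A)#}) = {}"
    and named: "distinctly_named (F + G + {#Cut k s A t#})"
    and A: "positive A" "rank A = r \<Longrightarrow> 2 \<le> width s"
  shows "\<exists>F0. contraction_site r n (F + G + {#Cut k s A t#}) F0 i j S C u E R"
proof -
  let ?P = "G + {#Tree t (dual A)#}" and ?Q = "F + {#Tree s A#}" and ?D = "F + {#Cut k s A t#}"
  have PQ: "node_set ?P \<inter> node_set ?Q = {}" and kP: "k \<notin> node_set ?P"
    using named by (auto simp: node_set_def)
  have otP: "tname s \<notin> node_set ?P" using PQ tname_node_set[of s "A" ?Q] by auto
  have eq: "F + G + {#Cut k s A t#} = G + ?D" by (simp add: ac_simps)
  from site show ?thesis unfolding eq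
  proof (rule contraction_site_extend)
    show "\<exists>t A. d = Tree t A" if "d \<in># {#Tree t (dual A)#}" for d using that by auto
    show "\<forall>w T. Wit w T \<notin># G" using nd_no_witness[OF G] by simp
    show "forest_vars ?P \<subseteq> forest_vars (G + ?D)" by auto
    assume E: "subnet ?P E"
    show "subnet (G + ?D) E \<and> roots (G + ?D) E = roots ?P E"
    proof (rule subnet_track_binary[OF _ nd_named[OF G] nd_named[OF F], of _ "{Node k LCut {tname s, tname t}}" "tname t"])
      show "distinctly_named (G + ?D)" using named unfolding eq .
      show "nodes (G + ?D) = nodes ?P \<union> (nodes ?Q \<union> {Node k LCut {tname s, tname t}})" by auto
      show "node_name y \<notin> node_set ?P \<and> (\<forall>x. node_label y \<noteq> LWire x) \<and> succs y \<inter> node_set ?P \<subseteq> {tname t}"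
        if "y \<in> {Node k LCut {tname s, tname t}}" for y using that by (elim insertE emptyE) (use kP otP in \<open>simp_all add: Int_insert_left\<close>)
    qed (use disj PQ E in auto)
  next
    fix u l' assume "labelled ?P u l'"
    then show "labelled (G + ?D) u l'" by (rule labelled_mono[rotated]) auto
  next
    fix t' B' assume "Tree t' B' \<in># ?D"
    then have "tname t' \<notin> node_set ?P"
      using names_apart(1)[of "Tree t' B'" F "node_set ?P" t' B'] kP PQ by (auto simp: Int_commute)
    then show "tname t' \<notin> node_set ?P \<or> (\<exists>t'' C. Tree t'' C \<in># {#Tree t (dual A)#} \<and> tname t'' = tname t')" by (rule disjI1)
  next
    fix k' s' B' s'' assume c: "Cut k' s' B' s'' \<in># ?D" "rank B' = r"
    show "k' \<notin> node_set ?P \<and> (2 \<le> width s' \<or> outer_names s' \<inter> node_set ?P = {})"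
    proof (cases "Cut k' s' B' s'' \<in># F")
      case True
      from names_apart(2)[OF this, of "node_set ?P" k' s' B' s''] PQ show ?thesis by (auto simp: Int_commute)
    next
      case False
      with c kP A show ?thesis by auto
    qed
  next
    fix f g V R m and K :: "('p, unit, 'v) gen_forest"
    assume V: "forest_vars (G + ?D) \<subseteq> V" "fresh_copies f g V" and R: "R \<subseteq> node_set ?P"
      and K: "forest_vars K \<subseteq> copied_vars f g (forest_vars G)" "drv r m True (K + sdup f g R {#Tree t (dual A)#})"
    have QR: "node_set ?Q \<inter> R = {}" using R PQ by blast
      have kR: "k \<notin> R" using R kP by blast
    have act: "drv r m True (K + {#Tree (dup_tree f g R t) (dual A)#})" using K(2) by simp
      have "tree_replace (duplicate_wit f g R) s = s"
        by (rule dup_untouched(1)) (use QR in \<open>simp add: Int_Un_distrib2\<close>)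
      note untouched_t = this
      then have "map_tree (\<lambda>_. ()) (\<lambda>x. x) s = dup_tree f g R s" by simp
      with drv_strip[OF drv_forget_flag[OF nd_drv[OF F], of r m]] sdup_untouched[of F R f g] nd_no_witness[OF F] QR
      have oth: "drv r m False (sdup f g R F + {#Tree (dup_tree f g R s) A#})"
        by (simp add: Int_Un_distrib2)
    have "copied_vars f g (forest_vars ?P) \<inter> forest_vars ?Q = {}"
      by (rule copied_vars_disjoint[OF V(2)]) (use V(1) disj in auto)
    moreover have "forest_vars (K + {#Tree (dup_tree f g R t) (dual A)#}) \<subseteq> copied_vars f g (forest_vars ?P)"
      using K(1) dup_tree_vars[of f g R t] by (simp, blast)
    moreover have "forest_vars (sdup f g R F + {#Tree (dup_tree f g R s) A#}) = forest_vars ?Q"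
      using sdup_untouched[of F R f g] nd_no_witness[OF F] QR untouched_t by (simp add: Int_Un_distrib2)
    ultimately have vd: "forest_vars (K + {#Tree (dup_tree f g R t) (dual A)#}) \<inter>
        forest_vars (sdup f g R F + {#Tree (dup_tree f g R s) A#}) = {}" by blast
      have w: "rank A = r \<Longrightarrow> 2 \<le> width (dup_tree f g R s)"
        using A(2) width_replace[OF sums_nonempty_duplicate, of s f g R] by simp
    show "drv r m True (K + sdup f g R ?D)"
      using drv.cut[OF oth act A(1), of True "()"] vd kR w by (simp add: ac_simps duplicate_wit_def Int_commute)
  qed
qed

text \<open>
  The subnet at the flagged cut is the whole net above its right premise. It remains a subnet through the rules below, and the derivation with the cut split in two is rebuilt alongside, the two copies of the context being merged by contractions.
\<close>

lemma nd_contraction_site: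
  fixes F :: "('p, 'i, 'v) gen_forest"
  shows "nd r n e F \<Longrightarrow> e \<Longrightarrow> \<exists>F0 i j S A t E R. contraction_site r n F F0 i j S A t E R"
proof (induction rule: nd.induct)
  case (mix b F c G e)
  then consider b | c by blast
  then show ?case
  proof cases
    case 1
    with mix.IH(1) obtain F0 i j S A t E R where "contraction_site r n F F0 i j S A t E R" by blast
    from contraction_site_mix[OF this mix.hyps(1,2,3,5)] show ?thesis by blast
  next
    case 2
    with mix.IH(2) obtain F0 i j S A t E R where "contraction_site r n G F0 i j S A t E R" by blast
    from contraction_site_mix[OF this mix.hyps(2,1)] mix.hyps(3,5) show ?thesis
      by (simp add: Int_commute union_commute[of F G]) blast
  qed
next
  case (un e F P c)
  then obtain F0 i j S A t E R where "contraction_site r n (F + P) F0 i j S A t E R" by blast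
  from contraction_site_unary[OF this un.hyps(1,2,4)] show ?case by blast
next
  case (tensor b F t A c G s B e i j)
  then consider b | c by blast
  then show ?case
  proof cases
    case 1
    with tensor.IH(1) obtain F0 i' j' S C u E R
      where "contraction_site r n (F + {#Tree t A#}) F0 i' j' S C u E R" by blast
    from contraction_site_tensor_left[OF this tensor.hyps(1,2,3,5)] show ?thesis by blast
  next
    case 2
    with tensor.IH(2) obtain F0 i' j' S C u E R
      where "contraction_site r n (G + {#Tree s B#}) F0 i' j' S C u E R" by blast
    from contraction_site_tensor_right[OF this tensor.hyps(1,2,3,5)] show ?thesis by blast
  qed
next
  case (cut b F s A c G t e i)
  show ?case
  proof (cases "(b \<or> c) \<and> (rank A = r \<longrightarrow> 2 \<le> width s)")
    case False
    with cut.hyps(5) cut.prems have "rank A = r" "width s = n" "lacks_rank r G" by auto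
    from contraction_site_base[OF cut.hyps(1,2,3) this cut.hyps(4,6)] show ?thesis by blast
  next
    case True
    then have w: "rank A = r \<Longrightarrow> 2 \<le> width s" by simp
    from True consider b | c by blast
    then show ?thesis
    proof cases
      case 1
      with cut.IH(1) obtain F0 i' j' S C u E R
        where "contraction_site r n (F + {#Tree s A#}) F0 i' j' S C u E R" by blast
      from contraction_site_cut_left[OF this cut.hyps(1,2,4,6,3) w] show ?thesis by blast
    next
      case 2
      with cut.IH(2) obtain F0 i' j' S C u E R
        where "contraction_site r n (G + {#Tree t (dual A)#}) F0 i' j' S C u E R" by blast
      from contraction_site_cut_right[OF this cut.hyps(1,2,4,6,3) w] show ?thesis by blast
    qed
  qed
qed simp_all

section \<open>The erased subnet\<close>

subsection \<open>The largest subnet below a factor of a tensor\<close>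

lemma switching_graph_iff:
  "(x, y) \<in> switching_graph F \<sigma> \<longleftrightarrow>
     (x, y) \<in> succ_edges F \<and> (switched F x \<longrightarrow> y = \<sigma> x) \<or>
     (y, x) \<in> succ_edges F \<and> (switched F y \<longrightarrow> x = \<sigma> y) \<or> (x, y) \<in> axiom_links F"
proof -
  have "(y, x) \<in> axiom_links F \<longleftrightarrow> (x, y) \<in> axiom_links F"
    using link_edges_sym[of x y] link_edges_sym[of y x] unfolding axiom_links_nodes by blast
  then show ?thesis unfolding switching_graph_def Let_def by blast
qed

lemma switching_graph_sym: "(x, y) \<in> switching_graph F \<sigma> \<Longrightarrow> (y, x) \<in> switching_graph F \<sigma>"
  unfolding switching_graph_def Let_def by blast

lemma path_append:
  "p \<noteq> [] \<Longrightarrow> q \<noteq> [] \<Longrightarrow>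
    path E (p @ q) \<longleftrightarrow> path E p \<and> path E q \<and> set p \<inter> set q = {} \<and> (last p, hd q) \<in> E"
  unfolding path_def successively_append_iff distinct_append by blast

lemma path_left: "path E (p @ q) \<Longrightarrow> p \<noteq> [] \<Longrightarrow> path E p"
  and path_right: "path E (p @ q) \<Longrightarrow> q \<noteq> [] \<Longrightarrow> path E q"
  unfolding path_def successively_append_iff distinct_append by blast+

lemma path_single [simp]: "path E [x]"
  by (simp add: path_def)

lemma path_cong:
  assumes "path (switching_graph F \<sigma>) p" "\<And>x. x \<in> set p \<Longrightarrow> \<sigma> x = \<tau> x"
  shows "path (switching_graph F \<tau>) p"
proof -
  have "successively (\<lambda>i j. (i, j) \<in> switching_graph F \<tau>) p"
  proof (rule successively_mono)
    show "successively (\<lambda>i j. (i, j) \<in> switching_graph F \<sigma>) p" using assms(1) by (simp add: path_def)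
    show "(x, y) \<in> switching_graph F \<tau>" if "x \<in> set p" "y \<in> set p" "(x, y) \<in> switching_graph F \<sigma>" for x y
      using that assms(2) by (simp add: switching_graph_iff)
  qed
  with assms(1) show ?thesis by (simp add: path_def)
qed

text \<open>At its last node, a path that arrives from above leaves the choice free.\<close>

lemma path_update_last:
  assumes p: "path (switching_graph F \<sigma>) p" "last p = v"
    and above: "p = [v] \<or> (v, last (butlast p)) \<notin> succ_edges F"
  shows "path (switching_graph F (\<sigma>(v := w))) p"
proof -
  have ne: "p \<noteq> []" using p(1) by (simp add: path_def)
  then have split: "p = butlast p @ [v]" using p(2) by (metis append_butlast_last_id)
  show ?thesis
  proof (cases "butlast p = []")
    case True
    with split have "p = [v]" by simp
    then show ?thesis by (simp add: path_def)
  next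
    case False
    from p(1) have "path (switching_graph F \<sigma>) (butlast p @ [v])" using split by simp
    then have b: "path (switching_graph F \<sigma>) (butlast p)" "v \<notin> set (butlast p)"
      and e: "(last (butlast p), v) \<in> switching_graph F \<sigma>"
      using path_append[OF False, of "[v]" "switching_graph F \<sigma>"] by simp_all
    have "path (switching_graph F (\<sigma>(v := w))) (butlast p)"
      by (rule path_cong[OF b(1)]) (use b(2) in auto)
    moreover have "(v, last (butlast p)) \<notin> succ_edges F" using above False split by auto
    moreover have "last (butlast p) \<noteq> v" using b(2) last_in_set[OF False] by metis
    ultimately have "(last (butlast p), v) \<in> switching_graph F (\<sigma>(v := w))"
      using e by (simp add: switching_graph_iff)
    with \<open>path (switching_graph F (\<sigma>(v := w))) (butlast p)\<close>
    have "path (switching_graph F (\<sigma>(v := w))) (butlast p @ [v])"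
      using b(2) path_append[OF False, of "[v]" "switching_graph F (\<sigma>(v := w))"] by simp
    then show ?thesis using split by simp
  qed
qed

lemma path_snoc:
  assumes "path E p" "(last p, x) \<in> E" "x \<notin> set p"
  shows "path E (p @ [x])"
proof -
  have "p \<noteq> []" using assms(1) by (simp add: path_def)
  with assms show ?thesis using path_append[of p "[x]" E] by simp
qed

lemma path_prefix:
  assumes "path E p" "x \<in> set p"
  obtains q where "path E q" "last q = x" "hd q = hd p" "set q \<subseteq> set p"
proof -
  obtain a b where p: "p = a @ x # b" using assms(2) by (meson split_list)
  then have "path E (a @ [x])" using assms(1) path_left[of E "a @ [x]" b] by simp
  moreover have "hd (a @ [x]) = hd p" using p by (cases a) auto
  ultimately show thesis using that[of "a @ [x]"] p by auto
qed

lemma path_ConsD: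
  assumes "path E (w # q)" "q \<noteq> []"
  shows "(w, hd q) \<in> E" "hd q \<noteq> w"
proof -
  have *: "path E ([w] @ q)" using assms(1) by simp
  have "set [w] \<inter> set q = {} \<and> (last [w], hd q) \<in> E"
    using iffD1[OF path_append[of "[w]" q E] *] assms(2) by blast
  with hd_in_set[OF assms(2)] show "(w, hd q) \<in> E" "hd q \<noteq> w" by auto
qed

text \<open>Changing the choice at a node disconnects it from at most one neighbour.\<close>

lemma switching_graph_change:
  assumes "(w, x) \<in> switching_graph F \<sigma>" "(w, y) \<in> switching_graph F \<sigma>" "x \<noteq> w" "y \<noteq> w" "x \<noteq> y"
  shows "(w, x) \<in> switching_graph F (\<sigma>(w := c)) \<or> (w, y) \<in> switching_graph F (\<sigma>(w := c))"
proof -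
  have "x = \<sigma> w" if "(w, x) \<notin> switching_graph F (\<sigma>(w := c))"
    using that assms(1,3) unfolding switching_graph_iff fun_upd_apply by argo
  moreover have "y = \<sigma> w" if "(w, y) \<notin> switching_graph F (\<sigma>(w := c))"
    using that assms(2,4) unfolding switching_graph_iff fun_upd_apply by argo
  ultimately show ?thesis using assms(5) by blast
qed

lemma distinct_neighbours: "distinct (e # (l @ w # r) @ [e']) \<Longrightarrow> hd (r @ [e']) \<noteq> hd (rev l @ [e])"
  by (cases r; cases l rule: rev_cases) auto

lemma switching_update: "switching F \<sigma> \<Longrightarrow> (v, w) \<in> succ_edges F \<Longrightarrow> switching F (\<sigma>(v := w))"
  by (auto simp: switching_def)

definition reachable :: "('p, 'i, 'v) gen_forest \<Rightarrow> 'i \<Rightarrow> 'i \<Rightarrow> 'i set" where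
  "reachable F k u = {n. \<exists>\<sigma> p. switching F \<sigma> \<and> path (switching_graph F \<sigma>) p \<and> hd p = k \<and>
     last p = n \<and> u \<notin> set p}"

lemma reachableI:
  "switching F \<sigma> \<Longrightarrow> path (switching_graph F \<sigma>) p \<Longrightarrow> hd p = k \<Longrightarrow> u \<notin> set p \<Longrightarrow> last p \<in> reachable F k u"
  by (auto simp: reachable_def)

lemma reachable_path:
  assumes "switching F \<sigma>" "path (switching_graph F \<sigma>) p" "hd p = k" "u \<notin> set p"
  shows "set p \<subseteq> reachable F k u"
proof
  fix x assume "x \<in> set p"
  then obtain q where "path (switching_graph F \<sigma>) q" "last q = x" "hd q = hd p" "set q \<subseteq> set p"
    by (rule path_prefix[OF assms(2)])
  with reachableI[of F \<sigma> q k u] assms show "x \<in> reachable F k u" by auto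
qed

text \<open>
  Here \<open>u\<close> is a factor of the unswitched node \<open>k\<close>. The nodes reachable from \<open>k\<close> by a switching path that avoids \<open>u\<close> have to stay; the others form the subnet to erase.
\<close>

locale factor =
  fixes F :: "('p, 'i, 'v) gen_forest" and k u :: 'i
  assumes named: "distinctly_named F" and ac: "AC F"
    and ku: "(k, u) \<in> succ_edges F" and k_unswitched: "\<not> switched F k" and uk: "(u, k) \<notin> succ_edges F"
    and u_no_wire: "\<And>x. \<not> labelled F u (LWire x)" and u_no_star: "\<not> labelled F u LStar"
    and switching_exists: "\<exists>\<sigma>. switching F \<sigma>"
    and star_unswitched: "\<And>i j. (i, j) \<in> succ_edges F \<Longrightarrow> labelled F j LStar \<Longrightarrow> \<not> switched F i"
begin

abbreviation N where "N \<equiv> reachable F k u"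

definition E where "E = node_set F - N"

lemma k_in_N: "k \<in> N"
proof -
  obtain \<sigma> where "switching F \<sigma>" using switching_exists by blast
  moreover have "k \<noteq> u" using ku uk by auto
  ultimately show ?thesis using reachableI[of F \<sigma> "[k]" k u] by (simp add: path_def)
qed

lemma u_not_N: "u \<notin> N"
  unfolding reachable_def path_def by (auto dest: last_in_set)

lemma N_path:
  assumes "n \<in> N"
  obtains \<sigma> p where "switching F \<sigma>" "path (switching_graph F \<sigma>) p" "hd p = k" "last p = n" "u \<notin> set p"
    "p \<noteq> []"
  using assms unfolding reachable_def path_def by blast

text \<open>
  The only predecessor that a path must not visit is \<open>u\<close>, and reaching \<open>u\<close> from above its subtree would close a cycle through the edge from \<open>k\<close> to \<open>u\<close>.
\<close>

lemma N_up:
  assumes "n \<in> N" "(q, n) \<in> succ_edges F"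
  shows "q \<in> N"
proof -
  from assms(1) obtain \<sigma> p where p: "switching F \<sigma>" "path (switching_graph F \<sigma>) p" "hd p = k"
    "last p = n" "u \<notin> set p" "p \<noteq> []" by (rule N_path)
  show ?thesis
  proof (cases "q \<in> set p")
    case True
    then show ?thesis using reachable_path[OF p(1,2,3,5)] by blast
  next
    case False
    let ?\<tau> = "\<sigma>(q := n)"
    have sw: "switching F ?\<tau>" using p(1) assms(2) by (rule switching_update)
    have "path (switching_graph F ?\<tau>) p" by (rule path_cong[OF p(2)]) (use False in auto)
    moreover have "(n, q) \<in> switching_graph F ?\<tau>" using assms(2) by (simp add: switching_graph_iff)
    ultimately have pq: "path (switching_graph F ?\<tau>) (p @ [q])" using False p(4) by (auto intro: path_snoc)
    show ?thesis
    proof (cases "q = u")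
      case False
      with reachableI[OF sw pq, of k u] p show ?thesis by auto
    next
      case True
      have "n \<noteq> k" using assms(2) uk True by auto
      then have "3 \<le> length (p @ [q])" using p(3,4,6) by (cases p) (auto simp: Suc_le_eq split: if_splits)
      moreover have "(last (p @ [q]), hd (p @ [q])) \<in> switching_graph F ?\<tau>"
        using ku k_unswitched True p(3,6) by (simp add: switching_graph_iff)
      ultimately show ?thesis using ac sw pq unfolding AC_def acyclic_graph_def by blast
    qed
  qed
qed

lemma N_link:
  assumes "n \<in> N" "(n, m) \<in> axiom_links F"
  shows "m \<in> N"
proof -
  from assms(1) obtain \<sigma> p where p: "switching F \<sigma>" "path (switching_graph F \<sigma>) p" "hd p = k"
    "last p = n" "u \<notin> set p" "p \<noteq> []" by (rule N_path)
  have "m \<noteq> u" using assms(2) u_no_wire by (auto simp: axiom_links_def)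
  show ?thesis
  proof (cases "m \<in> set p")
    case True
    then show ?thesis using reachable_path[OF p(1,2,3,5)] by blast
  next
    case False
    have "(n, m) \<in> switching_graph F \<sigma>" using assms(2) by (simp add: switching_graph_iff)
    with path_snoc[OF p(2)] False p(4) have "path (switching_graph F \<sigma>) (p @ [m])" by simp
    from reachableI[OF p(1) this, of k u] p \<open>m \<noteq> u\<close> show ?thesis by auto
  qed
qed

lemma N_down_unswitched:
  assumes "v \<in> N" "(v, w) \<in> succ_edges F" "\<not> switched F v" "w \<noteq> u"
  shows "w \<in> N"
proof -
  from assms(1) obtain \<sigma> p where p: "switching F \<sigma>" "path (switching_graph F \<sigma>) p" "hd p = k"
    "last p = v" "u \<notin> set p" "p \<noteq> []" by (rule N_path)
  show ?thesis
  proof (cases "w \<in> set p")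
    case True
    then show ?thesis using reachable_path[OF p(1,2,3,5)] by blast
  next
    case False
    have "(v, w) \<in> switching_graph F \<sigma>" using assms by (simp add: switching_graph_iff)
    with path_snoc[OF p(2)] False p(4) have "path (switching_graph F \<sigma>) (p @ [w])" by simp
    from reachableI[OF p(1) this, of k u] p \<open>w \<noteq> u\<close> show ?thesis by auto
  qed
qed

lemma u_predecessor: "(v, u) \<in> succ_edges F \<Longrightarrow> v = k"
  using unique_predecessor[OF named _ ku] .

text \<open>
  A path arriving at a switched node from elsewhere leaves its choice free, so it can be continued to any successor; hence a successor outside \<open>N\<close> means that the path arrived from another successor.
\<close>

lemma N_down_switched:
  assumes "v \<in> N" "(v, w) \<in> succ_edges F" "switched F v" "w \<notin> N"
  shows "\<exists>w'. (v, w') \<in> succ_edges F \<and> w' \<in> N"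
proof (rule ccontr)
  assume no: "\<nexists>w'. (v, w') \<in> succ_edges F \<and> w' \<in> N"
  from assms(1) obtain \<sigma> p where p: "switching F \<sigma>" "path (switching_graph F \<sigma>) p" "hd p = k"
    "last p = v" "u \<notin> set p" "p \<noteq> []" by (rule N_path)
  have "v \<noteq> k" using assms(3) k_unswitched by auto
  then have "w \<noteq> u" using u_predecessor assms(2) by auto
  have "set p \<subseteq> N" using reachable_path[OF p(1,2,3,5)] .
  have "w \<notin> set p" using assms(4) \<open>set p \<subseteq> N\<close> by blast
  have "(v, last (butlast p)) \<notin> succ_edges F" if "p \<noteq> [v]"
  proof -
    have "butlast p \<noteq> []" using that p(4,6) by (metis append_butlast_last_id append_Nil)
    then have "last (butlast p) \<in> N" using \<open>set p \<subseteq> N\<close> by (meson in_set_butlastD last_in_set subsetD)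
    with no show ?thesis by blast
  qed
  then have "path (switching_graph F (\<sigma>(v := w))) p" using path_update_last[OF p(2,4)] by blast
  moreover have "(v, w) \<in> switching_graph F (\<sigma>(v := w))" using assms(2) by (simp add: switching_graph_iff)
  ultimately have "path (switching_graph F (\<sigma>(v := w))) (p @ [w])"
    using \<open>w \<notin> set p\<close> p(4) by (auto intro: path_snoc)
  from reachableI[OF switching_update[OF p(1) assms(2)] this, of k u] p \<open>w \<noteq> u\<close> assms(4) show False by auto
qed

lemma u_in_E: "u \<in> E"
  using u_not_N succ_edge_nodes[OF named ku] unfolding E_def by blast

lemma E_down: "i \<in> E \<Longrightarrow> (i, j) \<in> succ_edges F \<Longrightarrow> j \<in> E"
  using N_up[of j i] succ_edge_nodes[OF named, of i j] unfolding E_def by blast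

lemma E_link: "i \<in> E \<Longrightarrow> (i, j) \<in> axiom_links F \<Longrightarrow> j \<in> E"
proof -
  assume i: "i \<in> E" and l: "(i, j) \<in> axiom_links F"
  have "(j, i) \<in> axiom_links F"
    using l link_edges_sym[of i j] link_edges_sym[of j i] unfolding axiom_links_nodes by blast
  then have "j \<notin> N" using N_link[of j i] i unfolding E_def by blast
  moreover from l obtain n where "n \<in># forest_nodes F" "node_name n = j"
    unfolding axiom_links_def labelled_def by blast
  then have "j \<in> node_set F" unfolding node_set_def by blast
  ultimately show "j \<in> E" unfolding E_def by blast
qed

lemma E_up_unswitched:
  assumes "(v, w) \<in> succ_edges F" "w \<in> E" "\<not> switched F v" "v \<noteq> k"
  shows "v \<in> E"
proof -
  have "w \<noteq> u" using u_predecessor[of v] assms(1,4) by blast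
  with N_down_unswitched[of v w] assms succ_edge_nodes[OF named assms(1)] show ?thesis
    unfolding E_def by blast
qed

lemma E_up_switched:
  assumes "switched F v" "(v, w) \<in> succ_edges F" "\<And>w. (v, w) \<in> succ_edges F \<Longrightarrow> w \<in> E"
  shows "v \<in> E"
proof (rule ccontr)
  assume "v \<notin> E"
  then have "v \<in> N" using succ_edge_nodes[OF named assms(2)] by (simp add: E_def)
  moreover have "w \<notin> N" using assms(3)[OF assms(2)] by (simp add: E_def)
  ultimately obtain w' where "(v, w') \<in> succ_edges F" "w' \<in> N"
    using N_down_switched[OF _ assms(2,1)] by blast
  with assms(3)[of w'] show False by (simp add: E_def)
qed

lemma substructure_E: "substructure F E"
  unfolding substructure_def
proof (intro conjI ballI)
  show "E \<noteq> {}" using u_in_E by blast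
  show "E \<subseteq> node_set F" by (auto simp: E_def)
  show "case e of (i, j) \<Rightarrow> i \<in> E \<longrightarrow> j \<in> E" if "e \<in> succ_edges F" for e
    using that E_down[of "fst e" "snd e"] by (simp add: case_prod_beta)
  show "case e of (i, j) \<Rightarrow> i \<in> E \<longrightarrow> j \<in> E" if "e \<in> axiom_links F" for e
    using that E_link[of "fst e" "snd e"] by (simp add: case_prod_beta)
  have star: "i \<in> E" if ij: "(i, j) \<in> succ_edges F" and j: "j \<in> E" "labelled F j LStar" for i j
  proof (rule ccontr)
    assume "i \<notin> E"
    then have "i \<in> N" using succ_edge_nodes[OF named ij] unfolding E_def by blast
    moreover have "j \<noteq> u" using j(2) u_no_star by blast
    ultimately have "j \<in> N" using N_down_unswitched[OF _ ij star_unswitched[OF ij j(2)]] by blast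
    with j(1) show False unfolding E_def by blast
  qed
  show "case e of (i, j) \<Rightarrow> j \<in> E \<and> labelled F j LStar \<longrightarrow> i \<in> E" if "e \<in> succ_edges F" for e
    using that star[of "fst e" "snd e"] by (simp add: case_prod_beta)
qed

lemma u_root: "u \<in> roots F E"
proof -
  have "(i, u) \<notin> succ_edges F" if "i \<in> E" for i
    using u_predecessor[of i] k_in_N that unfolding E_def by blast
  with u_in_E show ?thesis by (simp add: roots_def)
qed

lemma prunable_E:
  assumes "w \<in> roots F E" "w \<noteq> u"
  shows "prunable F E w"
proof (cases "\<exists>v. (v, w) \<in> succ_edges F")
  case False
  have "w \<in> node_set F" using assms(1) by (auto simp: roots_def E_def)
  with False node_set_succs[OF named] show ?thesis by (auto simp: prunable_def)
next
  case True
  then obtain v where v: "(v, w) \<in> succ_edges F" by blast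
  then have vN: "v \<in> N" using assms(1) succ_edge_nodes[OF named v] by (auto simp: roots_def E_def)
  have wN: "w \<notin> N" using assms(1) by (auto simp: roots_def E_def)
  have sw: "switched F v" using N_down_unswitched[OF vN v _ assms(2)] wN by blast
  from N_down_switched[OF vN v this wN] obtain w' where w': "(v, w') \<in> succ_edges F" "w' \<in> N" by blast
  then have "w' \<notin> E" "w' \<noteq> w" using wN by (auto simp: E_def)
  with sw v w' show ?thesis unfolding prunable_def switched_def by blast
qed

lemma path_leaving:
  assumes "path G p" "hd p \<in> E" "last p \<in> E" "\<not> set p \<subseteq> E"
  obtains a e s e' b where "p = a @ e # s @ e' # b" "s \<noteq> []" "set s \<inter> E = {}" "e \<in> E" "e' \<in> E"
proof -
  have "\<exists>x\<in>set p. x \<notin> E" using assms(4) by blast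
  then obtain a v c where p: "p = a @ v # c" "v \<notin> E" "\<forall>x\<in>set a. x \<in> E"
    using split_list_first_prop[of p "\<lambda>x. x \<notin> E"] by blast
  have "a \<noteq> []" using p assms(2) by (cases a) auto
  then obtain a' e where a: "a = a' @ [e]" by (metis rev_exhaust)
  have "last (v # c) \<in> E" using assms(3) p(1) by simp
  then have "\<exists>x\<in>set (v # c). x \<in> E" using last_in_set[of "v # c"] by blast
  then obtain s e' b where s: "v # c = s @ e' # b" "e' \<in> E" "\<forall>x\<in>set s. x \<notin> E"
    using split_list_first_prop[of "v # c" "\<lambda>x. x \<in> E"] by blast
  have "s \<noteq> []" using s(1,2) p(2) by (cases s) auto
  show thesis
    by (rule that[of a' e s e' b]) (use p a s \<open>s \<noteq> []\<close> in auto)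
qed

text \<open>Two switchings that are used on disjoint parts of a path can be merged.\<close>

lemma path_merge:
  assumes p: "path (switching_graph F \<tau>) (p @ [w])" "p \<noteq> []" and q: "path (switching_graph F \<sigma>) (w # q)" "q \<noteq> []"
    and disj: "set p \<inter> set q = {}"
    and sw: "switching F \<sigma>" "switching F \<tau>"
    and c: "switched F w \<Longrightarrow> c = \<sigma> w \<or> c = \<tau> w"
    and ew: "(last p, w) \<in> switching_graph F (\<tau>(w := c))" "(w, hd q) \<in> switching_graph F (\<sigma>(w := c))"
  shows "\<exists>\<rho>. switching F \<rho> \<and> path (switching_graph F \<rho>) (p @ w # q)"
proof -
  define \<rho> where "\<rho> n = (if n = w then c else if n \<in> set p then \<tau> n else \<sigma> n)" for n
  have "switching F \<rho>" unfolding switching_def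
  proof (intro allI impI)
    fix n assume "switched F n"
    then have "(n, \<sigma> n) \<in> succ_edges F" "(n, \<tau> n) \<in> succ_edges F" using sw by (auto simp: switching_def)
    with c \<open>switched F n\<close> show "(n, \<rho> n) \<in> succ_edges F" by (auto simp: \<rho>_def)
  qed
  moreover have "path (switching_graph F \<rho>) p"
  proof (rule path_cong)
    show "path (switching_graph F \<tau>) p" using path_left[OF p] .
    have "w \<notin> set p" using p(1) by (simp add: path_def)
    then show "\<tau> x = \<rho> x" if "x \<in> set p" for x using that by (auto simp: \<rho>_def)
  qed
  moreover have "path (switching_graph F \<rho>) q"
  proof (rule path_cong)
    show "path (switching_graph F \<sigma>) q" using q path_right[of _ "[w]" q] by simp
    have "w \<notin> set q" using q(1) by (simp add: path_def)
    then show "\<sigma> x = \<rho> x" if "x \<in> set q" for x using that disj by (auto simp: \<rho>_def)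
  qed
  moreover have "(last p, w) \<in> switching_graph F \<rho>"
  proof -
    have "\<rho> (last p) = (\<tau>(w := c)) (last p)" "\<rho> w = c" using p last_in_set[OF p(2)] by (auto simp: \<rho>_def)
    with ew(1) show ?thesis by (simp add: switching_graph_iff)
  qed
  moreover have "(w, hd q) \<in> switching_graph F \<rho>"
  proof -
    have "hd q \<notin> set p" using disj hd_in_set[OF q(2)] by blast
    then have "\<rho> (hd q) = (\<sigma>(w := c)) (hd q)" "\<rho> w = c" by (auto simp: \<rho>_def)
    with ew(2) show ?thesis by (simp add: switching_graph_iff)
  qed
  moreover have "w \<notin> set p" "w \<notin> set q" using p(1) q(1) by (auto simp: path_def)
  ultimately have "path (switching_graph F \<rho>) (p @ w # q)"
    using disj path_append[OF p(2), of "w # q" "switching_graph F \<rho>"]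
      path_append[of "[w]" q "switching_graph F \<rho>"] q(2) by simp
  with \<open>switching F \<rho>\<close> show ?thesis by blast
qed

lemma path_rev: "path (switching_graph F \<sigma>) p \<Longrightarrow> path (switching_graph F \<sigma>) (rev p)"
proof -
  assume p: "path (switching_graph F \<sigma>) p"
  have "successively (\<lambda>x y. (y, x) \<in> switching_graph F \<sigma>) p"
  proof (rule successively_mono)
    show "successively (\<lambda>x y. (x, y) \<in> switching_graph F \<sigma>) p" using p by (simp add: path_def)
  qed (rule switching_graph_sym)
  with p show ?thesis by (simp add: path_def successively_rev)
qed

text \<open>
  An excursion outside \<open>E\<close> meets some path from \<open>k\<close>; one of its two halves continues that path
  consistently, whence \<open>k\<close> reaches \<open>E\<close>.
\<close>

lemma subnet_E: "subnet F E"
  unfolding subnet_def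
proof (intro conjI allI impI)
  show "substructure F E" by (rule substructure_E)
  fix P assume P: "switching_path F P \<and> hd P \<in> roots F E \<and> last P \<in> roots F E"
  then obtain \<sigma> where \<sigma>: "switching F \<sigma>" "path (switching_graph F \<sigma>) P" by (auto simp: switching_path_def)
  show "set P \<subseteq> E"
  proof (rule ccontr)
    assume "\<not> set P \<subseteq> E"
    moreover have "hd P \<in> E" "last P \<in> E" using P by (auto simp: roots_def)
    ultimately obtain a e s e' b where s: "P = a @ e # s @ e' # b" "s \<noteq> []" "set s \<inter> E = {}" "e \<in> E" "e' \<in> E"
      using path_leaving[OF \<sigma>(2)] by blast
    have "path (switching_graph F \<sigma>) (e # s @ e' # b)"
      using \<sigma>(2) s(1) path_right[of _ a "e # s @ e' # b"] by simp
    then have es: "path (switching_graph F \<sigma>) (e # s @ [e'])"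
      using path_left[of _ "e # s @ [e']" b] by simp
    have "set P \<subseteq> node_set F"
    proof (rule path_within[OF \<sigma>(2)])
      show "hd P \<in> node_set F" using \<open>hd P \<in> E\<close> by (simp add: E_def)
      show "switching_graph F \<sigma> \<subseteq> node_set F \<times> node_set F"
        using sgraph_nodes[OF named] switching_graph_nodes[OF named] by blast
    qed
    then have sN: "set s \<subseteq> N" using s(1,3) by (auto simp: E_def)
    have "hd s \<in> N" using sN s(2) by auto
    then obtain \<tau> p where p: "switching F \<tau>" "path (switching_graph F \<tau>) p" "hd p = k"
      "last p = hd s" "u \<notin> set p" "p \<noteq> []" by (rule N_path)
    have "\<exists>x\<in>set p. x \<in> set s" using p(4,6) s(2) by (metis hd_in_set last_in_set)
    then obtain p0 w p1 where w: "p = p0 @ w # p1" "w \<in> set s" "\<forall>x\<in>set p0. x \<notin> set s"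
      using split_list_first_prop[of p "\<lambda>x. x \<in> set s"] by blast
    obtain l r where lr: "s = l @ w # r" using w(2) by (meson split_list)
    have pN: "set p \<subseteq> N" using reachable_path[OF p(1,2,3,5)] .
    have p0w: "path (switching_graph F \<tau>) (p0 @ [w])"
      using p(2) w(1) path_left[of _ "p0 @ [w]" p1] by simp
    have u_s: "u \<notin> set s" using sN u_not_N by blast
    have fwd: "path (switching_graph F \<sigma>) (w # r @ [e'])"
      using es lr path_right[of _ "e # l" "w # r @ [e']"] by simp
    have "path (switching_graph F \<sigma>) (e # l @ [w])"
      using es lr path_left[of _ "e # l @ [w]" "r @ [e']"] by simp
    from path_rev[OF this] have bwd: "path (switching_graph F \<sigma>) (w # rev l @ [e])" by simp
    have "e \<noteq> e'" using es by (auto simp: path_def)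
    show False
    proof (cases "p0 = []")
      case True
      then have "w = k" using w(1) p(3) by simp
      show False
      proof (cases "e' = u")
        case False
        with reachableI[OF \<sigma>(1) fwd, of k u] \<open>w = k\<close> u_s lr s(5) show False by (auto simp: E_def)
      next
        case True
        with reachableI[OF \<sigma>(1) bwd, of k u] \<open>w = k\<close> u_s lr s(4) \<open>e \<noteq> e'\<close> show False by (auto simp: E_def)
      qed
    next
      case False
      then have "k \<in> set p0" using w(1) p(3) by (cases p0) auto
      then have "k \<notin> set s" using w(3) by blast
      \<comment> \<open>A neighbour of \<open>u\<close> outside \<open>E\<close> can only be \<open>k\<close>.\<close>
      have not_u: "x \<noteq> u" if "(y, x) \<in> switching_graph F \<sigma>" "y \<in> set s" for x y
      proof
        assume "x = u"
        with that(1) have "(y, u) \<in> succ_edges F \<or> (u, y) \<in> succ_edges F \<or> (y, u) \<in> axiom_links F"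
          by (auto simp: switching_graph_iff)
        moreover have "(y, u) \<notin> succ_edges F" using u_predecessor that(2) \<open>k \<notin> set s\<close> by blast
        moreover have "(u, y) \<notin> succ_edges F" using E_down[OF u_in_E] that(2) s(3) by blast
        moreover have "(y, u) \<notin> axiom_links F" using u_no_wire by (auto simp: axiom_links_def)
        ultimately show False by blast
      qed
      have p0N: "set p0 \<subseteq> N" using pN w(1) by auto
      have extend: False if q: "path (switching_graph F \<sigma>) (w # q @ [x])" and x: "x \<in> E" and qs: "set q \<subseteq> set s"
        and c: "switched F w \<Longrightarrow> c = \<sigma> w \<or> c = \<tau> w"
        and ew: "(last p0, w) \<in> switching_graph F (\<tau>(w := c))" "(w, hd (q @ [x])) \<in> switching_graph F (\<sigma>(w := c))"
        for q x c
      proof -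
        have "(last (w # q), x) \<in> switching_graph F \<sigma>" using q path_append[of "w # q" "[x]" "switching_graph F \<sigma>"] by simp
        moreover have "last (w # q) \<in> set s" using w(2) qs by auto
        ultimately have "x \<noteq> u" using not_u by blast
        have "set p0 \<inter> set (q @ [x]) = {}" using w(3) qs p0N x by (auto simp: E_def)
        then obtain \<rho> where \<rho>: "switching F \<rho>" "path (switching_graph F \<rho>) (p0 @ w # q @ [x])"
          using path_merge[OF p0w False q _ _ \<sigma>(1) p(1) c ew] by blast
        have "u \<notin> set (p0 @ w # q @ [x])" using p(5) w(1) u_s qs \<open>x \<noteq> u\<close> by auto
        moreover have "hd (p0 @ w # q @ [x]) = k" using w(1) p(3) False by (cases p0) auto
        ultimately show False using reachableI[OF \<rho>, of k u] x by (auto simp: E_def)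
      qed
      have x_w: "(last p0, w) \<in> switching_graph F \<tau>"
        using iffD1[OF path_append[OF False, of "[w]" "switching_graph F \<tau>"] p0w] by simp
      have qr: "set r \<subseteq> set s" "set (rev l) \<subseteq> set s" using lr by auto
      have "r @ [e'] \<noteq> []" "rev l @ [e] \<noteq> []" by blast+
      note fw = path_ConsD[OF fwd this(1)] and bw = path_ConsD[OF bwd this(2)]
      have "distinct (e # s @ [e'])" using es by (simp only: path_def)
      then have ne: "hd (r @ [e']) \<noteq> hd (rev l @ [e])" unfolding lr by (rule distinct_neighbours)
      show False
      proof (cases "(last p0, w) \<in> switching_graph F (\<tau>(w := \<sigma> w))")
        case True
        show False by (rule extend[OF fwd s(5) qr(1) _ True]) (use fw(1) in simp_all)
      next
        case False
        \<comment> \<open>Then \<open>\<tau>\<close> chooses at \<open>w\<close> the successor from which the path arrives, and the excursion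
          cannot pass through \<open>w\<close> between two successors.\<close>
        have "(w, hd (r @ [e'])) \<in> switching_graph F (\<sigma>(w := \<tau> w)) \<or>
            (w, hd (rev l @ [e])) \<in> switching_graph F (\<sigma>(w := \<tau> w))"
          using switching_graph_change[OF fw(1) bw(1) fw(2) bw(2) ne] .
        then show False
        proof
          assume *: "(w, hd (r @ [e'])) \<in> switching_graph F (\<sigma>(w := \<tau> w))"
          show False by (rule extend[OF fwd s(5) qr(1) _ _ *]) (use x_w in simp_all)
        next
          assume *: "(w, hd (rev l @ [e])) \<in> switching_graph F (\<sigma>(w := \<tau> w))"
          show False by (rule extend[OF bwd s(4) qr(2) _ _ *]) (use x_w in simp_all)
        qed
      qed
    qed
  qed
qed

lemma weakening_subnet_E: "weakening_subnet F E (roots F E - {u}) u"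
  using subnet_E u_root prunable_E by (auto simp: weakening_subnet_def)

end

section \<open>Derivability after default weakening\<close>

subsection \<open>Default weakening\<close>

lemma typed_succs_nonempty:
  fixes t :: "('i, 'v) tree" and w :: "('i, 'v) wit"
  shows "tree_typed \<Theta> t A \<Longrightarrow> \<forall>n\<in>#tree_nodes t. is_switched n \<longrightarrow> succs n \<noteq> {}"
    and "wit_typed \<Theta> w T \<Longrightarrow> \<forall>n\<in>#wit_nodes w. is_switched n \<longrightarrow> succs n \<noteq> {}"
proof (induction t and w arbitrary: A and T)
  case (Exp i ws)
  from Exp.prems obtain T where T: "ws \<noteq> {#}" "\<forall>w\<in>#ws. wit_typed \<Theta> w T"
    by (cases rule: tree_typed.cases) auto
  show ?case
  proof (intro ballI impI)
    fix n assume n: "n \<in># tree_nodes (Exp i ws)" "is_switched n"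
    show "succs n \<noteq> {}"
    proof (cases "n = Node i LExp (wname ` set_mset ws)")
      case True
      with T(1) show ?thesis by simp
    next
      case False
      with n(1) obtain w where w: "w \<in># ws" "n \<in># wit_nodes w" by auto
      show ?thesis using Exp.IH[OF w(1)] T(2) w n(2) by blast
    qed
  qed
next
  case (Vee i t s)
  from Vee.prems obtain A B where "tree_typed \<Theta> t A" "tree_typed \<Theta> s B"
    by (cases rule: tree_typed.cases) auto
  with Vee.IH(1)[of A] Vee.IH(2)[of B] show ?case by (simp add: ball_Un)
next
  case (VeeL i t j)
  from VeeL.prems obtain A where "tree_typed \<Theta> t A"
    by (cases rule: tree_typed.cases) auto
  with VeeL.IH[of A] show ?case by (simp add: is_switched_def)
next
  case (VeeR i j t)
  from VeeR.prems obtain A where "tree_typed \<Theta> t A"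
    by (cases rule: tree_typed.cases) auto
  with VeeR.IH[of A] show ?case by (simp add: is_switched_def)
next
  case (Tensor i t s)
  from Tensor.prems obtain A B where "tree_typed \<Theta> t A" "tree_typed \<Theta> s B"
    by (cases rule: wit_typed.cases) auto
  with Tensor.IH(1)[of A] Tensor.IH(2)[of B] show ?case by (simp add: ball_Un is_switched_def)
qed (simp_all add: is_switched_def)

lemma typed_root_succs_nonempty:
  assumes "root_typed \<Theta> c" "n \<in># root_nodes c" "is_switched n"
  shows "succs n \<noteq> {}"
proof (cases c)
  case (Tree t A)
  with assms typed_succs_nonempty(1)[of \<Theta> t A] show ?thesis by simp
next
  case (Wit w T)
  with assms typed_succs_nonempty(2)[of \<Theta> w T] show ?thesis by simp
next
  case (Cut i t A s)
  then have "n = Node i LCut {tname t, tname s} \<or> n \<in># tree_nodes t \<or> n \<in># tree_nodes s"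
    using assms(2) by simp
  with Cut assms typed_succs_nonempty(1)[of \<Theta> t A] typed_succs_nonempty(1)[of \<Theta> s "dual A"]
  show ?thesis by (elim disjE) (simp add: is_switched_def, auto)
qed

lemma typed_switching_exists:
  assumes named: "distinctly_named F" and typed: "forest_typed \<Theta> F"
  shows "\<exists>\<sigma>. switching F \<sigma>"
proof -
  have "\<exists>j. (i, j) \<in> succ_edges F" if i: "switched F i" for i
  proof -
    from i obtain n where n: "n \<in> nodes F" "node_name n = i" "is_switched n"
      unfolding switched_def labelled_def is_switched_def by blast
    from n(1) obtain c where c: "c \<in># F" "n \<in># root_nodes c" unfolding forest_nodes_def by auto
    have "root_typed \<Theta> c" using typed c(1) by (simp add: forest_typed_def)
    then have "succs n \<noteq> {}" using c(2) n(3) by (rule typed_root_succs_nonempty)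
    with n show ?thesis unfolding succ_edges_def by blast
  qed
  then have "\<forall>i. \<exists>j. switched F i \<longrightarrow> (i, j) \<in> succ_edges F" by blast
  then show ?thesis unfolding switching_def by (rule choice)
qed

definition proper_names :: "('i, 'v) node multiset \<Rightarrow> 'i set" where
  "proper_names M = node_name ` {m \<in> set_mset M. node_label m \<noteq> LStar}"

lemma proper_namesI: "m \<in># M \<Longrightarrow> node_label m \<noteq> LStar \<Longrightarrow> node_name m \<in> proper_names M"
  by (auto simp: proper_names_def)

lemma proper_names_mono: "set_mset M \<subseteq> set_mset N \<Longrightarrow> proper_names M \<subseteq> proper_names N"
  by (auto simp: proper_names_def)

lemma root_proper: "tname t \<in> proper_names (tree_nodes t)" "wname w \<in> proper_names (wit_nodes w)"
proof -
  from tree_root_label[of t] obtain m where "m \<in># tree_nodes t" "node_name m = tname t" "node_label m \<noteq> LStar"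
    by (elim bexE conjE) (erule that, simp, elim insertE emptyE, simp_all)
  then show "tname t \<in> proper_names (tree_nodes t)" using proper_namesI[of m "tree_nodes t"] by simp
  from wit_root_label[of w] obtain m where "m \<in># wit_nodes w" "node_name m = wname w" "node_label m \<noteq> LStar"
    by (elim bexE conjE) (erule that, simp, elim disjE exE, simp_all)
  then show "wname w \<in> proper_names (wit_nodes w)" using proper_namesI[of m "wit_nodes w"] by simp
qed

lemma switched_succs_proper:
  fixes t :: "('i, 'v) tree" and w :: "('i, 'v) wit"
  shows "\<forall>n\<in>#tree_nodes t. is_switched n \<longrightarrow> succs n \<subseteq> proper_names (tree_nodes t)"
    and "\<forall>n\<in>#wit_nodes w. is_switched n \<longrightarrow> succs n \<subseteq> proper_names (wit_nodes w)"
proof (induction t and w)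
  case (Exp i ws)
  have sub: "proper_names (wit_nodes w) \<subseteq> proper_names (tree_nodes (Exp i ws))" if "w \<in># ws" for w
    by (rule proper_names_mono) (use that in auto)
  show ?case
  proof (intro ballI impI)
    fix n assume n: "n \<in># tree_nodes (Exp i ws)" "is_switched n"
    show "succs n \<subseteq> proper_names (tree_nodes (Exp i ws))"
    proof (cases "n = Node i LExp (wname ` set_mset ws)")
      case True
      have "wname w \<in> proper_names (tree_nodes (Exp i ws))" if "w \<in># ws" for w
        using sub[OF that] root_proper(2)[of w] by blast
      then have "wname ` set_mset ws \<subseteq> proper_names (tree_nodes (Exp i ws))" by blast
      with True show ?thesis by (simp only: node.sel)
    next
      case False
      with n(1) obtain w where w: "w \<in># ws" "n \<in># wit_nodes w" by auto
      then have "succs n \<subseteq> proper_names (wit_nodes w)" using Exp.IH n(2) by blast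
      with sub[OF w(1)] show ?thesis by blast
    qed
  qed
next
  case (Vee i t s)
  have sub: "proper_names (tree_nodes t) \<subseteq> proper_names (tree_nodes (Vee i t s))"
    "proper_names (tree_nodes s) \<subseteq> proper_names (tree_nodes (Vee i t s))"
    by (rule proper_names_mono, force)+
  have "{tname t, tname s} \<subseteq> proper_names (tree_nodes (Vee i t s))"
    using sub root_proper(1)[of t] root_proper(1)[of s] by blast
  moreover have "succs n \<subseteq> proper_names (tree_nodes (Vee i t s))"
    if "n \<in># tree_nodes t \<or> n \<in># tree_nodes s" "is_switched n" for n
    using that Vee.IH sub by blast
  ultimately have "succs n \<subseteq> proper_names (tree_nodes (Vee i t s))"
    if "n = Node i LVee {tname t, tname s} \<or> n \<in># tree_nodes t \<or> n \<in># tree_nodes s" "is_switched n" for n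
    using that by (metis node.sel(3))
  moreover have "n = Node i LVee {tname t, tname s} \<or> n \<in># tree_nodes t \<or> n \<in># tree_nodes s"
    if "n \<in># tree_nodes (Vee i t s)" for n using that by simp
  ultimately show ?case by blast
next
  case (VeeL i t j)
  have "proper_names (tree_nodes t) \<subseteq> proper_names (tree_nodes (VeeL i t j))"
    by (rule proper_names_mono) force
  moreover have "n \<in># tree_nodes t" if "n \<in># tree_nodes (VeeL i t j)" "is_switched n" for n
    using that by (auto simp: is_switched_def)
  ultimately show ?case using VeeL.IH by blast
next
  case (VeeR i j t)
  have "proper_names (tree_nodes t) \<subseteq> proper_names (tree_nodes (VeeR i j t))"
    by (rule proper_names_mono) force
  moreover have "n \<in># tree_nodes t" if "n \<in># tree_nodes (VeeR i j t)" "is_switched n" for n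
    using that by (auto simp: is_switched_def)
  ultimately show ?case using VeeR.IH by blast
next
  case (Tensor i t s)
  have "proper_names (tree_nodes t) \<subseteq> proper_names (wit_nodes (Tensor i t s))"
    "proper_names (tree_nodes s) \<subseteq> proper_names (wit_nodes (Tensor i t s))"
    by (rule proper_names_mono, force)+
  moreover have "n \<in># tree_nodes t \<or> n \<in># tree_nodes s" if "n \<in># wit_nodes (Tensor i t s)" "is_switched n" for n
    using that by (auto simp: is_switched_def)
  ultimately show ?case using Tensor.IH by blast
qed (simp_all add: is_switched_def)

lemma root_switched_succs_proper:
  assumes "n \<in># root_nodes c" "is_switched n"
  shows "succs n \<subseteq> proper_names (root_nodes c)"
proof (cases c)
  case (Tree t A)
  with assms switched_succs_proper(1)[of t] show ?thesis by simp
next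
  case (Wit w T)
  with assms switched_succs_proper(2)[of w] show ?thesis by simp
next
  case (Cut i t A s)
  have "proper_names (tree_nodes t) \<subseteq> proper_names (root_nodes c)"
    "proper_names (tree_nodes s) \<subseteq> proper_names (root_nodes c)"
    by (rule proper_names_mono, force simp: Cut)+
  moreover have "n = Node i LCut {tname t, tname s} \<or> n \<in># tree_nodes t \<or> n \<in># tree_nodes s"
    using assms(1) Cut by simp
  moreover have "n \<noteq> Node i LCut {tname t, tname s}" using assms(2) by (auto simp: is_switched_def)
  ultimately show ?thesis
    using assms(2) switched_succs_proper(1)[of t] switched_succs_proper(1)[of s] by blast
qed

lemma star_not_switched:
  assumes named: "distinctly_named F" and e: "(i, j) \<in> succ_edges F" "labelled F j LStar"
  shows "\<not> switched F i"
proof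
  assume "switched F i"
  from e(1) obtain n where n: "n \<in> nodes F" "node_name n = i" "j \<in> succs n" by (auto simp: succ_edges_def)
  with \<open>switched F i\<close> have sw: "is_switched n" using switched_iff[OF named n(1)] by simp
  obtain c where c: "c \<in># F" "n \<in># root_nodes c" using n(1) by (auto simp: forest_nodes_def)
  have "j \<in> proper_names (root_nodes c)" using root_switched_succs_proper[OF c(2) sw] n(3) by blast
  then obtain m where m: "m \<in> nodes F" "node_name m = j" "node_label m \<noteq> LStar"
    using root_nodes_subset[OF c(1)] unfolding proper_names_def by blast
  with labelledI[OF m(1)] unique_label[OF named e(2)] show False by metis
qed

text \<open>
  Locally at a node, \<open>D\<close> is closed under successors, default weakenings and tensors, and predecessors all of
  whose other successors are in \<open>D\<close> as well.
\<close>

definition settled :: "'i set \<Rightarrow> 'v set \<Rightarrow> ('i, 'v) node \<Rightarrow> bool" where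
  "settled D V n \<longleftrightarrow>
     (if is_switched n then node_name n \<in> D \<longleftrightarrow> succs n \<subseteq> D
      else (\<forall>j\<in>succs n. j \<in> D \<longleftrightarrow> node_name n \<in> D) \<and>
        (\<forall>x. node_label n = LWire x \<longrightarrow> (node_name n \<in> D \<longleftrightarrow> wire_var x \<in> V)))"

lemma settled_coherent:
  fixes t :: "('i, 'v) tree" and w :: "('i, 'v) wit"
  shows "\<forall>n\<in>#tree_nodes t. settled D V n \<Longrightarrow> coherent D V t \<and> (vanishes D t \<longleftrightarrow> tname t \<in> D)"
    and "\<forall>n\<in>#wit_nodes w. settled D V n \<Longrightarrow> wit_coherent D V w"
proof (induction t and w)
  case (Exp i ws)
  have "settled D V n" if "w \<in># ws" "n \<in># wit_nodes w" for w n using Exp.prems that by auto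
  with Exp.IH have "\<forall>w\<in>#ws. wit_coherent D V w" by blast
  moreover have "settled D V (Node i LExp (wname ` set_mset ws))" using Exp.prems by simp
  ultimately show ?case by (auto simp: settled_def is_switched_def)
qed (auto simp: settled_def is_switched_def ball_Un)

lemma prune_roots:
  fixes t :: "('i, 'v) tree" and w :: "('i, 'v) wit"
  assumes "\<And>n j. n \<in># M \<Longrightarrow> node_name n \<notin> D \<Longrightarrow> j \<in> succs n \<Longrightarrow> j \<in> D \<longleftrightarrow> j \<in> U"
    and "\<And>n. n \<in># M \<Longrightarrow> settled D V n"
  shows "set_mset (tree_nodes t) \<subseteq> set_mset M \<Longrightarrow> tname t \<notin> D \<Longrightarrow> 
      map_tree (\<lambda>_. ()) (\<lambda>x. x) (tree_prune U t) = map_tree (\<lambda>_. ()) (\<lambda>x. x) (tree_prune D t)"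
    and "set_mset (wit_nodes w) \<subseteq> set_mset M \<Longrightarrow> wname w \<notin> D \<Longrightarrow>
      map_wit (\<lambda>_. ()) (\<lambda>x. x) (wit_prune U w) = map_wit (\<lambda>_. ()) (\<lambda>x. x) (wit_prune D w)"
proof (induction t and w)
  case (Exp i ws)
  have n: "Node i LExp (wname ` set_mset ws) \<in># M" using Exp.prems by auto
  have f: "wname w \<in> D \<longleftrightarrow> wname w \<in> U" if "w \<in># ws" for w
    using assms(1)[OF n] Exp.prems(2) that by simp
  have eq: "{#w \<in># image_mset (wit_prune Z) ws. wname w \<notin> Z'#} = image_mset (wit_prune Z) {#w \<in># ws. wname w \<notin> Z'#}" for Z Z'
    by (induction ws) auto
  have "{#w \<in># ws. wname w \<notin> U#} = {#w \<in># ws. wname w \<notin> D#}" by (rule filter_mset_cong) (use f in auto)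
  moreover have "image_mset (\<lambda>w. map_wit (\<lambda>_. ()) (\<lambda>x. x) (wit_prune U w)) {#w \<in># ws. wname w \<notin> D#} =
      image_mset (\<lambda>w. map_wit (\<lambda>_. ()) (\<lambda>x. x) (wit_prune D w)) {#w \<in># ws. wname w \<notin> D#}"
  proof (rule image_mset_cong)
    fix w assume w: "w \<in># {#w \<in># ws. wname w \<notin> D#}"
    then have "set_mset (wit_nodes w) \<subseteq> set_mset M" using Exp.prems(1) by auto
    with Exp.IH[of w] w show "map_wit (\<lambda>_. ()) (\<lambda>x. x) (wit_prune U w) = map_wit (\<lambda>_. ()) (\<lambda>x. x) (wit_prune D w)"
      by simp
  qed
  ultimately show ?case by (simp add: eq image_mset.compositionality comp_def)
next
  case (Vee i t s)
  have n: "Node i LVee {tname t, tname s} \<in># M" using Vee.prems by auto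
  have "tname t \<in> D \<longleftrightarrow> tname t \<in> U" "tname s \<in> D \<longleftrightarrow> tname s \<in> U"
    using assms(1)[OF n] Vee.prems(2) by simp_all
  moreover have "\<not> (tname t \<in> D \<and> tname s \<in> D)"
    using assms(2)[OF n] Vee.prems(2) by (simp add: settled_def is_switched_def)
  ultimately show ?case using Vee by auto
next
  case (VeeL i t j)
  have n: "Node i LWeak {tname t, j} \<in># M" using VeeL.prems by auto
  have "tname t \<notin> D" using assms(2)[OF n] VeeL.prems(2) by (simp add: settled_def is_switched_def)
  with VeeL show ?case by simp
next
  case (VeeR i j t)
  have n: "Node i LWeak {j, tname t} \<in># M" using VeeR.prems by auto
  have "tname t \<notin> D" using assms(2)[OF n] VeeR.prems(2) by (simp add: settled_def is_switched_def)
  with VeeR show ?case by simp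
next
  case (Tensor i t s)
  have n: "Node i LTensor {tname t, tname s} \<in># M" using Tensor.prems by auto
  have "tname t \<notin> D" "tname s \<notin> D" using assms(2)[OF n] Tensor.prems(2) by (simp_all add: settled_def is_switched_def)
  with Tensor show ?case by simp
qed auto

lemma prune_disjoint:
  fixes t :: "('i, 'v) tree" and w :: "('i, 'v) wit"
  shows "node_name ` set_mset (tree_nodes t) \<inter> D = {} \<Longrightarrow> tree_prune D t = t"
    and "node_name ` set_mset (wit_nodes w) \<inter> D = {} \<Longrightarrow> wit_prune D w = w"
proof (induction t and w)
  case (Exp i ws)
  have d: "node_name ` set_mset (wit_nodes w) \<inter> D = {}" if "w \<in># ws" for w
    using Exp.prems that by auto
  then have "wit_prune D w = w" if "w \<in># ws" for w using Exp.IH that by blast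
  moreover have "wname w \<notin> D" if "w \<in># ws" for w using d[OF that] name_in_nodes(2)[of w] by blast
  ultimately have "image_mset (wit_prune D) ws = ws" "\<forall>w\<in>#ws. wname w \<notin> D"
    by (auto cong: image_mset_cong)
  then show ?case by (simp add: filter_mset_eq_conv)
next
  case (Vee i t s)
  then have "tname t \<notin> D" "tname s \<notin> D" using name_in_nodes(1)[of t] name_in_nodes(1)[of s] by auto
  with Vee show ?case by (auto simp: image_Un Int_Un_distrib2)
qed (auto simp: image_Un Int_Un_distrib2)

lemma tree_succs_names_aux:
  fixes t :: "('i, 'v) tree" and w :: "('i, 'v) wit"
  shows "\<forall>n\<in>#tree_nodes t. succs n \<subseteq> node_name ` set_mset (tree_nodes t)"
    and "\<forall>n\<in>#wit_nodes w. succs n \<subseteq> node_name ` set_mset (wit_nodes w)"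
proof (induction t and w)
  case (Exp i ws)
  have sub: "node_name ` set_mset (wit_nodes w) \<subseteq> node_name ` set_mset (tree_nodes (Exp i ws))" if "w \<in># ws" for w
    by (rule image_mono) (use that in auto)
  show ?case
  proof
    fix n assume n: "n \<in># tree_nodes (Exp i ws)"
    show "succs n \<subseteq> node_name ` set_mset (tree_nodes (Exp i ws))"
    proof (cases "n = Node i LExp (wname ` set_mset ws)")
      case True
      have "wname w \<in> node_name ` set_mset (tree_nodes (Exp i ws))" if "w \<in># ws" for w
        using sub[OF that] name_in_nodes(2)[of w] by blast
      then have "wname ` set_mset ws \<subseteq> node_name ` set_mset (tree_nodes (Exp i ws))" by blast
      with True show ?thesis by (simp only: node.sel)
    next
      case False
      with n obtain w where w: "w \<in># ws" "n \<in># wit_nodes w" by auto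
      then have "succs n \<subseteq> node_name ` set_mset (wit_nodes w)" using Exp.IH by blast
      with sub[OF w(1)] show ?thesis by blast
    qed
  qed
next
  case (Vee i t s)
  let ?W = "node_name ` set_mset (tree_nodes (Vee i t s))"
  have sub: "node_name ` set_mset (tree_nodes t) \<subseteq> ?W" "node_name ` set_mset (tree_nodes s) \<subseteq> ?W"
    by (rule image_mono, force)+
  have root: "{tname t, tname s} \<subseteq> ?W"
    using subsetD[OF sub(1) name_in_nodes(1)] subsetD[OF sub(2) name_in_nodes(1)] by simp
  show ?case
  proof
    fix n assume "n \<in># tree_nodes (Vee i t s)"
    then consider "n \<in># tree_nodes t" | "n \<in># tree_nodes s" | "succs n = {tname t, tname s}" by auto
    then show "succs n \<subseteq> ?W"
    proof cases
      case 1
      from order.trans[OF bspec[OF Vee.IH(1) 1] sub(1)] show ?thesis .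
    next
      case 2
      from order.trans[OF bspec[OF Vee.IH(2) 2] sub(2)] show ?thesis .
    qed (simp only: root)
  qed
next
  case (VeeL i t j)
  let ?W = "node_name ` set_mset (tree_nodes (VeeL i t j))"
  have sub: "node_name ` set_mset (tree_nodes t) \<subseteq> ?W" by (rule image_mono) force
  have root: "{tname t, j} \<subseteq> ?W" using subsetD[OF sub name_in_nodes(1)] by simp
  show ?case
  proof
    fix n assume "n \<in># tree_nodes (VeeL i t j)"
    then consider "n \<in># tree_nodes t" | "succs n = {tname t, j}" | "succs n = {}" by auto
    then show "succs n \<subseteq> ?W"
    proof cases
      case 1
      from order.trans[OF bspec[OF VeeL.IH 1] sub] show ?thesis .
    next
      case 2
      with root show ?thesis by (simp only:)
    next
      case 3
      then show ?thesis by (simp only: empty_subsetI)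
    qed
  qed
next
  case (VeeR i j t)
  let ?W = "node_name ` set_mset (tree_nodes (VeeR i j t))"
  have sub: "node_name ` set_mset (tree_nodes t) \<subseteq> ?W" by (rule image_mono) force
  have root: "{j, tname t} \<subseteq> ?W" using subsetD[OF sub name_in_nodes(1)] by simp
  show ?case
  proof
    fix n assume "n \<in># tree_nodes (VeeR i j t)"
    then consider "n \<in># tree_nodes t" | "succs n = {j, tname t}" | "succs n = {}" by auto
    then show "succs n \<subseteq> ?W"
    proof cases
      case 1
      from order.trans[OF bspec[OF VeeR.IH 1] sub] show ?thesis .
    next
      case 2
      with root show ?thesis by (simp only:)
    next
      case 3
      then show ?thesis by (simp only: empty_subsetI)
    qed
  qed
next
  case (Tensor i t s)
  let ?W = "node_name ` set_mset (wit_nodes (Tensor i t s))"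
  have sub: "node_name ` set_mset (tree_nodes t) \<subseteq> ?W" "node_name ` set_mset (tree_nodes s) \<subseteq> ?W"
    by (rule image_mono, force)+
  have root: "{tname t, tname s} \<subseteq> ?W"
    using subsetD[OF sub(1) name_in_nodes(1)] subsetD[OF sub(2) name_in_nodes(1)] by simp
  show ?case
  proof
    fix n assume "n \<in># wit_nodes (Tensor i t s)"
    then consider "n \<in># tree_nodes t" | "n \<in># tree_nodes s" | "succs n = {tname t, tname s}" by auto
    then show "succs n \<subseteq> ?W"
    proof cases
      case 1
      from order.trans[OF bspec[OF Tensor.IH(1) 1] sub(1)] show ?thesis .
    next
      case 2
      from order.trans[OF bspec[OF Tensor.IH(2) 2] sub(2)] show ?thesis .
    qed (simp only: root)
  qed
qed simp_all

lemma tree_succs_names: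
  fixes t :: "('i, 'v) tree" and w :: "('i, 'v) wit"
  shows "n \<in># tree_nodes t \<Longrightarrow> succs n \<subseteq> node_name ` set_mset (tree_nodes t)"
    and "n \<in># wit_nodes w \<Longrightarrow> succs n \<subseteq> node_name ` set_mset (wit_nodes w)"
  by (rule bspec[OF tree_succs_names_aux(1)], assumption) (rule bspec[OF tree_succs_names_aux(2)], assumption)

definition descends :: "('p, 'i, 'v) gen_forest \<Rightarrow> 'i \<Rightarrow> 'i \<Rightarrow> bool" where
  "descends F v w \<longleftrightarrow> (v, w) \<in> succ_edges F \<and> (w, v) \<notin> succ_edges F"

lemma descendsI:
  assumes named: "distinctly_named F"
    and n: "n \<in> nodes F" "w \<in> succs n" and m: "m \<in> nodes F" "node_name m = w" "node_name n \<notin> succs m"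
  shows "descends F (node_name n) w"
  unfolding descends_def
proof
  show "(node_name n, w) \<in> succ_edges F" using n unfolding succ_edges_def by blast
  show "(w, node_name n) \<notin> succ_edges F"
  proof
    assume "(w, node_name n) \<in> succ_edges F"
    then obtain m' where m': "m' \<in> nodes F" "node_name m' = w" "node_name n \<in> succs m'"
      unfolding succ_edges_def by blast
    then have "m' = m" using unique_node[OF named m'(1) m(1)] m(2) by simp
    with m'(3) m(3) show False by simp
  qed
qed

definition chain :: "('p, 'i, 'v) gen_forest \<Rightarrow> 'i \<Rightarrow> 'i set \<Rightarrow> 'i \<Rightarrow> bool" where
  "chain F v W x \<longleftrightarrow> (\<exists>q. distinct (v # q) \<and> set (v # q) \<subseteq> W \<and> last (v # q) = x \<and>
     successively (descends F) (v # q))"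

lemma chain_Nil: "x \<in> W \<Longrightarrow> chain F x W x"
  unfolding chain_def by (rule exI[of _ "[]"]) simp

lemma chain_Cons:
  assumes "chain F w W x" "descends F v w" "v \<notin> W" "insert v W \<subseteq> W'"
  shows "chain F v W' x"
proof -
  from assms(1) obtain q where q: "distinct (w # q)" "set (w # q) \<subseteq> W" "last (w # q) = x"
    "successively (descends F) (w # q)" unfolding chain_def by blast
  have "v \<notin> set (w # q)" using q(2) assms(3) by (meson subsetD)
  then have "distinct (v # w # q)" using q(1) by simp
  moreover have "set (v # w # q) \<subseteq> W'" using q(2) assms(4) by auto
  moreover have "last (v # w # q) = x" "successively (descends F) (v # w # q)" using q(3,4) assms(2) by simp_all
  ultimately show ?thesis unfolding chain_def by (intro exI[of _ "w # q"] conjI)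
qed

lemma chain_step:
  assumes named: "distinctly_named F" and n: "n \<in> nodes F" "w \<in> succs n"
    and N: "set_mset M \<subseteq> nodes F" "w \<in> node_name ` set_mset M"
      "\<And>m. m \<in># M \<Longrightarrow> succs m \<subseteq> node_name ` set_mset M" "node_name n \<notin> node_name ` set_mset M"
    and c: "chain F w (node_name ` set_mset M) x" and W: "insert (node_name n) (node_name ` set_mset M) \<subseteq> W"
  shows "chain F (node_name n) W x"
proof -
  from N(2) obtain m where m: "m \<in># M" "node_name m = w" by blast
  have "m \<in> nodes F" using N(1) m(1) by (rule subsetD)
  moreover have "node_name n \<notin> succs m" using N(3)[OF m(1)] N(4) by (meson subsetD)
  ultimately
  have *: "m \<in> nodes F" "node_name n \<notin> succs m" by simp_all
  from descendsI[OF named n *(1) m(2) *(2)] show ?thesis by (rule chain_Cons[OF c _ N(4) W])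
qed

lemma chain_tree:
  assumes "distinctly_named F" "n \<in> nodes F" "node_name n = i" "tname t \<in> succs n"
    "set_mset (tree_nodes t) \<subseteq> nodes F" "i \<notin> node_name ` set_mset (tree_nodes t)"
    "chain F (tname t) (node_name ` set_mset (tree_nodes t)) x"
    "insert i (node_name ` set_mset (tree_nodes t)) \<subseteq> W"
  shows "chain F i W x"
  using chain_step[of F n "tname t" "tree_nodes t" x W] assms name_in_nodes(1)[of t] tree_succs_names(1)[of _ t]
  by simp

lemma chain_wit:
  assumes "distinctly_named F" "n \<in> nodes F" "node_name n = i" "wname w \<in> succs n"
    "set_mset (wit_nodes w) \<subseteq> nodes F" "i \<notin> node_name ` set_mset (wit_nodes w)"
    "chain F (wname w) (node_name ` set_mset (wit_nodes w)) x"
    "insert i (node_name ` set_mset (wit_nodes w)) \<subseteq> W"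
  shows "chain F i W x"
  using chain_step[of F n "wname w" "wit_nodes w" x W] assms name_in_nodes(2)[of w] tree_succs_names(2)[of _ w]
  by simp

lemma chain_star:
  assumes "distinctly_named F" "n \<in> nodes F" "node_name n = i" "j \<in> succs n" "Node j LStar {} \<in> nodes F"
    "i \<noteq> j" "{i, j} \<subseteq> W"
  shows "chain F i W j"
  using chain_step[of F n j "{#Node j LStar {}#}" j W] assms chain_Nil[of j "{j}" F] by simp

lemma tree_chain:
  fixes t :: "('i, 'v) tree" and w :: "('i, 'v) wit"
  assumes named: "distinctly_named F"
  shows "set_mset (tree_nodes t) \<subseteq> nodes F \<Longrightarrow> distinct_names (tree_nodes t) \<Longrightarrow>
      x \<in> node_name ` set_mset (tree_nodes t) \<Longrightarrow> chain F (tname t) (node_name ` set_mset (tree_nodes t)) x"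
    and "set_mset (wit_nodes w) \<subseteq> nodes F \<Longrightarrow> distinct_names (wit_nodes w) \<Longrightarrow>
      x \<in> node_name ` set_mset (wit_nodes w) \<Longrightarrow> chain F (wname w) (node_name ` set_mset (wit_nodes w)) x"
proof (induction t and w)
  case (Unit i)
  then show ?case by (simp add: chain_Nil)
next
  case (Exp i ws)
  show ?case
  proof (cases "x = i")
    case True
    then show ?thesis by (simp add: chain_Nil)
  next
    case False
    with Exp.prems(3) obtain w where w: "w \<in># ws" "x \<in> node_name ` set_mset (wit_nodes w)" by auto
    let ?n = "Node i LExp (wname ` set_mset ws)"
    obtain ws' where ws: "ws = add_mset w ws'" using w(1) by (meson multi_member_split)
    have sub: "set_mset (wit_nodes w) \<subseteq> nodes F" "distinct_names (wit_nodes w)" "i \<notin> node_name ` set_mset (wit_nodes w)"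
      using Exp.prems(1,2) unfolding ws by (auto simp: image_Un)
    show ?thesis unfolding tree.sel
    proof (rule chain_wit[OF named _ _ _ sub(1,3) Exp.IH[OF w(1) sub(1,2) w(2)]])
      show "?n \<in> nodes F" using Exp.prems(1) by simp
      show "wname w \<in> succs ?n" using w(1) by simp
      show "insert i (node_name ` set_mset (wit_nodes w)) \<subseteq> node_name ` set_mset (tree_nodes (Exp i ws))"
        using w(1) by auto
    qed simp
  qed
next
  case (Vee i t s)
  let ?n = "Node i LVee {tname t, tname s}" and ?W = "node_name ` set_mset (tree_nodes (Vee i t s))"
  have n: "?n \<in> nodes F" using Vee.prems(1) by simp
  have sub: "set_mset (tree_nodes t) \<subseteq> nodes F" "distinct_names (tree_nodes t)" "i \<notin> node_name ` set_mset (tree_nodes t)"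
     "set_mset (tree_nodes s) \<subseteq> nodes F" "distinct_names (tree_nodes s)" "i \<notin> node_name ` set_mset (tree_nodes s)"
    using Vee.prems(1,2) by (auto simp: image_Un)
  consider "x = i" | "x \<in> node_name ` set_mset (tree_nodes t)" | "x \<in> node_name ` set_mset (tree_nodes s)"
    using Vee.prems(3) by auto
  then show ?case
  proof cases
    case 2
    show ?thesis unfolding tree.sel wit.sel
      by (rule chain_tree[OF named n _ _ sub(1) sub(3) Vee.IH(1)[OF sub(1,2) 2]]) auto
  next
    case 3
    show ?thesis unfolding tree.sel wit.sel
      by (rule chain_tree[OF named n _ _ sub(4) sub(6) Vee.IH(2)[OF sub(4,5) 3]]) auto
  qed (simp add: chain_Nil)
next
  case (VeeL i t j)
  let ?n = "Node i LWeak {tname t, j}" and ?W = "node_name ` set_mset (tree_nodes (VeeL i t j))"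
  have n: "?n \<in> nodes F" "Node j LStar {} \<in> nodes F" using VeeL.prems(1) by simp_all
  have sub: "set_mset (tree_nodes t) \<subseteq> nodes F" "distinct_names (tree_nodes t)" "i \<notin> node_name ` set_mset (tree_nodes t)" "i \<noteq> j"
    using VeeL.prems(1,2) by (auto simp: image_Un)
  consider "x = i" | "x = j" | "x \<in> node_name ` set_mset (tree_nodes t)"
    using VeeL.prems(3) by auto
  then show ?case
  proof cases
    case 2
    show ?thesis unfolding tree.sel 2
      by (rule chain_star[OF named n(1) _ _ n(2) sub(4)]) simp_all
  next
    case 3
    show ?thesis unfolding tree.sel wit.sel
      by (rule chain_tree[OF named n(1) _ _ sub(1) sub(3) VeeL.IH[OF sub(1,2) 3]]) auto
  qed (simp add: chain_Nil)
next
  case (VeeR i j t)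
  let ?n = "Node i LWeak {j, tname t}" and ?W = "node_name ` set_mset (tree_nodes (VeeR i j t))"
  have n: "?n \<in> nodes F" "Node j LStar {} \<in> nodes F" using VeeR.prems(1) by simp_all
  have sub: "set_mset (tree_nodes t) \<subseteq> nodes F" "distinct_names (tree_nodes t)" "i \<notin> node_name ` set_mset (tree_nodes t)" "i \<noteq> j"
    using VeeR.prems(1,2) by (auto simp: image_Un)
  consider "x = i" | "x = j" | "x \<in> node_name ` set_mset (tree_nodes t)"
    using VeeR.prems(3) by auto
  then show ?case
  proof cases
    case 2
    show ?thesis unfolding tree.sel 2
      by (rule chain_star[OF named n(1) _ _ n(2) sub(4)]) simp_all
  next
    case 3
    show ?thesis unfolding tree.sel wit.sel
      by (rule chain_tree[OF named n(1) _ _ sub(1) sub(3) VeeR.IH[OF sub(1,2) 3]]) auto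
  qed (simp add: chain_Nil)
next
  case (Wire i x')
  then show ?case by (simp add: chain_Nil)
next
  case (Tensor i t s)
  let ?n = "Node i LTensor {tname t, tname s}" and ?W = "node_name ` set_mset (wit_nodes (Tensor i t s))"
  have n: "?n \<in> nodes F" using Tensor.prems(1) by simp
  have sub: "set_mset (tree_nodes t) \<subseteq> nodes F" "distinct_names (tree_nodes t)" "i \<notin> node_name ` set_mset (tree_nodes t)"
     "set_mset (tree_nodes s) \<subseteq> nodes F" "distinct_names (tree_nodes s)" "i \<notin> node_name ` set_mset (tree_nodes s)"
    using Tensor.prems(1,2) by (auto simp: image_Un)
  consider "x = i" | "x \<in> node_name ` set_mset (tree_nodes t)" | "x \<in> node_name ` set_mset (tree_nodes s)"
    using Tensor.prems(3) by auto
  then show ?case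
  proof cases
    case 2
    show ?thesis unfolding tree.sel wit.sel
      by (rule chain_tree[OF named n _ _ sub(1) sub(3) Tensor.IH(1)[OF sub(1,2) 2]]) auto
  next
    case 3
    show ?thesis unfolding tree.sel wit.sel
      by (rule chain_tree[OF named n _ _ sub(4) sub(6) Tensor.IH(2)[OF sub(4,5) 3]]) auto
  qed (simp add: chain_Nil)
qed

context factor
begin

lemma path_down:
  assumes "switching F \<sigma>" "path (switching_graph F \<sigma>) p" "last p = v"
    "p = [v] \<or> (v, last (butlast p)) \<notin> succ_edges F"
    "successively (descends F) (v # q)" "distinct q" "set p \<inter> set q = {}"
  shows "\<exists>\<sigma>. switching F \<sigma> \<and> path (switching_graph F \<sigma>) (p @ q)"
  using assms
proof (induction q arbitrary: p \<sigma> v)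
  case Nil
  then show ?case by auto
next
  case (Cons w q)
  let ?\<tau> = "\<sigma>(v := w)"
  have e: "(v, w) \<in> succ_edges F" "(w, v) \<notin> succ_edges F" using Cons.prems(5) by (simp_all add: descends_def)
  have "path (switching_graph F ?\<tau>) p" using path_update_last[OF Cons.prems(2,3,4)] .
  moreover have "(last p, w) \<in> switching_graph F ?\<tau>" using e Cons.prems(3) by (simp add: switching_graph_iff)
  moreover have "w \<notin> set p" using Cons.prems(7) by simp
  ultimately have p: "path (switching_graph F ?\<tau>) (p @ [w])" by (rule path_snoc)
  have "\<exists>\<sigma>. switching F \<sigma> \<and> path (switching_graph F \<sigma>) ((p @ [w]) @ q)"
  proof (rule Cons.IH[OF switching_update[OF Cons.prems(1) e(1)] p])
    show "last (p @ [w]) = w" by simp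
    show "p @ [w] = [w] \<or> (w, last (butlast (p @ [w]))) \<notin> succ_edges F"
      using e(2) Cons.prems(3) by simp
    show "successively (descends F) (w # q)" "distinct q" using Cons.prems(5,6) by simp_all
    show "set (p @ [w]) \<inter> set q = {}" using Cons.prems(6,7) by auto
  qed
  then show ?case by simp
qed

text \<open>
  Downward paths choose their own switching: the choices are made one at a time at the last node of the path.
\<close>

lemma tree_reachable:
  assumes t: "set_mset (tree_nodes t) \<subseteq> nodes F" "distinct_names (tree_nodes t)"
    and p: "switching F \<sigma>" "path (switching_graph F \<sigma>) p" "hd p = k" "last p = v"
      "p = [v] \<or> (v, last (butlast p)) \<notin> succ_edges F" "u \<notin> set p"
    and v: "descends F v (tname t)" "set p \<inter> node_name ` set_mset (tree_nodes t) = {}"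
    and u: "u \<notin> node_name ` set_mset (tree_nodes t)"
  shows "node_name ` set_mset (tree_nodes t) \<subseteq> N"
proof
  fix x assume "x \<in> node_name ` set_mset (tree_nodes t)"
  then obtain q where q: "distinct (tname t # q)" "set (tname t # q) \<subseteq> node_name ` set_mset (tree_nodes t)"
    "last (tname t # q) = x" "successively (descends F) (tname t # q)"
    using tree_chain(1)[OF named t] unfolding chain_def by blast
  have "\<exists>\<sigma>. switching F \<sigma> \<and> path (switching_graph F \<sigma>) (p @ tname t # q)"
    by (rule path_down[OF p(1,2,4,5) _ q(1)]) (use v(1) q(4) in simp, use v(2) q(2) in blast)
  then obtain \<rho> where \<rho>: "switching F \<rho>" "path (switching_graph F \<rho>) (p @ tname t # q)" by blast
  have "hd (p @ tname t # q) = k" using p(2,3) by (simp add: path_def)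
  moreover have "u \<notin> set (p @ tname t # q)" using p(6) q(2) u by auto
  ultimately show "x \<in> N" using reachableI[OF \<rho>] q(3) by (metis last_appendR list.distinct(1))
qed

end

lemma settled_root_coherent:
  assumes "\<forall>n\<in>#root_nodes c. settled D V n"
  shows "root_coherent D V c \<and> (root_vanishes D c \<longleftrightarrow> rname c \<in> D)"
proof (cases c)
  case (Tree t A)
  with assms settled_coherent(1)[of t D V] show ?thesis by simp
next
  case (Wit w T)
  with assms settled_coherent(2)[of w D V] show ?thesis by simp
next
  case (Cut i t A s)
  then have "settled D V (Node i LCut {tname t, tname s})" using assms by simp
  then have "tname t \<in> D \<longleftrightarrow> i \<in> D" "tname s \<in> D \<longleftrightarrow> i \<in> D" by (simp_all add: settled_def is_switched_def)
  with Cut assms settled_coherent(1)[of t D V] settled_coherent(1)[of s D V] show ?thesis by (simp add: ball_Un)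
qed

lemma root_prune_roots:
  assumes "\<And>n j. n \<in># M \<Longrightarrow> node_name n \<notin> D \<Longrightarrow> j \<in> succs n \<Longrightarrow> j \<in> D \<longleftrightarrow> j \<in> U"
    and "\<And>n. n \<in># M \<Longrightarrow> settled D V n"
    and "set_mset (root_nodes c) \<subseteq> set_mset M" "rname c \<notin> D"
  shows "rename (\<lambda>_. ()) (\<lambda>x. x) (root_prune U c) = rename (\<lambda>_. ()) (\<lambda>x. x) (root_prune D c)"
proof (cases c)
  case (Tree t A)
  with prune_roots(1)[OF assms(1,2), where t = t] assms(3,4) show ?thesis by simp
next
  case (Wit w T)
  with prune_roots(2)[OF assms(1,2), where w = w] assms(3,4) show ?thesis by simp
next
  case (Cut i t A s)
  then have "settled D V (Node i LCut {tname t, tname s})" using assms(2,3) by auto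
  then have "tname t \<notin> D" "tname s \<notin> D" using assms(4) Cut by (simp_all add: settled_def is_switched_def)
  with Cut prune_roots(1)[OF assms(1,2), where t = t] prune_roots(1)[OF assms(1,2), where t = s] assms(3) show ?thesis
    by simp
qed

lemma linked_dual_node:
  assumes "linked F" "n \<in> nodes F" "node_label n = LWire x"
  obtains d where "d \<in> nodes F" "node_label d = LWire (wdual x)"
proof -
  have "n \<in># {#n \<in># forest_nodes F. node_label n = LWire x#}" using assms(2,3) by simp
  then have "0 < occurrences F x" unfolding occurrences_def by (metis gr0I multi_member_last size_eq_0_iff_empty empty_iff set_mset_empty)
  then have "0 < occurrences F (wdual x)" using assms(1) by (simp add: linked_def)
  then have "{#n \<in># forest_nodes F. node_label n = LWire (wdual x)#} \<noteq> {#}" unfolding occurrences_def nonempty_has_size .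
  then obtain d where "d \<in># {#n \<in># forest_nodes F. node_label n = LWire (wdual x)#}" by (rule multiset_nonemptyE)
  then show thesis using that[of d] by simp
qed

lemma wire_var_eq: "wire_var x = wire_var y \<Longrightarrow> x = y \<or> x = wdual y"
  by (cases x; cases y) simp_all

lemma (in factor) settled_E:
  assumes typed: "forest_typed \<Theta> F" and lk: "linked F"
    and n: "n \<in> nodes F" "node_name n \<noteq> k"
  shows "settled E {wire_var x |x m. m \<in> nodes F \<and> node_label m = LWire x \<and> node_name m \<in> E} n"
proof -
  have edge: "(node_name n, j) \<in> succ_edges F \<longleftrightarrow> j \<in> succs n" for j
    using unique_node[OF named _ n(1)] n(1) unfolding succ_edges_def by blast
  have sw: "switched F (node_name n) \<longleftrightarrow> is_switched n" using switched_iff[OF named n(1)] .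
  have switched: "node_name n \<in> E \<longleftrightarrow> succs n \<subseteq> E" if "is_switched n"
  proof
    assume "node_name n \<in> E"
    then show "succs n \<subseteq> E" using E_down edge by blast
  next
    assume s: "succs n \<subseteq> E"
    from n(1) obtain c where c: "c \<in># F" "n \<in># root_nodes c" unfolding forest_nodes_def by auto
    have "root_typed \<Theta> c" using typed c(1) by (simp add: forest_typed_def)
    then have "succs n \<noteq> {}" using c(2) that by (rule typed_root_succs_nonempty)
    then obtain w where w: "w \<in> succs n" by blast
    show "node_name n \<in> E"
      by (rule E_up_switched[of _ w]) (use that sw w edge s in blast)+
  qed
  have unswitched: "j \<in> E \<longleftrightarrow> node_name n \<in> E" if "\<not> is_switched n" "j \<in> succs n" for j
  proof
    assume j: "j \<in> E"
    show "node_name n \<in> E" by (rule E_up_unswitched[OF _ j _ n(2)]) (use that sw edge in blast)+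
  next
    assume "node_name n \<in> E"
    then show "j \<in> E" using E_down edge that by blast
  qed
  have wire: "node_name n \<in> E" if x: "node_label n = LWire x"
    and m: "m \<in> nodes F" "node_label m = LWire y" "node_name m \<in> E" and xy: "wire_var x = wire_var y" for x y m
  proof -
    have link: "node_name b \<in> E" if "a \<in> nodes F" "b \<in> nodes F" "node_label a = LWire z" "node_label b = LWire (wdual z)"
      "node_name a \<in> E" for a b z
    proof (rule E_link[OF that(5)])
      show "(node_name a, node_name b) \<in> axiom_links F"
        using labelledI[OF that(1)] labelledI[OF that(2)] that(3,4) unfolding axiom_links_def by auto
    qed
    from wire_var_eq[OF xy] show ?thesis
    proof
      assume "x = wdual y"
      then show ?thesis using link[OF m(1) n(1) m(2) _ m(3)] x by simp
    next
      assume "x = y"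
      obtain d where d: "d \<in> nodes F" "node_label d = LWire (wdual y)" using linked_dual_node[OF lk m(1,2)] .
      have "node_name d \<in> E" using link[OF m(1) d(1) m(2) d(2) m(3)] .
      then show ?thesis using link[OF d(1) n(1) d(2)] x \<open>x = y\<close> by simp
    qed
  qed
  show ?thesis unfolding settled_def using switched unswitched wire n(1) by (simp, blast)
qed

text \<open>
  The kept factor \<open>o'\<close> and the kept disjunct \<open>t\<close> are reachable from \<open>k\<close> along their own branches, so the erased set avoids them and acts on the rest of the forest exactly as \<open>prune\<close> does.
\<close>

lemma weakening_step:
  fixes F0 :: "('p, 'i, 'v) gen_forest" and s o' t :: "('i, 'v) tree"
  assumes F: "F = F0 + {#c#}" and named: "distinctly_named F" and ac: "AC F"
    and typed: "forest_typed \<Theta> F" and lk: "linked F" and ri: "rname c = i"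
    and nc: "root_nodes c = add_mset (Node i LCut {j, l}) (add_mset (Node j LExp {k})
      (add_mset (Node k LTensor {tname o', tname s}) (add_mset (Node l LWeak {tname t, m})
      (add_mset (Node m LStar {}) (tree_nodes o' + tree_nodes s + tree_nodes t)))))"
    and d: "drv r n False (F0 + {#mk_cut i o' A t, Tree s B#})"
  shows "\<exists>E U. weakening_subnet F E U (tname s) \<and> drv r n False (strip (prune U F0 + {#mk_cut i o' A t#}))"
proof -
  have dn: "distinct_names (root_nodes c)" and d0: "node_name ` set_mset (root_nodes c) \<inter> node_set F0 = {}"
    using named by (simp_all add: F)
  have dist: "distinct [i, j, k, l]" and dt: "distinct_names (tree_nodes o')" "distinct_names (tree_nodes s)" "distinct_names (tree_nodes t)"
    and nin: "set [i, j, k, l] \<inter> node_name ` set_mset (tree_nodes o') = {}"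
      "set [i, j, k, l] \<inter> node_name ` set_mset (tree_nodes s) = {}"
      "set [i, j, k, l] \<inter> node_name ` set_mset (tree_nodes t) = {}"
    and disj: "node_name ` set_mset (tree_nodes o') \<inter> node_name ` set_mset (tree_nodes s) = {}"
      "node_name ` set_mset (tree_nodes t) \<inter> node_name ` set_mset (tree_nodes s) = {}"
    using dn unfolding nc by (simp_all add: image_Un Int_Un_distrib Int_Un_distrib2 Int_commute)
  have cF: "set_mset (root_nodes c) \<subseteq> nodes F" by (simp add: F)
  then have nd: "Node i LCut {j, l} \<in> nodes F" "Node j LExp {k} \<in> nodes F"
      "Node k LTensor {tname o', tname s} \<in> nodes F" "Node l LWeak {tname t, m} \<in> nodes F"
    and tr: "set_mset (tree_nodes o') \<subseteq> nodes F" "set_mset (tree_nodes s) \<subseteq> nodes F" "set_mset (tree_nodes t) \<subseteq> nodes F"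
    unfolding nc by simp_all
  have desc: "descends F (node_name a) (tname t')" if "a \<in> nodes F" "tname t' \<in> succs a"
    "set_mset (tree_nodes t') \<subseteq> nodes F" "node_name a \<notin> node_name ` set_mset (tree_nodes t')" for a t'
  proof -
    from name_in_nodes(1)[of t'] obtain b where b: "b \<in># tree_nodes t'" "node_name b = tname t'" by (metis imageE)
    have "b \<in> nodes F" using b(1) that(3) by blast
    moreover have "node_name a \<notin> succs b" using tree_succs_names(1)[OF b(1)] that(4) by blast
    ultimately show ?thesis using descendsI[OF named that(1,2)] b(2) by blast
  qed
  have ks: "descends F k (tname s)" and ko: "descends F k (tname o')" and lt: "descends F l (tname t)"
    using desc[OF nd(3), of s] desc[OF nd(3), of o'] desc[OF nd(4), of t] tr nin by simp_all
  from tree_root_label[of s] obtain b where b: "b \<in># tree_nodes s" "node_name b = tname s"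
    "node_label b \<in> {LUnit, LExp, LVee, LWeak}" by blast
  have lb: "labelled F (tname s) (node_label b)" using labelledI[of b F] b tr(2) by auto
  have names_in: "tname t' \<in> node_name ` set_mset (tree_nodes t')" for t' :: "('i, 'v) tree" by (rule name_in_nodes)
  interpret factor F k "tname s"
  proof
    show "distinctly_named F" "AC F" by fact+
    show "(k, tname s) \<in> succ_edges F" "(tname s, k) \<notin> succ_edges F" using ks by (simp_all add: descends_def)
    show "\<not> switched F k" using switched_iff[OF named nd(3)] by (simp add: is_switched_def)
    show "\<not> labelled F (tname s) (LWire x)" for x using unique_label[OF named lb, of "LWire x"] b(3) by auto
    show "\<not> labelled F (tname s) LStar" using unique_label[OF named lb, of LStar] b(3) by auto
    show "\<exists>\<sigma>. switching F \<sigma>" using typed_switching_exists[OF named typed] .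
    show "\<not> switched F v" if "(v, w) \<in> succ_edges F" "labelled F w LStar" for v w
      using star_not_switched[OF named that] .
  qed
  have edges: "(i, j) \<in> succ_edges F" "(i, l) \<in> succ_edges F" "(j, k) \<in> succ_edges F"
    using nd(1,2) unfolding succ_edges_def by force+
  have iN: "i \<in> N" using N_up[OF N_up[OF k_in_N edges(3)] edges(1)] .
  obtain \<sigma> where \<sigma>: "switching F \<sigma>" using typed_switching_exists[OF named typed] by blast
  have us: "tname s \<notin> {i, j, k, l}" using nin(2) names_in[of s] by (metis disjoint_iff empty_set list.simps(15))
  have oN: "node_name ` set_mset (tree_nodes o') \<subseteq> N"
  proof (rule tree_reachable[OF tr(1) dt(1) \<sigma> path_single[of _ k], of k])
    show "tname s \<notin> set [k]" using us by simp
    show "set [k] \<inter> node_name ` set_mset (tree_nodes o') = {}" using nin(1) by simp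
    show "tname s \<notin> node_name ` set_mset (tree_nodes o')" using disj(1) names_in[of s] by (metis disjoint_iff)
  qed (use ko in simp_all)
  have tN: "node_name ` set_mset (tree_nodes t) \<subseteq> N"
  proof (rule tree_reachable[OF tr(3) dt(3) \<sigma>, of "[k, j, i, l]" l])
    have "(j, \<sigma> j) \<in> succ_edges F"
      using \<sigma> switched_iff[OF named nd(2)] by (simp add: switching_def is_switched_def)
    then obtain n' where n': "n' \<in> nodes F" "node_name n' = j" "\<sigma> j \<in> succs n'" unfolding succ_edges_def by blast
    then have "n' = Node j LExp {k}" using unique_node[OF named n'(1) nd(2)] by simp
    then have "\<sigma> j = k" using n'(3) by simp
    moreover have "\<not> switched F i" using switched_iff[OF named nd(1)] by (simp add: is_switched_def)
    ultimately have "successively (\<lambda>x y. (x, y) \<in> switching_graph F \<sigma>) [k, j, i, l]"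
      using edges by (simp add: switching_graph_iff)
    moreover have "distinct [k, j, i, l]" using dist by (simp add: eq_commute)
    ultimately show "path (switching_graph F \<sigma>) [k, j, i, l]" by (simp only: path_def) simp
    have "(l, i) \<notin> succ_edges F" using root_no_predecessor[OF named, of c l] ri by (simp add: F)
    then show "[k, j, i, l] = [l] \<or> (l, last (butlast [k, j, i, l])) \<notin> succ_edges F" by simp
    show "tname s \<notin> set [k, j, i, l]" using us by simp
    show "set [k, j, i, l] \<inter> node_name ` set_mset (tree_nodes t) = {}" using nin(3) by simp
    show "tname s \<notin> node_name ` set_mset (tree_nodes t)" using disj(2) names_in[of s] by (metis disjoint_iff)
  qed (use lt in simp_all)
  define V where "V = {wire_var x |x m. m \<in> nodes F \<and> node_label m = LWire x \<and> node_name m \<in> E}"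
  define U where "U = roots F E - {tname s}"
  have settled: "settled E V a" if "a \<in> nodes F" "node_name a \<noteq> k" for a
    unfolding V_def by (rule settled_E[OF typed lk that])
  have k0: "node_name a \<noteq> k" if "a \<in># forest_nodes F0" for a
  proof -
    have "k \<in> node_name ` set_mset (root_nodes c)" by (simp add: nc)
    moreover have "node_name a \<in> node_set F0" using that by (simp add: node_set_def)
    ultimately show ?thesis using d0 by blast
  qed
  have settled0: "settled E V a" if "a \<in># forest_nodes F0" for a
    by (rule settled) (use that k0[OF that] in \<open>simp_all add: F\<close>)
  have settled_tree: "\<forall>a\<in>#tree_nodes t'. settled E V a" if "set_mset (tree_nodes t') \<subseteq> nodes F" "k \<notin> node_name ` set_mset (tree_nodes t')" for t'
    using settled that by blast
  have st: "\<forall>a\<in>#tree_nodes o'. settled E V a" "\<forall>a\<in>#tree_nodes s. settled E V a" "\<forall>a\<in>#tree_nodes t. settled E V a"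
    using settled_tree[OF tr(1)] settled_tree[OF tr(2)] settled_tree[OF tr(3)] nin by simp_all
  have EN: "node_name ` set_mset (tree_nodes o') \<inter> E = {}" "node_name ` set_mset (tree_nodes t) \<inter> E = {}" "i \<notin> E"
    using oN tN iN unfolding E_def by blast+
  have notE: "tname o' \<notin> E" "tname t \<notin> E" using EN names_in[of o'] names_in[of t] by (metis disjoint_iff)+
  note co = settled_coherent(1)[OF st(1)] settled_coherent(1)[OF st(2)] settled_coherent(1)[OF st(3)]
  have cut_ok: "root_coherent E V (mk_cut i o' A t)" "\<not> root_vanishes E (mk_cut i o' A t)"
    "root_prune E (mk_cut i o' A t) = mk_cut i o' A t"
    unfolding mk_cut_def using co notE EN(3) prune_disjoint(1)[OF EN(1)] prune_disjoint(1)[OF EN(2)]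
    by (cases "positive A"; simp)+
  have F0c: "root_coherent E V e \<and> (root_vanishes E e \<longleftrightarrow> rname e \<in> E)" if "e \<in># F0" for e
    by (rule settled_root_coherent) (use settled0 root_nodes_subset[OF that] in blast)
  have "survivors E (F0 + {#mk_cut i o' A t, Tree s B#}) = {#} \<or>
      drv r n False (survivors E (F0 + {#mk_cut i o' A t, Tree s B#}))"
    by (rule drv_survivors[OF d, of E V]) (use F0c cut_ok co in simp)
  then have fin: "drv r n False (survivors E F0 + {#rename (\<lambda>_. ()) (\<lambda>x. x) (mk_cut i o' A t)#})"
    using cut_ok co u_in_E by simp
  have EU: "w \<in> E \<longleftrightarrow> w \<in> U" if "a \<in># forest_nodes F0" "node_name a \<notin> E" "w \<in> succs a" for a w
  proof
    have e: "(node_name a, w) \<in> succ_edges F" using that(1,3) unfolding succ_edges_def F by auto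
    assume w: "w \<in> E"
    have "(v, w) \<notin> succ_edges F" if "v \<in> E" for v
      using unique_predecessor[OF named e, of v] \<open>v \<in> E\<close> \<open>node_name a \<notin> E\<close> by metis
    moreover have "w \<noteq> tname s" using u_predecessor[of "node_name a"] e k0[OF \<open>a \<in># forest_nodes F0\<close>] by metis
    ultimately show "w \<in> U" using w by (simp add: U_def roots_def)
  qed (simp add: U_def roots_def)
  have root: "rname e \<in> U \<longleftrightarrow> rname e \<in> E" if "e \<in># F0" for e
  proof
    assume "rname e \<in> E"
    moreover have eF: "e \<in># F" using that by (simp add: F)
    then have "(v, rname e) \<notin> succ_edges F" for v using root_no_predecessor[OF named eF] by blast
    moreover from this have "rname e \<noteq> tname s" using ku by auto
    ultimately show "rname e \<in> U" by (simp add: U_def roots_def)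
  qed (simp add: U_def roots_def)
  have "strip (prune U F0) = survivors E F0"
  proof -
    have "{#e \<in># F0. rname e \<notin> U#} = {#e \<in># F0. \<not> root_vanishes E e#}"
      by (rule filter_mset_cong) (use root F0c in auto)
    moreover have "rename (\<lambda>_. ()) (\<lambda>x. x) (root_prune U e) = rename (\<lambda>_. ()) (\<lambda>x. x) (root_prune E e)"
      if "e \<in># {#e \<in># F0. \<not> root_vanishes E e#}" for e
    proof (rule root_prune_roots[of "forest_nodes F0", OF EU settled0])
      show "set_mset (root_nodes e) \<subseteq> nodes F0" using that by (intro root_nodes_subset) simp
      show "rname e \<notin> E" using that F0c by auto
    qed
    then have "image_mset (\<lambda>e. rename (\<lambda>_. ()) (\<lambda>x. x) (root_prune U e)) {#e \<in># F0. \<not> root_vanishes E e#} =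
        survivors E F0" unfolding survivors_def by (rule image_mset_cong)
    moreover have "strip (prune U F0) =
        image_mset (\<lambda>e. rename (\<lambda>_. ()) (\<lambda>x. x) (root_prune U e)) {#e \<in># F0. rname e \<notin> U#}"
      by (simp add: prune_def image_mset.compositionality comp_def)
    ultimately show ?thesis by simp
  qed
  with fin have "drv r n False (strip (prune U F0 + {#mk_cut i o' A t#}))" by simp
  with weakening_subnet_E[folded U_def] show ?thesis by (intro exI conjI)
qed

section \<open>Termination and cut-elimination\<close>

subsection \<open>Nets and derivations\<close>

lemma erase_strip: "erase F = strip F"
  unfolding erase_def map_root_rename by (simp only: id_def)

text \<open>
  Typing excludes empty sums, and a cut whose left term is not positive is turned around.
\<close>

lemma derivable_drv: "derivable b F \<Longrightarrow> drv r n False F"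
proof (induction rule: derivable.induct)
  case (unit i)
  show ?case by (rule drv.unit)
next
  case (axiom i j x p k l)
  show ?case by (rule drv.axiom)
next
  case (mix F G)
  show ?case by (rule drv.mix[OF mix.IH mix.hyps(3)]) simp
next
  case (vee F t A s B i)
  show ?case by (rule drv.un[OF vee.IH unary.vee])
next
  case (vee0 F t A i j B)
  show ?case by (rule drv.un[OF vee0.IH unary.veeL])
next
  case (vee1 F s B i j A)
  show ?case by (rule drv.un[OF vee1.IH unary.veeR])
next
  case (tensor F t A G s B i j)
  show ?case by (rule drv.tensor[OF tensor.IH tensor.hyps(3)]) simp
next
  case (contraction F i ws T j vs k)
  from drv_typed[OF contraction.IH] have "ws \<noteq> {#}" "vs \<noteq> {#}" by (auto elim: typed_elims)
  then show ?case by (intro drv.un[OF contraction.IH unary.contraction])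
next
  case (cut F t A G s i)
  show ?case by (rule drv_mk_cut[OF cut.IH cut.hyps(6)])
qed

lemma drv_derivable: "drv r n e F \<Longrightarrow> \<forall>i s A t. Cut i s A t \<notin># F \<Longrightarrow> derivable False F"
proof (induction rule: drv.induct)
  case (unit i)
  show ?case by (rule derivable.unit)
next
  case (axiom i j x p k l)
  show ?case by (rule derivable.axiom)
next
  case (mix b F c G e)
  show ?case by (rule derivable.mix[OF mix.IH(1) mix.IH(2) mix.hyps(3)]) (use mix.prems in auto)
next
  case (un e F P c)
  from un.hyps(2) un.prems have "\<forall>i s A t. Cut i s A t \<notin># F + P" by (cases rule: unary.cases) auto
  then have IH: "derivable False (F + P)" by (rule un.IH)
  from un.hyps(2) show ?case
  proof cases
    case (vee t A s B i)
    show ?thesis unfolding vee by (rule derivable.vee) (use IH vee in simp)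
  next
    case (veeL t A i j B)
    show ?thesis unfolding veeL by (rule derivable.vee0) (use IH veeL in simp)
  next
    case (veeR s B i j A)
    show ?thesis unfolding veeR by (rule derivable.vee1) (use IH veeR in simp)
  next
    case (contraction ws vs i T j k)
    show ?thesis unfolding contraction by (rule derivable.contraction) (use IH contraction in simp)
  qed
next
  case (tensor b F t A c G s B e i j)
  show ?case by (rule derivable.tensor[OF tensor.IH(1) tensor.IH(2) tensor.hyps(3)]) (use tensor.prems in auto)
next
  case (cut b F s A c G t e i)
  have "Cut i s A t \<notin># F + G + {#Cut i s A t#}" using cut.prems by blast
  then show ?case by simp
qed

subsection \<open>The measure\<close>

fun is_ranked :: "nat \<Rightarrow> ('p, 'i, 'v) root \<Rightarrow> nat" where
  "is_ranked r (Cut i s A t) = (if rank A = r then 1 else 0)"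
| "is_ranked r c = 0"

fun is_wide :: "nat \<Rightarrow> ('p, 'i, 'v) root \<Rightarrow> nat" where
  "is_wide r (Cut i s A t) = (if rank A = r \<and> 2 \<le> width s then 1 else 0)"
| "is_wide r c = 0"

fun low :: "nat \<Rightarrow> ('p, 'i, 'v) root \<Rightarrow> bool" where
  "low r (Cut i s A t) \<longleftrightarrow> rank A \<le> r"
| "low r c \<longleftrightarrow> True"

definition ranked_cuts where "ranked_cuts r F = (\<Sum>c\<in>#F. is_ranked r c)"
definition wide_cuts where "wide_cuts r F = (\<Sum>c\<in>#F. is_wide r c)"
definition rank_bounded where "rank_bounded r F \<longleftrightarrow> (\<forall>c\<in>#F. low r c)"

lemma measure_simps [simp]:
  "ranked_cuts r {#} = 0" "ranked_cuts r (add_mset c F) = is_ranked r c + ranked_cuts r F"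
  "ranked_cuts r (F + G) = ranked_cuts r F + ranked_cuts r G"
  "wide_cuts r {#} = 0" "wide_cuts r (add_mset c F) = is_wide r c + wide_cuts r F"
  "wide_cuts r (F + G) = wide_cuts r F + wide_cuts r G"
  "rank_bounded r {#}" "rank_bounded r (add_mset c F) \<longleftrightarrow> low r c \<and> rank_bounded r F"
  "rank_bounded r (F + G) \<longleftrightarrow> rank_bounded r F \<and> rank_bounded r G"
  by (auto simp: ranked_cuts_def wide_cuts_def rank_bounded_def)

lemma forest_type_simps [simp]:
  "forest_type {#} = {#}" "forest_type (add_mset c F) = root_type c + forest_type F"
  "forest_type (F + G) = forest_type F + forest_type G"
  by (auto simp: forest_type_def)

lemma measure_rename [simp]:
  "is_ranked r (rename u f c) = is_ranked r c" "is_wide r (rename u f c) = is_wide r c"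
  "low r (rename u f c) = low r c" "root_type (rename u f c) = root_type c"
  by (cases c; simp)+

lemma measure_strip [simp]:
  "ranked_cuts r (image_mset (rename u f) F) = ranked_cuts r F"
  "wide_cuts r (image_mset (rename u f) F) = wide_cuts r F"
  "rank_bounded r (image_mset (rename u f) F) = rank_bounded r F"
  "forest_type (image_mset (rename u f) F) = forest_type F"
  by (induction F) auto

lemma measure_mk_cut [simp]:
  "rank A < r \<Longrightarrow> is_ranked r (mk_cut i s A t) = 0"
  "rank A < r \<Longrightarrow> is_wide r (mk_cut i s A t) = 0"
  "rank A < r \<Longrightarrow> low r (mk_cut i s A t)"
  "root_type (mk_cut i s A t) = {#}"
  by (simp_all add: mk_cut_def)

lemma width_prune: "width (tree_prune U t) \<le> width t"
proof (cases t)
  case (Exp i ws)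
  then show ?thesis using size_filter_mset_lesseq[of "\<lambda>w. wname w \<notin> U" "image_mset (wit_prune U) ws"] by simp
qed (simp_all)

lemma measure_prune:
  fixes F :: "('b, 'a, 'c) gen_forest"
  shows
  "ranked_cuts r (prune U F) \<le> ranked_cuts r F" "wide_cuts r (prune U F) \<le> wide_cuts r F"
  "rank_bounded r F \<Longrightarrow> rank_bounded r (prune U F)" "forest_type (prune U F) \<subseteq># forest_type F"
proof -
  have p: "prune U (add_mset c F) = (if rname c \<in> U then {#} else {#root_prune U c#}) + prune U F" for c F
    by (simp add: prune_def)
  have [simp]: "prune U {#} = {#}" by (simp add: prune_def)
  have w: "is_wide r (root_prune U c) \<le> is_wide r c" for c :: "('b, 'a, 'c) root"
  proof (cases c)
    case (Cut i s A t)
    with width_prune[of U s] show ?thesis by auto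
  qed simp_all
  have c: "is_ranked r (root_prune U c) = is_ranked r c" 
    "low r (root_prune U c) = low r c" "root_type (root_prune U c) = root_type c" for c :: "('b, 'a, 'c) root"
    by (cases c; simp)+
  show "ranked_cuts r (prune U F) \<le> ranked_cuts r F" by (induction F) (simp_all add: p c)
  show "wide_cuts r (prune U F) \<le> wide_cuts r F" 
  proof (induction F)
    case (add c F)
    then show ?case using w[of c] by (auto simp: p)
  qed simp
  show "rank_bounded r F \<Longrightarrow> rank_bounded r (prune U F)" by (induction F) (simp_all add: p c)
  show "forest_type (prune U F) \<subseteq># forest_type F"
  proof (induction F)
    case (add c F)
    then have "root_type c + forest_type (prune U F) \<subseteq># root_type c + forest_type F" by simp
    moreover have "forest_type (prune U F) \<subseteq># root_type c + forest_type F"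
      using add by (simp add: subset_mset.add_increasing)
    ultimately show ?case by (simp add: p c)
  qed simp
qed

subsection \<open>Cuts of width one\<close>

lemma cut_reducesI:
  assumes "nd r n e G" "reduct G G'"
  shows "cut_reduces (strip G) (strip G')"
  unfolding cut_reduces_def
  by (rule exI[of _ G], rule exI[of _ G'])
    (simp add: assms(2) nd_named[OF assms(1)] drv_typed_forest[OF nd_drv[OF assms(1)]] nd_AC[OF assms(1)] erase_strip)

lemma rename_mk_cut [simp]: "rename u f (mk_cut i s A t) = mk_cut (u i) (map_tree u f s) A (map_tree u f t)"
  by (simp add: mk_cut_def)

lemma rename_replace:
  fixes t :: "('i, 'v) tree" and w :: "('i, 'v) wit"
  assumes "\<And>w. h' (map_wit u f w) = map_option (image_mset (map_wit u f)) (h w)"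
  shows "map_tree u f (tree_replace h t) = tree_replace h' (map_tree u f t)"
    and "image_mset (map_wit u f) (wit_replace h w) = wit_replace h' (map_wit u f w)"
proof (induction t and w)
  case (Exp i ws)
  have "image_mset (map_wit u f) (\<Sum>\<^sub># (image_mset (wit_replace h) ws)) =
      \<Sum>\<^sub># (image_mset (\<lambda>w. image_mset (map_wit u f) (wit_replace h w)) ws)"
    by (induction ws) auto
  also have "image_mset (\<lambda>w. image_mset (map_wit u f) (wit_replace h w)) ws =
      image_mset (\<lambda>w. wit_replace h' (map_wit u f w)) ws"
    by (rule image_mset_cong) (rule Exp.IH)
  finally show ?case by (simp add: image_mset.compositionality comp_def)
next
  case (Wire i x)
  then show ?case using assms[of "Wire i x"] by (simp split: option.split)
next
  case (Tensor i t s)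
  then show ?case using assms[of "Tensor i t s"] by (simp split: option.split)
qed simp_all

lemma strip_subst:
  assumes "\<forall>w T. Wit w T \<notin># F"
  shows "strip (subst y us F) =
    image_mset (rmap (wire_subst y (image_mset (map_wit (\<lambda>_. ()) (\<lambda>x. x)) us))) (strip F)"
proof -
  have h: "wire_subst y (image_mset (map_wit (\<lambda>_. ()) (\<lambda>x. x)) us) (map_wit (\<lambda>_. ()) (\<lambda>x. x) w) =
      map_option (image_mset (map_wit (\<lambda>_. ()) (\<lambda>x. x))) (wire_subst y us w)" for w
    by (cases w) (auto simp: wire_subst_def wire.map_ident)
  have "subst y us F = \<Sum>\<^sub># (image_mset (root_replace (wire_subst y us)) F)"
    by (simp add: subst_def wire_subst_def)
  moreover have "strip (\<Sum>\<^sub># (image_mset (root_replace (wire_subst y us)) F)) =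
      image_mset (rmap (wire_subst y (image_mset (map_wit (\<lambda>_. ()) (\<lambda>x. x)) us))) (strip F)"
    using assms
  proof (induction F)
    case (add c F)
    have "strip (root_replace (wire_subst y us) c) =
      {#rmap (wire_subst y (image_mset (map_wit (\<lambda>_. ()) (\<lambda>x. x)) us)) (rename (\<lambda>_. ()) (\<lambda>x. x) c)#}"
    proof (cases c)
      case (Wit w T)
      with add.prems show ?thesis by auto
    qed (simp_all add: rename_replace(1)[where h = "wire_subst y us" and
        h' = "wire_subst y (image_mset (map_wit (\<lambda>_. ()) (\<lambda>x. x)) us)" and u = "\<lambda>_. ()" and f = "\<lambda>x. x", OF h])
    with add show ?case by simp
  qed simp
  ultimately show ?thesis by simp
qed

definition improves :: "nat \<Rightarrow> ('p, 'i, 'v) gen_forest \<Rightarrow> ('p, 'j, 'v) gen_forest \<Rightarrow> bool" where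
  "improves r F F' \<longleftrightarrow> (wide_cuts r F', ranked_cuts r F') \<in> {(a, b). a \<le> wide_cuts r F \<and> b < ranked_cuts r F \<or> a < wide_cuts r F} \<and>
     (rank_bounded r F \<longrightarrow> rank_bounded r F') \<and> forest_type F' \<subseteq># forest_type F"

lemma wire_subst_narrow:
  assumes "wit_typed \<Theta> w (NegW p)"
  shows "size (wit_replace (wire_subst (X a) us) w) = 1"
  using assms by (cases rule: wit_typed.cases) (simp_all add: wire_subst_def)

lemma size_sum_one:
  fixes h :: "'a \<Rightarrow> 'b multiset"
  shows "\<forall>w\<in>#ws. size (h w) = 1 \<Longrightarrow> size (\<Sum>\<^sub># (image_mset h ws)) = size ws"
  by (induction ws) auto

text \<open>
  At rank \<open>0\<close> the positive side of a cut has only wires of the polarity that is not substituted, so no cut becomes wide.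
\<close>

lemma atomic_improves:
  assumes typed: "forest_typed \<Theta> F"
  shows "wide_cuts 0 (image_mset (rmap (wire_subst (X a) us)) F) = wide_cuts 0 F"
    "ranked_cuts 0 (image_mset (rmap (wire_subst (X a) us)) F) = ranked_cuts 0 F"
    "rank_bounded 0 F \<Longrightarrow> rank_bounded 0 (image_mset (rmap (wire_subst (X a) us)) F)"
    "(\<forall>w T. Wit w T \<notin># F) \<Longrightarrow> forest_type (image_mset (rmap (wire_subst (X a) us)) F) = forest_type F"
proof -
  let ?h = "wire_subst (X a) us"
  have w: "is_wide 0 (rmap ?h c) = is_wide 0 c" if "root_typed \<Theta> c" for c
  proof (cases c)
    case (Cut i s A t)
    have "width (tree_replace ?h s) = width s" if A: "rank A = 0"
    proof -
      have "positive A" "tree_typed \<Theta> s A" using \<open>root_typed \<Theta> c\<close> Cut by simp_all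
      with A obtain p where p: "tree_typed \<Theta> s (Neg p)" by (cases A) simp_all
      then obtain j ws where s: "s = Exp j ws" "\<forall>w\<in>#ws. wit_typed \<Theta> w (NegW p)"
      proof (cases rule: tree_typed.cases)
        case (2 ws T i)
        then show thesis using that by (cases T) auto
      qed
      have "\<forall>w\<in>#ws. size (wit_replace ?h w) = 1"
      proof
        fix w assume "w \<in># ws"
        with s(2) have "wit_typed \<Theta> w (NegW p)" by blast
        then show "size (wit_replace ?h w) = 1" by (rule wire_subst_narrow)
      qed
      from size_sum_one[OF this] s(1) show ?thesis by simp
    qed
    with Cut show ?thesis by (cases "rank A = 0") simp_all
  qed simp_all
  have c: "is_ranked 0 (rmap ?h c) = is_ranked 0 c" "low 0 (rmap ?h c) = low 0 c" for c
    by (cases c; simp)+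
  show "wide_cuts 0 (image_mset (rmap ?h) F) = wide_cuts 0 F" using typed by (induction F) (simp_all add: w)
  show "ranked_cuts 0 (image_mset (rmap ?h) F) = ranked_cuts 0 F" by (induction F) (simp_all add: c)
  show "rank_bounded 0 F \<Longrightarrow> rank_bounded 0 (image_mset (rmap ?h) F)" by (induction F) (simp_all add: c)
  show "(\<forall>w T. Wit w T \<notin># F) \<Longrightarrow> forest_type (image_mset (rmap ?h) F) = forest_type F"
  proof (induction F)
    case (add c F)
    have "root_type (rmap ?h c) = root_type c"
    proof (cases c)
      case (Wit w T)
      with add.prems show ?thesis by (metis union_single_eq_member)
    qed simp_all
    moreover have "forest_type (image_mset (rmap ?h) F) = forest_type F"
      by (rule add.IH) (use add.prems in simp)
    ultimately show ?case by simp
  qed simp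
qed

lemma weakening_improves:
  assumes nd: "nd r n e G" and G: "G = F0 + {#Cut i s A t#}" and r: "rank A = r" and s: "width s < 2"
    and red: "reduct G (prune U F0 + {#mk_cut i' o' B t'#})" and B: "rank B < r"
    and d: "drv r n False (strip (prune U F0 + {#mk_cut i' o' B t'#}))"
  shows "\<exists>F'. cut_reduces (strip G) F' \<and> drv r n False F' \<and> improves r G F'"
proof (intro exI conjI)
  show "cut_reduces (strip G) (strip (prune U F0 + {#mk_cut i' o' B t'#}))" using cut_reducesI[OF nd red] .
  show "drv r n False (strip (prune U F0 + {#mk_cut i' o' B t'#}))" by (rule d)
  have "wide_cuts r (prune U F0) \<le> wide_cuts r F0" "ranked_cuts r (prune U F0) \<le> ranked_cuts r F0"
    "rank_bounded r F0 \<Longrightarrow> rank_bounded r (prune U F0)" "forest_type (prune U F0) \<subseteq># forest_type F0"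
    by (simp_all add: measure_prune)
  then show "improves r G (strip (prune U F0 + {#mk_cut i' o' B t'#}))"
    using r s B by (simp add: improves_def G)
qed

text \<open>
  The type of the cut and the shape of its negative term determine which of the logical, atomic and weakening steps applies.
\<close>

lemma narrow_cut_step:
  fixes G :: "'p named_forest"
  assumes nd: "nd r n False G" and c: "Cut i s A t \<in># G" "rank A = r" "width s < 2"
  shows "\<exists>F'. cut_reduces (strip G) F' \<and> drv r n False F' \<and> improves r G F'"
proof -
  obtain F0 where G: "G = F0 + {#Cut i s A t#}" using c(1) by (metis multi_member_split add_mset_add_single)
  have d: "drv r n False G" by (rule nd_drv[OF nd])
  have named: "distinctly_named G" by (rule nd_named[OF nd])
  have ac: "AC G" by (rule nd_AC[OF nd])
  have lk: "linked G" by (rule drv_linked[OF d])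
  from drv_typed[OF d] obtain \<Theta> where \<Theta>: "forest_typed \<Theta> G" by blast
  then have ty: "positive A" "tree_typed \<Theta> s A" "tree_typed \<Theta> t (dual A)" and ty0: "forest_typed \<Theta> F0"
    by (simp_all add: G)
  from ty(1) consider (neg) p where "A = Neg p" | (conj) B C where "A = Conj B C" by (cases A) simp_all
  then show ?thesis
  proof cases
    case neg
    from ty(2) neg obtain j ws where s: "s = Exp j ws" "ws \<noteq> {#}" "\<forall>w\<in>#ws. wit_typed \<Theta> w (NegW p)"
    proof (cases rule: tree_typed.cases)
      case (2 ws T i)
      with neg show thesis using that by (cases T) auto
    qed simp_all
    from ty(3) neg obtain l us where t: "t = Exp l us" by (cases rule: tree_typed.cases) auto
    from s c(3) have "size ws = 1" using nonempty_has_size[of ws] by simp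
    then obtain w where w: "ws = {#w#}" by (metis size_1_singleton_mset)
    with s(3) have "wit_typed \<Theta> w (NegW p)" by simp
    then obtain k a where wa: "w = Wire k (Xbar a)" by (cases rule: wit_typed.cases) auto
    let ?us = "image_mset (map_wit (\<lambda>_. ()) (\<lambda>x. x)) us"
    have nw: "\<forall>w T. Wit w T \<notin># F0" using nd_no_witness[OF nd] by (simp add: G)
    have r0: "r = 0" using c(2) neg by simp
    have red: "reduct G (subst (X a) us F0)"
      using reduct.atomic[of "Neg p" p F0 i j k "Xbar a" l us]
      by (simp add: G neg s(1) w wa t mk_cut_def)
    have "drv r n False (strip F0 + {#Cut () (Exp () {#Wire () (Xbar a)#}) (Neg p) (Exp () ?us)#})"
      using drv_strip[OF d] by (simp add: G neg s(1) w wa t)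
    from drv_atomic[OF this] have "drv r n False (strip (subst (X a) us F0))" using strip_subst[OF nw, of "X a" us] by simp
    moreover have "improves r G (strip (subst (X a) us F0))"
    proof -
      obtain \<Theta>' where "forest_typed \<Theta>' (strip F0)"
        using drv_typed[OF drv_strip[OF d]] by (auto simp: G)
      note am = atomic_improves[OF this, of a ?us]
      have "\<forall>w T. Wit w T \<notin># strip F0" using drv_no_witness[OF drv_strip[OF d]] by (auto simp: G)
      note am(4)[OF this]
      with am(1-3) show ?thesis unfolding improves_def strip_subst[OF nw] r0
        by (simp only: measure_strip) (use c(2,3) r0 in \<open>simp add: G\<close>)
    qed
    ultimately show ?thesis using cut_reducesI[OF nd red] by blast
  next
    case conj
    from ty(2) conj obtain j ws where s: "s = Exp j ws" "ws \<noteq> {#}" "\<forall>w\<in>#ws. wit_typed \<Theta> w (TensorW B C)"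
    proof (cases rule: tree_typed.cases)
      case (2 ws T i)
      with conj show thesis using that by (cases T) auto
    qed simp_all
    from s c(3) have "size ws = 1" using nonempty_has_size[of ws] by simp
    then obtain w where w: "ws = {#w#}" by (metis size_1_singleton_mset)
    with s(3) have "wit_typed \<Theta> w (TensorW B C)" by simp
    then obtain k s1 s2 where ws: "w = Tensor k s1 s2" by (cases rule: wit_typed.cases) auto
    have ranks: "rank B < r" "rank C < r" using c(2) conj by simp_all
    have "tree_typed \<Theta> t (Disj (dual B) (dual C))" using ty(3) conj by simp
    then consider (vee) l t1 t2 where "t = Vee l t1 t2" | (veeL) l t' m where "t = VeeL l t' m"
      | (veeR) l t' m where "t = VeeR l m t'"
    proof (cases rule: tree_typed.cases)
      case (2 ws T i)
      then show thesis by (cases T) simp_all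
    qed (use that in blast)+
    then show ?thesis
    proof cases
      case vee
      let ?G' = "F0 + {#mk_cut i s1 B t1, mk_cut i s2 C t2#}"
      have "reduct G ?G'" unfolding G conj s(1) w ws vee by (rule reduct.logical)
      moreover have "drv r n False (strip ?G')"
        by (rule drv_strip, rule drv_logical) (use d in \<open>simp only: G conj s(1) w ws vee\<close>)
      moreover have "improves r G (strip ?G')"
        using ranks c(2,3) by (simp add: improves_def G)
      ultimately show ?thesis using cut_reducesI[OF nd] by blast
    next
      case veeL
      have "\<exists>E U. weakening_subnet G E U (tname s2) \<and> drv r n False (strip (prune U F0 + {#mk_cut i s1 B t'#}))"
      proof (rule weakening_step[OF G named ac \<Theta> lk, where B = C])
        show "drv r n False (F0 + {#mk_cut i s1 B t', Tree s2 C#})"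
          by (rule drv_weakening_left) (use d in \<open>simp only: G conj s(1) w ws veeL\<close>)
      qed (simp_all add: conj s(1) w ws veeL add_mset_commute)
      then obtain E U where EU: "weakening_subnet G E U (tname s2)" "drv r n False (strip (prune U F0 + {#mk_cut i s1 B t'#}))"
        by blast
      have "reduct G (prune U F0 + {#mk_cut i s1 B t'#})"
        by (rule reduct.weakening_left[OF _ EU(1)]) (simp only: G conj s(1) w ws veeL)
      from weakening_improves[OF nd G c(2,3) this ranks(1) EU(2)] show ?thesis .
    next
      case veeR
      have "\<exists>E U. weakening_subnet G E U (tname s1) \<and> drv r n False (strip (prune U F0 + {#mk_cut i s2 C t'#}))"
      proof (rule weakening_step[OF G named ac \<Theta> lk, where B = B])
        show "drv r n False (F0 + {#mk_cut i s2 C t', Tree s1 B#})"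
          by (rule drv_weakening_right) (use d in \<open>simp only: G conj s(1) w ws veeR\<close>)
      qed (simp_all add: conj s(1) w ws veeR add_mset_commute insert_commute ac_simps)
      then obtain E U where EU: "weakening_subnet G E U (tname s1)" "drv r n False (strip (prune U F0 + {#mk_cut i s2 C t'#}))"
        by blast
      have "reduct G (prune U F0 + {#mk_cut i s2 C t'#})"
        by (rule reduct.weakening_right[OF _ EU(1)]) (simp only: G conj s(1) w ws veeR)
      from weakening_improves[OF nd G c(2,3) this ranks(2) EU(2)] show ?thesis .
    qed
  qed
qed

subsection \<open>Wide cuts\<close>

fun not_narrow :: "nat \<Rightarrow> ('p, 'i, 'v) root \<Rightarrow> bool" where
  "not_narrow r (Cut i s A t) \<longleftrightarrow> (rank A = r \<longrightarrow> 2 \<le> width s)"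
| "not_narrow r c \<longleftrightarrow> True"

text \<open>
  Going up from the conclusion into the right premise of a cut whenever it has a cut of rank \<open>r\<close> leads to a cut of rank \<open>r\<close> whose right premise has none.
\<close>

lemma wide_flag:
  "drv r m e F \<Longrightarrow> \<not> lacks_rank r F \<Longrightarrow> \<forall>c\<in>#F. not_narrow r c \<Longrightarrow>
    \<exists>n\<ge>2. drv r n True F"
proof (induction rule: drv.induct)
  case (mix b F c G e)
  show ?case
  proof (cases "lacks_rank r F")
    case True
    then have "\<not> lacks_rank r G" using mix.prems(1) by simp
    from mix.IH(2)[OF this] mix.prems(2) obtain n where n: "2 \<le> n" "drv r n True G" by auto
    with drv.mix[OF drv_forget_flag[OF mix.hyps(1)] n(2) mix.hyps(3), of True] show ?thesis by blast
  next
    case False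
    from mix.IH(1)[OF this] mix.prems(2) obtain n where n: "2 \<le> n" "drv r n True F" by auto
    with drv.mix[OF n(2) drv_forget_flag[OF mix.hyps(2)] mix.hyps(3), of True] show ?thesis by blast
  qed
next
  case (un e F P c)
  have l: "lacks_rank r (F + P) \<longleftrightarrow> lacks_rank r (F + {#c#})" using un.hyps(2) by (cases rule: unary.cases) simp_all
  have "\<forall>c\<in>#F + P. not_narrow r c"
    using un.hyps(2) un.prems(2) by (cases rule: unary.cases) auto
  with un.IH un.prems(1) l obtain n where n: "2 \<le> n" "drv r n True (F + P)" by blast
  with drv.un[OF n(2) un.hyps(2)] show ?case by blast
next
  case (tensor b F t A c G s B e i j)
  show ?case
  proof (cases "lacks_rank r F")
    case True
    then have "\<not> lacks_rank r (G + {#Tree s B#})" using tensor.prems(1) by simp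
    from tensor.IH(2)[OF this] tensor.prems(2) obtain n where n: "2 \<le> n" "drv r n True (G + {#Tree s B#})" by auto
    with drv.tensor[OF drv_forget_flag[OF tensor.hyps(1)] n(2) tensor.hyps(3), of True] show ?thesis by blast
  next
    case False
    then have "\<not> lacks_rank r (F + {#Tree t A#})" by simp
    from tensor.IH(1)[OF this] tensor.prems(2) obtain n where n: "2 \<le> n" "drv r n True (F + {#Tree t A#})" by auto
    with drv.tensor[OF n(2) drv_forget_flag[OF tensor.hyps(2)] tensor.hyps(3), of True] show ?thesis by blast
  qed
next
  case (cut b F s A c G t e i)
  have w: "rank A = r \<longrightarrow> 2 \<le> width s" using cut.prems(2) by simp
  consider "\<not> lacks_rank r G" | "lacks_rank r G" "rank A = r" | "lacks_rank r G" "rank A \<noteq> r" "\<not> lacks_rank r F"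
    using cut.prems(1) by auto
  then show ?case
  proof cases
    case 1
    then have "\<not> lacks_rank r (G + {#Tree t (dual A)#})" by simp
    from cut.IH(2)[OF this] cut.prems(2) obtain n where n: "2 \<le> n" "drv r n True (G + {#Tree t (dual A)#})" by auto
    from drv.cut[OF drv_forget_flag[OF cut.hyps(1)] n(2) cut.hyps(3,4), where e = True and i = i] w n(1) show ?thesis by blast
  next
    case 2
    from drv.cut[OF drv_forget_flag[OF cut.hyps(1), of r "width s"] drv_forget_flag[OF cut.hyps(2), of r "width s"]
        cut.hyps(3,4), where e = True and i = i] w 2
    show ?thesis by blast
  next
    case 3
    then have "\<not> lacks_rank r (F + {#Tree s A#})" by simp
    from cut.IH(1)[OF this] cut.prems(2) obtain n where n: "2 \<le> n" "drv r n True (F + {#Tree s A#})" by auto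
    from drv.cut[OF n(2) drv_forget_flag[OF cut.hyps(2)] cut.hyps(3,4), where e = True and i = i] w n(1) show ?thesis by blast
  qed
qed simp_all

lemma finite_vars:
  fixes t :: "('i, 'v) tree" and w :: "('i, 'v) wit"
  shows "finite (tree_vars t)" and "finite (wit_vars w)"
  by (induction t and w) (simp_all add: wire_vars_eq)

lemma finite_forest_vars: "finite (forest_vars F)"
proof (induction F)
  case (add c F)
  moreover have "finite (root_vars c)" by (cases c) (simp_all add: finite_vars)
  ultimately show ?case by simp
qed simp

lemma fresh_copies_exist:
  assumes "finite (V :: nat set)"
  shows "\<exists>f g. fresh_copies f g V"
proof -
  obtain m where m: "\<forall>x\<in>V. x < m" using assms finite_nat_set_iff_bounded by blast
  have "fresh_copies (\<lambda>x. x + m) (\<lambda>x. x + 2 * m) V"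
    unfolding fresh_copies_def using m by (auto simp: inj_on_def)
  then show ?thesis by blast
qed

lemma replace_outer:
  fixes t :: "('i, 'v) tree" and w :: "('i, 'v) wit"
  shows "outer_names (Exp j ws) \<inter> R = {} \<Longrightarrow> width (tree_replace (duplicate_wit f g R) (Exp j ws)) = size ws"
proof -
  assume "outer_names (Exp j ws) \<inter> R = {}"
  then have "\<forall>w\<in>#ws. wname w \<notin> R" by auto
  then have "\<forall>w\<in>#ws. size (wit_replace (duplicate_wit f g R) w) = 1"
  proof (intro ballI)
    fix w assume "w \<in># ws" "\<forall>w\<in>#ws. wname w \<notin> R"
    then show "size (wit_replace (duplicate_wit f g R) w) = 1" by (cases w) (auto simp: duplicate_wit_def)
  qed
  then show ?thesis using size_sum_one[of ws "wit_replace (duplicate_wit f g R)"] by simp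
qed

text \<open>
  No cut of rank \<open>r\<close> is duplicated, and a narrow cut of rank \<open>r\<close> has no outermost witness among the duplicated ones.
\<close>

lemma sdup_measure:
  assumes "\<And>k s B s'. Cut k s B s' \<in># F \<Longrightarrow> rank B = r \<Longrightarrow> k \<notin> R \<and> (2 \<le> width s \<or> outer_names s \<inter> R = {})"
    and "\<forall>w T. Wit w T \<notin># F"
  shows "wide_cuts r (sdup f g R F) \<le> wide_cuts r F \<and> (rank_bounded r F \<longrightarrow> rank_bounded r (sdup f g R F)) \<and>
    forest_type (sdup f g R F) = forest_type F"
  using assms
proof (induction F)
  case (add c F)
  have IH: "wide_cuts r (sdup f g R F) \<le> wide_cuts r F \<and> (rank_bounded r F \<longrightarrow> rank_bounded r (sdup f g R F)) \<and>
    forest_type (sdup f g R F) = forest_type F"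
  proof (rule add.IH)
    show "k \<notin> R \<and> (2 \<le> width s \<or> outer_names s \<inter> R = {})" if "Cut k s B s' \<in># F" "rank B = r" for k s B s'
      using add.prems(1)[of k s B s'] that by simp
    show "\<forall>w T. Wit w T \<notin># F" using add.prems(2) by simp
  qed
  show ?case
  proof (cases c)
    case (Tree t A)
    with IH show ?thesis by simp
  next
    case (Wit w T)
    with add.prems(2) show ?thesis by auto
  next
    case (Cut k s B s')
    have "width (tree_replace (duplicate_wit f g R) s) < 2" if "\<not> 2 \<le> width s" "rank B = r"
    proof -
      have o: "outer_names s \<inter> R = {}" using add.prems(1)[of k s B s'] Cut that by auto
      show ?thesis
      proof (cases s)
        case (Exp j ws)
        with o that replace_outer[of j ws R f g] show ?thesis by simp
      qed simp_all
    qed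
    moreover have "rank B = r \<Longrightarrow> k \<notin> R" using add.prems(1)[of k s B s'] Cut by auto
    ultimately have "(\<Sum>c\<in>#sdup f g R {#c#}. is_wide r c) \<le> is_wide r c" using Cut by (auto simp: not_less)
    moreover have "sdup f g R (add_mset c F) = sdup f g R {#c#} + sdup f g R F" using Cut by simp
    moreover have "low r c \<Longrightarrow> rank_bounded r (sdup f g R {#c#})" "forest_type (sdup f g R {#c#}) = {#}"
      using Cut by simp_all
    ultimately show ?thesis using IH Cut by (simp add: wide_cuts_def)
  qed
qed simp

text \<open>
  The sum is split into all but one of its summands and a single one: the flag moves to the cut with the larger part, and the other new cut is narrow.
\<close>

lemma contraction_step:
  fixes F :: "'p forest"
  assumes d: "drv r n True F" and n: "2 \<le> n"
  shows "\<exists>F'. cut_reduces F F' \<and> drv r (n - 1) True F' \<and>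
    wide_cuts r F' + (if n = 2 then 1 else 0) \<le> wide_cuts r F \<and>
    (rank_bounded r F \<longrightarrow> rank_bounded r F') \<and> forest_type F' = forest_type F"
proof -
  obtain G :: "'p named_forest" where G: "strip G = F" "distinctly_named G" using naming_exists by blast
  have nd: "nd r n True G" by (rule nd_lift[OF d G])
  from nd_contraction_site[OF nd] obtain F0 i j S A t E R where "contraction_site r n G F0 i j S A t E R" by blast
  then show ?thesis
  proof cases
    case site
    obtain f g where fg: "fresh_copies f g (forest_vars G)"
      using fresh_copies_exist[of "forest_vars G"] finite_forest_vars[of G] by blast
    obtain w S1 where S: "S = add_mset w S1" using site(3) n by (metis multiset_cases not_numeral_le_zero size_empty)
    have S': "S = S1 + {#w#}" "S1 \<noteq> {#}" "size S1 = n - 1" using S site(3) n by auto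
    let ?G' = "duplicate f g R F0 + {#Cut i (Exp j S1) A (map_tree id f t), Cut i (Exp j {#w#}) A (map_tree id g t)#}"
    have red: "reduct G ?G'"
    proof (rule reduct.contraction[of G F0 i j S1 "{#w#}" A t E R f g])
      show "G = F0 + {#Cut i (Exp j (S1 + {#w#})) A t#}" using site(1) S'(1) by simp
      show "subnet G E" "roots G E = insert (tname t) R" "fresh_copies f g (forest_vars G)" "S1 \<noteq> {#}"
        by (fact site fg S')+
      show "\<forall>u\<in>R. (\<exists>x. labelled G u (LWire x)) \<or> labelled G u LTensor \<or> labelled G u LCut" using site(6) by blast
    qed simp
    have "drv r (size S1) True (sdup f g R F0 +
         {#Cut () (Exp () (image_mset (map_wit (\<lambda>_. ()) (\<lambda>x. x)) S1)) A (map_tree (\<lambda>_. ()) f t),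
           Cut () (Exp () (image_mset (map_wit (\<lambda>_. ()) (\<lambda>x. x)) {#w#})) A (map_tree (\<lambda>_. ()) g t)#})"
      by (rule site(9)[OF subset_refl fg S'(1,2)]) simp
    then have dG: "drv r (n - 1) True (strip ?G')" using S'(3) by (simp add: sdup_def map_tree_comp_id)
    have nw: "\<forall>w T. Wit w T \<notin># F0" using nd_no_witness[OF nd] site(1) by simp
    have m: "wide_cuts r (sdup f g R F0) \<le> wide_cuts r F0 \<and>
      (rank_bounded r F0 \<longrightarrow> rank_bounded r (sdup f g R F0)) \<and> forest_type (sdup f g R F0) = forest_type F0"
    proof (rule sdup_measure[OF _ nw])
      show "k \<notin> R \<and> (2 \<le> width s \<or> outer_names s \<inter> R = {})" if "Cut k s B s' \<in># F0" "rank B = r" for k s B s'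
        using site(8)[OF that] .
    qed
    have sG: "strip ?G' = sdup f g R F0 + {#Cut () (Exp () (image_mset (map_wit (\<lambda>_. ()) (\<lambda>x. x)) S1)) A (map_tree (\<lambda>_. ()) f t),
           Cut () (Exp () {#map_wit (\<lambda>_. ()) (\<lambda>x. x) w#}) A (map_tree (\<lambda>_. ()) g t)#}"
      by (simp add: sdup_def map_tree_comp_id)
    have F: "wide_cuts r F = wide_cuts r F0 + 1" "rank_bounded r F \<Longrightarrow> rank_bounded r F0" "forest_type F = forest_type F0"
      unfolding G(1)[symmetric] measure_strip using site(1-3) n by simp_all
    have "wide_cuts r (strip ?G') + (if n = 2 then 1 else 0) \<le> wide_cuts r F"
      "rank_bounded r F \<longrightarrow> rank_bounded r (strip ?G')" "forest_type (strip ?G') = forest_type F"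
      unfolding sG using m F site(2) S'(3) n by simp_all
    then show ?thesis using cut_reducesI[OF nd red] dG G(1) by blast
  qed
qed

lemma narrow_wide_cut:
  fixes F :: "'p forest"
  shows "drv r n True F \<Longrightarrow> 2 \<le> n \<Longrightarrow> \<exists>F'. cut_reduces\<^sup>*\<^sup>* F F' \<and> drv r 0 False F' \<and>
    wide_cuts r F' < wide_cuts r F \<and> (rank_bounded r F \<longrightarrow> rank_bounded r F') \<and> forest_type F' = forest_type F"
proof (induction n arbitrary: F)
  case (Suc n)
  from contraction_step[OF Suc.prems] obtain F1 where F1: "cut_reduces F F1" "drv r n True F1"
    "wide_cuts r F1 + (if Suc n = 2 then 1 else 0) \<le> wide_cuts r F" "rank_bounded r F \<longrightarrow> rank_bounded r F1"
    "forest_type F1 = forest_type F" by auto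
  show ?case
  proof (cases "Suc n = 2")
    case True
    then have "wide_cuts r F1 < wide_cuts r F" using F1(3) by simp
    moreover have "drv r 0 False F1" using drv_forget_flag[OF F1(2)] .
    ultimately show ?thesis using F1(1,4,5) by (meson r_into_rtranclp)
  next
    case False
    then have "2 \<le> n" using Suc.prems(2) by simp
    from Suc.IH[OF F1(2) this] obtain F' where F': "cut_reduces\<^sup>*\<^sup>* F1 F'" "drv r 0 False F'"
      "wide_cuts r F' < wide_cuts r F1" "rank_bounded r F1 \<longrightarrow> rank_bounded r F'" "forest_type F' = forest_type F1" by blast
    have "wide_cuts r F' < wide_cuts r F" using F'(3) F1(3) by simp
    moreover have "cut_reduces\<^sup>*\<^sup>* F F'" using F1(1) F'(1) by (rule converse_rtranclp_into_rtranclp)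
    ultimately show ?thesis using F' F1 by metis
  qed
qed simp

subsection \<open>Cut-elimination\<close>

lemma rank_step:
  fixes F :: "'p forest"
  assumes d: "drv r 0 False F" and c: "\<not> lacks_rank r F"
  shows "\<exists>F'. cut_reduces\<^sup>*\<^sup>* F F' \<and> drv r 0 False F' \<and> improves r F F'"
proof (cases "\<exists>i s A t. Cut i s A t \<in># F \<and> rank A = r \<and> width s < 2")
  case True
  obtain G :: "'p named_forest" where G: "strip G = F" "distinctly_named G" using naming_exists by blast
  have nd: "nd r 0 False G" by (rule nd_lift[OF d G])
  from True obtain i s A t where cc: "Cut i s A t \<in># strip G" "rank A = r" "width s < 2" unfolding G(1) by blast
  then obtain c where c: "c \<in># G" "rename (\<lambda>_. ()) (\<lambda>x. x) c = Cut i s A t" by auto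
  then obtain i' s' t' where "c = Cut i' s' A t'" "map_tree (\<lambda>_. ()) (\<lambda>x. x) s' = s" by (auto simp: rename_Cut)
  then have "Cut i' s' A t' \<in># G" "width s' < 2" using c cc(3) by auto
  from narrow_cut_step[OF nd this(1) cc(2) this(2)] obtain F' where
    F': "cut_reduces (strip G) F'" "drv r 0 False F'" "improves r G F'" by blast
  have "improves r F F'" using F'(3) unfolding G(1)[symmetric] improves_def measure_strip .
  with F' G(1) show ?thesis by (metis r_into_rtranclp)
next
  case False
  have "not_narrow r c" if "c \<in># F" for c
  proof (cases c)
    case (Cut i s A t)
    then have "rank A = r \<longrightarrow> \<not> width s < 2" using False that by blast
    with Cut show ?thesis by (simp add: not_less)
  qed simp_all
  then have "\<forall>c\<in>#F. not_narrow r c" by blast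
  from wide_flag[OF d c this] obtain n where "2 \<le> n" "drv r n True F" by blast
  from narrow_wide_cut[OF this(2,1)] show ?thesis by (auto simp: improves_def)
qed

text \<open>
  Narrow cuts lower the number of cuts of rank \<open>r\<close> and never create wide ones; if all of these cuts are wide, making one of them narrow lowers the number of wide cuts.
\<close>

lemma eliminate_rank:
  fixes F :: "'p forest"
  shows "drv r 0 False F \<Longrightarrow> rank_bounded r F \<Longrightarrow>
    \<exists>F'. cut_reduces\<^sup>*\<^sup>* F F' \<and> drv r 0 False F' \<and> rank_bounded r F' \<and> lacks_rank r F' \<and> forest_type F' \<subseteq># forest_type F"
proof (induction F rule: wf_induct_rule[OF wf_measures[of "[wide_cuts r, ranked_cuts r]"]])
  case (1 F)
  show ?case
  proof (cases "lacks_rank r F")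
    case True
    with 1 show ?thesis by blast
  next
    case False
    from rank_step[OF 1(2) this] obtain F1 where F1: "cut_reduces\<^sup>*\<^sup>* F F1" "drv r 0 False F1" "improves r F F1" by blast
    have "(F1, F) \<in> measures [wide_cuts r, ranked_cuts r]" "rank_bounded r F1" "forest_type F1 \<subseteq># forest_type F"
      using F1(3) 1(3) by (auto simp: improves_def)
    from 1(1)[OF this(1) F1(2) this(2)] this(3) F1(1) show ?thesis
      by (meson rtranclp_trans subset_mset.order_trans)
  qed
qed

lemma eliminate_cuts:
  fixes F :: "'p forest"
  shows "drv 0 0 False F \<Longrightarrow> (\<forall>i s A t. Cut i s A t \<in># F \<longrightarrow> rank A < r) \<Longrightarrow>
    \<exists>F'. cut_reduces\<^sup>*\<^sup>* F F' \<and> drv 0 0 False F' \<and> (\<forall>i s A t. Cut i s A t \<notin># F') \<and> forest_type F' \<subseteq># forest_type F"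
proof (induction r arbitrary: F)
  case 0
  then show ?case by (intro exI[of _ F]) simp
next
  case (Suc r)
  have low: "low r c" if "c \<in># F" for c
    using Suc.prems(2) that by (cases c) (auto simp: less_Suc_eq_le)
  then have "rank_bounded r F" by (simp add: rank_bounded_def)
  from eliminate_rank[OF drv_forget_flag[OF Suc.prems(1)] this] obtain F1 where
    F1: "cut_reduces\<^sup>*\<^sup>* F F1" "drv r 0 False F1" "rank_bounded r F1" "lacks_rank r F1" "forest_type F1 \<subseteq># forest_type F"
    by blast
  have "rank A < r" if "Cut i s A t \<in># F1" for i s A t
  proof -
    have "low r (Cut i s A t)" using F1(3) that by (simp only: rank_bounded_def)
    moreover have "rank A \<noteq> r" using F1(4) that unfolding lacks_rank_def by blast
    ultimately show ?thesis by simp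
  qed
  then have "\<forall>i s A t. Cut i s A t \<in># F1 \<longrightarrow> rank A < r" by blast
  from Suc.IH[OF drv_forget_flag[OF F1(2)] this] F1(1,5) show ?case
    by (meson rtranclp_trans subset_mset.order_trans)
qed

theorem theorem61:
  fixes F :: "'p forest" and \<Gamma> :: "'p formula multiset"
  assumes "expansion_net_with_cut F"
    and "forest_type F = image_mset Formula \<Gamma>"
  shows "\<exists>F' \<Delta>. cut_reduces\<^sup>*\<^sup>* F F' \<and> expansion_net F' \<and>
           forest_type F' = image_mset Formula \<Delta> \<and> \<Delta> \<subseteq># \<Gamma>"
proof -
  have d: "drv 0 0 False F" using assms(1) derivable_drv unfolding expansion_net_with_cut_def by blast
  define cut_rank :: "('p, unit, nat) root \<Rightarrow> nat" where
    "cut_rank c = (case c of Cut i s A t \<Rightarrow> rank A | _ \<Rightarrow> 0)" for c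
  obtain m where m: "\<forall>x\<in>cut_rank ` set_mset F. x < m"
    using finite_nat_set_iff_bounded[of "cut_rank ` set_mset F"] by auto
  have "\<forall>i s A t. Cut i s A t \<in># F \<longrightarrow> rank A < m" using m by (force simp: cut_rank_def)
  from eliminate_cuts[OF d this] obtain F' where F': "cut_reduces\<^sup>*\<^sup>* F F'" "drv 0 0 False F'"
    "\<forall>i s A t. Cut i s A t \<notin># F'" "forest_type F' \<subseteq># forest_type F" by blast
  have "expansion_net F'"
    using drv_typed_forest[OF F'(2)] drv_derivable[OF F'(2,3)] F'(3) unfolding expansion_net_def by blast
  moreover obtain K where "image_mset Formula \<Gamma> = forest_type F' + K"
    using F'(4) assms(2) by (metis subset_mset.le_iff_add)
  from image_mset_eq_plusD[OF this] obtain \<Delta> K' where "\<Gamma> = \<Delta> + K'" "forest_type F' = image_mset Formula \<Delta>" by blast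
  ultimately show ?thesis using F'(1) by (metis mset_subset_eq_add_left)
qed

end
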